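(* Let $G$ be an almost controllable graph on $n$ vertices, let $\mathcal{C}(G)$ be the set of unlabeled graphs (isomorphism classes) generalized cospectral with $G$ (including $G$), and let $\phi$ be the map from the set of maximum cliques of $\Omega(G)$ to $\mathcal{C}(G)$ sending $K=\{\xi_1,\ldots,\xi_n\}$ to the isomorphism class of the graph with adjacency matrix $Q^TA(G)Q$, where $Q=\frac1L[\xi_1,\ldots,\xi_n]$. Then $\phi$ is surjective; moreover every symmetric graph in $\mathcal{C}(G)$ has exactly one preimage under $\phi$, and every asymmetric graph in $\mathcal{C}(G)$ has exactly two preimages.
   Context: Graphs are simple, undirected on $n$ vertices; $A=A(G)$, $e$ all-ones vector, $J$ all-ones matrix, $e^{(k)}$ the $k$-th unit vector. $W(G)=[e,Ae,\ldots,A^{n-1}e]$; $G$ is almost controllable if $\mathrm{rank}\,W(G)=n-1$. Two graphs are generalized cospectral if they have the same spectrum and their complements have the same spectrum. A graph is symmetric if its automorphism group is nontrivial, asymmetric otherwise. $d_n(M)$ is the last invariant factor of an integral matrix, $\mathrm{ord}_p$ the $p$-adic exponent, $\Delta(G)$ the discriminant of $\det(xI-A)$. $M_p(G;x)$: for odd $p$, $\chi(A;x)/\mathrm{sfp}(\gcd(\chi(A;x),\chi(A+J;x)))$ in $\mathbb{F}_p[x]$ ($\chi(B;x)=\det(xI-B)$, $\mathrm{sfp}$ = product of distinct monic irreducible factors); for $p=2$, with $\chi(A;x)=x^n+c_1x^{n-1}+\cdots+c_n$, $k=\lfloor n/2\rfloor$, it is $x^k+c_2x^{k-1}+\cdots+c_n$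 ($n$ even) or $x(x^k+c_2x^{k-1}+\cdots+c_{n-1})$ ($n$ odd) mod 2; coefficients in $\{0,\ldots,p-1\}$, $s_p=\deg M_p$, $M_p(A)e\equiv0\pmod p$. Let $\xi(G)$ be the vector whose $i$-th entry is the cofactor of the $(i,n)$ entry of $W(G)$, and $W_0(G)=[e,Ae,\ldots,A^{n-2}e,2^{-(\lfloor n/2\rfloor-1)}\xi(G)]$ (integral). For $p$ with $\mathrm{rank}_pW_0(G)\le n-1$: $W_0^{(p)}(G)=\left[e,\ldots,A^{s_p-1}e,\frac{M_p(A)e}{p},\ldots,\frac{A^{n-2-s_p}M_p(A)e}{p},\frac{1}{\mathrm{lcm}(2^{\lfloor n/2\rfloor-1},p^{n-1-s_p})}\xi(G)\right]$ (integral), with $W_0^{(p)}(G)=W_0(G)$ if $s_p=n-1$. Let $d=d_n(W_0(G))$ and $S=\{2\}\cup\{p\text{ odd prime}: p\mid\gcd(\Delta(G),d),\ p^2\mid\Delta(G)\}$; the potential primes $p_1,\ldots,p_s$ are the $p\in S$ with $\mathrm{rank}_pW_0(G)\le n-1$ and $\mathrm{ord}_p(d_n(W_0^{(p)}(G)))\ge1$; $t_i=\mathrm{ord}_{p_i}(d_n(W_0^{(p_i)}(G)))$, $L=\prod p_i^{t_i}$ ($L=1$ if $s=0$). $\Omega(G)$ is the graph whose vertices are the integral solutions $x$ of: $(W_0^{(p_i)}(G))^Tx\equiv0\pmod{p_i^{t_i}}$ ($i=1,\ldots,s$), $x^Tx=L^2$, $e^Tx=L$, $x^TA(G)x=0$;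 vertices $\xi,\eta$ are adjacent iff $\xi^T\eta=0$ and $\xi^TA(G)\eta\in\{0,L^2\}$. ($\Omega(G)$ contains the $n$-clique $\{Le^{(k)}\}$ and no clique of order $n+1$, so maximum cliques are the cliques of order $n$.) *)

theory Defs
  imports
    Berlekamp_Zassenhaus.Poly_Mod
    Subresultants.Resultant_Prelim
    Jordan_Normal_Form.Char_Poly
    Jordan_Normal_Form.DL_Rank
    "HOL-Computational_Algebra.Computational_Algebra"
    "HOL-Combinatorics.Permutations"
begin

text \<open>Simple graphs on the vertex set \<open>{0..<n}\<close>, given by their set of edges.
  All matrix and vector indices are zero-based.\<close>

definition complete_edges :: "nat \<Rightarrow> nat set set" where
  "complete_edges n = {{u, v} | u v. u < n \<and> v < n \<and> u \<noteq> v}"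

definition simple_graph :: "nat \<Rightarrow> nat set set \<Rightarrow> bool" where
  "simple_graph n G \<longleftrightarrow> G \<subseteq> complete_edges n"

definition complement :: "nat \<Rightarrow> nat set set \<Rightarrow> nat set set" where
  "complement n G = complete_edges n - G"

definition adj_mat :: "nat \<Rightarrow> nat set set \<Rightarrow> 'a :: zero_neq_one mat" where
  "adj_mat n G = mat n n (\<lambda>(i, j). if {i, j} \<in> G then 1 else 0)"

definition isomorphic :: "nat \<Rightarrow> nat set set \<Rightarrow> nat set set \<Rightarrow> bool" where
  "isomorphic n G H \<longleftrightarrow> (\<exists>\<pi>. bij_betw \<pi> {0..<n} {0..<n} \<and> (\<lambda>e. \<pi> ` e) ` G = H)"

definition iso_class :: "nat \<Rightarrow> nat set set \<Rightarrow> nat set set set" where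
  "iso_class n G = {H. simple_graph n H \<and> isomorphic n G H}"

definition automorphisms :: "nat \<Rightarrow> nat set set \<Rightarrow> (nat \<Rightarrow> nat) set" where
  "automorphisms n G = {\<pi>. \<pi> permutes {0..<n} \<and> (\<lambda>e. \<pi> ` e) ` G = G}"

definition symmetric_graph :: "nat \<Rightarrow> nat set set \<Rightarrow> bool" where
  "symmetric_graph n G \<longleftrightarrow> automorphisms n G \<noteq> {id}"

definition asymmetric_graph :: "nat \<Rightarrow> nat set set \<Rightarrow> bool" where
  "asymmetric_graph n G \<longleftrightarrow> \<not> symmetric_graph n G"

definition graph_spectrum :: "nat \<Rightarrow> nat set set \<Rightarrow> complex multiset" where
  "graph_spectrum n G = proots (char_poly (adj_mat n G))"

definition generalized_cospectral :: "nat \<Rightarrow> nat set set \<Rightarrow> nat set set \<Rightarrow> bool" where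
  "generalized_cospectral n G H \<longleftrightarrow>
     graph_spectrum n G = graph_spectrum n H \<and>
     graph_spectrum n (complement n G) = graph_spectrum n (complement n H)"

definition cospectral_classes :: "nat \<Rightarrow> nat set set \<Rightarrow> nat set set set set" where
  "cospectral_classes n G = iso_class n ` {H. simple_graph n H \<and> generalized_cospectral n G H}"

definition ones_vec :: "nat \<Rightarrow> 'a :: one vec" where
  "ones_vec n = vec n (\<lambda>_. 1)"

definition ones_mat :: "nat \<Rightarrow> 'a :: one mat" where
  "ones_mat n = mat n n (\<lambda>_. 1)"

definition walk_vec :: "nat \<Rightarrow> nat set set \<Rightarrow> nat \<Rightarrow> 'a :: semiring_1 vec" where
  "walk_vec n G k = (adj_mat n G ^\<^sub>m k) *\<^sub>v ones_vec n"

definition walk_mat :: "nat \<Rightarrow> nat set set \<Rightarrow> 'a :: semiring_1 mat" where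
  "walk_mat n G = mat_of_cols n (map (walk_vec n G) [0..<n])"

text \<open>Stated additively so that truncated subtraction does not admit \<open>n = 0\<close>.\<close>

definition almost_controllable :: "nat \<Rightarrow> nat set set \<Rightarrow> bool" where
  "almost_controllable n G \<longleftrightarrow> vec_space.rank n (walk_mat n G :: real mat) + 1 = n"

definition smith_normal_form_of :: "int mat \<Rightarrow> int mat \<Rightarrow> bool" where
  "smith_normal_form_of M D \<longleftrightarrow>
     (\<exists>U V. U \<in> carrier_mat (dim_row M) (dim_row M) \<and> V \<in> carrier_mat (dim_col M) (dim_col M) \<and>
        invertible_mat U \<and> invertible_mat V \<and> D = U * M * V) \<and>
     diagonal_mat D \<and>
     (\<forall>i < min (dim_row D) (dim_col D). D $$ (i, i) \<ge> 0) \<and>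
     (\<forall>i. i + 1 < min (dim_row D) (dim_col D) \<longrightarrow> D $$ (i, i) dvd D $$ (i + 1, i + 1))"

definition last_invariant_factor :: "int mat \<Rightarrow> int" where
  "last_invariant_factor M =
     (THE d. \<exists>D. smith_normal_form_of M D \<and> d = D $$ (dim_row M - 1, dim_col M - 1))"

text \<open>The rank over \<open>F\<^sub>p\<close> of the reduction of an integral matrix: the largest number of
  columns that are linearly independent modulo \<open>p\<close>.\<close>

definition cols_independent_mod :: "int \<Rightarrow> int mat \<Rightarrow> nat set \<Rightarrow> bool" where
  "cols_independent_mod p M J \<longleftrightarrow>
     (\<forall>c. (\<forall>i < dim_row M. p dvd (\<Sum>j\<in>J. c j * M $$ (i, j))) \<longrightarrow> (\<forall>j\<in>J. p dvd c j))"

definition rank_mod :: "int \<Rightarrow> int mat \<Rightarrow> nat" where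
  "rank_mod p M = Max {card J | J. J \<subseteq> {0..<dim_col M} \<and> cols_independent_mod p M J}"

definition discriminant :: "int poly \<Rightarrow> int" where
  "discriminant f =
     ((-1) ^ (degree f * (degree f - 1) div 2) * resultant f (pderiv f)) div lead_coeff f"

text \<open>Elements of \<open>F\<^sub>p[x]\<close> are represented by the integer polynomials with coefficients in
  \<open>{0..<p}\<close>, i.e. the fixed points of \<open>poly_mod.Mp p\<close>.\<close>

definition monic_gcd_mod :: "int \<Rightarrow> int poly \<Rightarrow> int poly \<Rightarrow> int poly" where
  "monic_gcd_mod p f g = (THE h. poly_mod.Mp p h = h \<and> monic h \<and>
     poly_mod.dvdm p h f \<and> poly_mod.dvdm p h g \<and>
     (\<forall>k. poly_mod.dvdm p k f \<and> poly_mod.dvdm p k g \<longrightarrow> poly_mod.dvdm p k h))"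

definition sfp_mod :: "int \<Rightarrow> int poly \<Rightarrow> int poly" where
  "sfp_mod p f = poly_mod.Mp p
     (\<Prod>h\<in>{h. poly_mod.Mp p h = h \<and> monic h \<and> poly_mod.irreducible_m p h \<and> poly_mod.dvdm p h f}. h)"

definition quotient_mod :: "int \<Rightarrow> int poly \<Rightarrow> int poly \<Rightarrow> int poly" where
  "quotient_mod p f g = (THE q. poly_mod.Mp p q = q \<and> poly_mod.eq_m p f (q * g))"

definition M_poly :: "nat \<Rightarrow> nat set set \<Rightarrow> int \<Rightarrow> int poly" where
  "M_poly n G p =
     (let \<chi> = char_poly (adj_mat n G); \<chi>' = char_poly (adj_mat n G + ones_mat n);
          c = (\<lambda>i. coeff \<chi> (n - i)); k = n div 2
      in if p = 2 then poly_mod.Mp 2 (monom 1 (n mod 2) * (\<Sum>i\<le>k. monom (c (2 * i)) (k - i)))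
         else quotient_mod p \<chi> (sfp_mod p (monic_gcd_mod p \<chi> \<chi>')))"

definition s_deg :: "nat \<Rightarrow> nat set set \<Rightarrow> int \<Rightarrow> nat" where
  "s_deg n G p = degree (M_poly n G p)"

definition poly_mat :: "'a :: comm_semiring_1 poly \<Rightarrow> 'a mat \<Rightarrow> 'a mat" where
  "poly_mat f A =
     mat (dim_row A) (dim_row A) (\<lambda>(i, j). \<Sum>k\<le>degree f. coeff f k * (A ^\<^sub>m k) $$ (i, j))"

definition xi_vec :: "nat \<Rightarrow> nat set set \<Rightarrow> int vec" where
  "xi_vec n G = vec n (\<lambda>i. cofactor (walk_mat n G) i (n - 1))"

text \<open>For an almost controllable graph and the primes to which they are applied, all the
  integer divisions in the next two definitions are exact.\<close>

definition W0_mat :: "nat \<Rightarrow> nat set set \<Rightarrow> int mat" where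
  "W0_mat n G = mat_of_cols n
     (map (walk_vec n G) [0..<n - 1] @
      [map_vec (\<lambda>z. z div 2 ^ (n div 2 - 1)) (xi_vec n G)])"

definition W0p_mat :: "nat \<Rightarrow> nat set set \<Rightarrow> int \<Rightarrow> int mat" where
  "W0p_mat n G p =
     (let s = s_deg n G p;
          w = map_vec (\<lambda>z. z div p) (poly_mat (M_poly n G p) (adj_mat n G) *\<^sub>v ones_vec n)
      in if s = n - 1 then W0_mat n G
         else mat_of_cols n
           (map (walk_vec n G) [0..<s] @
            map (\<lambda>k. (adj_mat n G ^\<^sub>m k) *\<^sub>v w) [0..<n - 1 - s] @
            [map_vec (\<lambda>z. z div lcm (2 ^ (n div 2 - 1)) (p ^ (n - 1 - s))) (xi_vec n G)]))"

definition candidate_primes :: "nat \<Rightarrow> nat set set \<Rightarrow> int set" where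
  "candidate_primes n G =
     (let d = last_invariant_factor (W0_mat n G); \<Delta> = discriminant (char_poly (adj_mat n G))
      in {2} \<union> {p. prime p \<and> odd p \<and> p dvd gcd \<Delta> d \<and> p ^ 2 dvd \<Delta>})"

definition t_exp :: "nat \<Rightarrow> nat set set \<Rightarrow> int \<Rightarrow> nat" where
  "t_exp n G p = multiplicity p (last_invariant_factor (W0p_mat n G p))"

definition potential_primes :: "nat \<Rightarrow> nat set set \<Rightarrow> int set" where
  "potential_primes n G =
     {p \<in> candidate_primes n G. rank_mod p (W0_mat n G) \<le> n - 1 \<and> t_exp n G p \<ge> 1}"

definition L_num :: "nat \<Rightarrow> nat set set \<Rightarrow> int" where
  "L_num n G = (\<Prod>p\<in>potential_primes n G. p ^ t_exp n G p)"

definition Omega_vertices :: "nat \<Rightarrow> nat set set \<Rightarrow> int vec set" where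
  "Omega_vertices n G = {x \<in> carrier_vec n.
     (\<forall>p \<in> potential_primes n G. \<forall>i < n.
        p ^ t_exp n G p dvd (transpose_mat (W0p_mat n G p) *\<^sub>v x) $ i) \<and>
     x \<bullet> x = (L_num n G)\<^sup>2 \<and>
     ones_vec n \<bullet> x = L_num n G \<and>
     x \<bullet> (adj_mat n G *\<^sub>v x) = 0}"

definition Omega_adjacent :: "nat \<Rightarrow> nat set set \<Rightarrow> int vec \<Rightarrow> int vec \<Rightarrow> bool" where
  "Omega_adjacent n G x y \<longleftrightarrow>
     x \<in> Omega_vertices n G \<and> y \<in> Omega_vertices n G \<and>
     x \<bullet> y = 0 \<and> x \<bullet> (adj_mat n G *\<^sub>v y) \<in> {0, (L_num n G)\<^sup>2}"

definition Omega_clique :: "nat \<Rightarrow> nat set set \<Rightarrow> int vec set \<Rightarrow> bool" where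
  "Omega_clique n G K \<longleftrightarrow> finite K \<and> K \<subseteq> Omega_vertices n G \<and>
     (\<forall>x\<in>K. \<forall>y\<in>K. x \<noteq> y \<longrightarrow> Omega_adjacent n G x y)"

definition Omega_max_cliques :: "nat \<Rightarrow> nat set set \<Rightarrow> int vec set set" where
  "Omega_max_cliques n G =
     {K. Omega_clique n G K \<and> (\<forall>K'. Omega_clique n G K' \<longrightarrow> card K' \<le> card K)}"

definition Q_mat :: "nat \<Rightarrow> nat set set \<Rightarrow> int vec list \<Rightarrow> rat mat" where
  "Q_mat n G xs =
     (1 / of_int (L_num n G)) \<cdot>\<^sub>m mat_of_cols n (map (map_vec of_int) xs)"

definition clique_graph :: "nat \<Rightarrow> nat set set \<Rightarrow> int vec list \<Rightarrow> nat set set \<Rightarrow> bool" where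
  "clique_graph n G xs H \<longleftrightarrow> simple_graph n H \<and>
     adj_mat n H = transpose_mat (Q_mat n G xs) * adj_mat n G * Q_mat n G xs"

text \<open>A clique is an unordered set, whereas \<open>Q\<close> needs an enumeration \<open>xs\<close> of it; the
  isomorphism class obtained does not depend on the enumeration.\<close>

definition phi :: "nat \<Rightarrow> nat set set \<Rightarrow> int vec set \<Rightarrow> nat set set set" where
  "phi n G K =
     (THE C. \<exists>xs H. distinct xs \<and> set xs = K \<and> clique_graph n G xs H \<and> C = iso_class n H)"

end

theory Submission
  imports Defs
begin

text \<open>
  A graph \<open>H\<close> is generalized cospectral with \<open>G\<close> iff \<open>A(H) = Q\<^sup>T A(G) Q\<close> for a rational orthogonal matrix
  \<open>Q\<close> fixing the all-ones vector. Such a \<open>Q\<^sup>T\<close> maps the walk vectors of \<open>G\<close> to those of \<open>H\<close>; these span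
  a hyperplane with normal vector \<open>\<xi>\<close>, so \<open>Q\<^sup>T \<xi>(G) = \<plusminus> \<xi>(H)\<close>, and each sign occurs for exactly one \<open>Q\<close>.

  The point is that \<open>L Q\<close> is integral. Since \<open>Q\<^sup>T W\<^sub>0\<^sup>(\<^sup>p\<^sup>)(G)\<close> is integral, the least \<open>l > 0\<close> with \<open>l Q\<close> integral
  divides every \<open>d\<^sub>n(W\<^sub>0\<^sup>(\<^sup>p\<^sup>)(G))\<close>. If a prime \<open>p\<close> divides \<open>l\<close>, take a column \<open>z\<close> of \<open>l Q\<close> that is nonzero modulo \<open>p\<close>.
  All \<open>z\<^sup>T A\<^sup>k z\<close> are divisible by \<open>p\<^sup>2\<close>, hence \<open>z\<^sup>T adj(x - A) z\<close> vanishes modulo \<open>p\<close>; by Jacobi's identity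
  \<open>\<chi>\<close> divides the squares of the entries of \<open>adj(x - A) z\<close>, which forces \<open>\<chi>'(A) z = 0\<close> modulo \<open>p\<close>, and therefore
  \<open>p\<^sup>2\<close> divides \<open>det \<chi>'(A) = \<plusminus> \<Delta>\<close>. So \<open>p\<close> is a potential prime.

  Maximum cliques are thus the matrices \<open>L Q\<close> up to the order of the columns, and the two matrices belonging to
  \<open>H\<close> have the same set of columns iff \<open>H\<close> has a nontrivial automorphism.
\<close>

unbundle no Formal_Power_Series.fps_syntax

text \<open>The overview leaves the origin of M_p open; it is that of \<chi>'(A) z. Since \<chi>(A +
  J) = \<chi>(A) - e^T adj(x - A) e, an irreducible common factor of the two modulo \<open>p\<close>
  divides the squares of the entries of adj(x - A) e, hence the entries; dividing \<chi> by all such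
  factors leaves a polynomial annihilating e. For \<open>p = 2\<close> one has M^2 = x^(n mod 2)
  \<chi> modulo 2 instead, and a symmetric integer matrix with even square has even row sums. M_p
  depends only on the two characteristic polynomials, so \<open>G\<close> and \<open>H\<close> share
  it, which is why the product with Q^T stays integral.

  The obstacle is the missing dimension: the walk vectors determine Q^T A(G) Q - A(H) only up to a
  multiple of the projection onto \<xi>(H). Both traces are zero, and this removes the multiple.

  Reductions modulo \<open>p\<close> are kept as congruences between integer objects, and inverses
  are replaced by adjugates, so that second factors of \<open>p\<close>, as in z^T A^k z, remain
  visible.\<close>

section \<open>Adjugates, bordered determinants and divisibility of determinants\<close>

text \<open>Both the adjugate and its transpose invert \<open>N\<close> up to the factor
  \<open>det N\<close>, which can be cancelled in an integral domain.\<close>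

lemma adjugate_symmetric:
  fixes N :: "'a :: idom mat"
  assumes N: "N \<in> carrier_mat n n" and sym: "transpose_mat N = N" and d: "det N \<noteq> 0"
  shows "transpose_mat (Determinant.adj_mat N) = Determinant.adj_mat N"
proof -
  let ?P = "Determinant.adj_mat N"
  have P: "?P \<in> carrier_mat n n" using adj_mat(1)[OF N] .
  have PT: "transpose_mat ?P \<in> carrier_mat n n" using P by simp
  have "transpose_mat ?P * N = transpose_mat (N * ?P)"
    using transpose_mult[OF N P] sym by simp
  also have "\<dots> = det N \<cdot>\<^sub>m 1\<^sub>m n" unfolding adj_mat(2)[OF N]
    by (rule eq_matI) auto
  finally have 1: "transpose_mat ?P * N = det N \<cdot>\<^sub>m 1\<^sub>m n" .
  have "det N \<cdot>\<^sub>m ?P = (transpose_mat ?P * N) * ?P"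
    unfolding 1 using P by (simp add: mult_smult_assoc_mat[of _ n n])
  also have "\<dots> = transpose_mat ?P * (N * ?P)" using assoc_mult_mat[OF PT N P] .
  also have "\<dots> = det N \<cdot>\<^sub>m transpose_mat ?P" unfolding adj_mat(2)[OF N]
    using mult_smult_distrib[OF PT one_carrier_mat] PT by simp
  finally have e: "det N \<cdot>\<^sub>m ?P = det N \<cdot>\<^sub>m transpose_mat ?P" .
  show ?thesis
  proof (rule eq_matI)
    fix i j assume "i < dim_row ?P" "j < dim_col ?P"
    then show "transpose_mat ?P $$ (i, j) = ?P $$ (i, j)"
      using arg_cong[OF e, of "\<lambda>M. M $$ (i,j)"] P d by auto
  qed (use P in auto)
qed

text \<open>For two columns this is Jacobi's identity on complementary minors of the adjugate,
  for one column the rank-one update formula.\<close>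

lemma det_bordered:
  fixes N :: "'a :: idom mat"
  assumes N: "N \<in> carrier_mat n n" and B: "B \<in> carrier_mat n m" and C: "C \<in> carrier_mat m n"
    and D: "D \<in> carrier_mat m m" and d: "det N \<noteq> 0"
  shows "det N ^ m * det (four_block_mat N B C D) =
     det N * det (det N \<cdot>\<^sub>m D - C * (Determinant.adj_mat N * B))"
proof -
  let ?P = "Determinant.adj_mat N" and ?d = "det N"
  let ?T = "four_block_mat N B C D"
  \<comment> \<open>Schur complement elimination with the adjugate in place of the inverse: the
    lower right block clears the denominator and is the source of the factor
    \<open>det N ^ m\<close>.\<close>
  let ?X = "four_block_mat (1\<^sub>m n) (- (?P * B)) (0\<^sub>m m n) (?d \<cdot>\<^sub>m 1\<^sub>m m)"
  have P: "?P \<in> carrier_mat n n" using adj_mat(1)[OF N] .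
  have PB: "?P * B \<in> carrier_mat n m" using P B by simp
  have CPB: "C * (?P * B) \<in> carrier_mat m m" using C PB by simp
  have NPB: "N * (?P * B) = ?d \<cdot>\<^sub>m B"
  proof -
    have "N * (?P * B) = (N * ?P) * B" using assoc_mult_mat[OF N P B] by simp
    also have "\<dots> = ?d \<cdot>\<^sub>m B" unfolding adj_mat(2)[OF N] using B
      by (simp add: mult_smult_assoc_mat[of _ n n])
    finally show ?thesis .
  qed
  have e: "?T * ?X = four_block_mat N (0\<^sub>m n m) C (?d \<cdot>\<^sub>m D - C * (?P * B))"
  proof (subst mult_four_block_mat[OF N B C D, of _ n _ m])
    have 1: "N * 1\<^sub>m n + B * 0\<^sub>m m n = N" using N B by simp
    have 2: "C * 1\<^sub>m n + D * 0\<^sub>m m n = C" using C D by simp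
    have 3: "N * - (?P * B) + B * (?d \<cdot>\<^sub>m 1\<^sub>m m) = 0\<^sub>m n m"
    proof -
      have "N * - (?P * B) = - (?d \<cdot>\<^sub>m B)" using NPB
        by (metis N PB carrier_matD(2) uminus_mult_right_mat carrier_matD(1))
      moreover have "B * (?d \<cdot>\<^sub>m 1\<^sub>m m) = ?d \<cdot>\<^sub>m B"
        using mult_smult_distrib[OF B one_carrier_mat] B by simp
      ultimately show ?thesis using B by (auto intro!: eq_matI)
    qed
    have 4: "C * - (?P * B) + D * (?d \<cdot>\<^sub>m 1\<^sub>m m) = ?d \<cdot>\<^sub>m D - C * (?P * B)"
    proof -
      have "C * - (?P * B) = - (C * (?P * B))"
        by (metis C PB carrier_matD(2) uminus_mult_right_mat carrier_matD(1))
      moreover have "D * (?d \<cdot>\<^sub>m 1\<^sub>m m) = ?d \<cdot>\<^sub>m D"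
        using mult_smult_distrib[OF D one_carrier_mat] D by simp
      ultimately show ?thesis using CPB D by (intro eq_matI) (auto simp del: index_mult_mat)
    qed
    show "four_block_mat (N * 1\<^sub>m n + B * 0\<^sub>m m n) (N * - (?P * B) + B * (?d \<cdot>\<^sub>m 1\<^sub>m m))
     (C * 1\<^sub>m n + D * 0\<^sub>m m n) (C * - (?P * B) + D * (?d \<cdot>\<^sub>m 1\<^sub>m m)) =
     four_block_mat N (0\<^sub>m n m) C (?d \<cdot>\<^sub>m D - C * (?P * B))"
      unfolding 1 2 3 4 ..
  qed (use PB in auto)
  have X: "det ?X = ?d ^ m"
    using det_four_block_mat_lower_left_zero[of "1\<^sub>m n" n "- (?P * B)" m "0\<^sub>m m n" "?d \<cdot>\<^sub>m 1\<^sub>m m"] PB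
    by (simp add: det_smult)
  have Xc: "?X \<in> carrier_mat (n+m) (n+m)" using PB by simp
  have Tc: "?T \<in> carrier_mat (n+m) (n+m)" using N D by simp
  have "det (?T * ?X) = det N * det (?d \<cdot>\<^sub>m D - C * (?P * B))" unfolding e
    by (rule det_four_block_mat_upper_right_zero[OF N refl C]) (rule minus_carrier_mat[OF CPB])
  then show ?thesis unfolding det_mult[OF Tc Xc] X by (simp add: mult.commute)
qed

lemma det_2x2:
  fixes M :: "'a :: comm_ring_1 mat"
  assumes "M \<in> carrier_mat 2 2"
  shows "det M = M $$ (0,0) * M $$ (1,1) - M $$ (0,1) * M $$ (1,0)"
  using assms unfolding laplace_expansion_column[OF assms, of 0, simplified]
  by (auto simp: numeral_2_eq_2 cofactor_def mat_delete_def det_single[of _] )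

text \<open>The difference is the 2 x 2 Gram determinant of \<open>z\<close> and a unit vector for
  the form given by the adjugate. Bordering \<open>N\<close> by these two vectors, with zero corner,
  shows that \<open>det N\<close> times this determinant is divisible by the square of
  \<open>det N\<close>.\<close>

lemma adjugate_bilinear_square:
  fixes N :: "'a :: idom mat"
  assumes N: "N \<in> carrier_mat n n" and sym: "transpose_mat N = N" and d: "det N \<noteq> 0"
    and z: "z \<in> carrier_vec n" and i: "i < n"
  defines "y \<equiv> Determinant.adj_mat N *\<^sub>v z"
  shows "det N dvd Determinant.adj_mat N $$ (i,i) * (z \<bullet> y) - (y $ i)\<^sup>2"
proof -
  let ?P = "Determinant.adj_mat N"
  let ?B = "mat_of_cols n [z, unit_vec n i]" and ?C = "mat_of_rows n [z, unit_vec n i]"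
  have P: "?P \<in> carrier_mat n n" using adj_mat(1)[OF N] .
  have B: "?B \<in> carrier_mat n 2" and C: "?C \<in> carrier_mat 2 n"
    by (simp_all add: numeral_2_eq_2 mat_of_cols_def mat_of_rows_def)
  have y: "y \<in> carrier_vec n" unfolding y_def using P z by simp
  have Ps: "?P $$ (a,b) = ?P $$ (b,a)" if "a < n" "b < n" for a b
    using arg_cong[OF adjugate_symmetric[OF N sym d], of "\<lambda>M. M $$ (a,b)"] that P by simp
  have PB: "?P * ?B \<in> carrier_mat n 2" using P B by simp
  let ?M = "?C * (?P * ?B)"
  have M: "?M \<in> carrier_mat 2 2" using C PB by simp
  have "col ?B 0 = z" using z by simp
  then have c0: "col (?P * ?B) 0 = y" using col_mult2[OF P B, of 0] unfolding y_def by (simp only: zero_less_numeral)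
  have c1: "col (?P * ?B) 1 = col ?P i"
  proof -
    have "col ?B 1 = unit_vec n i" by (auto simp: col_def mat_of_cols_def)
    then have "col (?P * ?B) 1 = ?P *\<^sub>v unit_vec n i" using col_mult2[OF P B, of 1] by simp
    also have "\<dots> = col ?P i" using P i by (intro eq_vecI) auto
    finally show ?thesis .
  qed
  have r0: "row ?C 0 = z" using z by (auto simp: row_def mat_of_rows_def)
  have r1: "row ?C 1 = unit_vec n i" by (auto simp: row_def mat_of_rows_def)
  have e: "?M $$ (0,0) = z \<bullet> y" "?M $$ (1,0) = y $ i" "?M $$ (0,1) = z \<bullet> col ?P i" "?M $$ (1,1) = ?P $$ (i,i)"
  proof -
    have "?M $$ (a,b) = row ?C a \<bullet> col (?P * ?B) b" if "a < 2" "b < 2" for a b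
      using that C PB by (intro index_mult_mat(1)) auto
    note this[of 0 0] this[of 1 0] this[of 0 1] this[of 1 1]
    then show "?M $$ (0,0) = z \<bullet> y" "?M $$ (1,0) = y $ i" "?M $$ (0,1) = z \<bullet> col ?P i" "?M $$ (1,1) = ?P $$ (i,i)"
      unfolding c0 c1 r0 r1 using y i P by simp_all
  qed
  have s: "z \<bullet> col ?P i = y $ i"
    unfolding y_def using P i z by (auto simp: scalar_prod_def Ps mult.commute intro!: sum.cong)
  have "det N ^ 2 * det (four_block_mat N ?B ?C (0\<^sub>m 2 2)) =
     det N * det (det N \<cdot>\<^sub>m 0\<^sub>m 2 2 - ?M)"
    by (rule det_bordered[OF N B C _ d]) simp
  also have "det N \<cdot>\<^sub>m 0\<^sub>m 2 2 - ?M = - ?M" using M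
    by (intro eq_matI) (auto simp del: index_mult_mat(1))
  also have "det (- ?M) = det ?M"
  proof -
    have "- ?M \<in> carrier_mat 2 2" using M by simp
    from det_2x2[OF this] det_2x2[OF M] show ?thesis using M
      by (simp del: index_mult_mat(1))
  qed
  also have "det ?M = ?P $$ (i,i) * (z \<bullet> y) - (y $ i)\<^sup>2"
    using det_2x2[OF M] unfolding e s by (simp add: power2_eq_square mult.commute)
  finally have "det N * (det N * det (four_block_mat N ?B ?C (0\<^sub>m 2 2))) = 
     det N * (?P $$ (i,i) * (z \<bullet> y) - (y $ i)\<^sup>2)"
    by (simp add: power2_eq_square mult.assoc)
  then show ?thesis using d by (metis dvd_triv_left mult_cancel_left)
qed

text \<open>The bordered matrix with corner 1 is eliminated in two ways: through \<open>N\<close>,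
  which gives the right-hand side, and through the corner, which gives the rank-one
  perturbation.\<close>

lemma det_minus_rank_one:
  fixes N :: "'a :: idom mat"
  assumes N: "N \<in> carrier_mat n n" and d: "det N \<noteq> 0"
    and z: "z \<in> carrier_vec n" and y: "y \<in> carrier_vec n"
  shows "det (mat n n (\<lambda>(i,j). N $$ (i,j) - z $ i * y $ j)) = det N - y \<bullet> (Determinant.adj_mat N *\<^sub>v z)"
proof -
  let ?P = "Determinant.adj_mat N"
  let ?B = "mat_of_cols n [z]" and ?C = "mat_of_rows n [y]"
  let ?D = "1\<^sub>m 1 :: 'a mat"
  have P: "?P \<in> carrier_mat n n" using adj_mat(1)[OF N] .
  have B: "?B \<in> carrier_mat n 1" and C: "?C \<in> carrier_mat 1 n"
    by (simp_all add: mat_of_cols_def mat_of_rows_def)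
  have PB: "?P * ?B \<in> carrier_mat n 1" using P B by simp
  have M: "?C * (?P * ?B) \<in> carrier_mat 1 1" using C PB by simp
  let ?T = "four_block_mat N ?B ?C ?D"
  have "det N ^ 1 * det ?T = det N * det (det N \<cdot>\<^sub>m ?D - ?C * (?P * ?B))"
    by (rule det_bordered[OF N B C _ d]) simp
  then have 1: "det ?T = det (det N \<cdot>\<^sub>m ?D - ?C * (?P * ?B))" using d by simp
  have "(?C * (?P * ?B)) $$ (0,0) = y \<bullet> (?P *\<^sub>v z)"
  proof -
    have "col ?B 0 = z" using z by simp
    then have "col (?P * ?B) 0 = ?P *\<^sub>v z" using col_mult2[OF P B, of 0] by (simp only: zero_less_one)
    moreover have "row ?C 0 = y" using y by (auto simp: row_def mat_of_rows_def)
    ultimately show ?thesis using C PB by auto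
  qed
  then have 2: "det (det N \<cdot>\<^sub>m ?D - ?C * (?P * ?B)) = det N - y \<bullet> (?P *\<^sub>v z)"
    using M by (subst det_single) (auto simp del: index_mult_mat(1))
  let ?Y = "four_block_mat (1\<^sub>m n) (0\<^sub>m n 1) (- ?C) ?D"
  let ?Z = "mat n n (\<lambda>(i,j). N $$ (i,j) - z $ i * y $ j)"
  have Y: "det ?Y = 1" by (subst det_four_block_mat_upper_right_zero[of _ n _ 1]) auto
  have e: "?T * ?Y = four_block_mat ?Z ?B (0\<^sub>m 1 n) ?D"
  proof (subst mult_four_block_mat[OF N B C, of _ _ n _ 1])
    have 1: "N * 1\<^sub>m n + ?B * - ?C = ?Z" using N z y
      by (auto simp: mat_of_cols_def mat_of_rows_def scalar_prod_def intro!: eq_matI)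
    have 2: "?C * 1\<^sub>m n + ?D * - ?C = 0\<^sub>m 1 n" using C by (auto intro!: eq_matI)
    have 3: "N * 0\<^sub>m n 1 + ?B * ?D = ?B" "?C * 0\<^sub>m n 1 + ?D * ?D = ?D" using N B C by auto
    show "four_block_mat (N * 1\<^sub>m n + ?B * - ?C) (N * 0\<^sub>m n 1 + ?B * ?D)
     (?C * 1\<^sub>m n + ?D * - ?C) (?C * 0\<^sub>m n 1 + ?D * ?D) = four_block_mat ?Z ?B (0\<^sub>m 1 n) ?D"
      unfolding 1 2 3 ..
  qed auto
  have "det (?T * ?Y) = det ?Z" unfolding e
    by (subst det_four_block_mat_lower_left_zero[of _ n _ 1]) auto
  moreover have "det (?T * ?Y) = det ?T * det ?Y" using N
    by (intro det_mult[of _ "n+1"]) auto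
  ultimately show ?thesis using 1 2 Y by simp
qed

text \<open>Every term of the Leibniz expansion contains one entry from each of the columns
  \<open>s\<close>, ..., \<open>n - 1\<close>.\<close>

lemma prime_power_dvd_det:
  fixes M :: "int mat"
  assumes M: "M \<in> carrier_mat n n" and d: "\<And>i j. i < n \<Longrightarrow> s \<le> j \<Longrightarrow> j < n \<Longrightarrow> p dvd M $$ (i,j)"
  shows "p ^ (n - s) dvd det M"
  unfolding det_col[OF M]
proof (rule dvd_sum)
  fix \<pi> assume "\<pi> \<in> {\<pi>. \<pi> permutes {0..<n}}"
  then have \<pi>: "\<pi> j < n" if "j < n" for j using that by (auto dest: permutes_in_image[of _ _ j])
  have "(\<Prod>j\<in>{s..<n}. p) dvd (\<Prod>j\<in>{s..<n}. M $$ (\<pi> j, j))"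
    using d \<pi> by (intro prod_dvd_prod) auto
  also have "\<dots> dvd (\<Prod>j<n. M $$ (\<pi> j, j))"
    by (rule prod_dvd_prod_subset) auto
  finally show "p ^ (n - s) dvd signof \<pi> * (\<Prod>j<n. M $$ (\<pi> j, j))" by simp
qed

text \<open>In a basis containing \<open>z\<close>, the row and the column of the symmetric form
  that belong to \<open>z\<close> are divisible by \<open>p\<close>, and their common entry by p^2.
  The change of basis has determinant \<open>z $ k\<close>, prime to \<open>p\<close>, so the
  divisibility passes back to \<open>det M\<close>.\<close>

lemma prime_square_dvd_det:
  fixes M :: "int mat" and z :: "int vec"
  assumes M: "M \<in> carrier_mat n n" and sym: "transpose_mat M = M" and z: "z \<in> carrier_vec n"
    and p: "prime p" and k: "k < n" "\<not> p dvd z $ k"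
    and Mz: "\<And>i. i < n \<Longrightarrow> p dvd (M *\<^sub>v z) $ i" and zMz: "p\<^sup>2 dvd z \<bullet> (M *\<^sub>v z)"
  shows "p\<^sup>2 dvd det M"
proof -
  define U where "U = replace_col (1\<^sub>m n) z k"
  have U: "U \<in> carrier_mat n n" unfolding U_def replace_col_def by simp
  have detU: "det U = z $ k"
    using cramer_lemma_mat[OF one_carrier_mat z k(1)] z unfolding U_def by simp
  define V where "V = transpose_mat U * (M * U)"
  have MU: "M * U \<in> carrier_mat n n" using M U by simp
  have V: "V \<in> carrier_mat n n" unfolding V_def using U MU by simp
  have detV: "det V = (z $ k)\<^sup>2 * det M"
    unfolding V_def using U M MU
    by (subst det_mult[of _ n], (auto)[2], subst det_mult[OF M U], simp add: det_transpose[OF U] detU power2_eq_square)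
  have colU: "col U j = (if j = k then z else unit_vec n j)" if "j < n" for j
    using that z k unfolding U_def by (auto simp: replace_col_def col_def unit_vec_def intro!: eq_vecI)
  have Ms: "M $$ (i,j) = M $$ (j,i)" if "i < n" "j < n" for i j
    using arg_cong[OF sym, of "\<lambda>X. X $$ (i,j)"] that M by simp
  have Vij: "V $$ (i,j) = col U i \<bullet> (M *\<^sub>v col U j)" if "i < n" "j < n" for i j
    using that U MU unfolding V_def by (simp add: index_mult_mat(1) col_mult2[OF M U])
  have Vk: "p dvd V $$ (i,k)" if "i < n" "i \<noteq> k" for i
    using that k Mz M z by (simp add: Vij colU del: index_mult_mat_vec)
  have Vkk: "p\<^sup>2 dvd V $$ (k,k)" using k zMz by (simp add: Vij colU)
  have Vr: "p dvd V $$ (k,j)" if "j < n" for j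
  proof (cases "j = k")
    case True
    then show ?thesis using Vkk by (auto intro: dvd_trans[of p "p\<^sup>2"])
  next
    case False
    have "M *\<^sub>v unit_vec n j = col M j" using M that by (intro eq_vecI) auto
    then have "z \<bullet> (M *\<^sub>v unit_vec n j) = (M *\<^sub>v z) $ j"
      using that M z by (auto simp: scalar_prod_def Ms mult.commute intro!: sum.cong)
    then show ?thesis using False that k Mz[OF that] by (simp add: Vij colU del: index_mult_mat_vec)
  qed
  \<comment> \<open>Row \<open>k\<close> is divided by \<open>p\<close>. Column \<open>k\<close>
    still keeps a factor \<open>p\<close>, also at the diagonal, because p^2 divides the diagonal
    entry of \<open>V\<close> there.\<close>
  define W where "W = mat n n (\<lambda>(i,j). if i = k then V $$ (i,j) div p else V $$ (i,j))"
  have W: "W \<in> carrier_mat n n" unfolding W_def by simp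
  have "multrow k p W = V"
    using V Vr unfolding W_def by (intro eq_matI) auto
  then have "det V = p * det W" using det_multrow[OF k(1) W, of p] by simp
  moreover have "p dvd det W" unfolding laplace_expansion_column[OF W k(1)]
  proof (intro dvd_sum dvd_mult2)
    fix i assume "i \<in> {..<n}"
    then show "p dvd W $$ (i,k)" using Vk Vkk k p unfolding W_def
      by (auto simp: power2_eq_square elim!: dvdE)
  qed
  ultimately have "p\<^sup>2 dvd (z $ k)\<^sup>2 * det M" unfolding detV[symmetric]
    by (auto simp: power2_eq_square)
  moreover have "algebraic_semidom_class.coprime (p\<^sup>2) ((z $ k)\<^sup>2)"
    using p k(2) by (simp add: prime_imp_coprime)
  ultimately show ?thesis by (metis coprime_dvd_mult_right_iff)
qed

subsection \<open>Smith normal form\<close>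

lemma invertible_mat_int_iff:
  fixes A :: "int mat"
  assumes A: "A \<in> carrier_mat n n"
  shows "invertible_mat A \<longleftrightarrow> \<bar>det A\<bar> = 1"
proof
  assume "invertible_mat A"
  then obtain B where B: "A * B = 1\<^sub>m n" "B * A = 1\<^sub>m (dim_row B)"
    unfolding invertible_mat_def inverts_mat_def using A by auto
  have "dim_col B = n" using arg_cong[OF B(1), of dim_col] by simp
  moreover have "dim_row B = n" using arg_cong[OF B(2), of dim_col] A by simp
  ultimately have Bc: "B \<in> carrier_mat n n" by auto
  have "det A * det B = 1" using det_mult[OF A Bc] B by simp
  then show "\<bar>det A\<bar> = 1" by (auto simp: zmult_eq_1_iff)
next
  assume u: "\<bar>det A\<bar> = 1"
  then have sq: "det A * det A = 1" by (metis abs_mult_self_eq mult_1)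
  let ?B = "det A \<cdot>\<^sub>m Determinant.adj_mat A"
  have P: "Determinant.adj_mat A \<in> carrier_mat n n" using adj_mat(1)[OF A] .
  have "A * ?B = 1\<^sub>m n"
    using mult_smult_distrib[OF A P] adj_mat(2)[OF A] sq by (auto intro!: eq_matI)
  moreover have "?B * A = 1\<^sub>m n"
    using mult_smult_assoc_mat[OF P A] adj_mat(3)[OF A] sq by (auto intro!: eq_matI)
  ultimately show "invertible_mat A" unfolding invertible_mat_def inverts_mat_def using A P
    by (intro conjI exI[of _ ?B]) auto
qed

text \<open>Unimodularity is stated by determinants because products, transposes and elementary
  matrices are then immediate; \<open>invertible_mat_int_iff\<close> translates back to the
  invertibility asked of a Smith form.\<close>

definition unimodular_equiv :: "nat \<Rightarrow> int mat \<Rightarrow> int mat \<Rightarrow> bool" where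
  "unimodular_equiv n M N \<longleftrightarrow> (\<exists>U V. U \<in> carrier_mat n n \<and> V \<in> carrier_mat n n \<and>
     \<bar>det U\<bar> = 1 \<and> \<bar>det V\<bar> = 1 \<and> N = U * M * V)"

lemma unimodular_equiv_refl: "M \<in> carrier_mat n n \<Longrightarrow> unimodular_equiv n M M"
  unfolding unimodular_equiv_def by (rule exI[of _ "1\<^sub>m n"], rule exI[of _ "1\<^sub>m n"]) auto

lemma unimodular_equiv_trans:
  assumes "unimodular_equiv n M N" "unimodular_equiv n N K" and M: "M \<in> carrier_mat n n"
  shows "unimodular_equiv n M K"
proof -
  obtain U V where 1: "U \<in> carrier_mat n n" "V \<in> carrier_mat n n" "\<bar>det U\<bar> = 1" "\<bar>det V\<bar> = 1" "N = U * M * V"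
    using assms(1) unfolding unimodular_equiv_def by blast
  obtain U' V' where 2: "U' \<in> carrier_mat n n" "V' \<in> carrier_mat n n" "\<bar>det U'\<bar> = 1" "\<bar>det V'\<bar> = 1" "K = U' * N * V'"
    using assms(2) unfolding unimodular_equiv_def by blast
  have "K = (U' * U) * M * (V * V')" unfolding 2(5) 1(5) using 1(1,2) 2(1,2) M
    by (simp add: assoc_mult_mat[of _ n n _ n _ n])
  then show ?thesis unfolding unimodular_equiv_def using 1(1-4) 2(1-4)
    by (intro exI[of _ "U' * U"] exI[of _ "V * V'"]) (auto simp: det_mult[of _ n] abs_mult)
qed

lemma unimodular_equiv_carrier:
  "unimodular_equiv n M N \<Longrightarrow> M \<in> carrier_mat n n \<Longrightarrow> N \<in> carrier_mat n n"
  unfolding unimodular_equiv_def by auto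

lemma unimodular_equiv_left:
  assumes "M \<in> carrier_mat n n" "U \<in> carrier_mat n n" "\<bar>det U\<bar> = 1"
  shows "unimodular_equiv n M (U * M)"
  unfolding unimodular_equiv_def using assms by (intro exI[of _ U] exI[of _ "1\<^sub>m n"]) auto

lemma unimodular_equiv_transpose:
  assumes "unimodular_equiv n M N" and M: "M \<in> carrier_mat n n"
  shows "unimodular_equiv n (transpose_mat M) (transpose_mat N)"
proof -
  obtain U V where 1: "U \<in> carrier_mat n n" "V \<in> carrier_mat n n" "\<bar>det U\<bar> = 1" "\<bar>det V\<bar> = 1" "N = U * M * V"
    using assms(1) unfolding unimodular_equiv_def by blast
  have UM: "U * M \<in> carrier_mat n n" using 1 M by simp
  have "transpose_mat N = transpose_mat V * transpose_mat M * transpose_mat U"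
    unfolding 1(5) transpose_mult[OF UM 1(2)] transpose_mult[OF 1(1) M]
    using 1 M by (simp add: assoc_mult_mat[of _ n n _ n _ n])
  then show ?thesis unfolding unimodular_equiv_def using 1
    by (intro exI[of _ "transpose_mat V"] exI[of _ "transpose_mat U"]) (auto simp: det_transpose)
qed

lemma unimodular_equiv_addrow:
  assumes "M \<in> carrier_mat n n" "k < n" "l < n" "k \<noteq> l"
  shows "unimodular_equiv n M (addrow a k l M)"
  unfolding addrow_mat[OF assms(1,3)]
  by (rule unimodular_equiv_left) (use assms in \<open>auto simp: det_addrow_mat\<close>)

lemma unimodular_equiv_swaprows:
  assumes "M \<in> carrier_mat n n" "k < n" "l < n"
  shows "unimodular_equiv n M (swaprows k l M)"
proof (cases "k = l")
  case True
  then have "swaprows k l M = M" using assms by (auto intro!: eq_matI)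
  then show ?thesis using unimodular_equiv_refl[OF assms(1)] by simp
next
  case False
  show ?thesis unfolding swaprows_mat[OF assms]
    by (rule unimodular_equiv_left) (use assms False in \<open>auto simp: det_swaprows_mat\<close>)
qed

lemma unimodular_equiv_multrow:
  assumes "M \<in> carrier_mat n n" "k < n" "\<bar>a\<bar> = 1"
  shows "unimodular_equiv n M (multrow k a M)"
  unfolding multrow_mat[OF assms(1)]
  by (rule unimodular_equiv_left) (use assms in \<open>auto simp: det_multrow_mat\<close>)

text \<open>Otherwise the remainder modulo \<open>a\<close>, produced by one row addition and
  swapped into the corner, would be a smaller positive corner entry.\<close>

lemma pivot_dvd_column:
  assumes M: "M \<in> carrier_mat n n" and n: "0 < n"
    and least: "\<And>N. unimodular_equiv n M N \<Longrightarrow> N $$ (0,0) > 0 \<Longrightarrow> a \<le> N $$ (0,0)"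
    and N: "unimodular_equiv n M N" "N $$ (0,0) = a" and a: "a > 0" and i: "i < n"
  shows "a dvd N $$ (i,0)"
proof (rule ccontr)
  assume nd: "\<not> a dvd N $$ (i,0)"
  then have i0: "i \<noteq> 0" using N by (cases "i = 0") auto
  have Nc: "N \<in> carrier_mat n n" using unimodular_equiv_carrier[OF N(1) M] .
  let ?K = "addrow (- (N $$ (i,0) div a)) i 0 N"
  have K: "unimodular_equiv n N ?K" using unimodular_equiv_addrow[OF Nc i n i0] .
  have Kc: "?K \<in> carrier_mat n n" using Nc by simp
  have L: "unimodular_equiv n ?K (swaprows 0 i ?K)" using unimodular_equiv_swaprows[OF Kc n i] .
  have "unimodular_equiv n M (swaprows 0 i ?K)"
    using unimodular_equiv_trans[OF unimodular_equiv_trans[OF N(1) K M] L M] .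
  moreover have "swaprows 0 i ?K $$ (0,0) = N $$ (i,0) mod a"
    using Nc n i i0 N(2) by (simp add: minus_mult_div_eq_mod[symmetric] algebra_simps)
  moreover have "N $$ (i,0) mod a > 0" using nd a
    by (metis dvd_eq_mod_eq_0 order_le_less pos_mod_sign)
  ultimately have "a \<le> N $$ (i,0) mod a" using least by force
  then show False using a by (simp add: not_less[symmetric])
qed

text \<open>Induction on the size. The pivot is the least positive corner entry among all equivalent
  matrices. Minimality alone makes it divide its column, by transposition its row, and finally the
  whole remaining block, which yields the divisibility chain.\<close>

lemma smith_normal_form_exists:
  assumes "M \<in> carrier_mat n n"
  shows "\<exists>D. unimodular_equiv n M D \<and> diagonal_mat D \<and> (\<forall>i<n. D $$ (i,i) \<ge> 0) \<and>
    (\<forall>i. i + 1 < n \<longrightarrow> D $$ (i,i) dvd D $$ (i+1,i+1))"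
  using assms
proof (induction n arbitrary: M)
  case 0
  then show ?case using unimodular_equiv_refl[OF 0] by (intro exI[of _ M]) (auto simp: diagonal_mat_def)
next
  case (Suc n M)
  show ?case
  proof (cases "M = 0\<^sub>m (Suc n) (Suc n)")
    case True
    then show ?thesis using unimodular_equiv_refl[OF Suc.prems]
      by (intro exI[of _ M]) (auto simp: diagonal_mat_def)
  next
    case False
    let ?S = "{nat (N $$ (0,0)) | N. unimodular_equiv (Suc n) M N \<and> N $$ (0,0) > 0}"
    have "\<exists>N. unimodular_equiv (Suc n) M N \<and> N $$ (0,0) > 0"
    proof -
      obtain i j where ij: "i < Suc n" "j < Suc n" "M $$ (i,j) \<noteq> 0"
        using False Suc.prems by (metis carrier_matD eq_matI index_zero_mat(1) index_zero_mat(2) index_zero_mat(3))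
      let ?A = "swaprows 0 i M"
      have A: "unimodular_equiv (Suc n) M ?A" "?A \<in> carrier_mat (Suc n) (Suc n)"
        using unimodular_equiv_swaprows[OF Suc.prems, of 0 i] ij Suc.prems by auto
      let ?B = "swaprows 0 j (transpose_mat ?A)"
      have B: "unimodular_equiv (Suc n) (transpose_mat ?A) ?B"
        using unimodular_equiv_swaprows[of "transpose_mat ?A" "Suc n" 0 j] A ij by auto
      let ?C = "transpose_mat ?B"
      have C: "unimodular_equiv (Suc n) ?A ?C"
        using unimodular_equiv_transpose[OF B] A by simp
      have MC: "unimodular_equiv (Suc n) M ?C" using unimodular_equiv_trans[OF A(1) C Suc.prems] .
      have C00: "?C $$ (0,0) = M $$ (i,j)" using ij Suc.prems by auto
      let ?D = "multrow 0 (sgn (M $$ (i,j))) ?C"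
      have Cc: "?C \<in> carrier_mat (Suc n) (Suc n)" using unimodular_equiv_carrier[OF MC Suc.prems] .
      have "unimodular_equiv (Suc n) ?C ?D"
        using unimodular_equiv_multrow[OF Cc, of 0] ij by (simp add: abs_sgn_eq)
      then have "unimodular_equiv (Suc n) M ?D" using unimodular_equiv_trans[OF MC] Suc.prems by blast
      moreover have "?D $$ (0,0) = \<bar>M $$ (i,j)\<bar>" using Cc C00
        by (subst index_mat_multrow) (auto simp: abs_sgn mult.commute)
      ultimately show ?thesis using ij by (metis zero_less_abs_iff)
    qed
    then have "?S \<noteq> {}" by auto
    then have "(LEAST a. a \<in> ?S) \<in> ?S" by (metis (mono_tags, lifting) LeastI ex_in_conv)
    moreover have "\<And>b. b \<in> ?S \<Longrightarrow> (LEAST a. a \<in> ?S) \<le> b" by (rule Least_le)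
    ultimately obtain N where N: "unimodular_equiv (Suc n) M N" "N $$ (0,0) > 0"
      and least0: "\<And>K. unimodular_equiv (Suc n) M K \<Longrightarrow> K $$ (0,0) > 0 \<Longrightarrow> nat (N $$ (0,0)) \<le> nat (K $$ (0,0))"
      by (smt (verit) mem_Collect_eq)
    define a where "a = N $$ (0,0)"
    have a: "a > 0" using N a_def by simp
    have least: "a \<le> K $$ (0,0)" if "unimodular_equiv (Suc n) M K" "K $$ (0,0) > 0" for K
      using least0[OF that] that N unfolding a_def by simp
    have column: "a dvd K $$ (i,0)" if "unimodular_equiv (Suc n) M K" "K $$ (0,0) = a" "i < Suc n" for K i
      using pivot_dvd_column[OF Suc.prems _ least that(1,2) a that(3)] by simp
    have row: "a dvd K $$ (0,j)" if K: "unimodular_equiv (Suc n) M K" "K $$ (0,0) = a" and j: "j < Suc n" for K j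
    proof -
      have MT: "transpose_mat M \<in> carrier_mat (Suc n) (Suc n)" using Suc.prems by simp
      have Kc: "K \<in> carrier_mat (Suc n) (Suc n)" using unimodular_equiv_carrier[OF K(1) Suc.prems] .
      have l: "a \<le> L $$ (0,0)" if L: "unimodular_equiv (Suc n) (transpose_mat M) L" "L $$ (0,0) > 0" for L
      proof -
        have "unimodular_equiv (Suc n) M (transpose_mat L)"
          using unimodular_equiv_transpose[OF L(1) MT] by simp
        from least[OF this] show ?thesis using L unimodular_equiv_carrier[OF L(1) MT] by simp
      qed
      have "a dvd transpose_mat K $$ (j,0)"
        by (rule pivot_dvd_column[OF MT _ l unimodular_equiv_transpose[OF K(1) Suc.prems] _ a j])
          (use Kc K in auto)
      then show ?thesis using Kc j by simp
    qed
    have Nc: "N \<in> carrier_mat (Suc n) (Suc n)" using unimodular_equiv_carrier[OF N(1) Suc.prems] .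
    define c where "c i = N $$ (Suc i, 0) div a" for i
    define r where "r j = N $$ (0, Suc j) div a" for j
    have c: "N $$ (Suc i, 0) = a * c i" if "i < n" for i
      using column[OF N(1), of "Suc i"] that unfolding c_def a_def by simp
    have r: "N $$ (0, Suc j) = a * r j" if "j < n" for j
      using row[OF N(1), of "Suc j"] that unfolding r_def a_def by simp
    define R where "R = mat n n (\<lambda>(i,j). N $$ (Suc i, Suc j))"
    have R: "R \<in> carrier_mat n n" unfolding R_def by simp
    let ?a = "mat 1 1 (\<lambda>_. a)" and ?c = "mat n 1 (\<lambda>(i,_). c i)" and ?r = "mat 1 n (\<lambda>(_,j). r j)"
    have N4: "N = four_block_mat ?a (a \<cdot>\<^sub>m ?r) (a \<cdot>\<^sub>m ?c) R"
    proof (rule eq_matI)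
      fix i j assume "i < dim_row (four_block_mat ?a (a \<cdot>\<^sub>m ?r) (a \<cdot>\<^sub>m ?c) R)"
        "j < dim_col (four_block_mat ?a (a \<cdot>\<^sub>m ?r) (a \<cdot>\<^sub>m ?c) R)"
      then show "N $$ (i,j) = four_block_mat ?a (a \<cdot>\<^sub>m ?r) (a \<cdot>\<^sub>m ?c) R $$ (i,j)"
        using c[of "i - 1"] r[of "j - 1"] Nc unfolding R_def by (cases i; cases j) (auto simp: a_def)
    qed (use Nc R in auto)
    let ?U = "four_block_mat (1\<^sub>m 1) (0\<^sub>m 1 n) (- ?c) (1\<^sub>m n)"
    let ?V = "four_block_mat (1\<^sub>m 1) (- ?r) (0\<^sub>m n 1) (1\<^sub>m n)"
    define N' where "N' = R - a \<cdot>\<^sub>m (?c * ?r)"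
    have N': "N' \<in> carrier_mat n n" unfolding N'_def
      by (intro minus_carrier_mat smult_carrier_mat mult_carrier_mat[of _ n 1]) auto
    define K where "K = four_block_mat ?a (0\<^sub>m 1 n) (0\<^sub>m n 1) N'"
    have UN: "?U * N = four_block_mat ?a (a \<cdot>\<^sub>m ?r) (0\<^sub>m n 1) N'"
    proof -
      have "?U * N = four_block_mat (1\<^sub>m 1 * ?a + 0\<^sub>m 1 n * (a \<cdot>\<^sub>m ?c)) (1\<^sub>m 1 * (a \<cdot>\<^sub>m ?r) + 0\<^sub>m 1 n * R)
         (- ?c * ?a + 1\<^sub>m n * (a \<cdot>\<^sub>m ?c)) (- ?c * (a \<cdot>\<^sub>m ?r) + 1\<^sub>m n * R)" unfolding N4
        by (rule mult_four_block_mat[of _ 1 1 _ n _ n _ _ 1 _ n]) (use R in auto)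
      moreover have "1\<^sub>m 1 * ?a + 0\<^sub>m 1 n * (a \<cdot>\<^sub>m ?c) = ?a" "1\<^sub>m 1 * (a \<cdot>\<^sub>m ?r) + 0\<^sub>m 1 n * R = a \<cdot>\<^sub>m ?r"
        "- ?c * ?a + 1\<^sub>m n * (a \<cdot>\<^sub>m ?c) = 0\<^sub>m n 1" "- ?c * (a \<cdot>\<^sub>m ?r) + 1\<^sub>m n * R = N'"
        unfolding N'_def using R by (auto intro!: eq_matI simp: scalar_prod_def)
      ultimately show ?thesis by simp
    qed
    have UNV: "?U * N * ?V = K"
    proof -
      have "?U * N * ?V = four_block_mat (?a * 1\<^sub>m 1 + (a \<cdot>\<^sub>m ?r) * 0\<^sub>m n 1) (?a * - ?r + (a \<cdot>\<^sub>m ?r) * 1\<^sub>m n)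
         (0\<^sub>m n 1 * 1\<^sub>m 1 + N' * 0\<^sub>m n 1) (0\<^sub>m n 1 * - ?r + N' * 1\<^sub>m n)" unfolding UN
        by (rule mult_four_block_mat[of _ 1 1 _ n _ n _ _ 1 _ n]) (use N' in auto)
      moreover have "?a * 1\<^sub>m 1 + (a \<cdot>\<^sub>m ?r) * 0\<^sub>m n 1 = ?a" "?a * - ?r + (a \<cdot>\<^sub>m ?r) * 1\<^sub>m n = 0\<^sub>m 1 n"
        "0\<^sub>m n 1 * 1\<^sub>m 1 + N' * 0\<^sub>m n 1 = 0\<^sub>m n 1" "0\<^sub>m n 1 * - ?r + N' * 1\<^sub>m n = N'"
        using N' by (auto intro!: eq_matI simp: scalar_prod_def)
      ultimately show ?thesis unfolding K_def by simp
    qed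
    have detU: "det ?U = 1" by (subst det_four_block_mat_upper_right_zero[of _ 1 _ n]) auto
    have detV: "det ?V = 1" by (subst det_four_block_mat_lower_left_zero[of _ 1 _ n]) auto
    have "unimodular_equiv (Suc n) N K" unfolding unimodular_equiv_def
      by (rule exI[of _ ?U], rule exI[of _ ?V]) (use detU detV UNV in \<open>auto simp del: one_carrier_mat\<close>)
    then have MK: "unimodular_equiv (Suc n) M K" using unimodular_equiv_trans[OF N(1) _ Suc.prems] by blast
    have Kc: "K \<in> carrier_mat (Suc n) (Suc n)" using unimodular_equiv_carrier[OF MK Suc.prems] .
    have N'dvd: "a dvd N' $$ (i,j)" if ij: "i < n" "j < n" for i j
    proof -
      \<comment> \<open>Column 0 of \<open>K\<close> vanishes below the pivot, so this addition
        keeps the pivot \<open>a\<close> and places row \<open>i\<close> of \<open>N'\<close> beside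
        it, where \<open>row\<close> applies.\<close>
      let ?L = "addrow 1 0 (Suc i) K"
      have "unimodular_equiv (Suc n) M ?L"
        using unimodular_equiv_trans[OF MK unimodular_equiv_addrow[OF Kc, of 0 "Suc i"] Suc.prems] ij by simp
      from row[OF this, of "Suc j"] show ?thesis using ij N' Kc unfolding K_def by auto
    qed
    obtain D' where D': "unimodular_equiv n N' D'" "diagonal_mat D'" "\<forall>i<n. D' $$ (i,i) \<ge> 0"
      "\<forall>i. i + 1 < n \<longrightarrow> D' $$ (i,i) dvd D' $$ (i+1,i+1)" using Suc.IH[OF N'] by auto
    obtain U' V' where UV: "U' \<in> carrier_mat n n" "V' \<in> carrier_mat n n" "\<bar>det U'\<bar> = 1" "\<bar>det V'\<bar> = 1" "D' = U' * N' * V'"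
      using D'(1) unfolding unimodular_equiv_def by auto
    have D'c: "D' \<in> carrier_mat n n" using UV by auto
    have D'dvd: "a dvd D' $$ (i,j)" if "i < n" "j < n" for i j
    proof -
      have "a dvd (U' * N') $$ (i,k)" if "i < n" "k < n" for i k
        using that UV N' N'dvd by (auto simp: scalar_prod_def intro!: dvd_sum dvd_mult)
      moreover have "a dvd (W * V') $$ (i,j)"
        if "W \<in> carrier_mat n n" "\<And>i k. i < n \<Longrightarrow> k < n \<Longrightarrow> a dvd W $$ (i,k)" for W
        using that UV(2) \<open>i < n\<close> \<open>j < n\<close> by (auto simp: scalar_prod_def intro!: dvd_sum dvd_mult2)
      moreover have "U' * N' \<in> carrier_mat n n" using UV N' by simp
      ultimately show ?thesis unfolding UV(5) by blast
    qed
    define D where "D = four_block_mat ?a (0\<^sub>m 1 n) (0\<^sub>m n 1) D'"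
    let ?U2 = "four_block_mat (1\<^sub>m 1) (0\<^sub>m 1 n) (0\<^sub>m n 1) U'"
    let ?V2 = "four_block_mat (1\<^sub>m 1) (0\<^sub>m 1 n) (0\<^sub>m n 1) V'"
    have diag_mult: "four_block_mat X (0\<^sub>m 1 n) (0\<^sub>m n 1) Y * four_block_mat X' (0\<^sub>m 1 n) (0\<^sub>m n 1) Y' =
        four_block_mat (X * X') (0\<^sub>m 1 n) (0\<^sub>m n 1) (Y * Y')"
      if "X \<in> carrier_mat 1 1" "X' \<in> carrier_mat 1 1" "Y \<in> carrier_mat n n" "Y' \<in> carrier_mat n n" for X X' Y Y' :: "int mat"
    proof -
      have "four_block_mat X (0\<^sub>m 1 n) (0\<^sub>m n 1) Y * four_block_mat X' (0\<^sub>m 1 n) (0\<^sub>m n 1) Y' =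
        four_block_mat (X * X' + 0\<^sub>m 1 n * 0\<^sub>m n 1) (X * 0\<^sub>m 1 n + 0\<^sub>m 1 n * Y') (0\<^sub>m n 1 * X' + Y * 0\<^sub>m n 1) (0\<^sub>m n 1 * 0\<^sub>m 1 n + Y * Y')"
        by (rule mult_four_block_mat[of _ 1 1 _ n _ n _ _ 1 _ n]) (use that in auto)
      moreover have "X * X' + 0\<^sub>m 1 n * 0\<^sub>m n 1 = X * X'" "X * 0\<^sub>m 1 n + 0\<^sub>m 1 n * Y' = 0\<^sub>m 1 n"
        "0\<^sub>m n 1 * X' + Y * 0\<^sub>m n 1 = 0\<^sub>m n 1" "0\<^sub>m n 1 * 0\<^sub>m 1 n + Y * Y' = Y * Y'"
        using that by auto
      ultimately show ?thesis by simp
    qed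
    have "?U2 * K = four_block_mat (1\<^sub>m 1 * ?a) (0\<^sub>m 1 n) (0\<^sub>m n 1) (U' * N')"
      unfolding K_def by (rule diag_mult) (use UV N' in auto)
    then have "?U2 * K * ?V2 = four_block_mat (1\<^sub>m 1 * ?a * 1\<^sub>m 1) (0\<^sub>m 1 n) (0\<^sub>m n 1) (U' * N' * V')"
      by (simp only:, intro diag_mult) (use UV N' in auto)
    also have "1\<^sub>m 1 * ?a * 1\<^sub>m 1 = ?a" by auto
    finally have "?U2 * K * ?V2 = D" unfolding D_def UV(5) .
    moreover have "\<bar>det ?U2\<bar> = 1" "\<bar>det ?V2\<bar> = 1"
      using det_four_block_mat_upper_right_zero[of "1\<^sub>m 1 :: int mat" 1 _ n "0\<^sub>m n 1", OF _ refl] UV by auto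
    ultimately have "unimodular_equiv (Suc n) K D" unfolding unimodular_equiv_def
      by (intro exI[of _ ?U2] exI[of _ ?V2]) (use UV in auto)
    then have MD: "unimodular_equiv (Suc n) M D" using unimodular_equiv_trans[OF MK] Suc.prems by blast
    have Dij: "D $$ (i,j) = (if i = 0 \<and> j = 0 then a else if i = 0 \<or> j = 0 then 0 else D' $$ (i-1,j-1))"
      if "i < Suc n" "j < Suc n" for i j
      using that D'c unfolding D_def by auto
    have "diagonal_mat D" unfolding diagonal_mat_def
    proof (intro allI impI)
      fix i j assume "i < dim_row D" "j < dim_col D" "i \<noteq> j"
      moreover have "dim_row D = Suc n" "dim_col D = Suc n" using D'c unfolding D_def by auto
      ultimately show "D $$ (i,j) = 0" using D'(2) D'c by (auto simp: Dij diagonal_mat_def)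
    qed
    moreover have "\<forall>i<Suc n. D $$ (i,i) \<ge> 0" using D'(3) a by (auto simp: Dij)
    moreover have "\<forall>i. i + 1 < Suc n \<longrightarrow> D $$ (i,i) dvd D $$ (i+1,i+1)"
    proof (intro allI impI)
      fix i assume "i + 1 < Suc n"
      then show "D $$ (i,i) dvd D $$ (i+1,i+1)"
        using D'(4)[rule_format, of "i - 1"] D'dvd[of 0 0] by (cases i) (auto simp: Dij)
    qed
    ultimately show ?thesis using MD by blast
  qed
qed

text \<open>The last invariant factor generates the ideal of all \<open>c\<close> such that \<open>c M\<^sup>-\<^sup>1\<close> is integral.\<close>

lemma last_invariant_factor:
  assumes M: "M \<in> carrier_mat n n" and n: "n > 0" and det: "det M \<noteq> 0"
  shows last_invariant_factor_pos: "last_invariant_factor M > 0"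
    and last_invariant_factor_inverse: "\<exists>X\<in>carrier_mat n n. M * X = last_invariant_factor M \<cdot>\<^sub>m 1\<^sub>m n"
    and last_invariant_factor_least: "\<And>c X. X \<in> carrier_mat n n \<Longrightarrow> M * X = c \<cdot>\<^sub>m 1\<^sub>m n \<Longrightarrow> last_invariant_factor M dvd c"
proof -
  \<comment> \<open>A positive \<open>d\<close> with this property is unique, so all Smith forms
    share their last diagonal entry and the definite description denotes it.\<close>
  let ?good = "\<lambda>d. d > 0 \<and> (\<exists>X\<in>carrier_mat n n. M * X = d \<cdot>\<^sub>m 1\<^sub>m n) \<and>
    (\<forall>c X. X \<in> carrier_mat n n \<longrightarrow> M * X = c \<cdot>\<^sub>m 1\<^sub>m n \<longrightarrow> d dvd c)"
  have good: "?good (D $$ (n-1,n-1))" if D: "smith_normal_form_of M D" for D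
  proof -
    obtain U V where UV: "U \<in> carrier_mat n n" "V \<in> carrier_mat n n" "invertible_mat U" "invertible_mat V" and DUV: "D = U * M * V"
      using D M unfolding smith_normal_form_of_def by auto
    have Dc: "D \<in> carrier_mat n n" using UV DUV by auto
    have diag: "D $$ (i,j) = 0" if "i < n" "j < n" "i \<noteq> j" for i j
      using D that Dc unfolding smith_normal_form_of_def diagonal_mat_def by auto
    have nn: "D $$ (i,i) \<ge> 0" if "i < n" for i
      using D that Dc unfolding smith_normal_form_of_def by auto
    have chain: "D $$ (i,i) dvd D $$ (i+1,i+1)" if "i + 1 < n" for i
      using D that Dc unfolding smith_normal_form_of_def by auto
    have dv: "D $$ (i,i) dvd D $$ (n-1,n-1)" if "i < n" for i
    proof -
      have "D $$ (i,i) dvd D $$ (i+k,i+k)" if "i + k < n" for k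
        using that by (induction k) (auto intro: dvd_trans chain[simplified])
      from this[of "n - 1 - i"] show ?thesis using that by simp
    qed
    obtain U' where U': "U' \<in> carrier_mat n n" "U * U' = 1\<^sub>m n" "U' * U = 1\<^sub>m n"
      using UV(1,3) unfolding invertible_mat_def inverts_mat_def
      by (metis carrier_matD carrier_matI index_mult_mat(2,3) index_one_mat(2,3))
    obtain V' where V': "V' \<in> carrier_mat n n" "V * V' = 1\<^sub>m n" "V' * V = 1\<^sub>m n"
      using UV(2,4) unfolding invertible_mat_def inverts_mat_def
      by (metis carrier_matD carrier_matI index_mult_mat(2,3) index_one_mat(2,3))
    have detD: "det D \<noteq> 0"
    proof -
      have "det U \<noteq> 0" "det V \<noteq> 0" using UV invertible_mat_int_iff by fastforce+
      then show ?thesis unfolding DUV using UV M det by (simp add: det_mult[of _ n])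
    qed
    have "upper_triangular D" using diag Dc by auto
    then have "\<And>i. i < n \<Longrightarrow> D $$ (i,i) \<noteq> 0"
      using detD upper_triangular_imp_det_eq_0_iff[OF Dc] Dc by (fastforce simp: diag_mat_def)
    then have pos: "D $$ (i,i) > 0" if "i < n" for i using nn that by (simp add: order_less_le)
    define d where "d = D $$ (n-1,n-1)"
    \<comment> \<open>The matrix d D^-1, integral because every diagonal entry divides the last
      one.\<close>
    define D' where "D' = mat n n (\<lambda>(i,j). if i = j then d div D $$ (i,i) else 0)"
    have D'c: "D' \<in> carrier_mat n n" unfolding D'_def by simp
    have DD': "D * D' = d \<cdot>\<^sub>m 1\<^sub>m n"
    proof (rule eq_matI)
      fix i j assume "i < dim_row (d \<cdot>\<^sub>m 1\<^sub>m n)" "j < dim_col (d \<cdot>\<^sub>m 1\<^sub>m n)"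
      then have ij: "i < n" "j < n" by auto
      have "(D * D') $$ (i,j) = (\<Sum>k\<in>{0..<n}. D $$ (i,k) * D' $$ (k,j))"
        using ij Dc D'c by (auto simp: scalar_prod_def)
      also have "\<dots> = (\<Sum>k\<in>{0..<n}. if k = j then D $$ (i,j) * (d div D $$ (j,j)) else 0)"
        using ij by (intro sum.cong) (auto simp: D'_def)
      also have "\<dots> = (d \<cdot>\<^sub>m 1\<^sub>m n) $$ (i,j)" using ij diag[of i j] dv[of j] d_def by auto
      finally show "(D * D') $$ (i,j) = (d \<cdot>\<^sub>m 1\<^sub>m n) $$ (i,j)" .
    qed (use Dc D'c in auto)
    have UMV: "U' * D = M * V"
    proof -
      have "U' * D = U' * (U * (M * V))" unfolding DUV using U' UV M
        by (simp add: assoc_mult_mat[of _ n n _ n _ n])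
      also have "\<dots> = (U' * U) * (M * V)"
        by (rule assoc_mult_mat[symmetric]) (use U' UV M in auto)
      finally have "U' * D = (U' * U) * (M * V)" .
      then show ?thesis using U' UV M by simp
    qed
    let ?X = "V * (D' * U)"
    have "M * ?X = (M * V) * (D' * U)" using UV M D'c by (simp add: assoc_mult_mat[of _ n n _ n _ n])
    also have "\<dots> = U' * ((D * D') * U)" unfolding UMV[symmetric] using UV M D'c Dc U'
      by (simp add: assoc_mult_mat[of _ n n _ n _ n])
    also have "\<dots> = d \<cdot>\<^sub>m (U' * U)" unfolding DD' using UV U'
      by (simp add: mult_smult_assoc_mat[of _ n n] mult_smult_distrib[of _ n n])
    also have "\<dots> = d \<cdot>\<^sub>m 1\<^sub>m n" using U' by simp
    finally have ex: "\<exists>X\<in>carrier_mat n n. M * X = d \<cdot>\<^sub>m 1\<^sub>m n" using UV D'c by (intro bexI[of _ ?X]) auto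
    have least: "d dvd c" if X: "X \<in> carrier_mat n n" "M * X = c \<cdot>\<^sub>m 1\<^sub>m n" for c X
    proof -
      \<comment> \<open>\<open>D * ?Y\<close> is again \<open>c\<close> times the identity, and its
        last diagonal entry exhibits \<open>c\<close> as a multiple of \<open>d\<close>.\<close>
      let ?Y = "V' * (X * U')"
      have Y: "?Y \<in> carrier_mat n n" using V' X U' by auto
      have "V * ?Y = (V * V') * (X * U')"
        by (rule assoc_mult_mat[symmetric]) (use UV V' X U' in auto)
      then have VY: "V * ?Y = X * U'" using V' X U' by simp
      have "D * ?Y = U * (M * (V * ?Y))" unfolding DUV using UV M Y
        by (simp add: assoc_mult_mat[of _ n n _ n _ n])
      also have "\<dots> = U * ((M * X) * U')" unfolding VY using UV M X(1) U'
        by (simp add: assoc_mult_mat[of _ n n _ n _ n])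
      also have "\<dots> = c \<cdot>\<^sub>m (U * U')" unfolding X(2) using UV U'
        by (simp add: mult_smult_assoc_mat[of _ n n] mult_smult_distrib[of _ n n])
      finally have e: "D * ?Y = c \<cdot>\<^sub>m 1\<^sub>m n" using U' by simp
      have DZ: "(D * Z) $$ (n-1,n-1) = (\<Sum>k\<in>{0..<n}. D $$ (n-1,k) * Z $$ (k,n-1))" if "Z \<in> carrier_mat n n" for Z
        using n Dc that by (auto simp: scalar_prod_def)
      have "c = (D * ?Y) $$ (n-1,n-1)" unfolding e using n by simp
      also have "\<dots> = (\<Sum>k\<in>{0..<n}. D $$ (n-1,k) * ?Y $$ (k,n-1))" using DZ[OF Y] .
      also have "\<dots> = (\<Sum>k\<in>{0..<n}. if k = n - 1 then d * ?Y $$ (n-1,n-1) else 0)"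
        using n diag[of "n-1"] by (intro sum.cong) (auto simp: d_def)
      also have "\<dots> = d * ?Y $$ (n-1,n-1)" using n by simp
      finally show ?thesis by simp
    qed
    have "d > 0" using pos[of "n-1"] n unfolding d_def by simp
    then show ?thesis using ex least unfolding d_def[symmetric] by simp
  qed
  obtain D where D: "unimodular_equiv n M D" "diagonal_mat D" "\<forall>i<n. D $$ (i,i) \<ge> 0"
    "\<forall>i. i + 1 < n \<longrightarrow> D $$ (i,i) dvd D $$ (i+1,i+1)" using smith_normal_form_exists[OF M] by auto
  have Dc: "D \<in> carrier_mat n n" using unimodular_equiv_carrier[OF D(1) M] .
  have snf: "smith_normal_form_of M D"
  proof -
    obtain U V where UV: "U \<in> carrier_mat n n" "V \<in> carrier_mat n n" "\<bar>det U\<bar> = 1" "\<bar>det V\<bar> = 1" and DUV: "D = U * M * V"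
      using D(1) unfolding unimodular_equiv_def by blast
    have "invertible_mat U" "invertible_mat V" using UV invertible_mat_int_iff by blast+
    then have "\<exists>U V. U \<in> carrier_mat (dim_row M) (dim_row M) \<and> V \<in> carrier_mat (dim_col M) (dim_col M) \<and>
        invertible_mat U \<and> invertible_mat V \<and> D = U * M * V"
      using UV(1,2) DUV M by (intro exI[of _ U] exI[of _ V]) simp
    moreover have "dim_row D = n" "dim_col D = n" using Dc by auto
    ultimately show ?thesis unfolding smith_normal_form_of_def using D(2-4) by simp
  qed
  have uniq: "D1 $$ (n-1,n-1) = D2 $$ (n-1,n-1)" if "smith_normal_form_of M D1" "smith_normal_form_of M D2" for D1 D2
  proof -
    have "D1 $$ (n-1,n-1) dvd D2 $$ (n-1,n-1)" using good[OF that(1)] good[OF that(2)] by blast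
    moreover have "D2 $$ (n-1,n-1) dvd D1 $$ (n-1,n-1)" using good[OF that(1)] good[OF that(2)] by blast
    moreover have "D1 $$ (n-1,n-1) > 0" "D2 $$ (n-1,n-1) > 0" using good[OF that(1)] good[OF that(2)] by blast+
    ultimately show ?thesis by (simp add: zdvd_antisym_nonneg)
  qed
  have "last_invariant_factor M = D $$ (n-1,n-1)"
  proof -
    have dim: "dim_row M = n" "dim_col M = n" using M by auto
    show ?thesis unfolding last_invariant_factor_def dim
    proof (rule the_equality)
      show "\<exists>D'. smith_normal_form_of M D' \<and> D $$ (n-1,n-1) = D' $$ (n-1,n-1)" using snf by blast
    next
      fix d assume "\<exists>D'. smith_normal_form_of M D' \<and> d = D' $$ (n-1,n-1)"
      then obtain D' where "smith_normal_form_of M D'" "d = D' $$ (n-1,n-1)" by blast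
      then show "d = D $$ (n-1,n-1)" using uniq[OF _ snf] by simp
    qed
  qed
  then have g: "?good (last_invariant_factor M)" using good[OF snf] by simp
  show "last_invariant_factor M > 0" using g by (elim conjE)
  show "\<exists>X\<in>carrier_mat n n. M * X = last_invariant_factor M \<cdot>\<^sub>m 1\<^sub>m n" using g by (elim conjE)
  show "last_invariant_factor M dvd c" if "X \<in> carrier_mat n n" "M * X = c \<cdot>\<^sub>m 1\<^sub>m n" for c X
    using g that by (elim conjE) simp
qed

section \<open>Polynomials evaluated at matrices and the Cayley-Hamilton theorem\<close>

text \<open>The linear functional on polynomials that sends x^k to \<open>a k\<close>. Entries of
  f(A) and of f(A) z, and the values z^T f(A) z, are all of this kind, for sequences read off from
  the powers of A.\<close>

definition umbral :: "(nat \<Rightarrow> 'a) \<Rightarrow> 'a poly \<Rightarrow> 'a :: comm_ring_1" where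
  "umbral a f = (\<Sum>k\<le>degree f. coeff f k * a k)"

lemma umbral_altdef: "degree f \<le> N \<Longrightarrow> umbral a f = (\<Sum>k\<le>N. coeff f k * a k)"
  unfolding umbral_def by (intro sum.mono_neutral_left) (auto simp: coeff_eq_0)

lemma umbral_0 [simp]: "umbral a 0 = 0"
  by (simp add: umbral_def)

lemma umbral_add: "umbral a (f + g) = umbral a f + umbral a g"
proof -
  let ?N = "max (degree f) (degree g)"
  show ?thesis
    by (simp add: umbral_altdef[of _ ?N] degree_add_le_max algebra_simps sum.distrib)
qed

lemma umbral_smult: "umbral a (Polynomial.smult c f) = c * umbral a f"
  using degree_smult_le[of c f]
  by (simp add: umbral_altdef[of _ "degree f"] sum_distrib_left mult.assoc)

lemma umbral_minus: "umbral a (f - g) = umbral a f - umbral a g"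
  using umbral_add[of a f "Polynomial.smult (-1) g"] umbral_smult[of a "-1" g] by simp

lemma umbral_sum: "umbral a (\<Sum>j\<in>S. f j) = (\<Sum>j\<in>S. umbral a (f j))"
  by (induction S rule: infinite_finite_induct) (auto simp: umbral_add)

lemma umbral_pCons: "umbral a (pCons c f) = c * a 0 + umbral (\<lambda>k. a (Suc k)) f"
proof -
  have "degree (pCons c f) \<le> Suc (degree f)" by (rule degree_pCons_le)
  then show ?thesis
    by (simp add: umbral_altdef[of "pCons c f" "Suc (degree f)"] umbral_def sum.atMost_Suc_shift
        del: sum.atMost_Suc)
qed

lemma umbral_monom_mult: "umbral a (monom 1 r * f) = umbral (\<lambda>k. a (k + r)) f"
proof (induction r arbitrary: a)
  case (Suc r)
  have "monom 1 (Suc r) * f = pCons 0 (monom 1 r * f)" by (simp add: monom_Suc)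
  then show ?case using Suc[of "\<lambda>k. a (Suc k)"] by (simp add: umbral_pCons)
qed simp

lemma umbral_sum_left: "umbral (\<lambda>k. \<Sum>j\<in>S. c j * a j k) f = (\<Sum>j\<in>S. c j * umbral (a j) f)"
  unfolding umbral_def by (simp add: sum_distrib_left sum.swap[of _ S] algebra_simps)

lemma umbral_dvd: "[:p:] dvd f \<Longrightarrow> p dvd umbral a f"
  unfolding umbral_def const_poly_dvd_iff by (auto intro!: dvd_sum dvd_mult2)

lemma index_mult_mat_vec_sum:
  assumes "M \<in> carrier_mat m n" "z \<in> carrier_vec n" "r < m"
  shows "(M *\<^sub>v z) $ r = (\<Sum>i<n. M $$ (r,i) * z $ i)"
  using assms by (auto simp: scalar_prod_def atLeast0LessThan intro!: sum.cong)

lemma index_mult_mat_sum: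
  assumes "M \<in> carrier_mat m n" "N \<in> carrier_mat n l" "r < m" "s < l"
  shows "(M * N) $$ (r,s) = (\<Sum>i<n. M $$ (r,i) * N $$ (i,s))"
  using assms by (auto simp: scalar_prod_def atLeast0LessThan intro!: sum.cong)

lemma index_poly_mat_mult_vec:
  assumes A: "A \<in> carrier_mat n n" and z: "z \<in> carrier_vec n" and r: "r < n"
  shows "(poly_mat f A *\<^sub>v z) $ r = (\<Sum>i<n. z $ i * umbral (\<lambda>k. (A ^\<^sub>m k) $$ (r,i)) f)"
  using A z r unfolding poly_mat_def umbral_def
  by (auto simp: scalar_prod_def mult.commute atLeast0LessThan intro!: sum.cong)

lemma index_poly_mat_mult_vec_umbral:
  assumes A: "A \<in> carrier_mat n n" and z: "z \<in> carrier_vec n" and r: "r < n"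
  shows "(poly_mat f A *\<^sub>v z) $ r = umbral (\<lambda>k. ((A ^\<^sub>m k) *\<^sub>v z) $ r) f"
proof -
  have "((A ^\<^sub>m k) *\<^sub>v z) $ r = (\<Sum>i\<in>{..<n}. z $ i * (A ^\<^sub>m k) $$ (r,i))" for k
    using index_mult_mat_vec_sum[OF pow_carrier_mat[OF A] z r] by (simp add: mult.commute)
  then show ?thesis unfolding index_poly_mat_mult_vec[OF assms] by (simp add: umbral_sum_left)
qed

lemma poly_mat_carrier [simp]: "A \<in> carrier_mat n n \<Longrightarrow> poly_mat f A \<in> carrier_mat n n"
  unfolding poly_mat_def by auto

lemma char_poly_matrix_mult_vec:
  assumes A: "A \<in> carrier_mat n n" and v: "v \<in> carrier_vec n" and i: "i < n"
  shows "(char_poly_matrix A *\<^sub>v v) $ i = pCons 0 (v $ i) - (\<Sum>j<n. Polynomial.smult (A $$ (i,j)) (v $ j))"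
proof -
  have "(char_poly_matrix A *\<^sub>v v) $ i = (\<Sum>j<n. (if i = j then pCons 0 (v $ j) else 0) - Polynomial.smult (A $$ (i,j)) (v $ j))"
    using A v i unfolding char_poly_matrix_def
    by (auto simp: scalar_prod_def atLeast0LessThan algebra_simps intro!: sum.cong)
  also have "\<dots> = pCons 0 (v $ i) - (\<Sum>j<n. Polynomial.smult (A $$ (i,j)) (v $ j))"
    using i by (simp add: sum_subtractf)
  finally show ?thesis .
qed

text \<open>Substituting \<open>A\<close> for \<open>x\<close> on the left annihilates every vector of the form \<open>(x - A) v\<close>.
  With \<open>v\<close> the adjugate of \<open>x - A\<close> applied to a vector this is the Cayley--Hamilton theorem.\<close>

lemma poly_mat_mult_vec_dvd:
  assumes A: "A \<in> carrier_mat n n" and z: "z \<in> carrier_vec n" and v: "v \<in> carrier_vec n"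
    and dvd: "\<And>i. i < n \<Longrightarrow> [:p:] dvd Polynomial.smult (z $ i) f - (char_poly_matrix A *\<^sub>v v) $ i"
    and r: "r < n"
  shows "p dvd (poly_mat f A *\<^sub>v z) $ r"
proof -
  \<comment> \<open>Row \<open>r\<close> of the powers of \<open>A\<close>. Multiplication by x
    shifts the index \<open>k\<close>, which has the same effect as multiplication by
    \<open>A\<close>; hence the contributions of (x - A) v cancel.\<close>
  define a where "a i k = (A ^\<^sub>m k) $$ (r,i)" for i k
  have aS: "a j (Suc k) = (\<Sum>i<n. A $$ (i,j) * a i k)" if "j < n" for j k
    using index_mult_mat_sum[OF pow_carrier_mat[OF A] A r that] unfolding a_def by (simp add: mult.commute)
  have "(\<Sum>i<n. umbral (a i) ((char_poly_matrix A *\<^sub>v v) $ i)) =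
    (\<Sum>i<n. umbral (\<lambda>k. a i (Suc k)) (v $ i)) - (\<Sum>i<n. \<Sum>j<n. A $$ (i,j) * umbral (a i) (v $ j))"
    by (simp add: char_poly_matrix_mult_vec[OF A v] umbral_minus umbral_pCons umbral_sum umbral_smult sum_subtractf)
  also have "(\<Sum>i<n. umbral (\<lambda>k. a i (Suc k)) (v $ i)) = (\<Sum>j<n. \<Sum>i<n. A $$ (i,j) * umbral (a i) (v $ j))"
  proof (rule sum.cong)
    fix j assume "j \<in> {..<n}"
    then have "(\<lambda>k. a j (Suc k)) = (\<lambda>k. \<Sum>i<n. A $$ (i,j) * a i k)" using aS by auto
    then show "umbral (\<lambda>k. a j (Suc k)) (v $ j) = (\<Sum>i<n. A $$ (i,j) * umbral (a i) (v $ j))"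
      by (simp add: umbral_sum_left)
  qed simp
  also have "\<dots> = (\<Sum>i<n. \<Sum>j<n. A $$ (i,j) * umbral (a i) (v $ j))" by (rule sum.swap)
  finally have 0: "(\<Sum>i<n. umbral (a i) ((char_poly_matrix A *\<^sub>v v) $ i)) = 0" by simp
  have "(poly_mat f A *\<^sub>v z) $ r = (\<Sum>i<n. umbral (a i) (Polynomial.smult (z $ i) f))"
    unfolding index_poly_mat_mult_vec[OF A z r] a_def by (simp add: umbral_smult)
  also have "\<dots> = (\<Sum>i<n. umbral (a i) (Polynomial.smult (z $ i) f - (char_poly_matrix A *\<^sub>v v) $ i))"
    unfolding umbral_minus sum_subtractf 0 by simp
  finally show ?thesis using dvd by (auto intro!: dvd_sum umbral_dvd)
qed

lemma char_poly_matrix_adjugate: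
  assumes A: "A \<in> carrier_mat n n" and v: "v \<in> carrier_vec n"
  shows "char_poly_matrix A *\<^sub>v (Determinant.adj_mat (char_poly_matrix A) *\<^sub>v v) = char_poly A \<cdot>\<^sub>v v"
proof -
  have N: "char_poly_matrix A \<in> carrier_mat n n" using A by simp
  have P: "Determinant.adj_mat (char_poly_matrix A) \<in> carrier_mat n n" using adj_mat(1)[OF N] .
  show ?thesis unfolding assoc_mult_mat_vec[OF N P v, symmetric] adj_mat(2)[OF N]
    using v unfolding char_poly_def by (intro eq_vecI) auto
qed

lemma cayley_hamilton:
  fixes A :: "'a :: idom mat"
  assumes A: "A \<in> carrier_mat n n"
  shows "poly_mat (char_poly A) A = 0\<^sub>m n n"
proof (rule eq_matI)
  fix r j assume "r < dim_row (0\<^sub>m n n)" "j < dim_col (0\<^sub>m n n)"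
  then have r: "r < n" and j: "j < n" by auto
  let ?z = "unit_vec n j :: 'a vec"
  let ?zp = "map_vec (\<lambda>c. [:c:]) ?z"
  have zp: "?zp \<in> carrier_vec n" by simp
  let ?v = "Determinant.adj_mat (char_poly_matrix A) *\<^sub>v ?zp"
  have "?v \<in> carrier_vec n" using adj_mat(1)[of "char_poly_matrix A" n] A zp by auto
  \<comment> \<open>With modulus 0 the divisibility is an equation.\<close>
  then have "0 dvd (poly_mat (char_poly A) A *\<^sub>v ?z) $ r"
  proof (rule poly_mat_mult_vec_dvd[OF A _ _ _ r, rotated])
    fix i assume "i < n"
    then show "[:0:] dvd Polynomial.smult (?z $ i) (char_poly A) - (char_poly_matrix A *\<^sub>v ?v) $ i"
      unfolding char_poly_matrix_adjugate[OF A zp] by simp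
  qed simp
  moreover have "poly_mat (char_poly A) A *\<^sub>v ?z = col (poly_mat (char_poly A) A) j"
    using poly_mat_carrier[OF A, of "char_poly A"] j by (intro eq_vecI) auto
  ultimately show "poly_mat (char_poly A) A $$ (r,j) = 0\<^sub>m n n $$ (r,j)"
    using r j poly_mat_carrier[OF A, of "char_poly A"] by simp
qed (insert poly_mat_carrier[OF A, of "char_poly A"], auto)

lemma pow_mat_add:
  assumes A: "A \<in> carrier_mat n n"
  shows "A ^\<^sub>m (k + l) = A ^\<^sub>m k * A ^\<^sub>m l"
proof (induction l)
  case (Suc l)
  then show ?case using assoc_mult_mat[OF pow_carrier_mat[OF A] pow_carrier_mat[OF A] A, of k l] by simp
qed (use A in simp)

lemma pow_mat_add_mult_vec:
  assumes A: "A \<in> carrier_mat n n" and v: "v \<in> carrier_vec n"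
  shows "(A ^\<^sub>m (k + l)) *\<^sub>v v = (A ^\<^sub>m k) *\<^sub>v ((A ^\<^sub>m l) *\<^sub>v v)"
  unfolding pow_mat_add[OF A]
  by (rule assoc_mult_mat_vec[OF pow_carrier_mat[OF A] pow_carrier_mat[OF A] v])

subsection \<open>The resultant of a characteristic polynomial\<close>

text \<open>Reversed Krylov matrix, in the column order of the Sylvester matrix.\<close>

definition krylov_mat :: "'a :: comm_ring_1 mat \<Rightarrow> 'a vec \<Rightarrow> 'a mat" where
  "krylov_mat A u = mat (dim_row A) (dim_row A) (\<lambda>(i,j). ((A ^\<^sub>m (dim_row A - 1 - i)) *\<^sub>v u) $ j)"

text \<open>The Sylvester matrix is multiplied by a matrix whose last \<open>n\<close> columns list
  the coordinates of the vectors A^k u. Rows with shifted coefficients of \<chi> become A^i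
  \<chi>(A) u = 0, those of \<open>g\<close> become A^i g(A) u, so the product is block triangular.
  By \<open>cyc\<close> the determinant of the Krylov matrix can be cancelled.\<close>

lemma resultant_char_poly_cyclic:
  fixes A :: "'a :: idom mat"
  assumes A: "A \<in> carrier_mat n n" and u: "u \<in> carrier_vec n" and cyc: "det (krylov_mat A u) \<noteq> 0"
  shows "resultant (char_poly A) g = det (poly_mat g A)"
proof -
  let ?f = "char_poly A"
  define m where "m = degree g"
  have deg: "degree ?f = n" "lead_coeff ?f = 1" using degree_monic_char_poly[OF A] by auto
  let ?S = "sylvester_mat ?f g"
  have S: "?S \<in> carrier_mat (m + n) (m + n)" using sylvester_carrier_mat[of ?f g] deg m_def by (simp add: add.commute)
  define Y where "Y j = (A ^\<^sub>m (n + m - 1 - j)) *\<^sub>v u" for j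
  have Y: "Y j \<in> carrier_vec n" for j unfolding Y_def
    by (rule mult_mat_vec_carrier[OF pow_carrier_mat[OF A] u])
  let ?Y1 = "mat m n (\<lambda>(i,j). Y i $ j)" and ?X = "krylov_mat A u"
  have X: "?X \<in> carrier_mat n n" unfolding krylov_mat_def using A by auto
  let ?F = "four_block_mat (1\<^sub>m m) ?Y1 (0\<^sub>m n m) ?X"
  have F: "?F \<in> carrier_mat (m + n) (m + n)" using X by simp
  have Fcol: "?F $$ (k, m + j) = ((A ^\<^sub>m (n + m - 1 - k)) *\<^sub>v u) $ j" if "k < m + n" "j < n" for k j
    using that X A unfolding krylov_mat_def Y_def by (auto simp: add.commute)
  have SFl: "(?S * ?F) $$ (i,j) = ?S $$ (i,j)" if "i < m + n" "j < m" for i j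
  proof -
    have "(?S * ?F) $$ (i,j) = (\<Sum>k<m+n. ?S $$ (i,k) * ?F $$ (k,j))"
      using that by (intro index_mult_mat_sum[OF S F]) auto
    also have "\<dots> = (\<Sum>k<m+n. if k = j then ?S $$ (i,j) else 0)"
      using that X by (intro sum.cong) auto
    finally show ?thesis using that by simp
  qed
  have SFr: "(?S * ?F) $$ (i, m + j) = umbral (\<lambda>k. ((A ^\<^sub>m k) *\<^sub>v u) $ j) h"
    if i: "i < m + n" and j: "j < n" and h: "degree h \<le> n + m - 1"
      and Sh: "\<And>k. k < m + n \<Longrightarrow> ?S $$ (i,k) = coeff h (n + m - 1 - k)" for i j h
  proof -
    have "(?S * ?F) $$ (i,m + j) = (\<Sum>k<m+n. ?S $$ (i,k) * ?F $$ (k,m + j))"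
      using i j by (intro index_mult_mat_sum[OF S F]) auto
    also have "\<dots> = (\<Sum>k<m+n. coeff h (n + m - 1 - k) * ((A ^\<^sub>m (n + m - 1 - k)) *\<^sub>v u) $ j)"
      using j by (intro sum.cong refl) (simp only: Sh Fcol lessThan_iff)
    also have "\<dots> = (\<Sum>k<m+n. coeff h k * ((A ^\<^sub>m k) *\<^sub>v u) $ j)"
      by (rule sum.reindex_bij_witness[of _ "\<lambda>k. n + m - 1 - k" "\<lambda>k. n + m - 1 - k"]) auto
    also have "\<dots> = (\<Sum>k\<le>n+m-1. coeff h k * ((A ^\<^sub>m k) *\<^sub>v u) $ j)"
      using j by (intro sum.cong) auto
    finally show ?thesis using umbral_altdef[OF h] by simp
  qed
  let ?T = "mat m m (\<lambda>(i,j). ?S $$ (i,j))" and ?R = "mat n m (\<lambda>(i,j). ?S $$ (m + i,j))"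
  let ?Z = "?X * transpose_mat (poly_mat g A)"
  have gA: "poly_mat g A \<in> carrier_mat n n" using A by simp
  have Z: "?Z \<in> carrier_mat n n" using X gA by simp
  have upper: "(?S * ?F) $$ (i,m + j) = 0" if "i < m" "j < n" for i j
  proof -
    have "(?S * ?F) $$ (i, m + j) = umbral (\<lambda>k. ((A ^\<^sub>m k) *\<^sub>v u) $ j) (monom 1 (m - 1 - i) * ?f)"
    proof (rule SFr)
      show "degree (monom 1 (m - 1 - i) * ?f) \<le> n + m - 1"
        using degree_mult_le[of "monom 1 (m - 1 - i)" ?f] deg that degree_monom_le[of "1::'a" "m-1-i"] by simp
      show "?S $$ (i,k) = coeff (monom 1 (m - 1 - i) * ?f) (n + m - 1 - k)" if "k < m + n" for k
        using that \<open>i < m\<close> deg coeff_eq_0[of ?f]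
        by (subst sylvester_index_mat) (auto simp: m_def[symmetric] coeff_monom_mult intro: arg_cong[of _ _ "coeff ?f"])
    qed (use that in auto)
    also have "\<dots> = umbral (\<lambda>k. ((A ^\<^sub>m k) *\<^sub>v ((A ^\<^sub>m (m - 1 - i)) *\<^sub>v u)) $ j) ?f"
      by (simp add: umbral_monom_mult pow_mat_add_mult_vec[OF A u])
    also have "\<dots> = (poly_mat ?f A *\<^sub>v ((A ^\<^sub>m (m - 1 - i)) *\<^sub>v u)) $ j"
      by (rule index_poly_mat_mult_vec_umbral[symmetric, OF A _ that(2)]) (rule mult_mat_vec_carrier[OF pow_carrier_mat[OF A] u])
    also have "\<dots> = 0" unfolding cayley_hamilton[OF A]
      using that mult_mat_vec_carrier[OF pow_carrier_mat[OF A] u, of "m-1-i"] by auto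
    finally show ?thesis .
  qed
  have lower: "(?S * ?F) $$ (m + i,m + j) = ?Z $$ (i,j)" if "i < n" "j < n" for i j
  proof -
    have "(?S * ?F) $$ (m + i, m + j) = umbral (\<lambda>k. ((A ^\<^sub>m k) *\<^sub>v u) $ j) (monom 1 (n - 1 - i) * g)"
    proof (rule SFr)
      show "degree (monom 1 (n - 1 - i) * g) \<le> n + m - 1"
        using degree_mult_le[of "monom 1 (n - 1 - i)" g] that degree_monom_le[of "1::'a" "n-1-i"] m_def by simp
      show "?S $$ (m + i,k) = coeff (monom 1 (n - 1 - i) * g) (n + m - 1 - k)" if "k < m + n" for k
        using that \<open>i < n\<close> deg coeff_eq_0[of g]
        by (subst sylvester_index_mat) (auto simp: m_def[symmetric] coeff_monom_mult intro: arg_cong[of _ _ "coeff g"])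
    qed (use that in auto)
    also have "\<dots> = umbral (\<lambda>k. ((A ^\<^sub>m k) *\<^sub>v ((A ^\<^sub>m (n - 1 - i)) *\<^sub>v u)) $ j) g"
      by (simp add: umbral_monom_mult pow_mat_add_mult_vec[OF A u])
    also have "\<dots> = (poly_mat g A *\<^sub>v ((A ^\<^sub>m (n - 1 - i)) *\<^sub>v u)) $ j"
      by (rule index_poly_mat_mult_vec_umbral[symmetric, OF A _ that(2)]) (rule mult_mat_vec_carrier[OF pow_carrier_mat[OF A] u])
    also have "\<dots> = ?Z $$ (i,j)"
    proof -
      let ?w = "(A ^\<^sub>m (n - 1 - i)) *\<^sub>v u"
      have "(poly_mat g A *\<^sub>v ?w) $ j = (\<Sum>k<n. poly_mat g A $$ (j,k) * ?w $ k)"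
        by (rule index_mult_mat_vec_sum[OF gA mult_mat_vec_carrier[OF pow_carrier_mat[OF A] u] that(2)])
      also have "\<dots> = (\<Sum>k<n. ?X $$ (i,k) * transpose_mat (poly_mat g A) $$ (k,j))"
      proof (rule sum.cong)
        fix k assume "k \<in> {..<n}"
        then have "?X $$ (i,k) = ?w $ k" "transpose_mat (poly_mat g A) $$ (k,j) = poly_mat g A $$ (j,k)"
          using that A carrier_matD[OF gA] by (auto simp: krylov_mat_def simp del: index_mult_mat_vec)
        then show "poly_mat g A $$ (j,k) * ?w $ k = ?X $$ (i,k) * transpose_mat (poly_mat g A) $$ (k,j)" by simp
      qed simp
      also have "\<dots> = ?Z $$ (i,j)"
        by (rule index_mult_mat_sum[symmetric, OF X _ that]) (use gA in simp)
      finally show ?thesis .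
    qed
    finally show ?thesis .
  qed
  have e: "?S * ?F = four_block_mat ?T (0\<^sub>m m n) ?R ?Z"
  proof (rule eq_matI)
    fix i j assume "i < dim_row (four_block_mat ?T (0\<^sub>m m n) ?R ?Z)" "j < dim_col (four_block_mat ?T (0\<^sub>m m n) ?R ?Z)"
    then have ij: "i < m + n" "j < m + n" using Z by auto
    show "(?S * ?F) $$ (i,j) = four_block_mat ?T (0\<^sub>m m n) ?R ?Z $$ (i,j)"
    proof (cases "j < m")
      case True
      then show ?thesis unfolding SFl[OF ij(1) True] using ij Z by auto
    next
      case False
      then obtain j' where j': "j = m + j'" "j' < n" using ij by (metis add_less_cancel_left le_Suc_ex not_less)
      show ?thesis
      proof (cases "i < m")
        case True
        then show ?thesis using upper[OF True j'(2)] True j' carrier_matD[OF X] carrier_matD[OF gA] by (simp del: index_mult_mat(1))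
      next
        case False
        then obtain i' where i': "i = m + i'" "i' < n" using ij by (metis add_less_cancel_left le_Suc_ex not_less)
        then show ?thesis using lower[OF i'(2) j'(2)] i' j' carrier_matD[OF X] carrier_matD[OF gA] by (simp del: index_mult_mat(1))
      qed
    qed
  qed (use carrier_matD[OF S] carrier_matD[OF X] carrier_matD[OF gA] m_def in auto)
  have "upper_triangular ?T" using deg by (auto simp: sylvester_index_mat m_def[symmetric])
  then have "det ?T = prod_list (diag_mat ?T)" by (rule det_upper_triangular[of _ m]) simp
  also have "diag_mat ?T = replicate m 1"
    using deg by (intro nth_equalityI) (auto simp: diag_mat_def sylvester_index_mat m_def[symmetric])
  finally have detT: "det ?T = 1" by simp
  have "det (?S * ?F) = det ?T * det ?Z" unfolding e
    by (rule det_four_block_mat_upper_right_zero) (use Z in auto)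
  moreover have "det (?S * ?F) = det ?S * det ?F" by (rule det_mult[OF S F])
  moreover have "det ?F = det ?X"
    by (subst det_four_block_mat_lower_left_zero[of _ m _ n]) (use X in auto)
  moreover have "det ?Z = det ?X * det (poly_mat g A)"
    using det_mult[OF X, of "transpose_mat (poly_mat g A)"] gA det_transpose[OF gA] by simp
  ultimately show ?thesis using detT cyc unfolding resultant_def by simp
qed

lemma (in comm_ring_hom) krylov_mat_hom:
  assumes A: "A \<in> carrier_mat n n" and u: "u \<in> carrier_vec n"
  shows "krylov_mat (map_mat hom A) (map_vec hom u) = map_mat hom (krylov_mat A u)"
proof (rule eq_matI)
  fix i j assume "i < dim_row (map_mat hom (krylov_mat A u))" "j < dim_col (map_mat hom (krylov_mat A u))"
  then have ij: "i < n" "j < n" using A by (auto simp: krylov_mat_def)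
  have "(map_mat hom A) ^\<^sub>m (n-1-i) *\<^sub>v map_vec hom u = map_vec hom ((A ^\<^sub>m (n-1-i)) *\<^sub>v u)"
    using mult_mat_vec_hom[OF pow_carrier_mat[OF A] u, of "n-1-i"] mat_hom_pow[OF A, of "n-1-i"] by simp
  then show "krylov_mat (map_mat hom A) (map_vec hom u) $$ (i,j) = map_mat hom (krylov_mat A u) $$ (i,j)"
    using ij A u pow_carrier_mat[OF A, of "n-1-i"] by (auto simp: krylov_mat_def)
qed (use A in \<open>auto simp: krylov_mat_def\<close>)

lemma (in comm_ring_hom) poly_mat_hom:
  assumes A: "A \<in> carrier_mat n n" and d: "degree (map_poly hom g) = degree g"
  shows "poly_mat (map_poly hom g) (map_mat hom A) = map_mat hom (poly_mat g A)"
proof (rule eq_matI)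
  fix i j assume "i < dim_row (map_mat hom (poly_mat g A))" "j < dim_col (map_mat hom (poly_mat g A))"
  then have "i < n" "j < n" using A by (auto simp: poly_mat_def)
  then show "poly_mat (map_poly hom g) (map_mat hom A) $$ (i,j) = map_mat hom (poly_mat g A) $$ (i,j)"
    using A pow_carrier_mat[OF A] d
    by (auto simp: poly_mat_def mat_hom_pow[OF A, symmetric] hom_distribs intro!: sum.cong)
qed (use A in \<open>auto simp: poly_mat_def\<close>)

definition shift_mat :: "nat \<Rightarrow> 'a :: zero_neq_one mat" where
  "shift_mat n = mat n n (\<lambda>(i,j). if i = Suc j then 1 else 0)"

text \<open>The powers of the shift run through the unit vectors, so this Krylov matrix is the
  reversal permutation, its own inverse.\<close>

lemma det_krylov_shift_mat: "det (krylov_mat (shift_mat n) (unit_vec n 0) :: 'a :: idom mat) \<noteq> 0"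
proof -
  let ?X = "krylov_mat (shift_mat n) (unit_vec n 0) :: 'a mat"
  have N: "(shift_mat n :: 'a mat) \<in> carrier_mat n n" by (simp add: shift_mat_def)
  have pw: "(shift_mat n ^\<^sub>m k) *\<^sub>v unit_vec n 0 = (unit_vec n k :: 'a vec)" if "k < n" for k
    using that
  proof (induction k)
    case (Suc k)
    have "(shift_mat n ^\<^sub>m (Suc k)) *\<^sub>v unit_vec n 0 = shift_mat n *\<^sub>v (unit_vec n k :: 'a vec)"
      using pow_mat_add_mult_vec[OF N, of "unit_vec n 0" 1 k] Suc N by simp
    also have "\<dots> = unit_vec n (Suc k)" using Suc.prems by (intro eq_vecI) (auto simp: shift_mat_def)
    finally show ?case .
  qed (use N in auto)
  have X: "?X = mat n n (\<lambda>(i,j). if i + j = n - 1 then 1 else 0)"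
    using N by (intro eq_matI) (auto simp: krylov_mat_def pw simp del: index_mult_mat_vec)
  have "?X * ?X = 1\<^sub>m n"
  proof (rule eq_matI)
    fix i j assume "i < dim_row (1\<^sub>m n)" "j < dim_col (1\<^sub>m n)"
    then have ij: "i < n" "j < n" by auto
    then have "(?X * ?X) $$ (i,j) = (\<Sum>k<n. if k = n - 1 - i then (if k + j = n - 1 then 1 else 0) else 0)"
      unfolding X by (subst index_mult_mat_sum[of _ n n _ n]) (auto intro!: sum.cong[OF refl] simp del: sum.delta)
    also have "\<dots> = 1\<^sub>m n $$ (i,j)" using ij by (auto simp: sum.delta)
    finally show "(?X * ?X) $$ (i,j) = 1\<^sub>m n $$ (i,j)" .
  qed (simp_all add: X)
  then have "det ?X * det ?X = 1" using det_mult[of ?X n ?X] X by (simp add: krylov_mat_def N)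
  then show ?thesis by auto
qed

text \<open>The line \<open>x A + (1 - x) N\<close> joins \<open>A\<close> to a matrix \<open>N\<close> with a cyclic vector.\<close>

lemma resultant_char_poly:
  fixes A :: "'a :: idom mat"
  assumes A: "A \<in> carrier_mat n n"
  shows "resultant (char_poly A) g = det (poly_mat g A)"
proof -
  let ?N = "shift_mat n :: 'a mat"
  have N: "?N \<in> carrier_mat n n" by (simp add: shift_mat_def)
  define B where "B = mat n n (\<lambda>(i,j). [:?N $$ (i,j), A $$ (i,j) - ?N $$ (i,j):])"
  have B: "B \<in> carrier_mat n n" unfolding B_def by simp
  have B0: "map_mat (\<lambda>q. poly q 0) B = ?N" unfolding B_def using N by auto
  have B1: "map_mat (\<lambda>q. poly q 1) B = A" unfolding B_def using A N by auto
  let ?u = "unit_vec n 0 :: 'a poly vec"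
  have u0: "map_vec (\<lambda>q. poly q 0) ?u = unit_vec n 0" by (auto simp: unit_vec_def)
  \<comment> \<open>Nonvanishing at x = 0 is enough over the polynomial ring. The identity obtained
    there is then evaluated at x = 1, where \<open>B\<close> becomes \<open>A\<close>.\<close>
  have "det (krylov_mat B ?u) \<noteq> 0"
  proof
    assume "det (krylov_mat B ?u) = 0"
    then have "det (map_mat (\<lambda>q. poly q 0) (krylov_mat B ?u)) = 0" unfolding comm_ring_hom.hom_det[OF poly_hom.comm_ring_hom_axioms] by simp
    then show False using comm_ring_hom.krylov_mat_hom[OF poly_hom.comm_ring_hom_axioms[of 0], OF B, of ?u] det_krylov_shift_mat[of n, where 'a = 'a]
      unfolding B0 u0 by simp
  qed
  then have r: "resultant (char_poly B) (map_poly (\<lambda>c. [:c:]) g) = det (poly_mat (map_poly (\<lambda>c. [:c:]) g) B)"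
    by (intro resultant_char_poly_cyclic[OF B, of ?u]) simp
  let ?g = "map_poly (\<lambda>c. [:c:]) g"
  have g1: "map_poly (\<lambda>q. poly q 1) ?g = g" by (simp add: map_poly_map_poly o_def)
  have dg: "degree ?g = degree g" by (simp add: degree_map_poly)
  have c1: "map_poly (\<lambda>q. poly q 1) (char_poly B) = char_poly A"
    using comm_ring_hom.char_poly_hom[OF poly_hom.comm_ring_hom_axioms[of 1], OF B] B1 by simp
  have "resultant (char_poly A) g = poly (resultant (char_poly B) ?g) 1"
    using comm_ring_hom.resultant_map_poly[OF poly_hom.comm_ring_hom_axioms[of 1], of "char_poly B" ?g] degree_monic_char_poly[OF A] degree_monic_char_poly[OF B]
    unfolding c1 g1 dg by simp
  also have "\<dots> = det (map_mat (\<lambda>q. poly q 1) (poly_mat ?g B))" unfolding r comm_ring_hom.hom_det[OF poly_hom.comm_ring_hom_axioms] ..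
  also have "map_mat (\<lambda>q. poly q 1) (poly_mat ?g B) = poly_mat g A"
    using comm_ring_hom.poly_mat_hom[OF poly_hom.comm_ring_hom_axioms[of 1], OF B, of ?g] unfolding g1 dg B1 by simp
  finally show ?thesis .
qed

subsection \<open>Integer polynomials modulo a prime\<close>

text \<open>The relation \<open>poly_mod.eq_m\<close> written as a divisibility, so that
  \<open>[:p:]\<close> can be used as a prime element and congruences can be chained.\<close>

definition pcong :: "int \<Rightarrow> int poly \<Rightarrow> int poly \<Rightarrow> bool" where
  "pcong p f g \<longleftrightarrow> [:p:] dvd f - g"

lemma pcong_refl [simp]: "pcong p f f"
  by (simp add: pcong_def)

lemma pcong_sym: "pcong p f g \<Longrightarrow> pcong p g f"
  unfolding pcong_def by (metis dvd_minus_iff minus_diff_eq)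

lemma pcong_trans [trans]: "pcong p f g \<Longrightarrow> pcong p g h \<Longrightarrow> pcong p f h"
  unfolding pcong_def using dvd_add[of "[:p:]" "f - g" "g - h"] by simp

lemma pcong_eq_trans [trans]: "f = g \<Longrightarrow> pcong p g h \<Longrightarrow> pcong p f h"
  by simp

lemma pcong_add: "pcong p a b \<Longrightarrow> pcong p c d \<Longrightarrow> pcong p (a + c) (b + d)"
  unfolding pcong_def using dvd_add[of "[:p:]" "a - b" "c - d"] by (simp add: algebra_simps)

lemma pcong_diff: "pcong p a b \<Longrightarrow> pcong p c d \<Longrightarrow> pcong p (a - c) (b - d)"
  unfolding pcong_def using dvd_diff[of "[:p:]" "a - b" "c - d"] by (simp add: algebra_simps)

lemma pcong_mult: "pcong p a b \<Longrightarrow> pcong p c d \<Longrightarrow> pcong p (a * c) (b * d)"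
proof -
  assume "pcong p a b" "pcong p c d"
  then have "[:p:] dvd (a - b) * c + b * (c - d)" unfolding pcong_def by (intro dvd_add dvd_mult dvd_mult2)
  also have "(a - b) * c + b * (c - d) = a * c - b * d" by (simp add: algebra_simps)
  finally show ?thesis unfolding pcong_def .
qed

lemma pcong_mult_left: "pcong p c d \<Longrightarrow> pcong p (a * c) (a * d)"
  by (rule pcong_mult[OF pcong_refl])

lemma pcong_mult_right: "pcong p c d \<Longrightarrow> pcong p (c * a) (d * a)"
  by (rule pcong_mult[OF _ pcong_refl])

lemma pcong_0_iff: "pcong p f 0 \<longleftrightarrow> [:p:] dvd f"
  by (simp add: pcong_def)

lemma pcong_iff_0: "pcong p f g \<longleftrightarrow> pcong p (f - g) 0"
  by (simp add: pcong_def)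

lemma pcong_pderiv: "pcong p f g \<Longrightarrow> pcong p (pderiv f) (pderiv g)"
  unfolding pcong_def pderiv_diff[symmetric] const_poly_dvd_iff coeff_pderiv by (intro allI dvd_mult) blast

lemma pcong_iff_coeff: "pcong p f g \<longleftrightarrow> (\<forall>i. coeff f i mod p = coeff g i mod p)"
  unfolding pcong_def const_poly_dvd_iff by (simp add: mod_eq_dvd_iff)

lemma eq_m_iff_pcong: "poly_mod.eq_m p f g \<longleftrightarrow> pcong p f g"
  unfolding pcong_iff_coeff poly_eq_iff poly_mod.Mp_coeff poly_mod.M_def by simp

lemma pcong_Mp [simp]: "pcong p (poly_mod.Mp p f) g \<longleftrightarrow> pcong p f g" "pcong p g (poly_mod.Mp p f) \<longleftrightarrow> pcong p g f"
  unfolding eq_m_iff_pcong[symmetric] by (simp_all add: poly_mod.Mp_Mp)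

lemma dvdm_iff_pcong: "poly_mod.dvdm p f g \<longleftrightarrow> (\<exists>h. pcong p g (f * h))"
  unfolding poly_mod.dvdm_def eq_m_iff_pcong ..

lemma dvdm_cong: "pcong p g g' \<Longrightarrow> poly_mod.dvdm p f g \<longleftrightarrow> poly_mod.dvdm p f g'"
  unfolding dvdm_iff_pcong using pcong_trans pcong_sym by blast

lemma dvdm_trans: "poly_mod.dvdm p f g \<Longrightarrow> poly_mod.dvdm p g h \<Longrightarrow> poly_mod.dvdm p f h"
  unfolding dvdm_iff_pcong by (metis mult.assoc pcong_mult_right pcong_trans)

lemma dvdm_add: "poly_mod.dvdm p f g \<Longrightarrow> poly_mod.dvdm p f h \<Longrightarrow> poly_mod.dvdm p f (g + h)"
  unfolding dvdm_iff_pcong by (metis distrib_left pcong_add)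

lemma dvdm_diff: "poly_mod.dvdm p f g \<Longrightarrow> poly_mod.dvdm p f h \<Longrightarrow> poly_mod.dvdm p f (g - h)"
  unfolding dvdm_iff_pcong by (metis right_diff_distrib pcong_diff)

lemma dvdm_mult: "poly_mod.dvdm p f g \<Longrightarrow> poly_mod.dvdm p f (g * h)"
  unfolding dvdm_iff_pcong by (metis mult.assoc pcong_mult_right)

lemma dvdm_mult2: "poly_mod.dvdm p f g \<Longrightarrow> poly_mod.dvdm p f (h * g)"
  using dvdm_mult[of p f g h] by (simp add: mult.commute)

lemma dvd_imp_dvdm: "f dvd g \<Longrightarrow> poly_mod.dvdm p f g"
  unfolding dvdm_iff_pcong by (metis dvdE pcong_refl)

lemma dvdm_Mp_left [simp]: "poly_mod.dvdm p (poly_mod.Mp p f) g \<longleftrightarrow> poly_mod.dvdm p f g"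
  by (rule poly_mod.Mp_dvdm)

context
  fixes p :: int
  assumes p: "prime p"
begin

lemma p_gt_1: "p > 1"
  using p prime_gt_1_int by blast

lemma prime_elem_const: "prime_elem [:p:]"
  by (rule lift_prime_elem_poly, rule prime_imp_prime_elem[OF p])

lemma monic_not_pcong_0: "monic f \<Longrightarrow> \<not> pcong p f 0"
  using p_gt_1 unfolding pcong_iff_coeff by (auto intro!: exI[of _ "degree f"])

lemma monic_pcong_cancel:
  assumes "monic f" "pcong p (f * g) (f * h)"
  shows "pcong p g h"
proof -
  have "[:p:] dvd f * (g - h)" using assms by (simp add: pcong_def algebra_simps)
  then show ?thesis using monic_not_pcong_0[OF assms(1)] prime_elem_dvd_mult_iff[OF prime_elem_const]
    by (simp add: pcong_def)
qed

lemma monic_Mp_poly: "monic f \<Longrightarrow> monic (poly_mod.Mp p f)" "monic f \<Longrightarrow> degree (poly_mod.Mp p f) = degree f"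
proof -
  interpret poly_mod_2 p using p_gt_1 by unfold_locales
  show "monic f \<Longrightarrow> monic (poly_mod.Mp p f)" "monic f \<Longrightarrow> degree (poly_mod.Mp p f) = degree f"
    using monic_Mp monic_degree_m by auto
qed

text \<open>If \<open>h\<close> were nonzero modulo \<open>p\<close>, the leading coefficient of its
  reduction would survive in the product with \<open>f\<close>, in a degree that \<open>r\<close>
  does not reach.\<close>

lemma monic_mult_pcong_small:
  assumes f: "monic f" and c: "pcong p (f * h) r" and d: "degree r < degree f"
  shows "pcong p r 0" "pcong p h 0"
proof -
  show h: "pcong p h 0"
  proof (rule ccontr)
    assume h: "\<not> pcong p h 0"
    define k where "k = poly_mod.Mp p h"
    have k0: "k \<noteq> 0" using h unfolding k_def by (metis pcong_Mp(1) pcong_refl)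
    have "pcong p (f * k) (f * h)" unfolding k_def by (rule pcong_mult_left) simp
    then have "pcong p (f * k) r" using c pcong_trans by blast
    moreover have "coeff (f * k) (degree f + degree k) = lead_coeff k" using f by (simp add: coeff_mult_degree_sum)
    moreover have "coeff r (degree f + degree k) = 0" using d by (intro coeff_eq_0) auto
    ultimately have "lead_coeff k mod p = 0" unfolding pcong_iff_coeff by (metis mod_0)
    moreover have "lead_coeff k mod p = lead_coeff k" unfolding k_def poly_mod.Mp_coeff poly_mod.M_def by simp
    ultimately show False using k0 by simp
  qed
  then show "pcong p r 0" using c pcong_mult_left[OF h, of f] by (metis mult_zero_right pcong_sym pcong_trans)
qed

lemma monic_dvdm_degree:
  assumes "monic f" "monic g" "poly_mod.dvdm p f g"
  shows "degree f \<le> degree g"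
proof (rule ccontr)
  assume "\<not> ?thesis"
  then have d: "degree g < degree f" by simp
  obtain h where "pcong p g (f * h)" using assms(3) unfolding dvdm_iff_pcong by blast
  from monic_mult_pcong_small(1)[OF assms(1) pcong_sym[OF this] d] show False
    using monic_not_pcong_0[OF assms(2)] by simp
qed

lemma monic_dvdm_antisym:
  assumes f: "monic f" "poly_mod.Mp p f = f" and g: "monic g" "poly_mod.Mp p g = g"
    and "poly_mod.dvdm p f g" "poly_mod.dvdm p g f"
  shows "f = g"
proof -
  have d: "degree f = degree g" using monic_dvdm_degree assms by (intro antisym) auto
  obtain h where h: "pcong p g (f * h)" using assms(5) unfolding dvdm_iff_pcong by blast
  have "pcong p f g"
  proof (cases "degree f = 0")
    case True
    then have "f = 1" "g = 1" using f g d by (auto elim!: degree_eq_zeroE)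
    then show ?thesis by simp
  next
    case False
    have "pcong p (f * (h - 1)) (g - f)" using pcong_sym[OF h] pcong_diff[of p "f * h" g f f] by (simp add: algebra_simps)
    moreover have "degree (g - f) < degree f"
      using False d f(1) g(1) by (metis coeff_diff degree_diff_le diff_self le_refl leading_coeff_0_iff degree_0 order_le_less not_gr_zero)
    ultimately have "pcong p (g - f) 0" by (rule monic_mult_pcong_small(1)[OF f(1)])
    then show ?thesis using pcong_iff_0 pcong_sym by blast
  qed
  then show ?thesis using f(2) g(2) unfolding eq_m_iff_pcong[symmetric] by simp
qed

lemma monic_division:
  fixes u h :: "int poly"
  assumes "monic h"
  obtains q r where "u = h * q + r" "r = 0 \<or> degree r < degree h"
proof -
  obtain q r where qr: "pseudo_divmod u h = (q,r)" by force
  have "h \<noteq> 0" using assms by auto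
  from pseudo_divmod[OF this qr] assms show ?thesis by (intro that[of q r]) auto
qed

lemma monic_associate:
  assumes "\<not> pcong p r 0"
  obtains c k where "monic k" "degree k \<le> degree r" "pcong p k (Polynomial.smult c r)"
proof -
  define k where "k = poly_mod.Mp p r"
  have k0: "k \<noteq> 0" using assms unfolding k_def by (metis pcong_Mp(1) pcong_refl)
  have dk: "degree k \<le> degree r" unfolding k_def by (rule poly_mod.degree_m_le_degree)
  have "lead_coeff k mod p = lead_coeff k" unfolding k_def poly_mod.Mp_coeff poly_mod.M_def by simp
  then have "\<not> p dvd lead_coeff k" using k0 by (metis dvd_imp_mod_0 leading_coeff_0_iff)
  then have "gcd (lead_coeff k) p = 1" using p
    by (metis prime_imp_coprime coprime_imp_gcd_eq_1 gcd.commute)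
  then obtain c d where cd: "c * lead_coeff k + d * p = 1"
    by (metis bezout_int)
  \<comment> \<open>The summand \<open>d * p\<close> makes the leading coefficient exactly 1 and
    changes nothing modulo \<open>p\<close>.\<close>
  let ?k = "Polynomial.smult c k + monom (d * p) (degree k)"
  have deg: "degree ?k \<le> degree k" by (intro degree_add_le) (auto intro: order.trans[OF degree_monom_le])
  have lc: "coeff ?k (degree k) = 1" using cd by simp
  have "degree ?k = degree k" using deg lc by (metis le_antisym le_degree zero_neq_one)
  then have "monic ?k" using lc by simp
  moreover have "pcong p ?k (Polynomial.smult c r)"
  proof -
    have "pcong p k r" unfolding k_def by simp
    then have "pcong p (Polynomial.smult c k) (Polynomial.smult c r)"
      using pcong_mult_left[of p k r "[:c:]"] by simp
    moreover have "pcong p (monom (d * p) (degree k)) 0" unfolding pcong_0_iff const_poly_dvd_iff by simp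
    ultimately show ?thesis using pcong_add[of p "Polynomial.smult c k" "Polynomial.smult c r" "monom (d * p) (degree k)" 0] by simp
  qed
  ultimately show ?thesis using that deg dk by (meson order.trans)
qed

text \<open>A monic element of least degree in the ideal generated by \<open>f\<close> and
  \<open>g\<close> modulo \<open>p\<close>: a nonzero remainder would lie in the ideal and, made
  monic, have smaller degree.\<close>

lemma monic_gcd_mod_exists:
  assumes f: "monic f"
  obtains h a b where "monic h" "poly_mod.Mp p h = h" "pcong p h (a * f + b * g)"
    "poly_mod.dvdm p h f" "poly_mod.dvdm p h g"
proof -
  define I where "I u \<longleftrightarrow> (\<exists>a b. pcong p u (a * f + b * g))" for u
  have If: "I f" unfolding I_def by (rule exI[of _ 1], rule exI[of _ 0]) simp
  have Ig: "I g" unfolding I_def by (rule exI[of _ 0], rule exI[of _ 1]) simp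
  have Icong: "I u" if "pcong p u v" "I v" for u v using that unfolding I_def using pcong_trans by blast
  have Icomb: "I (c * u + d * v)" if I: "I u" "I v" for c d u v
  proof -
    obtain a b a' b' where "pcong p u (a * f + b * g)" "pcong p v (a' * f + b' * g)" using I unfolding I_def by blast
    then have "pcong p (c * u + d * v) (c * (a * f + b * g) + d * (a' * f + b' * g))"
      by (intro pcong_add pcong_mult_left)
    also have "c * (a * f + b * g) + d * (a' * f + b' * g) = (c * a + d * a') * f + (c * b + d * b') * g"
      by (simp add: algebra_simps)
    finally show ?thesis unfolding I_def by blast
  qed
  obtain h0 where h0: "monic h0" "I h0" and least: "\<And>k. monic k \<Longrightarrow> I k \<Longrightarrow> degree h0 \<le> degree k"
    using ex_has_least_nat[of "\<lambda>k. monic k \<and> I k" f degree] f If by blast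
  define h where "h = poly_mod.Mp p h0"
  have hm: "monic h" "degree h = degree h0" unfolding h_def using monic_Mp_poly[OF h0(1)] by auto
  have Ih: "I h" using Icong[OF _ h0(2), of h] unfolding h_def by simp
  have dv: "poly_mod.dvdm p h u" if Iu: "I u" for u
  proof -
    obtain q r where qr: "u = h * q + r" "r = 0 \<or> degree r < degree h" using monic_division[OF hm(1)] .
    have "I (1 * u + (- q) * h)" by (rule Icomb[OF Iu Ih])
    then have Ir: "I r" unfolding qr(1) by (simp add: algebra_simps)
    have "pcong p r 0"
    proof (rule ccontr)
      assume r: "\<not> pcong p r 0"
      then obtain c k where k: "monic k" "degree k \<le> degree r" "pcong p k (Polynomial.smult c r)"
        using monic_associate by blast
      have "I ([:c:] * r + 0 * r)" by (rule Icomb[OF Ir Ir])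
      then have "I k" using Icong[OF k(3)] by simp
      then have "degree h0 \<le> degree k" using least k by blast
      moreover have "r \<noteq> 0" using r by auto
      ultimately show False using qr(2) k(2) hm(2) by auto
    qed
    then have "pcong p u (h * q)" unfolding qr(1) using pcong_add[of p "h*q" "h*q" r 0] by simp
    then show ?thesis unfolding dvdm_iff_pcong by blast
  qed
  obtain a b where "pcong p h (a * f + b * g)" using Ih unfolding I_def by blast
  moreover have "poly_mod.Mp p h = h" unfolding h_def by (rule poly_mod.Mp_Mp)
  ultimately show ?thesis using dv[OF If] dv[OF Ig] by (intro that[of h a b] hm(1))
qed

lemma monic_gcd_mod:
  fixes g :: "int poly"
  assumes f: "monic f"
  defines "h \<equiv> monic_gcd_mod p f g"
  shows "monic h" "poly_mod.Mp p h = h" "poly_mod.dvdm p h f" "poly_mod.dvdm p h g"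
    "\<And>k. poly_mod.dvdm p k f \<Longrightarrow> poly_mod.dvdm p k g \<Longrightarrow> poly_mod.dvdm p k h"
proof -
  let ?P = "\<lambda>h. poly_mod.Mp p h = h \<and> monic h \<and> poly_mod.dvdm p h f \<and> poly_mod.dvdm p h g \<and>
     (\<forall>k. poly_mod.dvdm p k f \<and> poly_mod.dvdm p k g \<longrightarrow> poly_mod.dvdm p k h)"
  obtain h0 a b where h0: "monic h0" "poly_mod.Mp p h0 = h0" "pcong p h0 (a * f + b * g)"
    "poly_mod.dvdm p h0 f" "poly_mod.dvdm p h0 g" using monic_gcd_mod_exists[OF f] .
  have Ph0: "?P h0"
  proof (intro conjI allI impI)
    fix k assume "poly_mod.dvdm p k f \<and> poly_mod.dvdm p k g"
    then have "poly_mod.dvdm p k (a * f + b * g)" by (intro dvdm_add dvdm_mult2) auto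
    then show "poly_mod.dvdm p k h0" using dvdm_cong[OF h0(3)] by simp
  qed (use h0 in auto)
  moreover have "h1 = h0" if h1: "?P h1" for h1
  proof (rule monic_dvdm_antisym)
    show "poly_mod.dvdm p h1 h0" "poly_mod.dvdm p h0 h1" using h1 Ph0 by simp_all
  qed (use h1 h0 in simp_all)
  ultimately have Ph: "?P h" unfolding h_def monic_gcd_mod_def by (rule theI)
  show "monic h" "poly_mod.Mp p h = h" "poly_mod.dvdm p h f" "poly_mod.dvdm p h g" using Ph by simp_all
  show "poly_mod.dvdm p k h" if "poly_mod.dvdm p k f" "poly_mod.dvdm p k g" for k using Ph that by simp
qed

text \<open>Euclid's lemma from the Bezout relation for \<open>f\<close> and \<open>a\<close>:
  either \<open>f\<close> divides the gcd, hence \<open>a\<close>, or the gcd is a unit and the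
  relation multiplied by \<open>b\<close> exhibits \<open>b\<close> as a multiple of
  \<open>f\<close>.\<close>

lemma irreducible_m_prime:
  assumes f: "monic f" "poly_mod.irreducible_m p f" and d: "poly_mod.dvdm p f (a * b)"
  shows "poly_mod.dvdm p f a \<or> poly_mod.dvdm p f b"
proof -
  obtain h \<alpha> \<beta> where h: "monic h" "pcong p h (\<alpha> * f + \<beta> * a)" "poly_mod.dvdm p h f" "poly_mod.dvdm p h a"
    using monic_gcd_mod_exists[OF f(1), of a] by metis
  obtain c where c: "pcong p f (h * c)" using h(3) unfolding dvdm_iff_pcong by blast
  then have "poly_mod.dvdm p h 1 \<or> poly_mod.dvdm p c 1"
    using f(2) unfolding poly_mod.irreducible_m_def eq_m_iff_pcong by blast
  then show ?thesis
  proof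
    assume "poly_mod.dvdm p c 1"
    then obtain e where "pcong p 1 (c * e)" unfolding dvdm_iff_pcong by blast
    then have "pcong p h (h * (c * e))" using pcong_mult_left[of p 1 "c * e" h] by simp
    also have "h * (c * e) = (h * c) * e" by (simp add: mult.assoc)
    also have "pcong p \<dots> (f * e)" by (rule pcong_mult_right[OF pcong_sym[OF c]])
    finally have "poly_mod.dvdm p f h" unfolding dvdm_iff_pcong by blast
    then show ?thesis using h(4) dvdm_trans by blast
  next
    assume "poly_mod.dvdm p h 1"
    then obtain e where e: "pcong p 1 (h * e)" unfolding dvdm_iff_pcong by blast
    have "pcong p (b * 1) (b * (h * e))" by (rule pcong_mult_left[OF e])
    also have "pcong p (b * (h * e)) (b * ((\<alpha> * f + \<beta> * a) * e))"
      by (intro pcong_mult_left pcong_mult_right h(2))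
    also have "b * ((\<alpha> * f + \<beta> * a) * e) = (b * \<alpha> * e) * f + (\<beta> * e) * (a * b)" by (simp add: algebra_simps)
    finally have "pcong p b ((b * \<alpha> * e) * f + (\<beta> * e) * (a * b))" by simp
    moreover have "poly_mod.dvdm p f ((b * \<alpha> * e) * f + (\<beta> * e) * (a * b))"
      by (intro dvdm_add dvdm_mult2 d) (simp add: dvd_imp_dvdm)
    ultimately show ?thesis using dvdm_cong by blast
  qed
qed

text \<open>For monic reduced polynomials associates are equal, so an irreducible factor outside
  \<open>F\<close> does not divide \<open>\<Prod>F\<close>, and the divisors can be collected one at
  a time.\<close>

lemma prod_irreducible_dvdm:
  assumes fin: "finite F" and F: "\<And>h. h \<in> F \<Longrightarrow> poly_mod.Mp p h = h \<and> monic h \<and> poly_mod.irreducible_m p h"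
    and dv: "\<And>h. h \<in> F \<Longrightarrow> poly_mod.dvdm p h a"
  shows "poly_mod.dvdm p (\<Prod>F) a"
  using assms
proof (induction F rule: finite_induct)
  case empty
  then show ?case by (simp add: dvd_imp_dvdm)
next
  case (insert h F)
  have unit: "\<not> poly_mod.dvdm p h 1" using insert.prems(1)[of h] unfolding poly_mod.irreducible_m_def by simp
  have nd: "\<not> poly_mod.dvdm p h (\<Prod>F')" if "finite F'" "F' \<subseteq> F" for F'
    using that
  proof (induction F' rule: finite_induct)
    case empty
    then show ?case using unit by simp
  next
    case (insert k F')
    show ?case
    proof
      assume "poly_mod.dvdm p h (\<Prod>(insert k F'))"
      then have "poly_mod.dvdm p h (k * \<Prod>F')" using insert.hyps by simp
      then have "poly_mod.dvdm p h k"
        using irreducible_m_prime[of h k "\<Prod>F'"] insert.IH insert.prems \<open>\<And>ha. ha \<in> Set.insert h F \<Longrightarrow> poly_mod.Mp p ha = ha \<and> monic ha \<and> poly_mod.irreducible_m p ha\<close> by blast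
      then obtain c where c: "pcong p k (h * c)" unfolding dvdm_iff_pcong by blast
      have kF: "k \<in> F" using insert.prems by simp
      have hk: "poly_mod.Mp p h = h" "monic h" "poly_mod.Mp p k = k" "monic k" "poly_mod.irreducible_m p k"
        using \<open>\<And>ha. ha \<in> Set.insert h F \<Longrightarrow> poly_mod.Mp p ha = ha \<and> monic ha \<and> poly_mod.irreducible_m p ha\<close> kF by blast+
      have "poly_mod.dvdm p h 1 \<or> poly_mod.dvdm p c 1"
        using hk(5) c unfolding poly_mod.irreducible_m_def eq_m_iff_pcong by blast
      then obtain e where "pcong p 1 (c * e)" using unit unfolding dvdm_iff_pcong by blast
      then have "pcong p h (h * (c * e))" using pcong_mult_left[of p 1 "c * e" h] by simp
      also have "h * (c * e) = (h * c) * e" by (simp add: mult.assoc)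
      also have "pcong p \<dots> (k * e)" by (rule pcong_mult_right[OF pcong_sym[OF c]])
      finally have "poly_mod.dvdm p k h" unfolding dvdm_iff_pcong by blast
      then have "h = k" using \<open>poly_mod.dvdm p h k\<close> hk monic_dvdm_antisym by blast
      then show False using kF insert.prems \<open>h \<notin> F\<close> by simp
    qed
  qed
  have "poly_mod.dvdm p (\<Prod>F) a" using insert by blast
  then obtain c where c: "pcong p a (\<Prod>F * c)" unfolding dvdm_iff_pcong by blast
  have "poly_mod.dvdm p h (\<Prod>F * c)" using insert.prems(2)[of h] dvdm_cong[OF c] by blast
  then have "poly_mod.dvdm p h c"
    using irreducible_m_prime[of h "\<Prod>F" c] insert.prems(1)[of h] nd[OF insert.hyps(1)] by blast
  then obtain e where "pcong p c (h * e)" unfolding dvdm_iff_pcong by blast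
  then have "pcong p (\<Prod>F * c) (\<Prod>F * (h * e))" by (rule pcong_mult_left)
  then have "pcong p a (\<Prod>F * (h * e))" using c pcong_trans by blast
  then have "pcong p a ((h * \<Prod>F) * e)" by (simp add: algebra_simps)
  then show ?case unfolding dvdm_iff_pcong using insert.hyps by auto
qed

lemma monic_prod: "(\<And>h. h \<in> F \<Longrightarrow> monic (h :: int poly)) \<Longrightarrow> monic (\<Prod>F)"
  by (induction F rule: infinite_finite_induct) (auto intro: monic_mult)

definition irreducible_factors :: "int poly \<Rightarrow> int poly set" where
  "irreducible_factors f = {h. poly_mod.Mp p h = h \<and> monic h \<and> poly_mod.irreducible_m p h \<and> poly_mod.dvdm p h f}"

lemma finite_irreducible_factors:
  assumes f: "monic f"
  shows "finite (irreducible_factors f)"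
proof (rule finite_subset)
  let ?L = "{xs. set xs \<subseteq> {0..<p} \<and> length xs \<le> Suc (degree f)}"
  show "finite (Poly ` ?L)" using finite_lists_length_le[of "{0..<p}"] by simp
  show "irreducible_factors f \<subseteq> Poly ` ?L"
  proof
    fix h assume h: "h \<in> irreducible_factors f"
    then have "degree h \<le> degree f" using monic_dvdm_degree[OF _ f] unfolding irreducible_factors_def by blast
    moreover have "h \<noteq> 0" using h unfolding irreducible_factors_def by auto
    ultimately have "length (coeffs h) \<le> Suc (degree f)" by (simp add: length_coeffs_degree)
    moreover have "coeff h i \<in> {0..<p}" for i
    proof -
      have "poly_mod.Mp p h = h" using h unfolding irreducible_factors_def by simp
      then have "coeff h i = coeff h i mod p"
        using poly_mod.Mp_coeff[of p h i] unfolding poly_mod.M_def by simp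
      moreover have "coeff h i mod p \<in> {0..<p}" using p_gt_1 by simp
      ultimately show ?thesis by simp
    qed
    then have "range (coeff h) \<subseteq> {0..<p}" by blast
    then have "set (coeffs h) \<subseteq> {0..<p}" using range_coeff[of h] by blast
    ultimately have "coeffs h \<in> ?L" by simp
    then have "Poly (coeffs h) \<in> Poly ` ?L" by (rule imageI)
    then show "h \<in> Poly ` ?L" by simp
  qed
qed

lemma sfp_mod:
  assumes f: "monic f"
  shows "monic (sfp_mod p f)" "\<And>a. (\<And>h. monic h \<Longrightarrow> poly_mod.irreducible_m p h \<Longrightarrow> poly_mod.dvdm p h f \<Longrightarrow> poly_mod.dvdm p h a) \<Longrightarrow> poly_mod.dvdm p (sfp_mod p f) a"
    "\<And>h. poly_mod.Mp p h = h \<Longrightarrow> monic h \<Longrightarrow> poly_mod.irreducible_m p h \<Longrightarrow> poly_mod.dvdm p h f \<Longrightarrow> degree h \<le> degree (sfp_mod p f)"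
proof -
  have s: "sfp_mod p f = poly_mod.Mp p (\<Prod>(irreducible_factors f))" unfolding sfp_mod_def irreducible_factors_def ..
  have m: "monic (\<Prod>(irreducible_factors f))" by (rule monic_prod) (simp add: irreducible_factors_def)
  show ms: "monic (sfp_mod p f)" unfolding s using monic_Mp_poly(1)[OF m] .
  show "poly_mod.dvdm p (sfp_mod p f) a"
    if "\<And>h. monic h \<Longrightarrow> poly_mod.irreducible_m p h \<Longrightarrow> poly_mod.dvdm p h f \<Longrightarrow> poly_mod.dvdm p h a" for a
    unfolding s dvdm_Mp_left
    by (rule prod_irreducible_dvdm[OF finite_irreducible_factors[OF f]]) (auto simp: irreducible_factors_def that)
  show "degree h \<le> degree (sfp_mod p f)"
    if "poly_mod.Mp p h = h" "monic h" "poly_mod.irreducible_m p h" "poly_mod.dvdm p h f" for h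
  proof -
    have "h dvd \<Prod>(irreducible_factors f)" using that finite_irreducible_factors[OF f]
      by (intro dvd_prodI[where f = "\<lambda>x. x", simplified]) (auto simp: irreducible_factors_def)
    then have "degree h \<le> degree (\<Prod>(irreducible_factors f))" using m by (intro dvd_imp_degree_le) auto
    then show ?thesis unfolding s monic_Mp_poly(2)[OF m] .
  qed
qed

text \<open>Division by the monic \<open>g\<close> over the integers leaves a remainder that is zero
  or of smaller degree and that \<open>g\<close> divides modulo \<open>p\<close>; so it is 0 modulo
  \<open>p\<close>. The reduction of the integer quotient is then the unique witness.\<close>

lemma quotient_mod:
  assumes f: "monic f" and g: "monic g" and d: "poly_mod.dvdm p g f"
  shows "monic (quotient_mod p f g)" "pcong p f (quotient_mod p f g * g)"
    "degree (quotient_mod p f g) + degree g = degree f"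
proof -
  obtain h where h: "pcong p f (g * h)" using d unfolding dvdm_iff_pcong by blast
  obtain q r where qr: "f = g * q + r" "r = 0 \<or> degree r < degree g" using monic_division[OF g] .
  have dg: "degree g \<le> degree f" using monic_dvdm_degree[OF g f d] .
  have r0: "pcong p r 0"
  proof (cases "r = 0")
    case False
    have "pcong p (g * h - g * q) r" using pcong_diff[OF pcong_sym[OF h] pcong_refl[of p "g * q"]] unfolding qr(1) by simp
    then have "pcong p (g * (h - q)) r" by (simp add: algebra_simps)
    then show ?thesis using monic_mult_pcong_small(1)[OF g] qr(2) False by blast
  qed simp
  then have c: "pcong p f (q * g)" unfolding qr(1) using pcong_add[of p "g*q" "g*q" r 0] by (simp add: mult.commute)
  have dr: "coeff r (degree f) = 0" using qr(2) dg by (auto intro: coeff_eq_0)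
  have q0: "q \<noteq> 0" using c monic_not_pcong_0[OF f] by auto
  have dq: "degree f = degree g + degree q"
  proof -
    have dgq: "degree (g * q) = degree g + degree q" using g q0 by (intro degree_mult_eq) auto
    show ?thesis
    proof (cases "r = 0")
      case True
      then show ?thesis using qr dgq by simp
    next
      case False
      then have "degree r < degree (g * q)" using qr(2) dgq by auto
      then show ?thesis unfolding qr(1) using dgq by (simp add: degree_add_eq_left)
    qed
  qed
  have "lead_coeff q = coeff (g * q) (degree f)" unfolding dq using g by (simp add: coeff_mult_degree_sum)
  also have "\<dots> = 1" using f dr arg_cong[OF qr(1), of "\<lambda>u. coeff u (degree f)"] by simp
  finally have mq: "monic q" .
  have uq: "q1 = q2" if "poly_mod.Mp p q1 = q1 \<and> poly_mod.eq_m p f (q1 * g)" "poly_mod.Mp p q2 = q2 \<and> poly_mod.eq_m p f (q2 * g)" for q1 q2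
  proof -
    have "pcong p (g * q1) (g * q2)" using that unfolding eq_m_iff_pcong[symmetric] by (simp add: mult.commute)
    then have "pcong p q1 q2" by (rule monic_pcong_cancel[OF g])
    then show ?thesis using that unfolding eq_m_iff_pcong[symmetric] by metis
  qed
  have ex: "poly_mod.Mp p (poly_mod.Mp p q) = poly_mod.Mp p q \<and> poly_mod.eq_m p f (poly_mod.Mp p q * g)"
    using c unfolding eq_m_iff_pcong[symmetric] by (simp add: poly_mod.mult_Mp poly_mod.Mp_Mp)
  have e: "quotient_mod p f g = poly_mod.Mp p q" unfolding quotient_mod_def
    using ex uq by (intro the_equality) blast+
  show "monic (quotient_mod p f g)" unfolding e using monic_Mp_poly(1)[OF mq] .
  show "degree (quotient_mod p f g) + degree g = degree f" unfolding e monic_Mp_poly(2)[OF mq] using dq by simp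
  show "pcong p f (quotient_mod p f g * g)" unfolding e eq_m_iff_pcong[symmetric] using ex by simp
qed

text \<open>With \<open>g = gcd(f, y)\<close> and \<open>f = g a\<close>, the hypothesis forces \<open>a\<close> to divide \<open>g\<close>, so
  \<open>f = a\<^sup>2 c\<close> and \<open>y = a c b\<close>.\<close>

lemma dvdm_square_imp_dvdm_pderiv_mult:
  assumes f: "monic f" and d: "poly_mod.dvdm p f (y * y)"
  shows "poly_mod.dvdm p f (pderiv f * y)"
proof -
  obtain g \<alpha> \<beta> where g: "monic g" "pcong p g (\<alpha> * f + \<beta> * y)" "poly_mod.dvdm p g f" "poly_mod.dvdm p g y"
    using monic_gcd_mod_exists[OF f, of y] by metis
  obtain a where a: "pcong p f (g * a)" using g(3) unfolding dvdm_iff_pcong by blast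
  obtain b where b: "pcong p y (g * b)" using g(4) unfolding dvdm_iff_pcong by blast
  obtain k where k: "pcong p (y * y) (f * k)" using d unfolding dvdm_iff_pcong by blast
  have "pcong p (\<alpha> * f + \<beta> * y) (\<alpha> * (g * a) + \<beta> * (g * b))" by (intro pcong_add pcong_mult_left a b)
  with g(2) have "pcong p g (\<alpha> * (g * a) + \<beta> * (g * b))" by (rule pcong_trans)
  also have "\<alpha> * (g * a) + \<beta> * (g * b) = g * (\<alpha> * a + \<beta> * b)" by (simp add: algebra_simps)
  finally have "pcong p (g * 1) (g * (\<alpha> * a + \<beta> * b))" by simp
  then have one: "pcong p 1 (\<alpha> * a + \<beta> * b)" by (rule monic_pcong_cancel[OF g(1)])
  have "pcong p (g * (g * (b * b))) (y * y)" using pcong_mult[OF pcong_sym[OF b] pcong_sym[OF b]] by (simp add: algebra_simps)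
  also have "pcong p (y * y) (f * k)" by (rule k)
  also have "pcong p (f * k) ((g * a) * k)" by (rule pcong_mult_right[OF a])
  also have "(g * a) * k = g * (a * k)" by (simp add: mult.assoc)
  finally have ak: "pcong p (g * (b * b)) (a * k)" by (rule monic_pcong_cancel[OF g(1)])
  \<comment> \<open>Squaring the Bezout relation of the cofactors brings in \<open>b * b\<close>,
    and \<open>g * (b * b)\<close> is a multiple of \<open>a\<close> because \<open>f\<close>
    divides \<open>y * y\<close>. Hence \<open>a\<close> divides \<open>g\<close>.\<close>
  have "pcong p (1 * 1) ((\<alpha> * a + \<beta> * b) * (\<alpha> * a + \<beta> * b))" by (rule pcong_mult[OF one one])
  then have "pcong p (g * (1 * 1)) (g * ((\<alpha> * a + \<beta> * b) * (\<alpha> * a + \<beta> * b)))" by (rule pcong_mult_left)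
  also have "g * ((\<alpha> * a + \<beta> * b) * (\<alpha> * a + \<beta> * b)) = a * (g * \<alpha> * (\<alpha> * a + 2 * \<beta> * b)) + \<beta> * \<beta> * (g * (b * b))"
    by (simp add: algebra_simps)
  also have "pcong p \<dots> (a * (g * \<alpha> * (\<alpha> * a + 2 * \<beta> * b)) + \<beta> * \<beta> * (a * k))"
    by (intro pcong_add pcong_refl pcong_mult_left ak)
  also have "\<dots> = a * (g * \<alpha> * (\<alpha> * a + 2 * \<beta> * b) + \<beta> * \<beta> * k)" by (simp add: algebra_simps)
  finally obtain c where c: "pcong p g (a * c)" by auto
  have f2: "pcong p f ((a * c) * a)" using a pcong_mult_right[OF c] pcong_trans by blast
  have y2: "pcong p y ((a * c) * b)" using b pcong_mult_right[OF c] pcong_trans by blast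
  have "pcong p (pderiv f * y) (pderiv ((a * c) * a) * ((a * c) * b))"
    by (rule pcong_mult[OF pcong_pderiv[OF f2] y2])
  \<comment> \<open>The derivative of a^2 c retains one factor a, which completes y = a c b to a
    multiple of f.\<close>
  also have "pderiv ((a * c) * a) = a * ((pderiv a + pderiv a) * c + a * pderiv c)"
    by (simp add: pderiv_mult algebra_simps)
  also have "a * ((pderiv a + pderiv a) * c + a * pderiv c) * ((a * c) * b) = ((a * c) * a) * (((pderiv a + pderiv a) * c + a * pderiv c) * b)"
    by (simp only: ac_simps)
  also have "pcong p \<dots> (f * (((pderiv a + pderiv a) * c + a * pderiv c) * b))"
    by (rule pcong_mult_right[OF pcong_sym[OF f2]])
  finally show ?thesis unfolding dvdm_iff_pcong by blast
qed

end

subsection \<open>Polynomials in a symmetric integer matrix\<close>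

lemma pcong_sum: "(\<And>i. i \<in> S \<Longrightarrow> pcong p (f i) (g i)) \<Longrightarrow> pcong p (sum f S) (sum g S)"
  by (induction S rule: infinite_finite_induct) (auto intro: pcong_add)

lemma pcong_prod: "(\<And>i. i \<in> S \<Longrightarrow> pcong p (f i) (g i)) \<Longrightarrow> pcong p (prod f S) (prod g S)"
  by (induction S rule: infinite_finite_induct) (auto intro: pcong_mult)

lemma poly_mat_umbral:
  "A \<in> carrier_mat n n \<Longrightarrow> i < n \<Longrightarrow> j < n \<Longrightarrow> poly_mat f A $$ (i,j) = umbral (\<lambda>k. (A ^\<^sub>m k) $$ (i,j)) f"
  unfolding poly_mat_def umbral_def by auto

lemma pow_mat_Suc_left: "A \<in> carrier_mat n n \<Longrightarrow> A ^\<^sub>m Suc k = A * A ^\<^sub>m k"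
  using pow_mat_add[of A n 1 k] by simp

lemma poly_mat_pCons:
  fixes A :: "'a :: comm_ring_1 mat"
  assumes A: "A \<in> carrier_mat n n"
  shows "poly_mat (pCons c f) A = c \<cdot>\<^sub>m 1\<^sub>m n + A * poly_mat f A"
proof (rule eq_matI)
  fix i j assume "i < dim_row (c \<cdot>\<^sub>m 1\<^sub>m n + A * poly_mat f A)" "j < dim_col (c \<cdot>\<^sub>m 1\<^sub>m n + A * poly_mat f A)"
  then have ij: "i < n" "j < n" using A poly_mat_carrier[OF A, of f] by auto
  have "(\<lambda>k. (A ^\<^sub>m Suc k) $$ (i,j)) = (\<lambda>k. \<Sum>l<n. A $$ (i,l) * (A ^\<^sub>m k) $$ (l,j))"
    unfolding pow_mat_Suc_left[OF A] by (intro ext index_mult_mat_sum[OF A pow_carrier_mat[OF A] ij])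
  then have "poly_mat (pCons c f) A $$ (i,j) = c * (1\<^sub>m n) $$ (i,j) + (\<Sum>l<n. A $$ (i,l) * poly_mat f A $$ (l,j))"
    using A ij by (simp add: poly_mat_umbral[OF A] umbral_pCons umbral_sum_left del: pow_mat.simps(2))
  also have "(\<Sum>l<n. A $$ (i,l) * poly_mat f A $$ (l,j)) = (A * poly_mat f A) $$ (i,j)"
    by (rule index_mult_mat_sum[symmetric, OF A poly_mat_carrier[OF A] ij])
  finally show "poly_mat (pCons c f) A $$ (i,j) = (c \<cdot>\<^sub>m 1\<^sub>m n + A * poly_mat f A) $$ (i,j)"
    using ij A carrier_matD[OF poly_mat_carrier[OF A, of f]] by (simp del: index_mult_mat(1))
qed (use A carrier_matD[OF poly_mat_carrier[OF A]] in auto)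

lemma poly_mat_0: "A \<in> carrier_mat n n \<Longrightarrow> poly_mat 0 A = 0\<^sub>m n n"
  unfolding poly_mat_def by auto

lemma poly_mat_add:
  fixes A :: "'a :: comm_ring_1 mat"
  assumes A: "A \<in> carrier_mat n n"
  shows "poly_mat (f + g) A = poly_mat f A + poly_mat g A"
  using carrier_matD[OF poly_mat_carrier[OF A]]
  by (intro eq_matI) (auto simp: poly_mat_umbral[OF A] umbral_add)

lemma poly_mat_smult:
  fixes A :: "'a :: comm_ring_1 mat"
  assumes A: "A \<in> carrier_mat n n"
  shows "poly_mat (Polynomial.smult c f) A = c \<cdot>\<^sub>m poly_mat f A"
  using carrier_matD[OF poly_mat_carrier[OF A]]
  by (intro eq_matI) (auto simp: poly_mat_umbral[OF A] umbral_smult)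

lemma poly_mat_mult:
  fixes A :: "'a :: comm_ring_1 mat"
  assumes A: "A \<in> carrier_mat n n"
  shows "poly_mat (f * g) A = poly_mat f A * poly_mat g A"
proof (induction f)
  case 0
  then show ?case using poly_mat_carrier[OF A, of g] by (simp add: poly_mat_0[OF A])
next
  case (pCons c f)
  have G: "poly_mat g A \<in> carrier_mat n n" and F: "poly_mat f A \<in> carrier_mat n n"
    using poly_mat_carrier[OF A] by auto
  have p0: "poly_mat (pCons 0 h) A = A * poly_mat h A" for h
    using carrier_matD[OF A] carrier_matD[OF poly_mat_carrier[OF A, of h]]
    unfolding poly_mat_pCons[OF A] by (intro eq_matI) auto
  have "poly_mat (pCons c f * g) A = c \<cdot>\<^sub>m poly_mat g A + A * (poly_mat f A * poly_mat g A)"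
    using F G A by (simp add: mult_pCons_left poly_mat_add[OF A] poly_mat_smult[OF A] p0 pCons.IH)
  also have "\<dots> = (c \<cdot>\<^sub>m 1\<^sub>m n + A * poly_mat f A) * poly_mat g A"
  proof -
    have "(c \<cdot>\<^sub>m 1\<^sub>m n + A * poly_mat f A) * poly_mat g A = (c \<cdot>\<^sub>m 1\<^sub>m n) * poly_mat g A + (A * poly_mat f A) * poly_mat g A"
      by (rule add_mult_distrib_mat[of _ n n _ _ n]) (use A F G in auto)
    then show ?thesis
      unfolding mult_smult_assoc_mat[OF one_carrier_mat G] assoc_mult_mat[OF A F G] using G by simp
  qed
  finally show ?case unfolding poly_mat_pCons[OF A] .
qed

lemma transpose_pow_mat:
  fixes A :: "'a :: comm_ring_1 mat"
  assumes A: "A \<in> carrier_mat n n"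
  shows "transpose_mat (A ^\<^sub>m k) = transpose_mat A ^\<^sub>m k"
proof (induction k)
  case (Suc k)
  have "transpose_mat (A ^\<^sub>m Suc k) = transpose_mat A * transpose_mat (A ^\<^sub>m k)"
    using transpose_mult[OF pow_carrier_mat[OF A] A] by simp
  then show ?case unfolding Suc using pow_mat_Suc_left[of "transpose_mat A" n k] A by simp
qed (use A in simp)

lemma transpose_poly_mat:
  fixes A :: "'a :: comm_ring_1 mat"
  assumes A: "A \<in> carrier_mat n n" and sym: "transpose_mat A = A"
  shows "transpose_mat (poly_mat f A) = poly_mat f A"
proof -
  have s: "(A ^\<^sub>m k) $$ (i,j) = (A ^\<^sub>m k) $$ (j,i)" if "i < n" "j < n" for i j k
    using arg_cong[OF transpose_pow_mat[OF A, of k], of "\<lambda>M. M $$ (j,i)"] that sym carrier_matD[OF pow_carrier_mat[OF A, of k]] by auto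
  show ?thesis using carrier_matD[OF poly_mat_carrier[OF A]] A
    by (intro eq_matI) (auto simp: poly_mat_def s)
qed

section \<open>The resolvent of an integer matrix as a polynomial vector\<close>

abbreviation const_vec :: "int vec \<Rightarrow> int poly vec" where
  "const_vec \<equiv> map_vec (\<lambda>c. [:c:])"

text \<open>The vector adj(x - A) z, that is, \<chi> times the resolvent (x - A)^-1 applied to
  \<open>z\<close>.\<close>

definition resolvent_vec :: "int mat \<Rightarrow> int vec \<Rightarrow> int poly vec" where
  "resolvent_vec A z = Determinant.adj_mat (char_poly_matrix A) *\<^sub>v const_vec z"

text \<open>z^T adj(x - A) z, the numerator over \<chi> of the generating function in 1/x of the
  numbers z^T A^k z. For the all-ones vector these numbers count walks.\<close>

definition resolvent_form :: "int mat \<Rightarrow> int vec \<Rightarrow> int poly" where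
  "resolvent_form A z = const_vec z \<bullet> resolvent_vec A z"

context
  fixes n :: nat and A :: "int mat"
  assumes A: "A \<in> carrier_mat n n"
begin

lemma resolvent_vec_carrier: "z \<in> carrier_vec n \<Longrightarrow> resolvent_vec A z \<in> carrier_vec n"
  unfolding resolvent_vec_def
  by (rule mult_mat_vec_carrier[OF adj_mat(1)[OF char_poly_matrix_closed[OF A]]]) simp

lemma resolvent_vec:
  assumes z: "z \<in> carrier_vec n" and i: "i < n"
  shows "(\<Sum>j<n. char_poly_matrix A $$ (i,j) * resolvent_vec A z $ j) = char_poly A * [:z $ i:]"
proof -
  have "(char_poly_matrix A *\<^sub>v resolvent_vec A z) $ i = (char_poly A \<cdot>\<^sub>v const_vec z) $ i"
    unfolding resolvent_vec_def using char_poly_matrix_adjugate[OF A, of "const_vec z"] z by simp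
  then show ?thesis
    using z i index_mult_mat_vec_sum[OF char_poly_matrix_closed[OF A] resolvent_vec_carrier[OF z] i] by simp
qed

lemma char_poly_monic: "monic (char_poly A)" "degree (char_poly A) = n"
  using degree_monic_char_poly[OF A] by auto

text \<open>Take an entry y_i of largest degree \<open>D\<close> in (x - A) y = \<chi> z. If
  \<open>D\<close> were at least \<open>n\<close>, the coefficient of x^(D + 1) would be the leading
  coefficient of y_i on the left and 0 on the right.\<close>

lemma resolvent_vec_degree:
  assumes z: "z \<in> carrier_vec n" and j: "j < n"
  shows "degree (resolvent_vec A z $ j) < n"
proof -
  define y where "y = resolvent_vec A z"
  have y: "y \<in> carrier_vec n" unfolding y_def by (rule resolvent_vec_carrier[OF z])
  have e: "pCons 0 (y $ i) - (\<Sum>j<n. Polynomial.smult (A $$ (i,j)) (y $ j)) = char_poly A * [:z $ i:]" if "i < n" for i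
    using char_poly_matrix_mult_vec[OF A y that] resolvent_vec[OF z that]
      index_mult_mat_vec_sum[OF char_poly_matrix_closed[OF A] y that] unfolding y_def by simp
  define D where "D = Max ((\<lambda>j. degree (y $ j)) ` {..<n})"
  have le: "degree (y $ i) \<le> D" if "i < n" for i unfolding D_def using that by (intro Max_ge) auto
  have "D \<in> (\<lambda>j. degree (y $ j)) ` {..<n}" unfolding D_def using j by (intro Max_in) auto
  then obtain i where i: "i < n" "degree (y $ i) = D" by auto
  have "D < n"
  proof (rule ccontr)
    assume "\<not> D < n"
    then have D: "n \<le> D" by simp
    have "coeff (pCons 0 (y $ i) - (\<Sum>j<n. Polynomial.smult (A $$ (i,j)) (y $ j))) (Suc D) = lead_coeff (y $ i)"
    proof -
      have "coeff (y $ j) (Suc D) = 0" if "j < n" for j using le[OF that] by (intro coeff_eq_0) simp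
      then show ?thesis using i by (simp add: coeff_sum)
    qed
    moreover have "coeff (char_poly A * [:z $ i:]) (Suc D) = 0"
      using D char_poly_monic(2) by (simp add: coeff_eq_0)
    ultimately have "y $ i = 0" using e[OF i(1)] by simp
    then have "D = 0" using i by simp
    then show False using D j by simp
  qed
  then show ?thesis using le[OF j] unfolding y_def by simp
qed

text \<open>The annihilation argument: \<open>f\<close> times the vector \<open>z\<close> is congruent to \<open>(x - A) v\<close>
  as soon as a multiple of the resolvent vector is divisible by \<open>s\<close>.\<close>

lemma poly_mat_annihilates:
  assumes z: "z \<in> carrier_vec n" and p: "prime p" and s: "monic s"
    and c: "pcong p (c * char_poly A) (s * f)"
    and d: "\<And>i. i < n \<Longrightarrow> poly_mod.dvdm p s (c * resolvent_vec A z $ i)"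
    and r: "r < n"
  shows "p dvd (poly_mat f A *\<^sub>v z) $ r"
proof -
  have "\<forall>i. \<exists>v. i < n \<longrightarrow> pcong p (c * resolvent_vec A z $ i) (s * v)"
    using d unfolding dvdm_iff_pcong by blast
  then obtain v where v: "\<And>i. i < n \<Longrightarrow> pcong p (c * resolvent_vec A z $ i) (s * v i)" by metis
  let ?v = "vec n v"
  show ?thesis
  proof (rule poly_mat_mult_vec_dvd[OF A z _ _ r, of ?v])
    fix i assume i: "i < n"
    let ?N = "\<lambda>j. char_poly_matrix A $$ (i,j)"
    have "s * (char_poly_matrix A *\<^sub>v ?v) $ i = (\<Sum>j<n. ?N j * (s * v j))"
      using index_mult_mat_vec_sum[OF char_poly_matrix_closed[OF A], of ?v i] i
      by (simp add: sum_distrib_left mult.left_commute)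
    also have "pcong p \<dots> (\<Sum>j<n. ?N j * (c * resolvent_vec A z $ j))"
      by (intro pcong_sum pcong_mult_left pcong_sym[OF v]) simp
    also have "(\<Sum>j<n. ?N j * (c * resolvent_vec A z $ j)) = c * char_poly A * [:z $ i:]"
    proof -
      have "(\<Sum>j<n. ?N j * (c * resolvent_vec A z $ j)) = c * (\<Sum>j<n. ?N j * resolvent_vec A z $ j)"
        by (simp only: sum_distrib_left mult.left_commute)
      then show ?thesis unfolding resolvent_vec[OF z i] by (simp only: mult.assoc)
    qed
    also have "pcong p \<dots> (s * f * [:z $ i:])" by (rule pcong_mult_right[OF c])
    also have "s * f * [:z $ i:] = s * Polynomial.smult (z $ i) f" by simp
    finally have "pcong p (s * Polynomial.smult (z $ i) f) (s * (char_poly_matrix A *\<^sub>v ?v) $ i)" by (rule pcong_sym)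
    then have "pcong p (Polynomial.smult (z $ i) f) ((char_poly_matrix A *\<^sub>v ?v) $ i)"
      by (rule monic_pcong_cancel[OF p s])
    then show "[:p:] dvd Polynomial.smult (z $ i) f - (char_poly_matrix A *\<^sub>v ?v) $ i" unfolding pcong_def .
  qed simp
qed

text \<open>The rank-one determinant formula for x - A. With the all-ones vector,
  \<open>c = 1\<close> gives A + J, and \<open>c = -1\<close> gives A - J, which leads to the
  complement.\<close>

lemma char_poly_add_rank_one:
  assumes z: "z \<in> carrier_vec n"
  shows "char_poly (mat n n (\<lambda>(i,j). A $$ (i,j) + c * (z $ i * z $ j))) = char_poly A - [:c:] * resolvent_form A z"
proof -
  let ?N = "char_poly_matrix A" and ?y = "[:c:] \<cdot>\<^sub>v const_vec z"
  have N: "?N \<in> carrier_mat n n" using A by simp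
  have P: "Determinant.adj_mat ?N *\<^sub>v const_vec z \<in> carrier_vec n"
    using resolvent_vec_carrier[OF z] unfolding resolvent_vec_def .
  have "char_poly_matrix (mat n n (\<lambda>(i,j). A $$ (i,j) + c * (z $ i * z $ j))) =
      mat n n (\<lambda>(i,j). ?N $$ (i,j) - const_vec z $ i * ?y $ j)"
    using A z by (intro eq_matI) (auto simp: char_poly_matrix_def)
  moreover have "det ?N \<noteq> 0" using char_poly_monic(1) unfolding char_poly_def by auto
  ultimately show ?thesis
    using det_minus_rank_one[OF N, of "const_vec z" ?y] z smult_scalar_prod_distrib[OF _ P, of "const_vec z"]
    unfolding char_poly_def resolvent_form_def resolvent_vec_def by simp
qed

context
  assumes sym: "transpose_mat A = A"
begin

text \<open>Let P be the diagonal entry \<open>i\<close> of the adjugate of x - A. As \<chi> divides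
  P times the form minus y_i^2, a common divisor of \<chi> and the form divides y_i^2.\<close>

lemma resolvent_square_dvdm:
  assumes z: "z \<in> carrier_vec n" and i: "i < n"
    and h: "poly_mod.dvdm p h (char_poly A)" "poly_mod.dvdm p h (resolvent_form A z)"
  shows "poly_mod.dvdm p h (resolvent_vec A z $ i * resolvent_vec A z $ i)"
proof -
  let ?N = "char_poly_matrix A"
  have N: "?N \<in> carrier_mat n n" using A by simp
  have As: "A $$ (i,j) = A $$ (j,i)" if "i < n" "j < n" for i j
    using arg_cong[OF sym, of "\<lambda>M. M $$ (i,j)"] that A by simp
  have Ns: "transpose_mat ?N = ?N"
    using A by (intro eq_matI) (auto simp: char_poly_matrix_def As)
  have d: "det ?N \<noteq> 0" using char_poly_monic(1) unfolding char_poly_def by auto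
  let ?y = "resolvent_vec A z" and ?P = "Determinant.adj_mat ?N $$ (i,i)"
  have "char_poly A dvd ?P * resolvent_form A z - (?y $ i)\<^sup>2"
    using adjugate_bilinear_square[OF N Ns d _ i, of "const_vec z"] z
    unfolding char_poly_def resolvent_form_def resolvent_vec_def by simp
  then have "poly_mod.dvdm p (char_poly A) (?P * resolvent_form A z - (?y $ i)\<^sup>2)" by (rule dvd_imp_dvdm)
  with h(1) have "poly_mod.dvdm p h (?P * resolvent_form A z - (?y $ i)\<^sup>2)" by (rule dvdm_trans)
  then have "poly_mod.dvdm p h (?P * resolvent_form A z - (?P * resolvent_form A z - (?y $ i)\<^sup>2))"
    by (rule dvdm_diff[OF dvdm_mult2[OF h(2)]])
  then show ?thesis by (simp add: power2_eq_square)
qed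

text \<open>Here \<chi> divides the square of every entry y_i of the resolvent vector, hence \<chi>'
  y_i. So \<chi>' z is congruent to (x - A) applied to \<chi>' y / \<chi>.\<close>

lemma isotropic_annihilated:
  assumes z: "z \<in> carrier_vec n" and p: "prime p" and iso: "pcong p (resolvent_form A z) 0" and r: "r < n"
  shows "p dvd (poly_mat (pderiv (char_poly A)) A *\<^sub>v z) $ r"
proof (rule poly_mat_annihilates[OF z p char_poly_monic(1) _ _ r])
  show "pcong p (pderiv (char_poly A) * char_poly A) (char_poly A * pderiv (char_poly A))"
    by (simp add: mult.commute)
  fix i assume i: "i < n"
  have "poly_mod.dvdm p (char_poly A) (resolvent_form A z)"
    using iso unfolding dvdm_iff_pcong by (intro exI[of _ 0]) simp
  then have "poly_mod.dvdm p (char_poly A) (resolvent_vec A z $ i * resolvent_vec A z $ i)"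
    by (intro resolvent_square_dvdm[OF z i]) (simp add: dvd_imp_dvdm)
  then show "poly_mod.dvdm p (char_poly A) (pderiv (char_poly A) * resolvent_vec A z $ i)"
    by (rule dvdm_square_imp_dvdm_pderiv_mult[OF p char_poly_monic(1)])
qed

lemma discriminant_char_poly:
  "discriminant (char_poly A) = (-1) ^ (n * (n - 1) div 2) * det (poly_mat (pderiv (char_poly A)) A)"
  unfolding discriminant_def resultant_char_poly[OF A] using char_poly_monic by simp

lemma prime_square_dvd_discriminant:
  assumes z: "z \<in> carrier_vec n" and p: "prime p" and iso: "pcong p (resolvent_form A z) 0"
    and k: "k < n" "\<not> p dvd z $ k"
    and q: "p\<^sup>2 dvd z \<bullet> (poly_mat (pderiv (char_poly A)) A *\<^sub>v z)"
  shows "p\<^sup>2 dvd discriminant (char_poly A)"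
  unfolding discriminant_char_poly
  by (intro dvd_mult prime_square_dvd_det[OF poly_mat_carrier[OF A] transpose_poly_mat[OF A sym] z p k _ q]
      isotropic_annihilated[OF z p iso])

text \<open>An irreducible common factor of \<chi> and \<chi> minus the form divides each y_i^2,
  hence y_i. So does the product \<open>s\<close> of these factors, and (\<chi> / s) z is congruent
  to (x - A) applied to y / s. For the all-ones vector the second polynomial is \<chi>(A + J), and
  the quotient is M_p for odd \<open>p\<close>.\<close>

lemma sfp_quotient_annihilates:
  assumes z: "z \<in> carrier_vec n" and p: "prime p" and r: "r < n"
  defines "s \<equiv> sfp_mod p (monic_gcd_mod p (char_poly A) (char_poly A - resolvent_form A z))"
  shows "p dvd (poly_mat (quotient_mod p (char_poly A) s) A *\<^sub>v z) $ r"
    and "monic (quotient_mod p (char_poly A) s)" "degree (quotient_mod p (char_poly A) s) + degree s = n"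
proof -
  define g where "g = monic_gcd_mod p (char_poly A) (char_poly A - resolvent_form A z)"
  note g = monic_gcd_mod[OF p char_poly_monic(1), of "char_poly A - resolvent_form A z", folded g_def]
  have s: "s = sfp_mod p g" unfolding s_def g_def ..
  have sm: "monic s" unfolding s by (rule sfp_mod(1)[OF p g(1)])
  have h\<chi>: "poly_mod.dvdm p h (char_poly A)" if "poly_mod.dvdm p h g" for h
    using that g(3) by (rule dvdm_trans)
  have hw: "poly_mod.dvdm p h (resolvent_form A z)" if "poly_mod.dvdm p h g" for h
    using dvdm_diff[OF h\<chi>[OF that] dvdm_trans[OF that g(4)]] by simp
  have sd: "poly_mod.dvdm p s (char_poly A)" unfolding s
    by (rule sfp_mod(2)[OF p g(1)]) (rule h\<chi>)
  note q = quotient_mod[OF p char_poly_monic(1) sm sd]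
  show "monic (quotient_mod p (char_poly A) s)" by (rule q(1))
  show "degree (quotient_mod p (char_poly A) s) + degree s = n" using q(3) char_poly_monic(2) by simp
  show "p dvd (poly_mat (quotient_mod p (char_poly A) s) A *\<^sub>v z) $ r"
  proof (rule poly_mat_annihilates[OF z p sm _ _ r, of 1])
    show "pcong p (1 * char_poly A) (s * quotient_mod p (char_poly A) s)" using q(2) by (simp add: mult.commute)
    fix i assume i: "i < n"
    have "poly_mod.dvdm p s (resolvent_vec A z $ i)" unfolding s
    proof (rule sfp_mod(2)[OF p g(1)])
      fix h assume h: "monic h" "poly_mod.irreducible_m p h" "poly_mod.dvdm p h g"
      have "poly_mod.dvdm p h (resolvent_vec A z $ i * resolvent_vec A z $ i)"
        by (rule resolvent_square_dvdm[OF z i h\<chi>[OF h(3)] hw[OF h(3)]])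
      then show "poly_mod.dvdm p h (resolvent_vec A z $ i)"
        using irreducible_m_prime[OF p h(1,2)] by blast
    qed
    then show "poly_mod.dvdm p s (1 * resolvent_vec A z $ i)" by simp
  qed
qed

end

end

subsection \<open>The prime 2\<close>

lemma pcong_char_poly:
  assumes A: "A \<in> carrier_mat n n" and B: "B \<in> carrier_mat n n"
    and c: "\<And>i j. i < n \<Longrightarrow> j < n \<Longrightarrow> p dvd A $$ (i,j) - B $$ (i,j)"
  shows "pcong p (char_poly A) (char_poly B)"
proof -
  have N: "pcong p (char_poly_matrix A $$ (i,j)) (char_poly_matrix B $$ (i,j))" if "i < n" "j < n" for i j
  proof -
    have "char_poly_matrix A $$ (i,j) - char_poly_matrix B $$ (i,j) = - [:A $$ (i,j) - B $$ (i,j):]"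
      using that A B by (simp add: char_poly_matrix_def)
    then show ?thesis using c[OF that] unfolding pcong_def by (simp add: const_poly_dvd dvd_diff_commute)
  qed
  show ?thesis unfolding char_poly_def det_def'[OF char_poly_matrix_closed[OF A]] det_def'[OF char_poly_matrix_closed[OF B]]
    by (intro pcong_sum pcong_mult_left pcong_prod N) (auto dest: permutes_in_image)
qed

text \<open>Transposing x - S gives x + S, whence \<chi>(-x) = (-1)^n \<chi>(x).\<close>

lemma char_poly_skew_coeff:
  fixes S :: "int mat"
  assumes S: "S \<in> carrier_mat n n" and skew: "\<And>i j. i < n \<Longrightarrow> j < n \<Longrightarrow> S $$ (i,j) = - S $$ (j,i)"
    and odd: "odd (n + i)"
  shows "coeff (char_poly S) i = 0"
proof -
  let ?N = "char_poly_matrix S"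
  have N: "?N \<in> carrier_mat n n" using S by simp
  have m1: "[:- 1:] = (- 1 :: int poly)" by (metis minus_pCons minus_zero pCons_one)
  have e: "map_mat (\<lambda>q. pcompose q [:0,-1:]) ?N = (-1) \<cdot>\<^sub>m transpose_mat ?N"
  proof (rule eq_matI)
    fix i j assume "i < dim_row ((-1) \<cdot>\<^sub>m transpose_mat ?N)" "j < dim_col ((-1) \<cdot>\<^sub>m transpose_mat ?N)"
    then have ij: "i < n" "j < n" using N by auto
    show "map_mat (\<lambda>q. pcompose q [:0,-1:]) ?N $$ (i,j) = ((-1) \<cdot>\<^sub>m transpose_mat ?N) $$ (i,j)"
    proof (cases "i = j")
      case True
      moreover have "S $$ (i,i) = 0" using skew[of i i] ij by simp
      ultimately show ?thesis using S ij by (simp add: char_poly_matrix_def pcompose_pCons m1)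
    next
      case False
      moreover have "S $$ (j,i) = - S $$ (i,j)" using skew[of j i] ij by simp
      ultimately show ?thesis using S ij by (simp add: char_poly_matrix_def pcompose_pCons)
    qed
  qed (use N in auto)
  have "pcompose (char_poly S) [:0,-1:] = det ((-1) \<cdot>\<^sub>m transpose_mat ?N)"
    unfolding char_poly_def comm_ring_hom.hom_det[OF pcompose_hom.comm_ring_hom_axioms, symmetric] e ..
  also have "\<dots> = (-1) ^ n * char_poly S"
    using carrier_matD[OF N] det_transpose[OF N] unfolding det_smult char_poly_def by simp
  finally have "pcompose (char_poly S) [:0,-1:] = (-1) ^ n * char_poly S" .
  then have "coeff (pcompose (char_poly S) [:0,-1:]) i = coeff ((-1) ^ n * char_poly S) i" by simp
  then have "(-1) ^ i * coeff (char_poly S) i = (-1) ^ n * coeff (char_poly S) i"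
    unfolding coeff_pcompose_linear by (cases "even n") auto
  then show ?thesis using odd by (cases "even n"; cases "even i") auto
qed

text \<open>Signs do not matter modulo 2, so a symmetric matrix with zero diagonal may be replaced
  by a skew-symmetric one.\<close>

lemma char_poly_coeff_even:
  fixes A :: "int mat"
  assumes A: "A \<in> carrier_mat n n" and sym: "transpose_mat A = A" and diag: "\<And>i. i < n \<Longrightarrow> A $$ (i,i) = 0"
    and odd: "odd (n + i)"
  shows "even (coeff (char_poly A) i)"
proof -
  define S where "S = mat n n (\<lambda>(i,j). if i < j then A $$ (i,j) else - A $$ (i,j))"
  have S: "S \<in> carrier_mat n n" unfolding S_def by simp
  have As: "A $$ (i,j) = A $$ (j,i)" if "i < n" "j < n" for i j
    using arg_cong[OF sym, of "\<lambda>M. M $$ (i,j)"] that A by simp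
  have "pcong 2 (char_poly A) (char_poly S)"
    by (rule pcong_char_poly[OF A S]) (auto simp: S_def)
  moreover have "coeff (char_poly S) i = 0"
    by (rule char_poly_skew_coeff[OF S _ odd]) (auto simp: S_def As diag not_less le_less)
  ultimately show ?thesis unfolding pcong_iff_coeff by (metis even_iff_mod_2_eq_zero mod_0)
qed

lemma pcong_2_sum_square: "pcong 2 ((\<Sum>i\<in>S. f i) * (\<Sum>i\<in>S. f i)) (\<Sum>i\<in>S. f i * f i)"
proof (induction S rule: infinite_finite_induct)
  case (insert x S)
  let ?s = "\<Sum>i\<in>S. f i"
  have "(\<Sum>i\<in>insert x S. f i) * (\<Sum>i\<in>insert x S. f i) = f x * f x + ?s * ?s + [:2:] * (f x * ?s)"
    using insert.hyps by (simp add: algebra_simps numeral_poly[symmetric])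
  also have "pcong 2 \<dots> (f x * f x + (\<Sum>i\<in>S. f i * f i) + 0)"
    by (intro pcong_add pcong_refl insert.IH) (simp add: pcong_def del: mult_pCons_left)
  finally show ?case using insert.hyps by simp
qed simp_all

lemma pcong_2_monom_square: "pcong 2 (monom c m * monom c m) (monom c (2 * m))"
proof -
  have "monom c m * monom c m - monom c (2 * m) = monom (c * c - c) (2 * m)"
    by (simp add: mult_monom mult_2 diff_monom)
  then show ?thesis unfolding pcong_def const_poly_dvd_iff by simp
qed

text \<open>Only the coefficients of x^(n - 2i) in \<chi> survive modulo 2, so \<chi> is x^(n mod 2)
  times a polynomial in x^2, which modulo 2 is a square. For odd \<open>n\<close> the factor x of
  \<open>M\<close> squares to x^2 where \<chi> has x; this is the extra factor on the right.\<close>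

lemma square_root_mod_2:
  fixes A :: "int mat"
  assumes A: "A \<in> carrier_mat n n" and sym: "transpose_mat A = A" and diag: "\<And>i. i < n \<Longrightarrow> A $$ (i,i) = 0"
  defines "M \<equiv> monom 1 (n mod 2) * (\<Sum>i\<le>n div 2. monom (coeff (char_poly A) (n - 2 * i)) (n div 2 - i))"
  shows "pcong 2 (M * M) (monom 1 (n mod 2) * char_poly A)"
proof -
  let ?c = "coeff (char_poly A)" and ?k = "n div 2" and ?r = "n mod 2"
  let ?m = "\<lambda>i. monom (?c (n - 2 * i)) (?k - i)"
  have "M * M = monom 1 (2 * ?r) * ((\<Sum>i\<le>?k. ?m i) * (\<Sum>i\<le>?k. ?m i))"
  proof -
    have "monom (1::int) (2 * ?r) = monom 1 ?r * monom 1 ?r" by (simp add: mult_monom mult_2)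
    then show ?thesis unfolding M_def by (simp only: ac_simps)
  qed
  also have "pcong 2 \<dots> (monom 1 (2 * ?r) * (\<Sum>i\<le>?k. ?m i * ?m i))"
    by (intro pcong_mult_left pcong_2_sum_square)
  also have "pcong 2 \<dots> (monom 1 (2 * ?r) * (\<Sum>i\<le>?k. monom (?c (n - 2 * i)) (2 * (?k - i))))"
    by (intro pcong_mult_left pcong_sum pcong_2_monom_square)
  also have "monom 1 (2 * ?r) * (\<Sum>i\<le>?k. monom (?c (n - 2 * i)) (2 * (?k - i))) =
      monom 1 ?r * (\<Sum>i\<le>?k. monom (?c (n - 2 * i)) (n - 2 * i))"
  proof -
    have e: "2 * ?r + 2 * (?k - i) = ?r + (n - 2 * i)" if le: "i \<le> ?k" for i
    proof -
      obtain t where t: "?k = i + t" using le_Suc_ex[OF le] by blast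
      have 1: "?k - i = t" using t by simp
      have 2: "n - 2 * i = 2 * t + ?r" using t mult_div_mod_eq[of 2 n] by linarith
      show ?thesis unfolding 1 2 by simp
    qed
    have "monom 1 (2 * ?r) * (\<Sum>i\<le>?k. monom (?c (n - 2 * i)) (2 * (?k - i))) =
        (\<Sum>i\<le>?k. monom (?c (n - 2 * i)) (2 * ?r + 2 * (?k - i)))"
      by (simp only: sum_distrib_left mult_monom mult_1)
    also have "\<dots> = (\<Sum>i\<le>?k. monom (?c (n - 2 * i)) (?r + (n - 2 * i)))"
      by (rule sum.cong) (simp_all only: e atMost_iff)
    also have "\<dots> = monom 1 ?r * (\<Sum>i\<le>?k. monom (?c (n - 2 * i)) (n - 2 * i))"
      by (simp only: sum_distrib_left mult_monom mult_1)
    finally show ?thesis .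
  qed
  also have "pcong 2 \<dots> (monom 1 ?r * char_poly A)"
  proof (rule pcong_mult_left)
    show "pcong 2 (\<Sum>i\<le>?k. monom (?c (n - 2 * i)) (n - 2 * i)) (char_poly A)"
      unfolding pcong_iff_coeff
    proof
      fix j
      have cf: "coeff (\<Sum>i\<le>?k. monom (?c (n - 2 * i)) (n - 2 * i)) j = (\<Sum>i\<le>?k. if n - 2 * i = j then ?c j else 0)"
        by (auto simp: coeff_sum intro!: sum.cong)
      show "coeff (\<Sum>i\<le>?k. monom (?c (n - 2 * i)) (n - 2 * i)) j mod 2 = ?c j mod 2"
      proof (cases "j \<le> n \<and> even (n + j)")
        case True
        then obtain m where m: "n = j + 2 * m"
          by (metis add_diff_inverse_nat dvdE even_add even_diff_nat not_less)
        then have "n - 2 * i = j \<longleftrightarrow> i = m" if "i \<le> ?k" for i using that by auto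
        then have "(\<Sum>i\<le>?k. if n - 2 * i = j then ?c j else 0) = (\<Sum>i\<le>?k. if i = m then ?c j else 0)"
          by (intro sum.cong) auto
        also have "\<dots> = ?c j" using m by simp
        finally show ?thesis unfolding cf by simp
      next
        case False
        have "n - 2 * i \<noteq> j" if "i \<le> ?k" for i
        proof
          assume e: "n - 2 * i = j"
          have "2 * i \<le> n" using that by simp
          then have "n + j = 2 * (j + i)" "j \<le> n" using e by auto
          then show False using False by simp
        qed
        then have "(\<Sum>i\<le>?k. if n - 2 * i = j then ?c j else 0) = 0" by (intro sum.neutral) auto
        moreover have "even (?c j)"
        proof (cases "j \<le> n")
          case True
          then show ?thesis using False char_poly_coeff_even[OF A sym diag] by blast
        next
          case False
          then show ?thesis using char_poly_monic(2)[OF A] by (simp add: coeff_eq_0)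
        qed
        ultimately show ?thesis unfolding cf by (simp add: even_iff_mod_2_eq_zero)
      qed
    qed
  qed
  finally show ?thesis .
qed

text \<open>B = M(A) is symmetric and has even square by Cayley-Hamilton. A diagonal entry of the
  square is the sum of the squares of a row, congruent modulo 2 to the row sum.\<close>

lemma square_root_annihilates_ones:
  fixes A :: "int mat"
  assumes A: "A \<in> carrier_mat n n" and sym: "transpose_mat A = A"
    and M: "pcong 2 (M * M) (q * char_poly A)" and r: "r < n"
  shows "even ((poly_mat M A *\<^sub>v ones_vec n) $ r)"
proof -
  let ?B = "poly_mat M A"
  have B: "?B \<in> carrier_mat n n" using A by simp
  have Bs: "?B $$ (r,j) = ?B $$ (j,r)" if "j < n" for j
    using arg_cong[OF transpose_poly_mat[OF A sym, of M], of "\<lambda>X. X $$ (r,j)"] that r carrier_matD[OF B] by simp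
  have "M * M = q * char_poly A + (M * M - q * char_poly A)" by simp
  moreover obtain u where "M * M - q * char_poly A = [:2:] * u" using M unfolding pcong_def by (rule dvdE)
  ultimately have "M * M = q * char_poly A + Polynomial.smult 2 u" by simp
  then have "?B * ?B = poly_mat q A * poly_mat (char_poly A) A + 2 \<cdot>\<^sub>m poly_mat u A"
    unfolding poly_mat_mult[OF A, symmetric] poly_mat_smult[OF A, symmetric] poly_mat_add[OF A, symmetric] by simp
  also have "\<dots> = 2 \<cdot>\<^sub>m poly_mat u A"
    unfolding cayley_hamilton[OF A] using poly_mat_carrier[OF A, of q] poly_mat_carrier[OF A, of u] by simp
  finally have "(?B * ?B) $$ (r,r) = 2 * poly_mat u A $$ (r,r)" using poly_mat_carrier[OF A, of u] r by simp
  then have "even (\<Sum>j<n. ?B $$ (r,j) * ?B $$ (j,r))"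
    unfolding index_mult_mat_sum[OF B B r r] by simp
  also have "(\<Sum>j<n. ?B $$ (r,j) * ?B $$ (j,r)) = (\<Sum>j<n. ?B $$ (r,j) * ?B $$ (r,j))"
    by (rule sum.cong) (simp_all only: Bs lessThan_iff)
  moreover have "even ((\<Sum>j<n. ?B $$ (r,j) * ?B $$ (r,j)) - (\<Sum>j<n. ?B $$ (r,j)))"
    unfolding sum_subtractf[symmetric] by (intro dvd_sum) auto
  ultimately have "even (\<Sum>j<n. ?B $$ (r,j))" by simp
  moreover have "(?B *\<^sub>v ones_vec n) $ r = (\<Sum>j<n. ?B $$ (r,j))"
  proof -
    have "ones_vec n \<in> carrier_vec n" by (simp add: ones_vec_def)
    from index_mult_mat_vec_sum[OF B this r] show ?thesis
      by (simp add: ones_vec_def del: index_mult_mat_vec)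
  qed
  ultimately show ?thesis by simp
qed

subsection \<open>The cofactor vector and the Gram determinant\<close>

text \<open>The generalized cross product of \<open>w 0\<close>, ..., \<open>w (n - 2)\<close>; for
  the walk vectors it is \<open>xi_vec\<close>.\<close>

definition last_cofactors :: "nat \<Rightarrow> (nat \<Rightarrow> 'a :: comm_ring_1 vec) \<Rightarrow> 'a vec" where
  "last_cofactors n w = vec n (\<lambda>i. cofactor (mat_of_cols n (map w [0..<n])) i (n - 1))"

definition append_col :: "nat \<Rightarrow> (nat \<Rightarrow> 'a :: comm_ring_1 vec) \<Rightarrow> 'a vec \<Rightarrow> 'a mat" where
  "append_col n w x = mat_of_cols n (map w [0..<n - 1] @ [x])"

definition gram_mat :: "nat \<Rightarrow> (nat \<Rightarrow> 'a :: comm_ring_1 vec) \<Rightarrow> 'a mat" where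
  "gram_mat n w = mat (n - 1) (n - 1) (\<lambda>(i,j). w i \<bullet> w j)"

context
  fixes n :: nat and w :: "nat \<Rightarrow> 'a :: linordered_field vec"
  assumes w: "\<And>k. w k \<in> carrier_vec n" and n: "n > 0"
begin

lemma last_cofactors_carrier: "last_cofactors n w \<in> carrier_vec n"
  by (simp add: last_cofactors_def)

lemma append_col_carrier: "append_col n w x \<in> carrier_mat n n"
  using n unfolding append_col_def by (intro carrier_matI) simp_all

lemma append_col_index: "i < n \<Longrightarrow> j < n \<Longrightarrow> append_col n w x $$ (i,j) = (if j = n - 1 then x $ i else w j $ i)"
  using n by (auto simp: append_col_def mat_of_cols_index nth_append)

lemma det_append_col:
  assumes x: "x \<in> carrier_vec n"
  shows "det (append_col n w x) = x \<bullet> last_cofactors n w"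
proof -
  have "mat_delete (append_col n w x) i (n - 1) = mat_delete (mat_of_cols n (map w [0..<n])) i (n - 1)" if "i < n" for i
    using n that append_col_carrier[of x]
    by (intro eq_matI) (auto simp: mat_delete_def append_col_index mat_of_cols_index)
  then have "cofactor (append_col n w x) i (n - 1) = cofactor (mat_of_cols n (map w [0..<n])) i (n - 1)" if "i < n" for i
    using that by (simp add: cofactor_def)
  then show ?thesis using n x
    by (subst laplace_expansion_column[OF append_col_carrier, of "n - 1"])
      (auto simp: append_col_index scalar_prod_def last_cofactors_def atLeast0LessThan intro!: sum.cong)
qed

text \<open>For the matrix V with last column \<open>x\<close>, the product V^T V is block diagonal,
  with the Gram matrix and \<open>x \<bullet> x\<close> as blocks.\<close>

lemma det_append_col_square:
  assumes x: "x \<in> carrier_vec n" and orth: "\<And>j. j < n - 1 \<Longrightarrow> x \<bullet> w j = 0"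
  shows "(x \<bullet> last_cofactors n w)\<^sup>2 = det (gram_mat n w) * (x \<bullet> x)"
proof -
  let ?V = "append_col n w x"
  have V: "?V \<in> carrier_mat n n" by (rule append_col_carrier)
  let ?c = "mat 1 1 (\<lambda>_. x \<bullet> x)"
  have col: "col ?V j = (if j = n - 1 then x else w j)" if "j < n" for j
    using that x w[of j] V by (intro eq_vecI) (auto simp: append_col_index)
  have orth': "w j \<bullet> x = 0" if "j < n - 1" for j
    using orth[OF that] comm_scalar_prod[OF x w[of j]] by simp
  have "transpose_mat ?V * ?V = four_block_mat (gram_mat n w) (0\<^sub>m (n - 1) 1) (0\<^sub>m 1 (n - 1)) ?c" (is "_ = ?F")
  proof (rule eq_matI)
    fix i j assume "i < dim_row ?F" "j < dim_col ?F"
    then have ij: "i < n" "j < n" using n by (auto simp: gram_mat_def)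
    have "(transpose_mat ?V * ?V) $$ (i,j) = col ?V i \<bullet> col ?V j" using ij V by simp
    also have "\<dots> = ?F $$ (i,j)" using ij n by (auto simp: col orth orth' gram_mat_def)
    finally show "(transpose_mat ?V * ?V) $$ (i,j) = ?F $$ (i,j)" .
  qed (use V n in \<open>auto simp: gram_mat_def\<close>)
  moreover have "det ?F = det (gram_mat n w) * det ?c"
    by (rule det_four_block_mat_lower_left_zero[of _ "n - 1" _ 1]) (auto simp: gram_mat_def)
  ultimately have "det (transpose_mat ?V * ?V) = det (gram_mat n w) * det ?c" by simp
  moreover have "det (transpose_mat ?V * ?V) = det ?V * det ?V"
    using V by (subst det_mult[of _ n]) (auto simp: det_transpose[OF V])
  moreover have "det ?c = x \<bullet> x" by (simp add: det_single)
  ultimately show ?thesis using det_append_col[OF x] by (simp add: power2_eq_square)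
qed

lemma scalar_prod_self_eq_0: "x \<in> carrier_vec n \<Longrightarrow> x \<bullet> x = 0 \<Longrightarrow> x = 0\<^sub>v n" for x :: "'a vec"
  by (intro eq_vecI) (auto simp: scalar_prod_def sum_nonneg_eq_0_iff)

text \<open>Appending a zero column gives a singular square matrix; a kernel vector of its transpose
  is orthogonal to the other columns.\<close>

lemma exists_orthogonal:
  "\<exists>x \<in> carrier_vec n. x \<noteq> 0\<^sub>v n \<and> (\<forall>j < n - 1. x \<bullet> w j = 0)"
proof -
  let ?M = "transpose_mat (append_col n w (0\<^sub>v n))"
  have M: "?M \<in> carrier_mat n n" using append_col_carrier by simp
  have "det ?M = 0" using det_append_col[of "0\<^sub>v n"] det_transpose[OF append_col_carrier[of "0\<^sub>v n"]]
    last_cofactors_carrier by simp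
  then obtain x where x: "x \<in> carrier_vec n" "x \<noteq> 0\<^sub>v n" "?M *\<^sub>v x = 0\<^sub>v n"
    using det_0_iff_vec_prod_zero_field[OF M] by blast
  have o: "x \<bullet> w j = 0" if j: "j < n - 1" for j
  proof -
    have "(?M *\<^sub>v x) $ j = w j \<bullet> x"
    proof -
      have "row ?M j = w j" using j w[of j] append_col_carrier[of "0\<^sub>v n"]
        by (intro eq_vecI) (auto simp: append_col_index)
      then show ?thesis using j M by simp
    qed
    then show ?thesis using x j comm_scalar_prod[OF x(1) w[of j]] by simp
  qed
  show ?thesis using x(1,2) o by blast
qed

lemma last_cofactors_orthogonal:
  assumes "j < n - 1"
  shows "w j \<bullet> last_cofactors n w = 0"
proof -
  have "det (append_col n w (w j)) = 0"
    by (rule det_identical_columns[OF append_col_carrier, of j "n - 1"])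
      (use assms n carrier_matD[OF append_col_carrier] in \<open>auto simp: append_col_index intro!: eq_vecI\<close>)
  then show ?thesis using det_append_col[OF w[of j]] by simp
qed

text \<open>The square identity is applied to the cofactor vector itself. If that is zero, a nonzero
  vector orthogonal to the \<open>w j\<close> shows that the Gram determinant is zero as well.
  Through this formula the length of \<xi> depends on the walk numbers only.\<close>

lemma last_cofactors_norm: "last_cofactors n w \<bullet> last_cofactors n w = det (gram_mat n w)"
proof (cases "last_cofactors n w = 0\<^sub>v n")
  case True
  obtain x where x: "x \<in> carrier_vec n" "x \<noteq> 0\<^sub>v n" "\<And>j. j < n - 1 \<Longrightarrow> x \<bullet> w j = 0"
    using exists_orthogonal by blast
  have "0 = det (gram_mat n w) * (x \<bullet> x)" using det_append_col_square[OF x(1,3)] True x(1) by simp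
  then show ?thesis using scalar_prod_self_eq_0[OF x(1)] x(2) True by auto
next
  case False
  have "(last_cofactors n w \<bullet> last_cofactors n w)\<^sup>2 = det (gram_mat n w) * (last_cofactors n w \<bullet> last_cofactors n w)"
    using last_cofactors_orthogonal comm_scalar_prod[OF last_cofactors_carrier w]
    by (intro det_append_col_square last_cofactors_carrier) auto
  moreover have "last_cofactors n w \<bullet> last_cofactors n w \<noteq> 0"
    using scalar_prod_self_eq_0[OF last_cofactors_carrier] False by blast
  ultimately show ?thesis by (simp add: power2_eq_square)
qed

text \<open>In the square identity the left side is 0, and the Gram factor is nonzero, being the
  squared length of the cofactor vector.\<close>

lemma orthogonal_complement_trivial:
  assumes "last_cofactors n w \<noteq> 0\<^sub>v n" and x: "x \<in> carrier_vec n"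
    and "\<And>j. j < n - 1 \<Longrightarrow> x \<bullet> w j = 0" and "x \<bullet> last_cofactors n w = 0"
  shows "x = 0\<^sub>v n"
proof -
  have "det (gram_mat n w) \<noteq> 0"
    using scalar_prod_self_eq_0[OF last_cofactors_carrier] assms(1) last_cofactors_norm by auto
  then have "x \<bullet> x = 0" using det_append_col_square[OF x assms(3)] assms(4) by simp
  then show ?thesis by (rule scalar_prod_self_eq_0[OF x])
qed

lemma orthogonal_complement_line:
  assumes nz: "last_cofactors n w \<noteq> 0\<^sub>v n" and x: "x \<in> carrier_vec n"
    and orth: "\<And>j. j < n - 1 \<Longrightarrow> x \<bullet> w j = 0"
  shows "x = (x \<bullet> last_cofactors n w / (last_cofactors n w \<bullet> last_cofactors n w)) \<cdot>\<^sub>v last_cofactors n w"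
proof -
  let ?\<xi> = "last_cofactors n w" 
  let ?c = "x \<bullet> ?\<xi> / (?\<xi> \<bullet> ?\<xi>)"
  have \<xi>: "?\<xi> \<in> carrier_vec n" by (rule last_cofactors_carrier)
  have nn: "?\<xi> \<bullet> ?\<xi> \<noteq> 0" using scalar_prod_self_eq_0[OF \<xi>] nz by blast
  have d: "(x - ?c \<cdot>\<^sub>v ?\<xi>) \<bullet> y = x \<bullet> y - ?c * (?\<xi> \<bullet> y)" if "y \<in> carrier_vec n" for y
    using that x \<xi> by (subst minus_scalar_prod_distrib[of _ n]) auto
  have "x - ?c \<cdot>\<^sub>v ?\<xi> = 0\<^sub>v n"
  proof (rule orthogonal_complement_trivial[OF nz])
    show "(x - ?c \<cdot>\<^sub>v ?\<xi>) \<bullet> w j = 0" if "j < n - 1" for j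
      unfolding d[OF w] using orth[OF that] last_cofactors_orthogonal[OF that] comm_scalar_prod[OF \<xi> w[of j]] by simp
    show "(x - ?c \<cdot>\<^sub>v ?\<xi>) \<bullet> ?\<xi> = 0" unfolding d[OF \<xi>] using nn by simp
  qed (use x \<xi> in auto)
  then show ?thesis using x \<xi>
    by (intro eq_vecI) (auto dest!: arg_cong[where f = "\<lambda>v. v $ i" for i] simp: vec_eq_iff)
qed

text \<open>A kernel vector of the Gram matrix gives a combination of the \<open>w j\<close> that is
  orthogonal to all of them, hence to itself; over an ordered field it vanishes.\<close>

lemma gram_singular:
  assumes "det (gram_mat n w) = 0"
  shows "\<exists>c k. k < n - 1 \<and> c k \<noteq> 0 \<and> (\<forall>i<n. (\<Sum>j<n-1. c j * w j $ i) = 0)"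
proof -
  have "gram_mat n w \<in> carrier_mat (n - 1) (n - 1)" by (simp add: gram_mat_def)
  then obtain v where v: "v \<in> carrier_vec (n - 1)" "v \<noteq> 0\<^sub>v (n - 1)" "gram_mat n w *\<^sub>v v = 0\<^sub>v (n - 1)"
    using assms det_0_iff_vec_prod_zero_field by blast
  define u where "u = vec n (\<lambda>i. \<Sum>j<n-1. v $ j * w j $ i)"
  have u: "u \<in> carrier_vec n" by (simp add: u_def)
  have wu: "w i \<bullet> u = 0" if "i < n - 1" for i
  proof -
    have "w i \<bullet> u = (\<Sum>l<n. \<Sum>j<n-1. w i $ l * (v $ j * w j $ l))"
      by (simp add: u_def scalar_prod_def sum_distrib_left atLeast0LessThan)
    also have "\<dots> = (\<Sum>j<n-1. \<Sum>l<n. w i $ l * (v $ j * w j $ l))" by (rule sum.swap)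
    also have "\<dots> = (\<Sum>j<n-1. (w i \<bullet> w j) * v $ j)"
      using carrier_vecD[OF w] by (simp add: scalar_prod_def sum_distrib_left sum_distrib_right atLeast0LessThan mult_ac)
    also have "\<dots> = (gram_mat n w *\<^sub>v v) $ i"
      using that v(1) by (subst index_mult_mat_vec_sum[of _ "n-1" "n-1"]) (auto simp: gram_mat_def)
    finally show ?thesis using v(3) that by simp
  qed
  have "u \<bullet> u = (\<Sum>j<n-1. v $ j * (w j \<bullet> u))"
  proof -
    have "u \<bullet> u = (\<Sum>l<n. \<Sum>j<n-1. v $ j * (w j $ l * u $ l))"
      using u by (subst (1) u_def) (simp add: scalar_prod_def sum_distrib_right atLeast0LessThan mult.assoc)
    also have "\<dots> = (\<Sum>j<n-1. \<Sum>l<n. v $ j * (w j $ l * u $ l))" by (rule sum.swap)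
    finally show ?thesis using u by (simp add: scalar_prod_def sum_distrib_left atLeast0LessThan)
  qed
  then have "u \<bullet> u = 0" using wu by simp
  then have u0: "u = 0\<^sub>v n" by (rule scalar_prod_self_eq_0[OF u])
  have "\<exists>k<n-1. v $ k \<noteq> 0"
  proof (rule ccontr)
    assume "\<not> ?thesis"
    then have "v = 0\<^sub>v (n - 1)" using v(1) by (intro eq_vecI) auto
    then show False using v(2) by simp
  qed
  then obtain k where k: "k < n - 1" "v $ k \<noteq> 0" by (elim exE conjE)
  show ?thesis
  proof (intro exI conjI allI impI)
    fix i assume "i < n"
    then show "(\<Sum>j<n-1. v $ j * w j $ i) = 0" using arg_cong[OF u0, of "\<lambda>v. v $ i"] by (simp add: u_def)
  qed (use k in auto)
qed

end

lemma rank_le_of_factor: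
  fixes M B :: "'a :: field mat"
  assumes M: "M \<in> carrier_mat n m" and B: "B \<in> carrier_mat n r"
    and c: "\<And>j. j < m \<Longrightarrow> \<exists>y\<in>carrier_vec r. col M j = B *\<^sub>v y"
  shows "vec_space.rank n M \<le> r"
proof -
  interpret vec_space "TYPE('a)" n .
  have e: "lin_indpt {}" unfolding lin_dep_def by simp
  have "\<exists>S. finite S \<and> maximal S (\<lambda>T. T \<subseteq> set (cols M) \<and> lin_indpt T) \<and> {} \<subseteq> S"
    by (rule maximal_exists_superset[OF finite_set[of "cols M"]]) (simp_all add: e)
  then obtain S where S: "maximal S (\<lambda>T. T \<subseteq> set (cols M) \<and> lin_indpt T)" "finite S" by (elim exE conjE)
  have rk: "rank M = card S" by (rule rank_card_indpt[OF M S(1)])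
  have SM: "S \<subseteq> set (cols M)" "lin_indpt S" using S(1) unfolding maximal_def by auto
  have "set (cols M) \<subseteq> span (set (cols B))"
  proof
    fix v assume "v \<in> set (cols M)"
    then obtain j where "j < m" "v = col M j" using M by (auto simp: cols_def)
    then show "v \<in> span (set (cols B))" using c[of j] col_space_eq[OF B] B unfolding col_space_def by auto
  qed
  then have sub: "S \<subseteq> span (set (cols B))" using SM by blast
  have Bc: "set (cols B) \<subseteq> carrier_vec n" using cols_dim[of B] B by auto
  from replacement[OF S(2) finite_set Bc SM(2) sub] have "int (card S) \<le> int (card (set (cols B)))" by auto
  also have "card (set (cols B)) \<le> length (cols B)" by (rule card_length)
  finally show ?thesis using rk B by simp
qed

lemma (in comm_ring_hom) cofactor_hom: "cofactor (map_mat hom M) i j = hom (cofactor M i j)"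
proof -
  have "mat_delete (map_mat hom M) i j = map_mat hom (mat_delete M i j)"
    by (intro eq_matI) (auto simp: mat_delete_def)
  then show ?thesis unfolding cofactor_def by (simp add: hom_distribs)
qed

subsection \<open>Walks in a graph\<close>

lemma adjacency_carrier [simp]: "adj_mat n G \<in> carrier_mat n n"
  by (simp add: adj_mat_def)

lemma adjacency_index: "i < n \<Longrightarrow> j < n \<Longrightarrow> adj_mat n G $$ (i,j) = (if {i,j} \<in> G then 1 else 0)"
  by (simp add: adj_mat_def)

lemma adjacency_symmetric: "transpose_mat (adj_mat n G) = adj_mat n G"
  by (intro eq_matI) (auto simp: adj_mat_def insert_commute)

lemma loop_free: "simple_graph n G \<Longrightarrow> {i,i} \<notin> G"
  unfolding simple_graph_def complete_edges_def by (auto simp: doubleton_eq_iff)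

lemma adjacency_hom: "map_mat of_int (adj_mat n G :: int mat) = (adj_mat n G :: 'a :: ring_1 mat)"
  by (intro eq_matI) (auto simp: adj_mat_def)

lemma ones_vec_carrier [simp]: "ones_vec n \<in> carrier_vec n"
  by (simp add: ones_vec_def)

lemma ones_vec_index [simp]: "i < n \<Longrightarrow> ones_vec n $ i = 1"
  by (simp add: ones_vec_def)

lemma ones_vec_hom: "map_vec of_int (ones_vec n :: int vec) = (ones_vec n :: 'a :: ring_1 vec)"
  by (intro eq_vecI) (auto simp: ones_vec_def)

lemma walk_vec_carrier [simp]: "walk_vec n G k \<in> carrier_vec n"
  unfolding walk_vec_def by (rule mult_mat_vec_carrier[OF pow_carrier_mat[OF adjacency_carrier] ones_vec_carrier])

lemma walk_vec_0: "walk_vec n G 0 = (ones_vec n :: 'a :: comm_ring_1 vec)"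
  unfolding walk_vec_def by (simp add: adj_mat_def)

lemma walk_vec_Suc: "walk_vec n G (Suc k) = adj_mat n G *\<^sub>v (walk_vec n G k :: 'a :: comm_ring_1 vec)"
  unfolding walk_vec_def pow_mat_Suc_left[OF adjacency_carrier]
  by (rule assoc_mult_mat_vec[OF adjacency_carrier pow_carrier_mat[OF adjacency_carrier] ones_vec_carrier])

lemma walk_vec_hom: "map_vec of_int (walk_vec n G k :: int vec) = (walk_vec n G k :: 'a :: comm_ring_1 vec)"
proof (induction k)
  case 0
  then show ?case by (simp add: walk_vec_0 ones_vec_hom)
next
  case (Suc k)
  then show ?case unfolding walk_vec_Suc
    using of_int_hom.mult_mat_vec_hom[of "adj_mat n G" n n "walk_vec n G k", where 'a = 'a]
    by (simp add: adjacency_hom)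
qed

lemma walk_mat_carrier [simp]: "walk_mat n G \<in> carrier_mat n n"
  unfolding walk_mat_def by (rule carrier_matI) simp_all

lemma walk_mat_index: "i < n \<Longrightarrow> j < n \<Longrightarrow> walk_mat n G $$ (i,j) = walk_vec n G j $ i"
  unfolding walk_mat_def by (simp add: mat_of_cols_index)

lemma walk_mat_hom: "map_mat of_int (walk_mat n G :: int mat) = (walk_mat n G :: 'a :: comm_ring_1 mat)"
proof (rule eq_matI)
  fix i j assume "i < dim_row (walk_mat n G :: 'a mat)" "j < dim_col (walk_mat n G :: 'a mat)"
  then have ij: "i < n" "j < n" using carrier_matD[OF walk_mat_carrier[of n G, where 'a = 'a]] by auto
  have "of_int (walk_vec n G j $ i) = (walk_vec n G j $ i :: 'a)"
    using arg_cong[OF walk_vec_hom[of n G j, where 'a = 'a], of "\<lambda>v. v $ i"] ij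
      carrier_vecD[OF walk_vec_carrier[of n G j, where 'a = int]] by simp
  then show "map_mat of_int (walk_mat n G :: int mat) $$ (i,j) = (walk_mat n G :: 'a mat) $$ (i,j)"
    using ij carrier_matD[OF walk_mat_carrier[of n G, where 'a = int]] by (simp add: walk_mat_index)
qed (simp_all add: walk_mat_def)

lemma xi_vec_carrier [simp]: "xi_vec n G \<in> carrier_vec n"
  by (simp add: xi_vec_def)

abbreviation xi_rat :: "nat \<Rightarrow> nat set set \<Rightarrow> rat vec" where
  "xi_rat n G \<equiv> map_vec of_int (xi_vec n G)"

lemma last_cofactors_walk:
  "last_cofactors n (walk_vec n G) = (map_vec of_int (xi_vec n G) :: 'a :: linordered_field vec)"
proof -
  have "(walk_mat n G :: 'a mat) = map_mat of_int (walk_mat n G :: int mat)" by (rule walk_mat_hom[symmetric])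
  then have "cofactor (walk_mat n G :: 'a mat) i j = of_int (cofactor (walk_mat n G) i j)" for i j
    by (simp add: of_int_hom.cofactor_hom)
  then show ?thesis unfolding last_cofactors_def xi_vec_def walk_mat_def[symmetric]
    by (intro eq_vecI) auto
qed

lemma scalar_prod_mult_symmetric:
  fixes A :: "'a :: comm_ring_1 mat"
  assumes A: "A \<in> carrier_mat n n" and sym: "transpose_mat A = A"
    and x: "x \<in> carrier_vec n" and y: "y \<in> carrier_vec n"
  shows "x \<bullet> (A *\<^sub>v y) = (A *\<^sub>v x) \<bullet> y"
proof -
  have As: "A $$ (i,j) = A $$ (j,i)" if "i < n" "j < n" for i j
    using arg_cong[OF sym, of "\<lambda>M. M $$ (i,j)"] that A by simp
  have "x \<bullet> (A *\<^sub>v y) = (\<Sum>i<n. \<Sum>j<n. x $ i * (A $$ (i,j) * y $ j))"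
    using A y unfolding scalar_prod_def
    by (simp add: index_mult_mat_vec_sum[OF A y] atLeast0LessThan sum_distrib_left del: index_mult_mat_vec)
  also have "\<dots> = (\<Sum>j<n. \<Sum>i<n. x $ i * (A $$ (i,j) * y $ j))" by (rule sum.swap)
  also have "\<dots> = (\<Sum>j<n. \<Sum>i<n. A $$ (j,i) * x $ i * y $ j)"
    by (intro sum.cong refl) (auto simp: As mult_ac)
  also have "\<dots> = (A *\<^sub>v x) \<bullet> y"
    using A x y unfolding scalar_prod_def[of _ y]
    by (simp add: index_mult_mat_vec_sum[OF A x] atLeast0LessThan sum_distrib_right del: index_mult_mat_vec)
  finally show ?thesis .
qed

lemma walk_inner: "walk_vec n G i \<bullet> walk_vec n G j = (ones_vec n \<bullet> walk_vec n G (i + j) :: 'a :: comm_ring_1)"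
proof (induction i arbitrary: j)
  case 0
  then show ?case by (simp add: walk_vec_0)
next
  case (Suc i)
  have "walk_vec n G (Suc i) \<bullet> walk_vec n G j = (walk_vec n G i \<bullet> walk_vec n G (Suc j) :: 'a)"
    unfolding walk_vec_Suc
    by (rule scalar_prod_mult_symmetric[symmetric, OF adjacency_carrier adjacency_symmetric]) simp_all
  then show ?case using Suc[of "Suc j"] by simp
qed

section \<open>Almost controllability in integral terms\<close>

text \<open>Stands in for rank n - 1: the vanishing determinant bounds the rank from above, a
  nonzero cofactor in the last column bounds it from below. That the last column is the one to omit
  comes from the Krylov form of the walk matrix.\<close>

definition corank_one :: "nat \<Rightarrow> nat set set \<Rightarrow> bool" where
  "corank_one n G \<longleftrightarrow> n > 0 \<and> xi_vec n G \<noteq> 0\<^sub>v n \<and> det (walk_mat n G :: int mat) = 0"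

text \<open>Once \<open>w K\<close> lies in the span of its predecessors, this span is invariant
  under \<open>A\<close> and contains all later vectors.\<close>

lemma krylov_combination:
  fixes w :: "nat \<Rightarrow> 'a :: field vec"
  assumes A: "A \<in> carrier_mat n n" and w: "\<And>k. w k \<in> carrier_vec n" and wS: "\<And>k. w (Suc k) = A *\<^sub>v w k"
    and K: "\<And>i. i < n \<Longrightarrow> w K $ i = (\<Sum>j<K. c j * w j $ i)"
  shows "\<exists>b. \<forall>i<n. w m $ i = (\<Sum>j<K. b j * w j $ i)"
proof (induction m)
  have low: "\<exists>b. \<forall>i<n. w m $ i = (\<Sum>j<K. b j * w j $ i)" if "m \<le> K" for m
  proof (cases "m = K")
    case True
    then show ?thesis using K by (intro exI[of _ c]) simp
  next
    case False
    then have "m < K" using that by simp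
    then show ?thesis by (intro exI[of _ "\<lambda>j. if j = m then 1 else 0"]) (simp add: if_distrib[of "\<lambda>x. x * _"] cong: if_cong)
  qed
  case 0
  show ?case by (rule low) simp
next
  case (Suc m)
  have low: "\<exists>b. \<forall>i<n. w m $ i = (\<Sum>j<K. b j * w j $ i)" if "m \<le> K" for m
  proof (cases "m = K")
    case True
    then show ?thesis using K by (intro exI[of _ c]) simp
  next
    case False
    then have "m < K" using that by simp
    then show ?thesis by (intro exI[of _ "\<lambda>j. if j = m then 1 else 0"]) (simp add: if_distrib[of "\<lambda>x. x * _"] cong: if_cong)
  qed
  obtain b where b: "\<And>i. i < n \<Longrightarrow> w m $ i = (\<Sum>j<K. b j * w j $ i)" using Suc by blast
  have "\<forall>j. \<exists>a. j < K \<longrightarrow> (\<forall>i<n. w (Suc j) $ i = (\<Sum>l<K. a l * w l $ i))"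
    using low by (metis Suc_leI)
  then obtain a where a: "\<And>j i. j < K \<Longrightarrow> i < n \<Longrightarrow> w (Suc j) $ i = (\<Sum>l<K. a j l * w l $ i)" by metis
  have "w (Suc m) $ i = (\<Sum>l<K. (\<Sum>j<K. b j * a j l) * w l $ i)" if i: "i < n" for i
  proof -
    have "w (Suc m) $ i = (\<Sum>r<n. A $$ (i,r) * (\<Sum>j<K. b j * w j $ r))"
      unfolding wS index_mult_mat_vec_sum[OF A w i] using b by simp
    also have "\<dots> = (\<Sum>r<n. \<Sum>j<K. b j * (A $$ (i,r) * w j $ r))"
      by (simp add: sum_distrib_left mult_ac)
    also have "\<dots> = (\<Sum>j<K. \<Sum>r<n. b j * (A $$ (i,r) * w j $ r))" by (rule sum.swap)
    also have "\<dots> = (\<Sum>j<K. b j * w (Suc j) $ i)"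
      unfolding wS index_mult_mat_vec_sum[OF A w i] by (simp add: sum_distrib_left)
    also have "\<dots> = (\<Sum>j<K. \<Sum>l<K. b j * (a j l * w l $ i))" by (intro sum.cong refl) (simp add: a i sum_distrib_left)
    also have "\<dots> = (\<Sum>l<K. \<Sum>j<K. b j * (a j l * w l $ i))" by (rule sum.swap)
    also have "\<dots> = (\<Sum>l<K. (\<Sum>j<K. b j * a j l) * w l $ i)" by (simp add: sum_distrib_right mult.assoc)
    finally show ?thesis .
  qed
  then show ?case by (intro exI[of _ "\<lambda>l. \<Sum>j<K. b j * a j l"]) simp
qed

text \<open>If \<xi> vanished, the first n - 1 walk vectors would satisfy a linear relation. Solving
  it for the last vector with nonzero coefficient, of index K < n - 1, puts all walk vectors into
  the span of the first K ones, against rank n - 1.\<close>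

lemma almost_controllable_corank_one:
  assumes "almost_controllable n G"
  shows "corank_one n G"
proof -
  interpret vec_space "TYPE(real)" n .
  have rk: "rank (walk_mat n G :: real mat) + 1 = n" using assms unfolding almost_controllable_def .
  have n: "n > 0" using rk by simp
  have "det (walk_mat n G :: real mat) = 0"
    using det_rank_iff[OF walk_mat_carrier[of n G]] rk by auto
  then have "det (walk_mat n G :: int mat) = 0"
    unfolding walk_mat_hom[of n G, where 'a = real, symmetric] of_int_hom.hom_det by simp
  moreover have "xi_vec n G \<noteq> 0\<^sub>v n"
  proof
    assume "xi_vec n G = 0\<^sub>v n"
    then have z: "last_cofactors n (walk_vec n G :: nat \<Rightarrow> real vec) = 0\<^sub>v n"
      unfolding last_cofactors_walk by auto
    let ?w = "walk_vec n G :: nat \<Rightarrow> real vec"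
    have "det (gram_mat n ?w) = 0" using last_cofactors_norm[of ?w n] n z by simp
    then obtain c k where k: "k < n - 1" "c k \<noteq> 0" and c: "\<And>i. i < n \<Longrightarrow> (\<Sum>j<n-1. c j * ?w j $ i) = 0"
      using gram_singular[of ?w n, OF walk_vec_carrier n] by blast
    define K where "K = Max {j. j < n - 1 \<and> c j \<noteq> 0}"
    have fin: "finite {j. j < n - 1 \<and> c j \<noteq> 0}" by simp
    have "K \<in> {j. j < n - 1 \<and> c j \<noteq> 0}" unfolding K_def using k by (intro Max_in fin) auto
    then have K: "K < n - 1" "c K \<noteq> 0" by auto
    have above: "c j = 0" if "K < j" "j < n - 1" for j
      using Max_ge[OF fin, of j] that unfolding K_def by (metis (mono_tags, lifting) mem_Collect_eq not_less)
    have comb: "?w K $ i = (\<Sum>j<K. (- c j / c K) * ?w j $ i)" if i: "i < n" for i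
    proof -
      have "0 = (\<Sum>j<n-1. c j * ?w j $ i)" using c[OF i] by simp
      also have "\<dots> = (\<Sum>j<Suc K. c j * ?w j $ i)"
        by (rule sum.mono_neutral_right) (use K above in auto)
      finally have "c K * ?w K $ i = - (\<Sum>j<K. c j * ?w j $ i)" by simp
      then have "?w K $ i = - (\<Sum>j<K. c j * ?w j $ i) / c K" using K(2) by (simp add: field_simps)
      then show ?thesis by (simp add: sum_negf[symmetric] sum_divide_distrib)
    qed
    have "rank (walk_mat n G :: real mat) \<le> K"
    proof (rule rank_le_of_factor[OF walk_mat_carrier])
      let ?B = "mat_of_cols n (map ?w [0..<K])"
      show "?B \<in> carrier_mat n K" by (rule carrier_matI) simp_all
      fix j assume j: "j < n"
      obtain b where b: "\<And>i. i < n \<Longrightarrow> ?w j $ i = (\<Sum>l<K. b l * ?w l $ i)"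
        using krylov_combination[OF adjacency_carrier walk_vec_carrier walk_vec_Suc comb, of j] by blast
      show "\<exists>y\<in>carrier_vec K. col (walk_mat n G) j = ?B *\<^sub>v y"
      proof (rule bexI[of _ "vec K b"], rule eq_vecI)
        fix i assume "i < dim_vec (?B *\<^sub>v vec K b)"
        then have i: "i < n" by simp
        have "(?B *\<^sub>v vec K b) $ i = (\<Sum>l<K. ?B $$ (i,l) * vec K b $ l)"
          by (rule index_mult_mat_vec_sum[OF _ _ i]) (auto intro: carrier_matI)
        also have "\<dots> = ?w j $ i" using b[OF i] i by (simp add: mat_of_cols_index mult.commute)
        finally show "col (walk_mat n G) j $ i = (?B *\<^sub>v vec K b) $ i"
          using i j carrier_matD[OF walk_mat_carrier[of n G, where 'a = real]] by (simp add: walk_mat_index del: index_mult_mat_vec)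
      qed (simp_all add: walk_mat_def)
    qed
    then show False using rk K(1) by simp
  qed
  ultimately show ?thesis using n unfolding corank_one_def by simp
qed

subsection \<open>Walk numbers from the characteristic polynomials\<close>

text \<open>(A^k z)^T adj(x - A) z. This sequence links the resolvent form, its member at
  \<open>k = 0\<close>, with the numbers z^T A^k z, its coefficients of degree n - 1.\<close>

definition power_form :: "int mat \<Rightarrow> int vec \<Rightarrow> nat \<Rightarrow> int poly" where
  "power_form A z k = (\<Sum>i<dim_vec z. [:((A ^\<^sub>m k) *\<^sub>v z) $ i:] * resolvent_vec A z $ i)"

context
  fixes n :: nat and A :: "int mat" and z :: "int vec"
  assumes A: "A \<in> carrier_mat n n" and sym: "transpose_mat A = A" and z: "z \<in> carrier_vec n"
begin

lemma power_form_0: "power_form A z 0 = resolvent_form A z"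
  using z A resolvent_vec_carrier[OF A z]
  by (simp add: power_form_def resolvent_form_def scalar_prod_def atLeast0LessThan)

lemma power_form_degree: "degree (power_form A z k) < n \<or> power_form A z k = 0"
proof (cases "n = 0")
  case True
  then show ?thesis using z by (simp add: power_form_def)
next
  case False
  have "degree (power_form A z k) \<le> n - 1" unfolding power_form_def
  proof (rule degree_sum_le)
    fix i assume "i \<in> {..<dim_vec z}"
    then have "degree (resolvent_vec A z $ i) < n" using resolvent_vec_degree[OF A z, of i] z by simp
    then show "degree ([:((A ^\<^sub>m k) *\<^sub>v z) $ i:] * resolvent_vec A z $ i) \<le> n - 1"
      using degree_mult_le[of "[:((A ^\<^sub>m k) *\<^sub>v z) $ i:]" "resolvent_vec A z $ i"] by simp
  qed simp
  then show ?thesis using False by linarith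
qed

lemma power_form_coeff: "n \<le> i \<Longrightarrow> coeff (power_form A z k) i = 0"
  using power_form_degree[of k] by (auto intro: coeff_eq_0)

text \<open>The identity (x - A) adj(x - A) = \<chi> taken between A^k z and z, with the factor A
  moved to the left vector by symmetry.\<close>

lemma power_form_Suc:
  "[:0,1:] * power_form A z k - power_form A z (Suc k) = char_poly A * [:z \<bullet> ((A ^\<^sub>m k) *\<^sub>v z):]"
proof -
  let ?u = "(A ^\<^sub>m k) *\<^sub>v z" and ?y = "resolvent_vec A z"
  have u: "?u \<in> carrier_vec n" by (rule mult_mat_vec_carrier[OF pow_carrier_mat[OF A] z])
  have y: "?y \<in> carrier_vec n" by (rule resolvent_vec_carrier[OF A z])
  have As: "A $$ (i,j) = A $$ (j,i)" if "i < n" "j < n" for i j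
    using arg_cong[OF sym, of "\<lambda>M. M $$ (i,j)"] that A by simp
  have dz: "dim_vec z = n" using z by simp
  have uS: "((A ^\<^sub>m Suc k) *\<^sub>v z) $ j = (\<Sum>i<n. A $$ (j,i) * ?u $ i)" if "j < n" for j
    using assoc_mult_mat_vec[OF A pow_carrier_mat[OF A] z, of k] index_mult_mat_vec_sum[OF A u that]
    unfolding pow_mat_Suc_left[OF A] by simp
  have "char_poly A * [:z \<bullet> ?u:] = (\<Sum>i<n. [:?u $ i:] * (char_poly A * [:z $ i:]))"
  proof -
    have "z \<bullet> ?u = (\<Sum>i<n. ?u $ i * z $ i)" using u
      unfolding scalar_prod_def by (simp only: carrier_vecD[OF u] atLeast0LessThan mult.commute)
    then have "[:z \<bullet> ?u:] = (\<Sum>i<n. [:?u $ i * z $ i:])" by (simp only: coeff_lift_hom.hom_sum)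
    then show ?thesis by (simp add: sum_distrib_left smult_sum2 mult.commute)
  qed
  also have "\<dots> = (\<Sum>i<n. [:?u $ i:] * (pCons 0 (?y $ i) - (\<Sum>j<n. Polynomial.smult (A $$ (i,j)) (?y $ j))))"
  proof (rule sum.cong)
    fix i assume "i \<in> {..<n}"
    then have i: "i < n" by simp
    show "[:?u $ i:] * (char_poly A * [:z $ i:]) = [:?u $ i:] * (pCons 0 (?y $ i) - (\<Sum>j<n. Polynomial.smult (A $$ (i,j)) (?y $ j)))"
      unfolding resolvent_vec[OF A z i, symmetric] char_poly_matrix_mult_vec[OF A y i, symmetric]
        index_mult_mat_vec_sum[OF char_poly_matrix_closed[OF A] y i] ..
  qed simp
  also have "\<dots> = (\<Sum>i<n. [:0,1:] * ([:?u $ i:] * ?y $ i)) - (\<Sum>i<n. \<Sum>j<n. [:?u $ i * A $$ (i,j):] * ?y $ j)"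
    by (simp add: sum_subtractf right_diff_distrib sum_distrib_left smult_sum2 smult_diff_right mult.commute)
  also have "(\<Sum>i<n. \<Sum>j<n. [:?u $ i * A $$ (i,j):] * ?y $ j) = (\<Sum>j<n. \<Sum>i<n. [:?u $ i * A $$ (i,j):] * ?y $ j)"
    by (rule sum.swap)
  also have "\<dots> = (\<Sum>j<n. [:((A ^\<^sub>m Suc k) *\<^sub>v z) $ j:] * ?y $ j)"
  proof (rule sum.cong)
    fix j assume "j \<in> {..<n}"
    then have j: "j < n" by simp
    have "((A ^\<^sub>m Suc k) *\<^sub>v z) $ j = (\<Sum>i<n. ?u $ i * A $$ (i,j))"
      unfolding uS[OF j] by (rule sum.cong) (use j in \<open>auto simp: As mult.commute\<close>)
    then have "[:((A ^\<^sub>m Suc k) *\<^sub>v z) $ j:] = (\<Sum>i<n. [:?u $ i * A $$ (i,j):])" by (simp only: coeff_lift_hom.hom_sum)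
    then show "(\<Sum>i<n. [:?u $ i * A $$ (i,j):] * ?y $ j) = [:((A ^\<^sub>m Suc k) *\<^sub>v z) $ j:] * ?y $ j"
      by (simp only: sum_distrib_right)
  qed simp
  also have "(\<Sum>i<n. [:0,1:] * ([:?u $ i:] * ?y $ i)) = [:0,1:] * power_form A z k"
    unfolding power_form_def dz by (simp only: sum_distrib_left)
  also have "(\<Sum>j<n. [:((A ^\<^sub>m Suc k) *\<^sub>v z) $ j:] * ?y $ j) = power_form A z (Suc k)"
    unfolding power_form_def dz ..
  finally show ?thesis by (rule HOL.sym)
qed

text \<open>The coefficients of x^n in the recursion are compared; the next power form has none in
  that degree.\<close>

lemma power_form_lead:
  assumes n: "n > 0"
  shows "coeff (power_form A z k) (n - 1) = z \<bullet> ((A ^\<^sub>m k) *\<^sub>v z)"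
proof -
  have c: "coeff ([:0,1:] * power_form A z k) n = coeff (power_form A z k) (n - 1)"
    using n by (cases n) (simp_all add: mult_pCons_left)
  have "coeff ([:0,1:] * power_form A z k - power_form A z (Suc k)) n = coeff (power_form A z k) (n - 1)"
    unfolding coeff_diff c using power_form_coeff[of n "Suc k"] by simp
  moreover have "coeff (char_poly A * [:z \<bullet> ((A ^\<^sub>m k) *\<^sub>v z):]) n = z \<bullet> ((A ^\<^sub>m k) *\<^sub>v z)"
    using char_poly_monic[OF A] by simp
  ultimately show ?thesis unfolding power_form_Suc by simp
qed

text \<open>Modulo \<open>p\<close> the power forms are \<open>x\<^sup>k\<close> times the resolvent form, but their degrees stay below \<open>n\<close>.\<close>

lemma resolvent_form_pcong_0:
  assumes d: "\<And>k. p dvd z \<bullet> ((A ^\<^sub>m k) *\<^sub>v z)"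
  shows "pcong p (resolvent_form A z) 0"
proof -
  have step: "pcong p (power_form A z (Suc k)) ([:0,1:] * power_form A z k)" for k
  proof -
    have "[:p:] dvd char_poly A * [:z \<bullet> ((A ^\<^sub>m k) *\<^sub>v z):]"
      by (rule dvd_mult) (simp only: const_poly_dvd d)
    then have "pcong p ([:0,1:] * power_form A z k) (power_form A z (Suc k))"
      unfolding pcong_def power_form_Suc .
    then show ?thesis by (rule pcong_sym)
  qed
  have "pcong p (power_form A z k) (monom 1 k * resolvent_form A z)" for k
  proof (induction k)
    case 0
    show ?case unfolding power_form_0 by (simp add: monom_0)
  next
    case (Suc k)
    have "pcong p (power_form A z (Suc k)) ([:0,1:] * (monom 1 k * resolvent_form A z))"
      using pcong_trans[OF step pcong_mult_left[OF Suc]] .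
    also have "[:0,1:] * (monom 1 k * resolvent_form A z) = monom 1 (Suc k) * resolvent_form A z"
      by (simp add: monom_Suc)
    finally show ?case .
  qed
  then have "pcong p (power_form A z n) (monom 1 n * resolvent_form A z)" .
  \<comment> \<open>The factor x^n pushes every coefficient of the resolvent form to degree at least
    \<open>n\<close>, where the power form has none.\<close>
  then have "coeff (power_form A z n) (n + i) mod p = coeff (resolvent_form A z) i mod p" for i
    unfolding pcong_iff_coeff by (simp add: coeff_monom_mult)
  then show ?thesis unfolding pcong_iff_coeff using power_form_coeff by simp
qed

end

text \<open>The coefficient of degree n - 1 of a power form is z^T A^k z, and with this number the
  recursion yields the next power form. So \<chi> and the resolvent form determine the whole
  sequence.\<close>

lemma walk_numbers_determined:
  assumes A: "A \<in> carrier_mat n n" "transpose_mat A = A" and B: "B \<in> carrier_mat n n" "transpose_mat B = B"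
    and z: "z \<in> carrier_vec n" and \<chi>: "char_poly A = char_poly B" and f: "resolvent_form A z = resolvent_form B z"
    and n: "n > 0"
  shows "z \<bullet> ((A ^\<^sub>m k) *\<^sub>v z) = z \<bullet> ((B ^\<^sub>m k) *\<^sub>v z)"
proof -
  have "power_form A z k = power_form B z k"
  proof (induction k)
    case 0
    then show ?case using f by (simp add: power_form_0[OF A z] power_form_0[OF B z])
  next
    case (Suc k)
    have "z \<bullet> ((A ^\<^sub>m k) *\<^sub>v z) = z \<bullet> ((B ^\<^sub>m k) *\<^sub>v z)"
      using power_form_lead[OF A z n, of k] power_form_lead[OF B z n, of k] Suc by simp
    then have "[:0,1:] * power_form A z k - power_form A z (Suc k) = [:0,1:] * power_form A z k - power_form B z (Suc k)"
      using power_form_Suc[OF A z, of k] power_form_Suc[OF B z, of k] Suc \<chi> by simp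
    then show ?case by simp
  qed
  then show ?thesis using power_form_lead[OF A z n, of k] power_form_lead[OF B z n, of k] by simp
qed

subsection \<open>Generalized spectra\<close>

lemma adjacency_char_poly_hom:
  "char_poly (adj_mat n G :: 'a :: comm_ring_1 mat) = map_poly of_int (char_poly (adj_mat n G :: int mat))"
  using of_int_hom.char_poly_hom[OF adjacency_carrier, of n G, where 'a = 'a] by (simp add: adjacency_hom)

lemma map_poly_of_int_inject:
  "map_poly (of_int :: int \<Rightarrow> 'a :: ring_char_0) f = map_poly of_int g \<Longrightarrow> f = g"
  by (rule poly_eqI) (metis coeff_map_poly of_int_0 of_int_eq_iff)

lemma graph_spectrum_eq_iff:
  "graph_spectrum n G = graph_spectrum n H \<longleftrightarrow> char_poly (adj_mat n G :: int mat) = char_poly (adj_mat n H)"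
proof
  assume e: "graph_spectrum n G = graph_spectrum n H"
  have m: "lead_coeff (char_poly (adj_mat n G :: complex mat)) = 1" for G
    using degree_monic_char_poly[OF adjacency_carrier[of n G, where 'a = complex]] by simp
  have "char_poly (adj_mat n G :: complex mat) = char_poly (adj_mat n H)"
    using complex_poly_decompose_multiset[of "char_poly (adj_mat n G)"] complex_poly_decompose_multiset[of "char_poly (adj_mat n H)"]
      e m[of G] m[of H] unfolding graph_spectrum_def by simp
  then show "char_poly (adj_mat n G :: int mat) = char_poly (adj_mat n H)"
    unfolding adjacency_char_poly_hom[where 'a = complex] by (rule map_poly_of_int_inject)
next
  assume e: "char_poly (adj_mat n G :: int mat) = char_poly (adj_mat n H)"
  show "graph_spectrum n G = graph_spectrum n H"
    unfolding graph_spectrum_def adjacency_char_poly_hom[where 'a = complex] e ..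
qed

lemma complement_adjacency_index:
  assumes "i < n" "j < n"
  shows "adj_mat n (complement n G) $$ (i,j) = (if i = j then 0 else if {i,j} \<in> G then 0 else 1)"
proof -
  have "{i,j} \<in> complete_edges n \<longleftrightarrow> i \<noteq> j"
    using assms unfolding complete_edges_def by (auto simp: doubleton_eq_iff)
  then show ?thesis using assms by (simp add: adjacency_index complement_def)
qed

abbreviation walk_form :: "nat \<Rightarrow> nat set set \<Rightarrow> int poly" where
  "walk_form n G \<equiv> resolvent_form (adj_mat n G) (ones_vec n)"

text \<open>The complement has adjacency matrix \<open>J - I - A\<close>, whence the substitution \<open>x \<mapsto> -1 - x\<close>.\<close>

lemma char_poly_complement:
  assumes G: "simple_graph n G"
  shows "pcompose (char_poly (adj_mat n G) + walk_form n G) [:-1,-1:] =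
     (-1) ^ n * char_poly (adj_mat n (complement n G) :: int mat)"
proof -
  let ?A = "adj_mat n G :: int mat" and ?B = "adj_mat n (complement n G) :: int mat"
  let ?C = "mat n n (\<lambda>(i,j). ?A $$ (i,j) + (-1) * (ones_vec n $ i * ones_vec n $ j))"
  have C: "?C \<in> carrier_mat n n" by simp
  have NB: "char_poly_matrix ?B \<in> carrier_mat n n" by simp
  have \<chi>: "char_poly ?C = char_poly ?A + walk_form n G"
    using char_poly_add_rank_one[of ?A n "ones_vec n" "-1"] by simp
  have "map_mat (\<lambda>q. pcompose q [:-1,-1:]) (char_poly_matrix ?C) = (-1) \<cdot>\<^sub>m char_poly_matrix ?B"
  proof (rule eq_matI)
    fix i j assume "i < dim_row ((-1) \<cdot>\<^sub>m char_poly_matrix ?B)" "j < dim_col ((-1) \<cdot>\<^sub>m char_poly_matrix ?B)"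
    then have ij: "i < n" "j < n" using NB by auto
    have c: "char_poly_matrix X $$ (i,j) = (if i = j then [:0,1:] else 0) + [:- (X $$ (i,j)):]"
      if "X \<in> carrier_mat n n" for X :: "int mat"
      using that ij by (simp add: char_poly_matrix_def)
    have CB: "?C $$ (i,j) = (if i = j then -1 else - ?B $$ (i,j))"
      using ij loop_free[OF G, of j] by (auto simp: complement_adjacency_index[OF ij] adjacency_index[OF ij, of G])
    have B0: "?B $$ (i,i) = 0" using ij by (simp add: complement_adjacency_index)
    have "pcompose (char_poly_matrix ?C $$ (i,j)) [:-1,-1:] = - char_poly_matrix ?B $$ (i,j)"
      unfolding c[OF C] c[OF adjacency_carrier] CB using B0
      by (cases "i = j") (simp_all add: pcompose_add pcompose_pCons one_pCons del: pCons_one)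
    moreover have "map_mat (\<lambda>q. pcompose q [:-1,-1:]) (char_poly_matrix ?C) $$ (i,j) = pcompose (char_poly_matrix ?C $$ (i,j)) [:-1,-1:]"
      by (rule index_map_mat(1)) (use ij carrier_matD[OF char_poly_matrix_closed[OF C]] in simp_all)
    moreover have "((-1) \<cdot>\<^sub>m char_poly_matrix ?B) $$ (i,j) = - char_poly_matrix ?B $$ (i,j)"
      using ij carrier_matD[OF NB] by simp
    ultimately show "map_mat (\<lambda>q. pcompose q [:-1,-1:]) (char_poly_matrix ?C) $$ (i,j) = ((-1) \<cdot>\<^sub>m char_poly_matrix ?B) $$ (i,j)"
      by simp
  qed (simp_all add: char_poly_matrix_def adj_mat_def)
  then have "pcompose (char_poly ?C) [:-1,-1:] = det ((-1) \<cdot>\<^sub>m char_poly_matrix ?B)"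
    unfolding char_poly_def comm_ring_hom.hom_det[OF pcompose_hom.comm_ring_hom_axioms, symmetric] by simp
  also have "\<dots> = (-1) ^ n * char_poly ?B" unfolding det_smult char_poly_def using carrier_matD[OF NB] by simp
  finally show ?thesis unfolding \<chi> .
qed

text \<open>The substitution of -1 - x for x is an involution, so the characteristic polynomial of
  the complement and the sum of \<chi> and the walk form determine each other. From here on
  complements are replaced by the walk form.\<close>

lemma generalized_cospectral_iff:
  assumes G: "simple_graph n G" and H: "simple_graph n H"
  shows "generalized_cospectral n G H \<longleftrightarrow>
     char_poly (adj_mat n G :: int mat) = char_poly (adj_mat n H) \<and> walk_form n G = walk_form n H"
proof -
  have "char_poly (adj_mat n (complement n G) :: int mat) = char_poly (adj_mat n (complement n H)) \<longleftrightarrow>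
     pcompose (char_poly (adj_mat n G) + walk_form n G) [:-1,-1:] = pcompose (char_poly (adj_mat n H) + walk_form n H) [:-1,-1:]"
    unfolding char_poly_complement[OF G] char_poly_complement[OF H] by simp
  also have "\<dots> \<longleftrightarrow> char_poly (adj_mat n G) + walk_form n G = char_poly (adj_mat n H) + walk_form n H"
  proof
    assume e: "pcompose (char_poly (adj_mat n G) + walk_form n G) [:-1,-1:] = pcompose (char_poly (adj_mat n H) + walk_form n H) [:-1,-1:]"
    have inv: "pcompose (pcompose q [:-1,-1:]) [:-1,-1:] = q" for q :: "int poly"
    proof -
      have "pcompose [:-1,-1:] [:-1,-1:] = ([:0,1:] :: int poly)" by (simp add: pcompose_pCons)
      then show ?thesis unfolding pcompose_assoc[symmetric] by (simp only: pcompose_idR)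
    qed
    show "char_poly (adj_mat n G) + walk_form n G = char_poly (adj_mat n H) + walk_form n H"
      using arg_cong[OF e, of "\<lambda>q. pcompose q [:-1,-1:]"] unfolding inv .
  qed simp
  finally show ?thesis unfolding generalized_cospectral_def graph_spectrum_eq_iff by auto
qed

lemma xi_vec_dim [simp]: "dim_vec (xi_vec n G) = n"
  by (simp add: xi_vec_def)

lemma ones_scalar_prod: "y \<in> carrier_vec n \<Longrightarrow> ones_vec n \<bullet> y = (\<Sum>i<n. y $ i :: 'a :: comm_ring_1)"
  by (auto simp: scalar_prod_def atLeast0LessThan intro!: sum.cong)

lemma walk_inner_eq:
  assumes n: "n > 0" and \<chi>: "char_poly (adj_mat n G :: int mat) = char_poly (adj_mat n H)"
    and f: "walk_form n G = walk_form n H"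
  shows "walk_vec n G i \<bullet> walk_vec n G j = (walk_vec n H i \<bullet> walk_vec n H j :: rat)"
proof -
  have "ones_vec n \<bullet> walk_vec n G k = (ones_vec n \<bullet> walk_vec n H k :: int)" for k
    unfolding walk_vec_def
    by (rule walk_numbers_determined[OF _ adjacency_symmetric _ adjacency_symmetric _ \<chi> f n]) simp_all
  moreover have h: "ones_vec n \<bullet> walk_vec n X k = (of_int (ones_vec n \<bullet> walk_vec n X k) :: rat)" for X k
  proof -
    have "walk_vec n X k $ i = (of_int (walk_vec n X k $ i) :: rat)" if "i < n" for i
      using arg_cong[OF walk_vec_hom[of n X k, where 'a = rat], of "\<lambda>v. v $ i"] that
        carrier_vecD[OF walk_vec_carrier[of n X k, where 'a = int]] by simp
    then show ?thesis
      unfolding ones_scalar_prod[OF walk_vec_carrier] of_int_sum by (intro sum.cong) simp_all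
  qed
  ultimately show ?thesis unfolding walk_inner by simp
qed

subsection \<open>The eigenvector orthogonal to the walks\<close>

context
  fixes n :: nat and G :: "nat set set"
  assumes G: "simple_graph n G" and co: "corank_one n G"
begin

lemma n_pos: "n > 0"
  using co unfolding corank_one_def by simp

lemma n_ge_2: "n \<ge> 2"
proof (rule ccontr)
  assume "\<not> ?thesis"
  then have n1: "n = 1" using n_pos by simp
  have "det (walk_mat n G :: int mat) = walk_vec n G 0 $ 0"
    using det_single[of "walk_mat n G :: int mat"] walk_mat_carrier[of n G, where 'a = int] walk_mat_index[of 0 n 0 G]
    unfolding n1 by simp
  then have "det (walk_mat n G :: int mat) = 1" unfolding walk_vec_0 using n1 by simp
  then show False using co unfolding corank_one_def by simp
qed

lemma xi_rat_carrier: "xi_rat n G \<in> carrier_vec n"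
  by simp

lemma xi_rat_nonzero: "xi_rat n G \<noteq> 0\<^sub>v n"
proof
  assume e: "xi_rat n G = 0\<^sub>v n"
  have "xi_vec n G = 0\<^sub>v n"
  proof (rule eq_vecI)
    fix i assume "i < dim_vec (0\<^sub>v n :: int vec)"
    then show "xi_vec n G $ i = 0\<^sub>v n $ i"
      using arg_cong[OF e, of "\<lambda>v. v $ i"] carrier_vecD[OF xi_vec_carrier[of n G]] by simp
  qed simp
  then show False using co unfolding corank_one_def by simp
qed

lemma xi_rat_norm: "xi_rat n G \<bullet> xi_rat n G \<noteq> 0"
  using scalar_prod_self_eq_0[OF walk_vec_carrier[of n G] n_pos xi_rat_carrier] xi_rat_nonzero by blast

text \<open>Up to index n - 2 this is the orthogonality of cofactors to foreign columns; at n - 1 it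
  is the vanishing of the determinant of the walk matrix, expanded along its last column.\<close>

lemma xi_walk_lt: "j < n \<Longrightarrow> walk_vec n G j \<bullet> xi_rat n G = 0"
proof (cases "j = n - 1")
  case True
  have e: "append_col n (walk_vec n G) (walk_vec n G (n - 1)) = (walk_mat n G :: rat mat)"
    unfolding append_col_def walk_mat_def using n_pos
    by (metis (no_types, lifting) One_nat_def Suc_pred list.map(1) list.map(2) map_append upt_Suc_append zero_le)
  have "det (walk_mat n G :: rat mat) = 0"
    using co unfolding corank_one_def walk_mat_hom[of n G, where 'a = rat, symmetric] of_int_hom.hom_det by simp
  then show ?thesis
    using det_append_col[of "walk_vec n G :: nat \<Rightarrow> rat vec" n "walk_vec n G (n - 1)"] n_pos True
    unfolding e last_cofactors_walk by simp
next
  case False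
  assume "j < n"
  then show ?thesis using False
    last_cofactors_orthogonal[of "walk_vec n G :: nat \<Rightarrow> rat vec" n j] n_pos
    unfolding last_cofactors_walk by simp
qed

lemma walks_span:
  assumes x: "x \<in> carrier_vec n" and "\<And>j. j < n - 1 \<Longrightarrow> x \<bullet> walk_vec n G j = 0" and "x \<bullet> xi_rat n G = 0"
  shows "x = 0\<^sub>v n"
  using orthogonal_complement_trivial[of "walk_vec n G :: nat \<Rightarrow> rat vec" n x] assms n_pos xi_rat_nonzero
  unfolding last_cofactors_walk by simp

lemma walks_orthogonal_line:
  assumes x: "x \<in> carrier_vec n" and "\<And>j. j < n - 1 \<Longrightarrow> x \<bullet> walk_vec n G j = 0"
  shows "\<exists>c. x = c \<cdot>\<^sub>v xi_rat n G"
proof (rule exI)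
  show "x = (x \<bullet> xi_rat n G / (xi_rat n G \<bullet> xi_rat n G)) \<cdot>\<^sub>v xi_rat n G"
    by (rule orthogonal_complement_line[of "walk_vec n G :: nat \<Rightarrow> rat vec" n x, unfolded last_cofactors_walk])
      (use assms n_pos xi_rat_nonzero in simp_all)
qed

text \<open>By symmetry A \<xi> is paired with a walk vector as \<xi> is with the next one, and for
  j < n - 1 the next one is still orthogonal to \<xi>.\<close>

lemma xi_eigenvector: "\<exists>c. adj_mat n G *\<^sub>v xi_rat n G = c \<cdot>\<^sub>v xi_rat n G"
proof (rule walks_orthogonal_line)
  show "adj_mat n G *\<^sub>v xi_rat n G \<in> carrier_vec n"
    by (rule mult_mat_vec_carrier[OF adjacency_carrier xi_rat_carrier])
  fix j assume "j < n - 1"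
  then have "xi_rat n G \<bullet> walk_vec n G (Suc j) = 0"
    using xi_walk_lt[of "Suc j"] comm_scalar_prod[OF xi_rat_carrier walk_vec_carrier[of n G "Suc j"]] by simp
  then show "(adj_mat n G *\<^sub>v xi_rat n G) \<bullet> walk_vec n G j = 0"
    unfolding walk_vec_Suc
      scalar_prod_mult_symmetric[OF adjacency_carrier adjacency_symmetric xi_rat_carrier walk_vec_carrier] .
qed

lemma linear_factor_char_poly:
  fixes M :: "int mat"
  assumes M: "M \<in> carrier_mat n n" and e: "map_mat of_int M *\<^sub>v xi_rat n G = c \<cdot>\<^sub>v xi_rat n G"
  shows "poly (map_poly of_int (char_poly M)) c = 0"
proof -
  have Mr: "map_mat rat_of_int M \<in> carrier_mat n n" using M by simp
  have "eigenvector (map_mat rat_of_int M) (xi_rat n G) c"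
    unfolding eigenvector_def using M e xi_rat_carrier xi_rat_nonzero by simp
  then have "eigenvalue (map_mat rat_of_int M) c" unfolding eigenvalue_def by blast
  then show ?thesis using eigenvalue_root_char_poly[OF Mr] of_int_hom.char_poly_hom[OF M, where 'a = rat] by simp
qed

text \<open>\<xi> is orthogonal to the all-ones vector, so J \<xi> = 0 and A and A + J share its
  eigenvalue, a rational root of a monic integer polynomial. This common linear factor keeps the
  degree of M_p below \<open>n\<close> for odd \<open>p\<close>.\<close>

lemma integer_eigenvalue:
  obtains l :: int where "[:-l,1:] dvd char_poly (adj_mat n G)" "[:-l,1:] dvd char_poly (adj_mat n G) - walk_form n G"
proof -
  let ?A = "adj_mat n G :: int mat"
  obtain c where c: "adj_mat n G *\<^sub>v xi_rat n G = c \<cdot>\<^sub>v xi_rat n G" using xi_eigenvector by blast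
  have r1: "poly (map_poly of_int (char_poly ?A)) c = 0"
    by (rule linear_factor_char_poly[OF adjacency_carrier]) (use c in \<open>simp add: adjacency_hom\<close>)
  let ?J = "mat n n (\<lambda>(i,j). ?A $$ (i,j) + 1 * (ones_vec n $ i * ones_vec n $ j))"
  have J: "?J \<in> carrier_mat n n" by simp
  have ones0: "(\<Sum>j<n. xi_rat n G $ j) = 0"
    using xi_walk_lt[OF n_pos] unfolding walk_vec_0 ones_scalar_prod[OF xi_rat_carrier] .
  have "map_mat of_int ?J *\<^sub>v xi_rat n G = c \<cdot>\<^sub>v xi_rat n G"
  proof (rule eq_vecI)
    fix i assume "i < dim_vec (c \<cdot>\<^sub>v xi_rat n G)"
    then have i: "i < n" using carrier_vecD[OF xi_vec_carrier[of n G]] by simp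
    have Jr: "map_mat rat_of_int ?J \<in> carrier_mat n n" by simp
    have "(map_mat of_int ?J *\<^sub>v xi_rat n G) $ i = (\<Sum>j<n. (adj_mat n G $$ (i,j) + 1) * xi_rat n G $ j)"
      unfolding index_mult_mat_vec_sum[OF Jr xi_rat_carrier i]
      by (rule sum.cong) (use i in \<open>auto simp: adjacency_index\<close>)
    also have "\<dots> = (adj_mat n G *\<^sub>v xi_rat n G) $ i"
      unfolding index_mult_mat_vec_sum[OF adjacency_carrier xi_rat_carrier i] by (simp only: distrib_right sum.distrib mult_1 ones0 add_0_right)
    finally show "(map_mat of_int ?J *\<^sub>v xi_rat n G) $ i = (c \<cdot>\<^sub>v xi_rat n G) $ i" unfolding c .
  qed (use carrier_vecD[OF xi_vec_carrier[of n G]] in simp)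
  then have "poly (map_poly of_int (char_poly ?J)) c = 0" by (rule linear_factor_char_poly[OF J])
  then have r2: "poly (map_poly of_int (char_poly ?A - walk_form n G)) c = 0"
    using char_poly_add_rank_one[of ?A n "ones_vec n" 1] by simp
  have "algebraic_int c"
  proof (rule algebraic_int.intros)
    show "poly (map_poly of_int (char_poly ?A)) c = 0" by (rule r1)
    show "lead_coeff (map_poly rat_of_int (char_poly ?A)) = 1"
      using char_poly_monic[OF adjacency_carrier[of n G, where 'a = int]] by simp
  qed simp
  moreover have "c \<in> \<rat>" using Rats_of_rat[of c, where 'a = rat] by simp
  ultimately have "c \<in> \<int>" by (rule rational_algebraic_int_is_int)
  then obtain l where l: "c = of_int l" by (auto elim: Ints_cases)
  have "[:-l,1:] dvd char_poly ?A" using r1 unfolding l of_int_hom.poly_map_poly poly_eq_0_iff_dvd[symmetric] by simp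
  moreover have "[:-l,1:] dvd char_poly ?A - walk_form n G"
    using r2 unfolding l of_int_hom.poly_map_poly poly_eq_0_iff_dvd[symmetric] by simp
  ultimately show ?thesis by (rule that)
qed

end

subsection \<open>The polynomial annihilating the all-ones vector modulo a prime\<close>

lemma pcong_const_dvdm_1:
  assumes p: "prime p" and c: "pcong p a [:c:]" "\<not> p dvd c"
  shows "poly_mod.dvdm p a 1"
proof -
  have "gcd c p = 1" using p c(2) by (metis prime_imp_coprime coprime_imp_gcd_eq_1 gcd.commute)
  then obtain e d where ed: "e * c + d * p = 1" by (metis bezout_int)
  have 1: "pcong p (a * [:e:]) ([:c:] * [:e:])" by (rule pcong_mult_right[OF c(1)])
  have "1 - c * e = p * d" using ed by (simp add: algebra_simps)
  moreover have "1 - [:c:] * [:e:] = [:1 - c * e:]" by (simp add: one_pCons del: pCons_one)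
  ultimately have "1 - [:c:] * [:e:] = [:p:] * [:d:]" by simp
  then have "pcong p 1 ([:c:] * [:e:])" unfolding pcong_def by (simp only: dvd_triv_left)
  then have "pcong p 1 (a * [:e:])" by (rule pcong_trans[OF _ pcong_sym[OF 1]])
  then show ?thesis unfolding dvdm_iff_pcong by (rule exI)
qed

lemma irreducible_m_linear:
  assumes p: "prime p" and f: "monic f" "degree f = 1"
  shows "poly_mod.irreducible_m p f"
  unfolding poly_mod.irreducible_m_def eq_m_iff_pcong
proof (intro conjI allI impI)
  show "\<not> pcong p f 0" by (rule monic_not_pcong_0[OF p f(1)])
  show "\<not> poly_mod.dvdm p f 1" using monic_dvdm_degree[OF p f(1), of 1] f(2) by auto
  fix a b assume ab: "pcong p f (a * b)"
  let ?a = "poly_mod.Mp p a" and ?b = "poly_mod.Mp p b"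
  have "pcong p (a * b) (?a * ?b)" by (rule pcong_mult) simp_all
  then have c: "pcong p f (?a * ?b)" using ab pcong_trans by blast
  have nz: "?a \<noteq> 0" "?b \<noteq> 0" using c monic_not_pcong_0[OF p f(1)] by auto
  have lead: "\<not> p dvd lead_coeff (poly_mod.Mp p h)" if "poly_mod.Mp p h \<noteq> 0" for h
  proof
    assume "p dvd lead_coeff (poly_mod.Mp p h)"
    moreover have "lead_coeff (poly_mod.Mp p h) = lead_coeff (poly_mod.Mp p h) mod p"
      unfolding poly_mod.Mp_coeff poly_mod.M_def by simp
    ultimately show False using that by (metis dvd_imp_mod_0 leading_coeff_0_iff)
  qed
  have "\<not> p dvd lead_coeff ?a * lead_coeff ?b" using lead[OF nz(1)] lead[OF nz(2)] p prime_dvd_mult_iff by blast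
  then have "\<not> p dvd coeff f (degree ?a + degree ?b)"
    using c unfolding pcong_iff_coeff coeff_mult_degree_sum[symmetric] by (metis dvd_eq_mod_eq_0)
  then have "degree ?a + degree ?b \<le> 1" using f(2) by (metis coeff_eq_0 dvd_0_right not_less)
  then consider "degree ?a = 0" | "degree ?b = 0" by linarith
  then show "poly_mod.dvdm p a 1 \<or> poly_mod.dvdm p b 1"
  proof cases
    case 1
    then obtain c where "?a = [:c:]" by (rule degree_eq_zeroE)
    then show ?thesis using lead[OF nz(1)] pcong_const_dvdm_1[OF p, of a c] pcong_Mp(2)[of p a a] by simp
  next
    case 2
    then obtain c where "?b = [:c:]" by (rule degree_eq_zeroE)
    then show ?thesis using lead[OF nz(2)] pcong_const_dvdm_1[OF p, of b c] pcong_Mp(2)[of p b b] by simp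
  qed
qed

lemma adjacency_plus_ones:
  "char_poly (adj_mat n G + ones_mat n) = char_poly (adj_mat n G) - walk_form n G"
proof -
  have "adj_mat n G + ones_mat n = mat n n (\<lambda>(i,j). (adj_mat n G :: int mat) $$ (i,j) + 1 * (ones_vec n $ i * ones_vec n $ j))"
    by (intro eq_matI) (auto simp: ones_mat_def adj_mat_def)
  then show ?thesis using char_poly_add_rank_one[of "adj_mat n G" n "ones_vec n" 1] by simp
qed

lemma M_poly_eq:
  "M_poly n G p = (if p = 2 then poly_mod.Mp 2 (monom 1 (n mod 2) *
        (\<Sum>i\<le>n div 2. monom (coeff (char_poly (adj_mat n G)) (n - 2 * i)) (n div 2 - i)))
     else quotient_mod p (char_poly (adj_mat n G))
        (sfp_mod p (monic_gcd_mod p (char_poly (adj_mat n G)) (char_poly (adj_mat n G) - walk_form n G))))"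
  unfolding M_poly_def Let_def adjacency_plus_ones ..

lemma M_poly_2_annihilates:
  assumes G: "simple_graph n G" and n: "n \<ge> 2"
  shows "monic (M_poly n G 2)" "degree (M_poly n G 2) = n mod 2 + n div 2"
    "\<And>r. r < n \<Longrightarrow> 2 dvd (poly_mat (M_poly n G 2) (adj_mat n G) *\<^sub>v ones_vec n) $ r"
proof -
  let ?c = "coeff (char_poly (adj_mat n G :: int mat))" and ?k = "n div 2"
  let ?S = "\<Sum>i\<le>?k. monom (?c (n - 2 * i)) (?k - i)"
  define M where "M = monom 1 (n mod 2) * ?S"
  have Mp: "M_poly n G 2 = poly_mod.Mp 2 M" unfolding M_poly_eq M_def by simp
  have "coeff ?S ?k = (\<Sum>i\<le>?k. if i = 0 then ?c n else 0)"
    unfolding coeff_sum by (rule sum.cong) auto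
  also have "\<dots> = 1" using char_poly_monic[OF adjacency_carrier[of n G, where 'a = int]] by simp
  finally have c1: "coeff ?S ?k = 1" .
  have "degree ?S \<le> ?k" by (rule degree_sum_le) (auto intro: order.trans[OF degree_monom_le])
  then have dS: "degree ?S = ?k" using c1 by (metis le_antisym le_degree zero_neq_one)
  have S0: "?S \<noteq> 0" using c1 by auto
  have dM: "degree M = n mod 2 + ?k" unfolding M_def using S0 dS by (simp add: degree_mult_eq degree_monom_eq)
  have mM: "monic M" unfolding M_def lead_coeff_mult using c1 dS by (simp add: degree_monom_eq)
  have p2: "prime (2 :: int)" by simp
  show "monic (M_poly n G 2)" unfolding Mp by (rule monic_Mp_poly(1)[OF p2 mM])
  show "degree (M_poly n G 2) = n mod 2 + n div 2" unfolding Mp monic_Mp_poly(2)[OF p2 mM] by (rule dM)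
  have "pcong 2 (poly_mod.Mp 2 M * poly_mod.Mp 2 M) (M * M)" by (rule pcong_mult) simp_all
  also have "pcong 2 (M * M) (monom 1 (n mod 2) * char_poly (adj_mat n G))"
    unfolding M_def by (rule square_root_mod_2[OF adjacency_carrier adjacency_symmetric])
      (simp add: adjacency_index loop_free[OF G, simplified])
  finally have c: "pcong 2 (poly_mod.Mp 2 M * poly_mod.Mp 2 M) (monom 1 (n mod 2) * char_poly (adj_mat n G))" .
  show "2 dvd (poly_mat (M_poly n G 2) (adj_mat n G) *\<^sub>v ones_vec n) $ r" if "r < n" for r
    unfolding Mp by (rule square_root_annihilates_ones[OF adjacency_carrier adjacency_symmetric c that])
qed

text \<open>The degree bound leaves room for \<xi> as the last column. For odd \<open>p\<close> the
  integer eigenvalue gives a linear factor of the gcd, so its squarefree part is not constant; for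
  \<open>p = 2\<close> the degree is n/2 rounded up, at most n - 1 since n is at least 2.\<close>

lemma M_poly_annihilates:
  assumes G: "simple_graph n G" and co: "corank_one n G" and p: "prime p"
  shows "monic (M_poly n G p)" "degree (M_poly n G p) \<le> n - 1"
    "\<And>r. r < n \<Longrightarrow> p dvd (poly_mat (M_poly n G p) (adj_mat n G) *\<^sub>v ones_vec n) $ r"
proof -
  let ?A = "adj_mat n G :: int mat"
  let ?\<chi> = "char_poly ?A" and ?\<chi>' = "char_poly ?A - walk_form n G"
  have n2: "n \<ge> 2" by (rule n_ge_2[OF G co])
  define s where "s = sfp_mod p (monic_gcd_mod p ?\<chi> ?\<chi>')"
  note q = sfp_quotient_annihilates[OF adjacency_carrier adjacency_symmetric ones_vec_carrier p, of _ n G, folded s_def]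
  have "monic (M_poly n G p) \<and> degree (M_poly n G p) \<le> n - 1 \<and>
    (\<forall>r<n. p dvd (poly_mat (M_poly n G p) ?A *\<^sub>v ones_vec n) $ r)"
  proof (cases "p = 2")
    case True
    have "n mod 2 + n div 2 \<le> n - 1" using n2 by presburger
    then show ?thesis using M_poly_2_annihilates[OF G n2] unfolding True by simp
  next
    case False
    have M: "M_poly n G p = quotient_mod p ?\<chi> s" unfolding M_poly_eq s_def using False by simp
    obtain l where l: "[:-l,1:] dvd ?\<chi>" "[:-l,1:] dvd ?\<chi>'" by (rule integer_eigenvalue[OF G co])
    define h where "h = poly_mod.Mp p [:-l,1:]"
    have lm: "lead_coeff [:-l,1:] = 1" by simp
    have h: "monic h" "degree h = 1" "poly_mod.Mp p h = h"
      unfolding h_def using monic_Mp_poly[OF p lm] by (simp_all add: poly_mod.Mp_Mp)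
    note g = monic_gcd_mod[OF p char_poly_monic(1)[OF adjacency_carrier[of n G]], where g = ?\<chi>']
    have "poly_mod.dvdm p h (monic_gcd_mod p ?\<chi> ?\<chi>')"
      unfolding h_def dvdm_Mp_left by (rule g(5)[OF dvd_imp_dvdm[OF l(1)] dvd_imp_dvdm[OF l(2)]])
    then have "degree h \<le> degree s" unfolding s_def
      by (rule sfp_mod(3)[OF p g(1) h(3) h(1) irreducible_m_linear[OF p h(1,2)]])
    then have "degree (quotient_mod p ?\<chi> s) \<le> n - 1" using q(3)[of 0] h(2) n2 by linarith
    then show ?thesis using q(1) q(2)[of 0] n2 unfolding M by auto
  qed
  then show "monic (M_poly n G p)" "degree (M_poly n G p) \<le> n - 1"
    "\<And>r. r < n \<Longrightarrow> p dvd (poly_mat (M_poly n G p) (adj_mat n G) *\<^sub>v ones_vec n) $ r" by auto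
qed

subsection \<open>Divisibility of the cofactors\<close>

text \<open>The unitriangular \<open>T\<close> leaves the determinant of the minor unchanged and
  turns its columns from deg M on into coordinates of A^m M(A) e, all divisible by \<open>p\<close>.
  There are n - 1 - deg M such columns.\<close>

lemma xi_vec_dvd:
  fixes M :: "int poly"
  assumes n: "n > 0" and M: "monic M" "degree M \<le> n - 1"
    and d: "\<And>r. r < n \<Longrightarrow> p dvd (poly_mat M (adj_mat n G) *\<^sub>v ones_vec n) $ r" and i: "i < n"
  shows "p ^ (n - 1 - degree M) dvd xi_vec n G $ i"
proof -
  let ?A = "adj_mat n G :: int mat" and ?s = "degree M"
  let ?w = "walk_vec n G :: nat \<Rightarrow> int vec"
  define D where "D = mat_delete (walk_mat n G :: int mat) i (n - 1)"
  define T where "T = mat (n - 1) (n - 1) (\<lambda>(k,j). if j < ?s then (if k = j then 1 else 0)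
     else if j - ?s \<le> k then coeff M (k - (j - ?s)) else 0)"
  have Dc: "D \<in> carrier_mat (n - 1) (n - 1)" unfolding D_def using carrier_matD[OF walk_mat_carrier[of n G, where 'a = int]]
    by (intro carrier_matI) simp_all
  have Tc: "T \<in> carrier_mat (n - 1) (n - 1)" unfolding T_def by simp
  have Dij: "D $$ (r,k) = ?w k $ insert_index i r" if "r < n - 1" "k < n - 1" for r k
    using that i carrier_matD[OF walk_mat_carrier[of n G, where 'a = int]]
    unfolding D_def mat_delete_def insert_index_def by (auto simp: walk_mat_index)
  have "upper_triangular T" unfolding T_def using M by (auto simp: coeff_eq_0)
  then have "det T = prod_list (diag_mat T)" by (rule det_upper_triangular[OF _ Tc])
  also have "diag_mat T = replicate (n - 1) 1"
    using M Tc unfolding diag_mat_def T_def by (intro nth_equalityI) auto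
  finally have detT: "det T = 1" by simp
  have "p dvd (D * T) $$ (r,j)" if r: "r < n - 1" and j: "?s \<le> j" "j < n - 1" for r j
  proof -
    let ?r = "insert_index i r" and ?m = "j - ?s"
    have rn: "?r < n" using r unfolding insert_index_def by (cases "r < i") auto
    have deg: "degree (monom 1 ?m * M) \<le> n - 1 - 1"
      using degree_mult_le[of "monom 1 ?m" M] degree_monom_le[of "1::int" ?m] j by simp
    have "(D * T) $$ (r,j) = (\<Sum>k<n-1. ?w k $ ?r * T $$ (k,j))"
      unfolding index_mult_mat_sum[OF Dc Tc r j(2)] using Dij[OF r] by simp
    also have "\<dots> = (\<Sum>k<n-1. coeff (monom 1 ?m * M) k * ?w k $ ?r)"
      using j by (intro sum.cong) (auto simp: T_def coeff_monom_mult)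
    also have "\<dots> = umbral (\<lambda>k. ?w k $ ?r) (monom 1 ?m * M)"
      unfolding umbral_altdef[OF deg] using j by (intro sum.cong) auto
    also have "\<dots> = umbral (\<lambda>k. \<Sum>l<n. (?A ^\<^sub>m ?m) $$ (?r,l) * ?w k $ l) M"
    proof -
      have "?w (k + ?m) $ ?r = (\<Sum>l<n. (?A ^\<^sub>m ?m) $$ (?r,l) * ?w k $ l)" for k
        using pow_mat_add_mult_vec[OF adjacency_carrier[of n G, where 'a = int] ones_vec_carrier, of ?m k]
          index_mult_mat_vec_sum[OF pow_carrier_mat[OF adjacency_carrier[of n G, where 'a = int]] walk_vec_carrier[of n G k] rn, of ?m]
        unfolding walk_vec_def[symmetric] by (simp add: add.commute walk_vec_def)
      then show ?thesis unfolding umbral_monom_mult by presburger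
    qed
    also have "\<dots> = (\<Sum>l<n. (?A ^\<^sub>m ?m) $$ (?r,l) * umbral (\<lambda>k. ?w k $ l) M)" by (rule umbral_sum_left)
    also have "\<dots> = (\<Sum>l<n. (?A ^\<^sub>m ?m) $$ (?r,l) * (poly_mat M ?A *\<^sub>v ones_vec n) $ l)"
      by (rule sum.cong) (simp_all only: index_poly_mat_mult_vec_umbral[OF adjacency_carrier ones_vec_carrier] walk_vec_def lessThan_iff)
    finally show ?thesis using d by (auto intro!: dvd_sum dvd_mult)
  qed
  then have "p ^ (n - 1 - ?s) dvd det (D * T)"
    using Dc Tc by (intro prime_power_dvd_det) auto
  then have "p ^ (n - 1 - ?s) dvd det D" unfolding det_mult[OF Dc Tc] detT by simp
  then show ?thesis using i unfolding xi_vec_def cofactor_def D_def by simp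
qed

subsection \<open>The integral matrices \<open>W\<^sub>0\<close> and \<open>W\<^sub>0\<^sup>(\<^sup>p\<^sup>)\<close>\<close>

text \<open>The columns of \<open>W0p_mat\<close> before the last, over the rationals and expanded
  into walk vectors, so that a matrix carrying the walk vectors of one graph to those of another
  carries these columns along.\<close>

definition reduced_walk :: "nat \<Rightarrow> nat set set \<Rightarrow> int poly \<Rightarrow> int \<Rightarrow> nat \<Rightarrow> rat vec" where
  "reduced_walk n G M p j = (if j < degree M then walk_vec n G j
     else vec n (\<lambda>i. (\<Sum>k\<le>degree M. of_int (coeff M k) * walk_vec n G (k + (j - degree M)) $ i) / of_int p))"

text \<open>\<open>M\<close>, \<open>p\<close> and the divisor \<open>c\<close> are parameters
  because cospectral graphs share them. \<open>W0_mat\<close> is covered by x^(n - 1) and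
  \<open>p = 1\<close>, where no column before the last is reduced.\<close>

definition scaled_walk_mat :: "nat \<Rightarrow> nat set set \<Rightarrow> int poly \<Rightarrow> int \<Rightarrow> int \<Rightarrow> int mat \<Rightarrow> bool" where
  "scaled_walk_mat n G M p c W \<longleftrightarrow> W \<in> carrier_mat n n \<and>
     (\<forall>i<n. \<forall>j<n. rat_of_int (W $$ (i,j)) =
       (if j = n - 1 then of_int (xi_vec n G $ i) / of_int c else reduced_walk n G M p j $ i))"

lemma walk_vec_dim [simp]: "dim_vec (walk_vec n G k) = n"
  by (rule carrier_vecD[OF walk_vec_carrier])

lemma reduced_walk_carrier: "reduced_walk n G M p j \<in> carrier_vec n"
  by (simp add: reduced_walk_def)

lemma walk_vec_of_int: "i < n \<Longrightarrow> walk_vec n G k $ i = rat_of_int (walk_vec n G k $ i)"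
  using arg_cong[OF walk_vec_hom[of n G k, where 'a = rat], of "\<lambda>v. v $ i"]
    carrier_vecD[OF walk_vec_carrier[of n G k, where 'a = int]] by simp

lemma of_int_div: "b dvd a \<Longrightarrow> rat_of_int (a div b) = of_int a / of_int b"
  by (auto elim!: dvdE)

lemma poly_mat_walk:
  assumes i: "i < n"
  shows "((adj_mat n G ^\<^sub>m m) *\<^sub>v (poly_mat M (adj_mat n G) *\<^sub>v ones_vec n)) $ i =
     (\<Sum>k\<le>degree M. coeff M k * walk_vec n G (k + m) $ i :: int)"
proof -
  let ?A = "adj_mat n G :: int mat"
  have P: "poly_mat M ?A *\<^sub>v ones_vec n \<in> carrier_vec n"
    by (rule mult_mat_vec_carrier[OF poly_mat_carrier[OF adjacency_carrier] ones_vec_carrier])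
  have Am: "?A ^\<^sub>m m \<in> carrier_mat n n" by (rule pow_carrier_mat[OF adjacency_carrier])
  have "((?A ^\<^sub>m m) *\<^sub>v (poly_mat M ?A *\<^sub>v ones_vec n)) $ i
      = (\<Sum>l<n. (?A ^\<^sub>m m) $$ (i,l) * umbral (\<lambda>k. walk_vec n G k $ l) M)"
    unfolding index_mult_mat_vec_sum[OF Am P i]
    by (rule sum.cong) (simp_all only: index_poly_mat_mult_vec_umbral[OF adjacency_carrier ones_vec_carrier] walk_vec_def lessThan_iff)
  also have "\<dots> = umbral (\<lambda>k. \<Sum>l<n. (?A ^\<^sub>m m) $$ (i,l) * walk_vec n G k $ l) M"
    by (rule umbral_sum_left[symmetric])
  also have "(\<lambda>k. \<Sum>l<n. (?A ^\<^sub>m m) $$ (i,l) * walk_vec n G k $ l) = (\<lambda>k. walk_vec n G (k + m) $ i)"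
  proof
    fix k
    have "walk_vec n G (m + k) = (?A ^\<^sub>m m) *\<^sub>v walk_vec n G k"
      unfolding walk_vec_def by (rule pow_mat_add_mult_vec[OF adjacency_carrier ones_vec_carrier])
    then show "(\<Sum>l<n. (?A ^\<^sub>m m) $$ (i,l) * walk_vec n G k $ l) = walk_vec n G (k + m) $ i"
      using index_mult_mat_vec_sum[OF Am walk_vec_carrier i, of G k] by (simp only: add.commute)
  qed
  finally show ?thesis unfolding umbral_def .
qed

context
  fixes n :: nat and G :: "nat set set"
  assumes G: "simple_graph n G" and co: "corank_one n G"
begin

text \<open>The exponent is n - 1 - deg M_2, where deg M_2 is n/2 rounded up.\<close>

lemma two_power_dvd_xi: "i < n \<Longrightarrow> 2 ^ (n div 2 - 1) dvd xi_vec n G $ i"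
proof -
  assume i: "i < n"
  have n2: "n \<ge> 2" by (rule n_ge_2[OF G co])
  have d: "degree (M_poly n G 2) = n mod 2 + n div 2" by (rule M_poly_2_annihilates(2)[OF G n2])
  have "n mod 2 + n div 2 \<le> n - 1" using n2 by presburger
  then have "2 ^ (n - 1 - (n mod 2 + n div 2)) dvd xi_vec n G $ i"
    using xi_vec_dvd[of n "M_poly n G 2" 2 G i] M_poly_2_annihilates[OF G n2] i n2 unfolding d by simp
  moreover have "n - 1 - (n mod 2 + n div 2) = n div 2 - 1" by presburger
  ultimately show ?thesis by (simp only:)
qed

lemma W0_scaled: "scaled_walk_mat n G (monom 1 (n - 1)) 1 (2 ^ (n div 2 - 1)) (W0_mat n G)"
proof -
  have n: "n > 0" by (rule n_pos[OF G co])
  have len: "length (map (walk_vec n G) [0..<n - 1] @ [map_vec (\<lambda>z. z div 2 ^ (n div 2 - 1)) (xi_vec n G)]) = n"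
    using n by simp
  have "W0_mat n G \<in> carrier_mat n n" unfolding W0_mat_def by (rule carrier_matI) (use len in simp_all)
  moreover have "rat_of_int (W0_mat n G $$ (i,j)) = (if j = n - 1 then of_int (xi_vec n G $ i) / of_int (2 ^ (n div 2 - 1))
      else reduced_walk n G (monom 1 (n - 1)) 1 j $ i)" if ij: "i < n" "j < n" for i j
  proof (cases "j = n - 1")
    case True
    have "W0_mat n G $$ (i,j) = xi_vec n G $ i div 2 ^ (n div 2 - 1)"
      unfolding W0_mat_def using ij len True by (simp add: mat_of_cols_index nth_append)
    then show ?thesis using of_int_div[OF two_power_dvd_xi[OF ij(1)]] True by simp
  next
    case False
    then have "j < n - 1" using ij by linarith
    then have "W0_mat n G $$ (i,j) = walk_vec n G j $ i"
      unfolding W0_mat_def using ij len by (simp add: mat_of_cols_index nth_append)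
    then show ?thesis using False ij walk_vec_of_int[OF ij(1), of G j]
      by (simp add: reduced_walk_def degree_monom_eq)
  qed
  ultimately show ?thesis unfolding scaled_walk_mat_def by blast
qed

lemma W0p_scaled:
  assumes p: "prime p"
  shows "scaled_walk_mat n G (M_poly n G p) p (lcm (2 ^ (n div 2 - 1)) (p ^ (n - 1 - s_deg n G p))) (W0p_mat n G p)"
proof -
  have n: "n > 0" by (rule n_pos[OF G co])
  define M where "M = M_poly n G p"
  define s where "s = s_deg n G p"
  have sM: "s = degree M" unfolding s_def M_def s_deg_def ..
  note M = M_poly_annihilates[OF G co p, folded M_def]
  have s: "s \<le> n - 1" using M(2) sM by simp
  show ?thesis
  proof (cases "s = n - 1")
    case True
    have "W0p_mat n G p = W0_mat n G" unfolding W0p_mat_def Let_def s_def[symmetric] using True by simp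
    moreover have "lcm (2 ^ (n div 2 - 1)) (p ^ (n - 1 - s)) = 2 ^ (n div 2 - 1)" unfolding True by simp
    moreover have "reduced_walk n G M p j = reduced_walk n G (monom 1 (n - 1)) 1 j" if "j < n" "j \<noteq> n - 1" for j
      using that True sM by (simp add: reduced_walk_def degree_monom_eq)
    ultimately show ?thesis using W0_scaled unfolding scaled_walk_mat_def M_def[symmetric] s_def[symmetric] by auto
  next
    case False
    let ?A = "adj_mat n G :: int mat"
    define c where "c = lcm (2 ^ (n div 2 - 1)) (p ^ (n - 1 - s))"
    define u where "u = poly_mat M ?A *\<^sub>v ones_vec n"
    define w where "w = map_vec (\<lambda>z. z div p) u"
    have u: "u \<in> carrier_vec n" unfolding u_def
      by (rule mult_mat_vec_carrier[OF poly_mat_carrier[OF adjacency_carrier] ones_vec_carrier])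
    have w: "w \<in> carrier_vec n" unfolding w_def using u by simp
    have pw: "p * w $ l = u $ l" if "l < n" for l
      using M(3)[OF that] u that unfolding w_def u_def[symmetric] by simp
    let ?cs = "map (walk_vec n G) [0..<s] @ map (\<lambda>k. (?A ^\<^sub>m k) *\<^sub>v w) [0..<n - 1 - s] @ [map_vec (\<lambda>z. z div c) (xi_vec n G)]"
    have W: "W0p_mat n G p = mat_of_cols n ?cs"
      unfolding W0p_mat_def Let_def s_def[symmetric] M_def[symmetric] u_def[symmetric] w_def[symmetric] c_def[symmetric]
      using False by simp
    have len: "length ?cs = n" using s n by simp
    have "W0p_mat n G p \<in> carrier_mat n n" unfolding W by (rule carrier_matI) (use len in simp_all)
    moreover have "rat_of_int (W0p_mat n G p $$ (i,j)) = (if j = n - 1 then of_int (xi_vec n G $ i) / of_int c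
        else reduced_walk n G M p j $ i)" if ij: "i < n" "j < n" for i j
    proof -
      have Wij: "W0p_mat n G p $$ (i,j) = ?cs ! j $ i"
        unfolding W using ij len by (simp add: mat_of_cols_index)
      consider "j = n - 1" | "j < s" | "s \<le> j" "j < n - 1" using ij by linarith
      then show ?thesis
      proof cases
        case 1
        have "?cs ! j = map_vec (\<lambda>z. z div c) (xi_vec n G)" using 1 s by (simp add: nth_append)
        then have "W0p_mat n G p $$ (i,j) = xi_vec n G $ i div c" unfolding Wij using ij by simp
        \<comment> \<open>The power of 2 comes from M_2 and the power of \<open>p\<close> from M_p;
          the lcm in the last column combines the two bounds.\<close>
        moreover have "c dvd xi_vec n G $ i" unfolding c_def
          using two_power_dvd_xi[OF ij(1)] xi_vec_dvd[OF n M(1,2,3) ij(1)] unfolding sM by (rule lcm_least)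
        ultimately show ?thesis using of_int_div 1 by simp
      next
        case 2
        then have "?cs ! j = walk_vec n G j" by (simp add: nth_append)
        then show ?thesis unfolding Wij using 2 s sM walk_vec_of_int[OF ij(1), of G j] by (simp add: reduced_walk_def)
      next
        case 3
        let ?m = "j - s"
        have Am: "?A ^\<^sub>m ?m \<in> carrier_mat n n" by (rule pow_carrier_mat[OF adjacency_carrier])
        have "?cs ! j = (?A ^\<^sub>m ?m) *\<^sub>v w" using 3 by (auto simp: nth_append)
        then have "p * W0p_mat n G p $$ (i,j) = p * ((?A ^\<^sub>m ?m) *\<^sub>v w) $ i" unfolding Wij by simp
        also have "\<dots> = (\<Sum>l<n. (?A ^\<^sub>m ?m) $$ (i,l) * (p * w $ l))"
          unfolding index_mult_mat_vec_sum[OF Am w ij(1)] by (simp add: sum_distrib_left mult.left_commute)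
        also have "\<dots> = ((?A ^\<^sub>m ?m) *\<^sub>v u) $ i"
          unfolding index_mult_mat_vec_sum[OF Am u ij(1)] by (rule sum.cong) (simp_all add: pw)
        also have "\<dots> = (\<Sum>k\<le>s. coeff M k * walk_vec n G (k + ?m) $ i)" unfolding u_def sM by (rule poly_mat_walk[OF ij(1)])
        finally have "rat_of_int (p * W0p_mat n G p $$ (i,j)) = of_int (\<Sum>k\<le>s. coeff M k * walk_vec n G (k + ?m) $ i)" by simp
        then have "of_int p * rat_of_int (W0p_mat n G p $$ (i,j)) = (\<Sum>k\<le>s. of_int (coeff M k) * walk_vec n G (k + ?m) $ i)"
          using walk_vec_of_int[OF ij(1), of G] by simp
        moreover have "p \<noteq> 0" using p by auto
        ultimately have "rat_of_int (W0p_mat n G p $$ (i,j)) = (\<Sum>k\<le>s. of_int (coeff M k) * walk_vec n G (k + ?m) $ i) / of_int p"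
          by (simp add: field_simps)
        then show ?thesis using 3 ij sM by (simp add: reduced_walk_def)
      qed
    qed
    ultimately show ?thesis unfolding scaled_walk_mat_def M_def[symmetric] s_def[symmetric] c_def[symmetric] by blast
  qed
qed

text \<open>A vector orthogonal to all columns of \<open>W\<close> is orthogonal to the reduced
  columns. As \<open>M\<close> is monic, these are triangular in the walk vectors, so by induction
  it is orthogonal to the first n - 1 walk vectors; the last column adds orthogonality to \<xi>.
  Together these vectors span.\<close>

lemma scaled_walk_mat_det:
  assumes W: "scaled_walk_mat n G M p c W" and M: "monic M" "degree M \<le> n - 1" and p: "p \<noteq> 0" and c: "c \<noteq> 0"
  shows "det W \<noteq> 0"
proof
  assume "det W = 0"
  have n: "n > 0" by (rule n_pos[OF G co])
  have Wc: "W \<in> carrier_mat n n" using W unfolding scaled_walk_mat_def by blast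
  have "det (transpose_mat W) = 0" using det_transpose[OF Wc] \<open>det W = 0\<close> by simp
  then obtain x where x: "x \<in> carrier_vec n" "x \<noteq> 0\<^sub>v n" "transpose_mat W *\<^sub>v x = 0\<^sub>v n"
    using det_0_iff_vec_prod_zero[of "transpose_mat W" n] Wc by auto
  let ?x = "map_vec rat_of_int x"
  have xc: "?x \<in> carrier_vec n" using x by simp
  have col: "(\<Sum>i<n. ?x $ i * rat_of_int (W $$ (i,j))) = 0" if j: "j < n" for j
  proof -
    have "(transpose_mat W *\<^sub>v x) $ j = (\<Sum>i<n. W $$ (i,j) * x $ i)"
      using j Wc by (subst index_mult_mat_vec_sum[of _ n n]) (auto simp: x(1))
    then have "(\<Sum>i<n. W $$ (i,j) * x $ i) = 0" using x(3) j by simp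
    then have "rat_of_int (\<Sum>i<n. W $$ (i,j) * x $ i) = 0" by simp
    moreover have "rat_of_int (\<Sum>i<n. W $$ (i,j) * x $ i) = (\<Sum>i<n. ?x $ i * rat_of_int (W $$ (i,j)))"
      unfolding of_int_sum by (rule sum.cong) (use x(1) in auto)
    ultimately show ?thesis by simp
  qed
  have sp: "?x \<bullet> y = (\<Sum>i<n. ?x $ i * y $ i)" if "y \<in> carrier_vec n" for y
    using that by (simp add: scalar_prod_def atLeast0LessThan)
  have colw: "?x \<bullet> reduced_walk n G M p j = 0" if "j < n - 1" for j
    unfolding sp[OF reduced_walk_carrier] using col[of j] that W unfolding scaled_walk_mat_def by auto
  have orth: "?x \<bullet> walk_vec n G j = 0" if "j < n - 1" for j
    using that
  proof (induction j rule: less_induct)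
    case (less j)
    show ?case
    proof (cases "j < degree M")
      case True
      then show ?thesis using colw[OF less.prems] by (simp add: reduced_walk_def)
    next
      case False
      let ?m = "j - degree M"
      have "0 = of_int p * (?x \<bullet> reduced_walk n G M p j)" using colw[OF less.prems] by simp
      also have "\<dots> = (\<Sum>i<n. ?x $ i * (\<Sum>k\<le>degree M. of_int (coeff M k) * walk_vec n G (k + ?m) $ i))"
        unfolding sp[OF reduced_walk_carrier]
        by (subst sum_distrib_left, rule sum.cong) (use False p in \<open>simp_all add: reduced_walk_def\<close>)
      also have "\<dots> = (\<Sum>k\<le>degree M. of_int (coeff M k) * (\<Sum>i<n. ?x $ i * walk_vec n G (k + ?m) $ i))"
        unfolding sum_distrib_left by (subst sum.swap) (simp only: mult.left_commute)
      also have "\<dots> = (\<Sum>k\<le>degree M. of_int (coeff M k) * (?x \<bullet> walk_vec n G (k + ?m)))"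
        unfolding sp[OF walk_vec_carrier] ..
      also have "\<dots> = (\<Sum>k\<le>degree M. if k = degree M then ?x \<bullet> walk_vec n G j else 0)"
      proof (rule sum.cong)
        fix k assume k: "k \<in> {..degree M}"
        show "of_int (coeff M k) * (?x \<bullet> walk_vec n G (k + ?m)) = (if k = degree M then ?x \<bullet> walk_vec n G j else 0)"
        proof (cases "k = degree M")
          case True
          then show ?thesis using M(1) False by simp
        next
          case kn: False
          then have "k + ?m < j" "k + ?m < n - 1" using k False less.prems by auto
          then show ?thesis using less.IH kn by simp
        qed
      qed simp
      also have "\<dots> = ?x \<bullet> walk_vec n G j" by simp
      finally show ?thesis by simp
    qed
  qed
  have "?x \<bullet> xi_rat n G = of_int c * (\<Sum>i<n. ?x $ i * rat_of_int (W $$ (i,n - 1)))"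
    unfolding sp[OF xi_rat_carrier[OF G co]] sum_distrib_left
    by (rule sum.cong) (use W n c in \<open>auto simp: scaled_walk_mat_def\<close>)
  then have "?x \<bullet> xi_rat n G = 0" using col[of "n - 1"] n by simp
  then have "?x = 0\<^sub>v n" using walks_span[OF G co xc orth] by simp
  have "x = 0\<^sub>v n"
  proof (rule eq_vecI)
    fix i assume "i < dim_vec (0\<^sub>v n :: int vec)"
    then show "x $ i = 0\<^sub>v n $ i" using arg_cong[OF \<open>?x = 0\<^sub>v n\<close>, of "\<lambda>v. v $ i"] x(1) by simp
  qed (use x(1) in simp)
  then show False using x(2) by simp
qed

end

text \<open>The Gram matrices consist of walk numbers and therefore agree. For the first n - 1 walk
  vectors they give the length of \<xi>, for all n of them the square of the determinant of the walk
  matrix.\<close>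

lemma cospectral_corank_one:
  assumes co: "corank_one n G" and \<chi>: "char_poly (adj_mat n G :: int mat) = char_poly (adj_mat n H)"
    and f: "walk_form n G = walk_form n H"
  shows "corank_one n H" "xi_rat n H \<bullet> xi_rat n H = xi_rat n G \<bullet> xi_rat n G"
proof -
  have n: "n > 0" using co unfolding corank_one_def by simp
  have gram: "gram_mat n (walk_vec n H) = (gram_mat n (walk_vec n G) :: rat mat)"
    unfolding gram_mat_def using walk_inner_eq[OF n \<chi> f] by simp
  have norm: "xi_rat n X \<bullet> xi_rat n X = det (gram_mat n (walk_vec n X) :: rat mat)" for X
    using last_cofactors_norm[of "walk_vec n X :: nat \<Rightarrow> rat vec" n] n unfolding last_cofactors_walk by simp
  show N: "xi_rat n H \<bullet> xi_rat n H = xi_rat n G \<bullet> xi_rat n G" unfolding norm gram ..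
  have xG: "xi_rat n G \<noteq> 0\<^sub>v n"
  proof
    assume "xi_rat n G = 0\<^sub>v n"
    then have "xi_vec n G $ i = 0" if "i < n" for i
      using arg_cong[of "xi_rat n G" "0\<^sub>v n" "\<lambda>v. v $ i"] that by simp
    then have "xi_vec n G = 0\<^sub>v n" by (intro eq_vecI) simp_all
    then show False using co unfolding corank_one_def by simp
  qed
  then have "xi_rat n G \<bullet> xi_rat n G \<noteq> 0"
    using scalar_prod_self_eq_0[of "walk_vec n G :: nat \<Rightarrow> rat vec" n "xi_rat n G"] n by auto
  then have "xi_rat n H \<bullet> xi_rat n H \<noteq> 0" unfolding N .
  then have xH: "xi_vec n H \<noteq> 0\<^sub>v n" by (auto simp: scalar_prod_def)
  have W: "(transpose_mat (walk_mat n X) * walk_mat n X :: rat mat) = mat n n (\<lambda>(i,j). walk_vec n X i \<bullet> walk_vec n X j)" for X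
  proof (rule eq_matI)
    have c: "col (walk_mat n X :: rat mat) j = walk_vec n X j" if "j < n" for j
      using that carrier_matD[OF walk_mat_carrier[of n X, where 'a = rat]] carrier_vecD[OF walk_vec_carrier[of n X j, where 'a = rat]]
      by (intro eq_vecI) (simp_all add: walk_mat_index)
    fix i j assume "i < dim_row (mat n n (\<lambda>(i,j). walk_vec n X i \<bullet> walk_vec n X j :: rat))"
      "j < dim_col (mat n n (\<lambda>(i,j). walk_vec n X i \<bullet> walk_vec n X j :: rat))"
    then show "(transpose_mat (walk_mat n X) * walk_mat n X :: rat mat) $$ (i,j) = mat n n (\<lambda>(i,j). walk_vec n X i \<bullet> walk_vec n X j) $$ (i,j)"
      using carrier_matD[OF walk_mat_carrier[of n X, where 'a = rat]] by (simp add: c)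
  qed (simp_all add: walk_mat_def)
  have d: "det (transpose_mat (walk_mat n X) * walk_mat n X :: rat mat) = (of_int (det (walk_mat n X :: int mat)))\<^sup>2" for X
  proof -
    have "det (transpose_mat (walk_mat n X) * walk_mat n X :: rat mat) = (det (walk_mat n X :: rat mat))\<^sup>2"
      using det_mult[of "transpose_mat (walk_mat n X) :: rat mat" n "walk_mat n X"] det_transpose[OF walk_mat_carrier[of n X, where 'a = rat]]
      by (simp add: power2_eq_square)
    then show ?thesis unfolding walk_mat_hom[of n X, where 'a = rat, symmetric] of_int_hom.hom_det .
  qed
  have "(rat_of_int (det (walk_mat n H :: int mat)))\<^sup>2 = (of_int (det (walk_mat n G :: int mat)))\<^sup>2"
    unfolding d[symmetric] W walk_inner_eq[OF n \<chi> f] ..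
  then have "det (walk_mat n H :: int mat) = 0" using co unfolding corank_one_def by simp
  then show "corank_one n H" using n xH unfolding corank_one_def by simp
qed

subsection \<open>Regular rational orthogonal similarities\<close>

definition regular_similarity :: "nat \<Rightarrow> nat set set \<Rightarrow> nat set set \<Rightarrow> rat mat \<Rightarrow> bool" where
  "regular_similarity n G H Q \<longleftrightarrow> Q \<in> carrier_mat n n \<and> transpose_mat Q * Q = 1\<^sub>m n \<and>
     transpose_mat Q * adj_mat n G * Q = adj_mat n H \<and> transpose_mat Q *\<^sub>v ones_vec n = ones_vec n"

lemma trace_comm:
  fixes X Y :: "'a :: comm_ring_1 mat"
  assumes "X \<in> carrier_mat n n" "Y \<in> carrier_mat n n"
  shows "(\<Sum>i<n. (X * Y) $$ (i,i)) = (\<Sum>i<n. (Y * X) $$ (i,i))"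
proof -
  have "(\<Sum>i<n. (X * Y) $$ (i,i)) = (\<Sum>i<n. \<Sum>k<n. X $$ (i,k) * Y $$ (k,i))"
    by (rule sum.cong) (simp_all add: index_mult_mat_sum[OF assms] del: index_mult_mat(1))
  also have "\<dots> = (\<Sum>k<n. \<Sum>i<n. X $$ (i,k) * Y $$ (k,i))" by (rule sum.swap)
  also have "\<dots> = (\<Sum>k<n. (Y * X) $$ (k,k))"
    by (rule sum.cong) (simp_all add: index_mult_mat_sum[OF assms(2,1)] mult.commute del: index_mult_mat(1))
  finally show ?thesis .
qed

lemma scalar_prod_transpose:
  fixes Q :: "'a :: comm_ring_1 mat"
  assumes Q: "Q \<in> carrier_mat n n" and x: "x \<in> carrier_vec n" and y: "y \<in> carrier_vec n"
  shows "(transpose_mat Q *\<^sub>v x) \<bullet> y = x \<bullet> (Q *\<^sub>v y)"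
proof -
  have QT: "transpose_mat Q \<in> carrier_mat n n" using Q by simp
  have "(transpose_mat Q *\<^sub>v x) \<bullet> y = (\<Sum>i<n. (\<Sum>j<n. transpose_mat Q $$ (i,j) * x $ j) * y $ i)"
    using y by (simp add: scalar_prod_def atLeast0LessThan index_mult_mat_vec_sum[OF QT x] del: index_mult_mat_vec)
  also have "\<dots> = (\<Sum>i<n. \<Sum>j<n. x $ j * (Q $$ (j,i) * y $ i))"
    unfolding sum_distrib_right by (intro sum.cong refl) (use Q in \<open>simp add: mult_ac\<close>)
  also have "\<dots> = (\<Sum>j<n. \<Sum>i<n. x $ j * (Q $$ (j,i) * y $ i))" by (rule sum.swap)
  also have "\<dots> = x \<bullet> (Q *\<^sub>v y)"
    using Q by (simp add: scalar_prod_def atLeast0LessThan index_mult_mat_vec_sum[OF Q y] sum_distrib_left del: index_mult_mat_vec)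
  finally show ?thesis .
qed

context
  fixes n :: nat and G H :: "nat set set" and Q :: "rat mat"
  assumes G: "simple_graph n G" and co: "corank_one n G" and H: "simple_graph n H"
    and Q: "regular_similarity n G H Q"
begin

lemma similarity_carrier: "Q \<in> carrier_mat n n" "transpose_mat Q \<in> carrier_mat n n"
  using Q unfolding regular_similarity_def by auto

lemma similarity_orthogonal: "transpose_mat Q * Q = 1\<^sub>m n" "Q * transpose_mat Q = 1\<^sub>m n"
proof -
  show 1: "transpose_mat Q * Q = 1\<^sub>m n" using Q unfolding regular_similarity_def by blast
  show "Q * transpose_mat Q = 1\<^sub>m n"
    by (rule mat_mult_left_right_inverse[OF similarity_carrier(2,1) 1])
qed

lemma similarity_mult_vec_inverse: "x \<in> carrier_vec n \<Longrightarrow> Q *\<^sub>v (transpose_mat Q *\<^sub>v x) = x"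
  using assoc_mult_mat_vec[OF similarity_carrier, of x] unfolding similarity_orthogonal by simp

lemma similarity_intertwines:
  assumes x: "x \<in> carrier_vec n"
  shows "transpose_mat Q *\<^sub>v (adj_mat n G *\<^sub>v x) = adj_mat n H *\<^sub>v (transpose_mat Q *\<^sub>v x)"
proof -
  have QA: "transpose_mat Q * adj_mat n G \<in> carrier_mat n n"
    by (rule mult_carrier_mat[OF similarity_carrier(2) adjacency_carrier])
  have "adj_mat n H *\<^sub>v (transpose_mat Q *\<^sub>v x) = (transpose_mat Q * adj_mat n G * Q) *\<^sub>v (transpose_mat Q *\<^sub>v x)"
    using Q unfolding regular_similarity_def by simp
  also have "\<dots> = (transpose_mat Q * adj_mat n G) *\<^sub>v (Q *\<^sub>v (transpose_mat Q *\<^sub>v x))"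
    by (rule assoc_mult_mat_vec[OF QA similarity_carrier(1) mult_mat_vec_carrier[OF similarity_carrier(2) x]])
  also have "\<dots> = (transpose_mat Q * adj_mat n G) *\<^sub>v x" unfolding similarity_mult_vec_inverse[OF x] ..
  also have "\<dots> = transpose_mat Q *\<^sub>v (adj_mat n G *\<^sub>v x)"
    by (rule assoc_mult_mat_vec[OF similarity_carrier(2) adjacency_carrier x])
  finally show ?thesis by simp
qed

lemma similarity_walk: "transpose_mat Q *\<^sub>v walk_vec n G k = walk_vec n H k"
proof (induction k)
  case 0
  then show ?case using Q unfolding regular_similarity_def walk_vec_0 by blast
next
  case (Suc k)
  then show ?case unfolding walk_vec_Suc similarity_intertwines[OF walk_vec_carrier] by simp
qed

lemma similarity_inner:
  assumes x: "x \<in> carrier_vec n" and y: "y \<in> carrier_vec n"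
  shows "(transpose_mat Q *\<^sub>v x) \<bullet> (transpose_mat Q *\<^sub>v y) = x \<bullet> y"
  unfolding scalar_prod_transpose[OF similarity_carrier(1) x mult_mat_vec_carrier[OF similarity_carrier(2) y]]
    similarity_mult_vec_inverse[OF y] ..

text \<open>Q^T J Q = J because Q^T fixes the all-ones vector, so A + J is conjugated together with
  A, and \<chi>(A + J) carries the walk form.\<close>

lemma similarity_char_poly_eq:
  "char_poly (adj_mat n G :: int mat) = char_poly (adj_mat n H)" "walk_form n G = walk_form n H"
proof -
  have sim: "char_poly A = char_poly B"
    if A: "A \<in> carrier_mat n n" and B: "B \<in> carrier_mat n n" and e: "transpose_mat Q * A * Q = B" for A B :: "rat mat"
  proof -
    have "similar_mat_wit B A (transpose_mat Q) Q"
      by (rule similar_mat_witI[of _ _ n]) (use similarity_orthogonal similarity_carrier A B e in auto)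
    then have "similar_mat B A" unfolding similar_mat_def by blast
    then show ?thesis using char_poly_similar by metis
  qed
  have hom: "char_poly M = char_poly N" if "M \<in> carrier_mat n n" "N \<in> carrier_mat n n"
    "char_poly (map_mat rat_of_int M) = char_poly (map_mat of_int N)" for M N
    using that unfolding of_int_hom.char_poly_hom[OF that(1)] of_int_hom.char_poly_hom[OF that(2)]
    by (intro map_poly_of_int_inject) 
  have QAQ: "transpose_mat Q * adj_mat n G * Q = adj_mat n H" using Q unfolding regular_similarity_def by blast
  show \<chi>: "char_poly (adj_mat n G :: int mat) = char_poly (adj_mat n H)"
    by (rule hom[OF adjacency_carrier adjacency_carrier]) (simp only: adjacency_hom sim[OF adjacency_carrier adjacency_carrier QAQ])
  let ?J = "ones_mat n :: rat mat"
  have J: "?J \<in> carrier_mat n n" by (simp add: ones_mat_def)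
  have colsum: "(\<Sum>k<n. Q $$ (k,i)) = 1" if i: "i < n" for i
  proof -
    have "(transpose_mat Q *\<^sub>v ones_vec n) $ i = 1" using Q i unfolding regular_similarity_def by simp
    then show ?thesis using index_mult_mat_vec_sum[OF similarity_carrier(2) ones_vec_carrier i] i similarity_carrier(1) by simp
  qed
  have QJQ: "transpose_mat Q * ?J * Q = ?J"
  proof (rule eq_matI)
    fix i j assume "i < dim_row ?J" "j < dim_col ?J"
    then have ij: "i < n" "j < n" by (simp_all add: ones_mat_def)
    have QJ: "transpose_mat Q * ?J \<in> carrier_mat n n" by (rule mult_carrier_mat[OF similarity_carrier(2) J])
    have QJ1: "(transpose_mat Q * ?J) $$ (i,k) = 1" if "k < n" for k
      unfolding index_mult_mat_sum[OF similarity_carrier(2) J ij(1) that]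
      using colsum[OF ij(1)] ij that similarity_carrier(1) by (simp add: ones_mat_def)
    have "(transpose_mat Q * ?J * Q) $$ (i,j) = (\<Sum>k<n. Q $$ (k,j))"
      unfolding index_mult_mat_sum[OF QJ similarity_carrier(1) ij] using QJ1 by simp
    then show "(transpose_mat Q * ?J * Q) $$ (i,j) = ?J $$ (i,j)" using colsum[OF ij(2)] ij by (simp add: ones_mat_def)
  qed (use similarity_carrier in \<open>simp_all add: ones_mat_def\<close>)
  have AJ: "transpose_mat Q * (adj_mat n G + ?J) * Q = adj_mat n H + ?J"
  proof -
    have "transpose_mat Q * (adj_mat n G + ?J) = transpose_mat Q * adj_mat n G + transpose_mat Q * ?J"
      by (rule mult_add_distrib_mat[OF similarity_carrier(2) adjacency_carrier J])
    then have "transpose_mat Q * (adj_mat n G + ?J) * Q = transpose_mat Q * adj_mat n G * Q + transpose_mat Q * ?J * Q"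
      using add_mult_distrib_mat[of "transpose_mat Q * adj_mat n G" n n "transpose_mat Q * ?J" Q n]
        mult_carrier_mat[OF similarity_carrier(2) J] mult_carrier_mat[OF similarity_carrier(2) adjacency_carrier[of n G]] similarity_carrier(1)
      by simp
    then show ?thesis unfolding QAQ QJQ .
  qed
  have hJ: "map_mat rat_of_int (adj_mat n X + ones_mat n) = adj_mat n X + ?J" for X
    by (intro eq_matI) (auto simp: ones_mat_def adj_mat_def)
  have c: "adj_mat n X + ones_mat n \<in> carrier_mat n n" for X by (simp add: ones_mat_def)
  have "char_poly (adj_mat n G + ones_mat n :: int mat) = char_poly (adj_mat n H + ones_mat n)"
    by (rule hom[OF c c]) (unfold hJ, rule sim[OF c c AJ])
  then show "walk_form n G = walk_form n H" unfolding adjacency_plus_ones \<chi> by simp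
qed

lemma similarity_corank_one: "corank_one n H"
  by (rule cospectral_corank_one(1)[OF co similarity_char_poly_eq])

text \<open>The image is orthogonal to the walk vectors of \<open>H\<close>, hence a multiple of
  \<xi>(H). Cospectrality makes the lengths of \<xi>(G) and \<xi>(H) equal, so the factor has square
  1.\<close>

lemma similarity_xi: "transpose_mat Q *\<^sub>v xi_rat n G = xi_rat n H \<or> transpose_mat Q *\<^sub>v xi_rat n G = (-1) \<cdot>\<^sub>v xi_rat n H"
proof -
  let ?y = "transpose_mat Q *\<^sub>v xi_rat n G" and ?N = "xi_rat n G \<bullet> xi_rat n G"
  have xG: "xi_rat n G \<in> carrier_vec n" and xH: "xi_rat n H \<in> carrier_vec n" by simp_all
  have y: "?y \<in> carrier_vec n" by (rule mult_mat_vec_carrier[OF similarity_carrier(2) xG])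
  obtain c where c: "?y = c \<cdot>\<^sub>v xi_rat n H"
  proof -
    have "?y \<bullet> walk_vec n H j = 0" if "j < n - 1" for j
      unfolding similarity_walk[symmetric] similarity_inner[OF xG walk_vec_carrier]
      using xi_walk_lt[OF G co, of j] comm_scalar_prod[OF xG walk_vec_carrier[of n G j]] that by simp
    then show ?thesis using walks_orthogonal_line[OF H similarity_corank_one y] that by blast
  qed
  have "?N = ?y \<bullet> ?y" unfolding similarity_inner[OF xG xG] ..
  also have "\<dots> = c * (c * (xi_rat n H \<bullet> xi_rat n H))" unfolding c
    by (simp add: smult_scalar_prod_distrib[OF xH smult_carrier_vec[THEN iffD2, OF xH]] scalar_prod_smult_distrib[OF xH xH])
  also have "xi_rat n H \<bullet> xi_rat n H = ?N" by (rule cospectral_corank_one(2)[OF co similarity_char_poly_eq])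
  finally have "c * c = 1" using xi_rat_norm[OF G co] by simp
  then have "c = 1 \<or> c = -1" by (simp add: square_eq_1_iff[symmetric] )
  then show ?thesis using c by auto
qed

text \<open>Integrality of \<open>Q\<^sup>T W\<close>: this product is again a scaled walk matrix, up to the sign of its last column.\<close>

lemma similarity_scaled_walk_mat:
  assumes WG: "scaled_walk_mat n G M p c W" and WH: "scaled_walk_mat n H M p c W'" and i: "i < n" and j: "j < n"
  shows "(\<Sum>r<n. Q $$ (r,i) * rat_of_int (W $$ (r,j))) \<in> \<int>"
proof -
  have QT: "(transpose_mat Q *\<^sub>v x) $ i = (\<Sum>r<n. Q $$ (r,i) * x $ r)" if "x \<in> carrier_vec n" for x
    unfolding index_mult_mat_vec_sum[OF similarity_carrier(2) that i]
    by (rule sum.cong) (use similarity_carrier(1) i in auto)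
  have W'Z: "rat_of_int (W' $$ (i,j)) \<in> \<int>" by simp
  show ?thesis
  proof (cases "j = n - 1")
    case True
    have "(\<Sum>r<n. Q $$ (r,i) * rat_of_int (W $$ (r,j))) = (\<Sum>r<n. Q $$ (r,i) * xi_rat n G $ r) / of_int c"
      unfolding sum_divide_distrib
      by (rule sum.cong) (use WG True j in \<open>auto simp: scaled_walk_mat_def\<close>)
    also have "\<dots> = (transpose_mat Q *\<^sub>v xi_rat n G) $ i / of_int c" unfolding QT[OF xi_rat_carrier[OF G co]] ..
    finally have e: "(\<Sum>r<n. Q $$ (r,i) * rat_of_int (W $$ (r,j))) = (transpose_mat Q *\<^sub>v xi_rat n G) $ i / of_int c" .
    have w: "rat_of_int (W' $$ (i,j)) = xi_rat n H $ i / of_int c"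
      using WH True i j unfolding scaled_walk_mat_def by simp
    from similarity_xi show ?thesis
    proof
      assume "transpose_mat Q *\<^sub>v xi_rat n G = xi_rat n H"
      then show ?thesis unfolding e using w W'Z by simp
    next
      assume "transpose_mat Q *\<^sub>v xi_rat n G = (-1) \<cdot>\<^sub>v xi_rat n H"
      then have "(transpose_mat Q *\<^sub>v xi_rat n G) $ i / of_int c = - rat_of_int (W' $$ (i,j))"
        unfolding w using i by simp
      then show ?thesis unfolding e using W'Z by (simp only: Ints_minus)
    qed
  next
    case False
    have walk: "(\<Sum>r<n. Q $$ (r,i) * walk_vec n G k $ r) = walk_vec n H k $ i" for k
      unfolding QT[OF walk_vec_carrier, symmetric] similarity_walk ..
    have "(\<Sum>r<n. Q $$ (r,i) * rat_of_int (W $$ (r,j))) = (\<Sum>r<n. Q $$ (r,i) * reduced_walk n G M p j $ r)"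
      by (rule sum.cong) (use WG False j in \<open>auto simp: scaled_walk_mat_def\<close>)
    also have "\<dots> = reduced_walk n H M p j $ i"
    proof (cases "j < degree M")
      case True
      then show ?thesis using walk by (simp add: reduced_walk_def)
    next
      case False
      let ?m = "j - degree M"
      have "(\<Sum>r<n. Q $$ (r,i) * reduced_walk n G M p j $ r)
          = (\<Sum>r<n. \<Sum>k\<le>degree M. of_int (coeff M k) * (Q $$ (r,i) * walk_vec n G (k + ?m) $ r)) / of_int p"
        unfolding sum_divide_distrib[of _ "{..<n}"]
        by (rule sum.cong) (use False in \<open>simp_all add: reduced_walk_def sum_distrib_left mult.left_commute\<close>)
      also have "(\<Sum>r<n. \<Sum>k\<le>degree M. of_int (coeff M k) * (Q $$ (r,i) * walk_vec n G (k + ?m) $ r))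
          = (\<Sum>k\<le>degree M. of_int (coeff M k) * walk_vec n H (k + ?m) $ i)"
        unfolding walk[symmetric] by (subst sum.swap) (simp only: sum_distrib_left)
      finally show ?thesis using False i by (simp add: reduced_walk_def)
    qed
    also have "\<dots> = rat_of_int (W' $$ (i,j))" using WH False i j unfolding scaled_walk_mat_def by simp
    finally show ?thesis by simp
  qed
qed

lemma similarity_power:
  assumes x: "x \<in> carrier_vec n"
  shows "transpose_mat Q *\<^sub>v ((adj_mat n G ^\<^sub>m k) *\<^sub>v x) = (adj_mat n H ^\<^sub>m k) *\<^sub>v (transpose_mat Q *\<^sub>v x)"
proof (induction k)
  case 0
  then show ?case using x mult_mat_vec_carrier[OF similarity_carrier(2) x] by (simp add: adj_mat_def)
next
  case (Suc k)
  have S: "(adj_mat n X ^\<^sub>m Suc k) *\<^sub>v y = adj_mat n X *\<^sub>v ((adj_mat n X ^\<^sub>m k) *\<^sub>v y)" if "y \<in> carrier_vec n" for X and y :: "rat vec"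
    unfolding pow_mat_Suc_left[OF adjacency_carrier]
    by (rule assoc_mult_mat_vec[OF adjacency_carrier pow_carrier_mat[OF adjacency_carrier] that])
  have Ax: "(adj_mat n G ^\<^sub>m k) *\<^sub>v x \<in> carrier_vec n"
    by (rule mult_mat_vec_carrier[OF pow_carrier_mat[OF adjacency_carrier] x])
  show ?case unfolding S[OF x] S[OF mult_mat_vec_carrier[OF similarity_carrier(2) x]] similarity_intertwines[OF Ax] Suc ..
qed

end

text \<open>The transposes agree on the walk vectors, whose images are prescribed, and on \<xi>(G)
  by hypothesis; these vectors span.\<close>

lemma similarity_determined:
  assumes G: "simple_graph n G" and co: "corank_one n G" and H: "simple_graph n H"
    and Q: "regular_similarity n G H Q" and R: "regular_similarity n G H R"
    and e: "transpose_mat Q *\<^sub>v xi_rat n G = transpose_mat R *\<^sub>v xi_rat n G"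
  shows "Q = R"
proof -
  have n: "n > 0" by (rule n_pos[OF G co])
  note cQ = similarity_carrier[OF G co H Q] and cR = similarity_carrier[OF G co H R]
  have "(Q *\<^sub>v y - R *\<^sub>v y) = 0\<^sub>v n" if y: "y \<in> carrier_vec n" for y
  proof (rule walks_span[OF G co])
    have Qy: "Q *\<^sub>v y \<in> carrier_vec n" and Ry: "R *\<^sub>v y \<in> carrier_vec n"
      using mult_mat_vec_carrier[OF cQ(1) y] mult_mat_vec_carrier[OF cR(1) y] by auto
    show "Q *\<^sub>v y - R *\<^sub>v y \<in> carrier_vec n" using Qy Ry by simp
    have d: "(Q *\<^sub>v y - R *\<^sub>v y) \<bullet> x = 0" if x: "x \<in> carrier_vec n" and xe: "transpose_mat Q *\<^sub>v x = transpose_mat R *\<^sub>v x" for x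
    proof -
      have "(Q *\<^sub>v y - R *\<^sub>v y) \<bullet> x = x \<bullet> (Q *\<^sub>v y) - x \<bullet> (R *\<^sub>v y)"
        using minus_scalar_prod_distrib[OF Qy Ry x] comm_scalar_prod[OF Qy x] comm_scalar_prod[OF Ry x] by simp
      then show ?thesis using xe
        unfolding scalar_prod_transpose[OF cQ(1) x y, symmetric] scalar_prod_transpose[OF cR(1) x y, symmetric] by simp
    qed
    show "(Q *\<^sub>v y - R *\<^sub>v y) \<bullet> walk_vec n G j = 0" if "j < n - 1" for j
      by (rule d[OF walk_vec_carrier]) (simp only: similarity_walk[OF G co H Q] similarity_walk[OF G co H R])
    show "(Q *\<^sub>v y - R *\<^sub>v y) \<bullet> xi_rat n G = 0" by (rule d[OF xi_rat_carrier[OF G co] e])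
  qed
  then have c: "(Q *\<^sub>v unit_vec n j - R *\<^sub>v unit_vec n j) $ i = 0" if "i < n" for i j
    using that by simp
  show ?thesis
  proof (rule eq_matI)
    fix i j assume "i < dim_row R" "j < dim_col R"
    then have ij: "i < n" "j < n" using cR by auto
    have col: "(X *\<^sub>v unit_vec n j) $ i = X $$ (i,j)" if "X \<in> carrier_mat n n" for X :: "rat mat"
      using that ij by simp
    show "Q $$ (i,j) = R $$ (i,j)"
      using c[OF ij(1), of j] ij cQ cR col[OF cQ(1)] col[OF cR(1)] by (simp del: index_mult_mat_vec)
  qed (use cQ cR in auto)
qed

text \<open>Q^T is forced: it maps the walk vectors of \<open>G\<close> to those of \<open>H\<close>
  and \<xi>(G) to \<open>\<sigma>\<close> times \<xi>(H). Equal Gram matrices make it orthogonal.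
  What remains is Q^T A(G) Q = A(H) in the direction of \<xi>(H), where the eigenvalues of the two
  sides might differ.\<close>

lemma similarity_exists:
  assumes G: "simple_graph n G" and co: "corank_one n G" and H: "simple_graph n H"
    and \<chi>: "char_poly (adj_mat n G :: int mat) = char_poly (adj_mat n H)" and f: "walk_form n G = walk_form n H"
    and \<sigma>: "\<sigma> * \<sigma> = (1 :: rat)"
  shows "\<exists>Q. regular_similarity n G H Q \<and> transpose_mat Q *\<^sub>v xi_rat n G = \<sigma> \<cdot>\<^sub>v xi_rat n H"
proof -
  have n: "n > 0" and n2: "n \<ge> 2" using n_pos[OF G co] n_ge_2[OF G co] by auto
  have coH: "corank_one n H" by (rule cospectral_corank_one(1)[OF co \<chi> f])
  have norm: "xi_rat n H \<bullet> xi_rat n H = xi_rat n G \<bullet> xi_rat n G" by (rule cospectral_corank_one(2)[OF co \<chi> f])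
  have xG: "xi_rat n G \<in> carrier_vec n" and xH: "xi_rat n H \<in> carrier_vec n" by simp_all
  define yH where "yH = \<sigma> \<cdot>\<^sub>v xi_rat n H"
  have yH: "yH \<in> carrier_vec n" unfolding yH_def using xH by simp
  define V where "V = append_col n (walk_vec n G) (xi_rat n G)"
  define U where "U = append_col n (walk_vec n H) yH"
  have V: "V \<in> carrier_mat n n" and U: "U \<in> carrier_mat n n"
    unfolding V_def U_def using append_col_carrier[OF _ n, of "walk_vec n G :: nat \<Rightarrow> rat vec" "xi_rat n G"]
      append_col_carrier[OF _ n, of "walk_vec n H :: nat \<Rightarrow> rat vec" yH] by simp_all
  have colV: "col V j = (if j = n - 1 then xi_rat n G else walk_vec n G j)" if "j < n" for j
    using that V append_col_index[of "walk_vec n G :: nat \<Rightarrow> rat vec" n _ j "xi_rat n G"] n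
    by (intro eq_vecI) (auto simp: V_def[symmetric])
  have colU: "col U j = (if j = n - 1 then yH else walk_vec n H j)" if "j < n" for j
    using that U append_col_index[of "walk_vec n H :: nat \<Rightarrow> rat vec" n _ j yH] n yH
    by (intro eq_vecI) (auto simp: U_def[symmetric])
  have detV: "det V \<noteq> 0"
    using det_append_col[of "walk_vec n G :: nat \<Rightarrow> rat vec" n "xi_rat n G"] n xi_rat_norm[OF G co]
    unfolding V_def last_cofactors_walk by simp
  obtain X where X: "X \<in> carrier_mat n n" "V * X = 1\<^sub>m n" "X * V = 1\<^sub>m n"
  proof
    let ?P = "Determinant.adj_mat V" and ?X = "(1 / det V) \<cdot>\<^sub>m Determinant.adj_mat V"
    have P: "?P \<in> carrier_mat n n" by (rule adj_mat(1)[OF V])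
    show "?X \<in> carrier_mat n n" using P by simp
    show "V * ?X = 1\<^sub>m n" using mult_smult_distrib[OF V P, of "1 / det V"] adj_mat(2)[OF V] detV by (auto intro!: eq_matI)
    show "?X * V = 1\<^sub>m n" using mult_smult_assoc_mat[OF P V, of "1 / det V"] adj_mat(3)[OF V] detV by (auto intro!: eq_matI)
  qed
  define Q where "Q = transpose_mat (U * X)"
  have UX: "U * X \<in> carrier_mat n n" by (rule mult_carrier_mat[OF U X(1)])
  have Q: "Q \<in> carrier_mat n n" and QT: "transpose_mat Q = U * X" unfolding Q_def using UX by simp_all
  have QTc: "transpose_mat Q \<in> carrier_mat n n" using Q by simp
  have xw: "xi_rat n Y \<bullet> walk_vec n Y j = 0" if "simple_graph n Y" "corank_one n Y" "j < n" for Y j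
    using xi_walk_lt[OF that] comm_scalar_prod[of "xi_rat n Y" n "walk_vec n Y j"] by simp
  have gram: "transpose_mat U * U = transpose_mat V * V"
  proof (rule eq_matI)
    fix i j assume "i < dim_row (transpose_mat V * V)" "j < dim_col (transpose_mat V * V)"
    then have ij: "i < n" "j < n" using V by auto
    have "col U i \<bullet> col U j = col V i \<bullet> col V j"
      unfolding colU[OF ij(1)] colU[OF ij(2)] colV[OF ij(1)] colV[OF ij(2)] yH_def
      using walk_inner_eq[OF n \<chi> f, of i j] xi_walk_lt[OF G co] xi_walk_lt[OF H coH] xw[OF G co] xw[OF H coH] ij norm \<sigma>
      by (simp add: smult_scalar_prod_distrib[of _ n] scalar_prod_smult_distrib[of _ n] mult.assoc[symmetric])
    then show "(transpose_mat U * U) $$ (i,j) = (transpose_mat V * V) $$ (i,j)" using ij U V by simp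
  qed (use U V in auto)
  have VT: "transpose_mat V \<in> carrier_mat n n" and UT: "transpose_mat U \<in> carrier_mat n n"
    and XT: "transpose_mat X \<in> carrier_mat n n" using V U X by auto
  have QQT: "Q * transpose_mat Q = 1\<^sub>m n"
  proof -
    have "Q * transpose_mat Q = (transpose_mat X * transpose_mat U) * (U * X)"
      unfolding QT unfolding Q_def transpose_mult[OF U X(1)] ..
    also have "\<dots> = transpose_mat X * ((transpose_mat U * U) * X)"
      using UT U X XT by (simp add: assoc_mult_mat[of _ n n _ n _ n])
    also have "\<dots> = (transpose_mat X * transpose_mat V) * (V * X)"
      unfolding gram using VT V X XT by (simp add: assoc_mult_mat[of _ n n _ n _ n])
    also have "\<dots> = transpose_mat (V * X) * (V * X)" unfolding transpose_mult[OF V X(1)] ..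
    also have "\<dots> = 1\<^sub>m n" unfolding X(2) by simp
    finally show ?thesis .
  qed
  have QTQ: "transpose_mat Q * Q = 1\<^sub>m n" by (rule mat_mult_left_right_inverse[OF Q QTc QQT])
  have QTV: "transpose_mat Q * V = U"
  proof -
    have "transpose_mat Q * V = U * (X * V)" unfolding QT by (rule assoc_mult_mat[OF U X(1) V])
    then show ?thesis unfolding X(3) using U by simp
  qed
  have QTcol: "transpose_mat Q *\<^sub>v col V j = col U j" if "j < n" for j
    using col_mult2[OF QTc V that] unfolding QTV by simp
  have QTw: "transpose_mat Q *\<^sub>v walk_vec n G j = walk_vec n H j" if "j < n - 1" for j
  proof -
    have jn: "j < n" "j \<noteq> n - 1" using that by linarith+
    then show ?thesis using QTcol[OF jn(1)] unfolding colV[OF jn(1)] colU[OF jn(1)] by simp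
  qed
  have QTx: "transpose_mat Q *\<^sub>v xi_rat n G = yH"
    using QTcol[of "n - 1"] n by (simp add: colV colU)
  have Qinv: "Q *\<^sub>v (transpose_mat Q *\<^sub>v x) = x" if "x \<in> carrier_vec n" for x
    using assoc_mult_mat_vec[OF Q QTc that] that unfolding QQT by simp
  have Qw: "Q *\<^sub>v walk_vec n H j = walk_vec n G j" if "j < n - 1" for j
    using Qinv[OF walk_vec_carrier[of n G j]] QTw[OF that] by simp
  have QyH: "Q *\<^sub>v yH = xi_rat n G" using Qinv[OF xG] unfolding QTx .
  \<comment> \<open>The walk vector of index n - 1 is not a column of \<open>V\<close>, but A maps
    the one of index n - 2 to it. Its image is recognized by its inner products with a spanning
    set.\<close>
  have QTlast: "transpose_mat Q *\<^sub>v walk_vec n G (n - 1) = walk_vec n H (n - 1)"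
  proof -
    let ?a = "transpose_mat Q *\<^sub>v walk_vec n G (n - 1)" and ?b = "walk_vec n H (n - 1) :: rat vec"
    have a: "?a \<in> carrier_vec n" by (rule mult_mat_vec_carrier[OF QTc walk_vec_carrier])
    have b: "?b \<in> carrier_vec n" by simp
    have "?a - ?b = 0\<^sub>v n"
    proof (rule walks_span[OF H coH])
      show "?a - ?b \<in> carrier_vec n" using a by simp
      show "(?a - ?b) \<bullet> walk_vec n H j = 0" if j: "j < n - 1" for j
        unfolding minus_scalar_prod_distrib[OF a b walk_vec_carrier] scalar_prod_transpose[OF Q walk_vec_carrier walk_vec_carrier] Qw[OF j]
          walk_inner_eq[OF n \<chi> f] by simp
      have "?a \<bullet> yH = 0" unfolding scalar_prod_transpose[OF Q walk_vec_carrier yH] QyH using xi_walk_lt[OF G co, of "n - 1"] n by simp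
      then have "\<sigma> * (?a \<bullet> xi_rat n H) = 0" unfolding yH_def by (simp only: scalar_prod_smult_distrib[OF a xH])
      then have "?a \<bullet> xi_rat n H = 0" using \<sigma> by auto
      then show "(?a - ?b) \<bullet> xi_rat n H = 0"
        unfolding minus_scalar_prod_distrib[OF a b xH] using xi_walk_lt[OF H coH, of "n - 1"] n by simp
    qed
    then have "(?a - ?b) $ i = 0" if "i < n" for i using that by simp
    then show ?thesis using a b Q by (intro eq_vecI) (auto simp del: index_mult_mat_vec)
  qed
  define D where "D = transpose_mat Q * adj_mat n G * Q - adj_mat n H"
  have AG: "(adj_mat n G :: rat mat) \<in> carrier_mat n n" and AH: "(adj_mat n H :: rat mat) \<in> carrier_mat n n" by simp_all
  have QA: "transpose_mat Q * adj_mat n G \<in> carrier_mat n n" by (rule mult_carrier_mat[OF QTc AG])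
  have QAQ: "transpose_mat Q * adj_mat n G * Q \<in> carrier_mat n n" by (rule mult_carrier_mat[OF QA Q])
  have D: "D \<in> carrier_mat n n" unfolding D_def using AH by (rule minus_carrier_mat)
  have Dv: "D *\<^sub>v x = transpose_mat Q *\<^sub>v (adj_mat n G *\<^sub>v (Q *\<^sub>v x)) - adj_mat n H *\<^sub>v x" if x: "x \<in> carrier_vec n" for x
  proof -
    have "D *\<^sub>v x = (transpose_mat Q * adj_mat n G * Q) *\<^sub>v x - adj_mat n H *\<^sub>v x"
      unfolding D_def by (rule minus_mult_distrib_mat_vec[OF QAQ AH x])
    also have "(transpose_mat Q * adj_mat n G * Q) *\<^sub>v x = (transpose_mat Q * adj_mat n G) *\<^sub>v (Q *\<^sub>v x)"
      by (rule assoc_mult_mat_vec[OF QA Q x])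
    also have "\<dots> = transpose_mat Q *\<^sub>v (adj_mat n G *\<^sub>v (Q *\<^sub>v x))"
      by (rule assoc_mult_mat_vec[OF QTc AG mult_mat_vec_carrier[OF Q x]])
    finally show ?thesis .
  qed
  have Dw: "D *\<^sub>v walk_vec n H j = 0\<^sub>v n" if j: "j < n - 1" for j
  proof -
    have "transpose_mat Q *\<^sub>v walk_vec n G (Suc j) = walk_vec n H (Suc j)"
      using QTw[of "Suc j"] QTlast j by (cases "Suc j = n - 1") auto
    then have "transpose_mat Q *\<^sub>v (adj_mat n G *\<^sub>v walk_vec n G j) = walk_vec n H (Suc j)" unfolding walk_vec_Suc .
    then show ?thesis unfolding Dv[OF walk_vec_carrier] Qw[OF j] walk_vec_Suc[symmetric] by simp
  qed
  obtain lG where lG: "adj_mat n G *\<^sub>v xi_rat n G = lG \<cdot>\<^sub>v xi_rat n G" using xi_eigenvector[OF G co] by blast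
  obtain lH where lH: "adj_mat n H *\<^sub>v xi_rat n H = lH \<cdot>\<^sub>v xi_rat n H" using xi_eigenvector[OF H coH] by blast
  have Dy: "D *\<^sub>v yH = (lG - lH) \<cdot>\<^sub>v yH"
  proof -
    have "adj_mat n H *\<^sub>v yH = lH \<cdot>\<^sub>v yH" unfolding yH_def mult_mat_vec[OF AH xH] lH by (simp add: smult_smult_assoc mult.commute)
    moreover have "transpose_mat Q *\<^sub>v (adj_mat n G *\<^sub>v (Q *\<^sub>v yH)) = lG \<cdot>\<^sub>v yH"
      unfolding QyH lG mult_mat_vec[OF QTc xG] QTx ..
    ultimately show ?thesis unfolding Dv[OF yH] using yH by (intro eq_vecI) (auto simp: algebra_simps)
  qed
  define d where "d = lG - lH"
  define N where "N = yH \<bullet> yH"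
  have N: "N \<noteq> 0"
  proof -
    have "N = \<sigma> * (\<sigma> * (xi_rat n H \<bullet> xi_rat n H))" unfolding N_def yH_def
      by (simp only: smult_scalar_prod_distrib[OF xH smult_carrier_vec[THEN iffD2, OF xH]] scalar_prod_smult_distrib[OF xH xH])
    then have "N = xi_rat n H \<bullet> xi_rat n H" using \<sigma> by (simp only: mult.assoc[symmetric] mult_1)
    then show ?thesis using xi_rat_norm[OF H coH] by simp
  qed
  \<comment> \<open>\<open>D\<close> kills the first n - 1 walk vectors and multiplies
    \<open>yH\<close> by \<open>d\<close>, so it must be this rank-one matrix, whose trace is
    \<open>d\<close>.\<close>
  define E where "E = mat n n (\<lambda>(i,j). d / N * (yH $ i * yH $ j))"
  have E: "E \<in> carrier_mat n n" unfolding E_def by simp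
  have Ev: "E *\<^sub>v x = (d / N * (yH \<bullet> x)) \<cdot>\<^sub>v yH" if x: "x \<in> carrier_vec n" for x
  proof (rule eq_vecI)
    fix i assume "i < dim_vec ((d / N * (yH \<bullet> x)) \<cdot>\<^sub>v yH)"
    then have i: "i < n" using yH by simp
    have s: "yH \<bullet> x = (\<Sum>j<n. yH $ j * x $ j)" using x by (simp add: scalar_prod_def atLeast0LessThan)
    show "(E *\<^sub>v x) $ i = ((d / N * (yH \<bullet> x)) \<cdot>\<^sub>v yH) $ i"
      unfolding index_mult_mat_vec_sum[OF E x i] s using i yH
      by (simp add: E_def sum_distrib_left sum_distrib_right mult_ac)
  qed (use E yH in simp)
  have DE: "D *\<^sub>v col U j = E *\<^sub>v col U j" if j: "j < n" for j
  proof (cases "j = n - 1")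
    case True
    then show ?thesis unfolding colU[OF j] using Dy Ev[OF yH] N unfolding N_def[symmetric] d_def[symmetric] by simp
  next
    case False
    then have j': "j < n - 1" using j by linarith
    have "yH \<bullet> walk_vec n H j = 0" unfolding yH_def smult_scalar_prod_distrib[OF xH walk_vec_carrier] xw[OF H coH j] by simp
    then have "E *\<^sub>v walk_vec n H j = 0 \<cdot>\<^sub>v yH" unfolding Ev[OF walk_vec_carrier] by simp
    also have "\<dots> = 0\<^sub>v n" using yH by (intro eq_vecI) auto
    finally show ?thesis unfolding colU[OF j] using Dw[OF j'] False by simp
  qed
  have DUEU: "D * U = E * U"
  proof (rule eq_matI)
    fix i j assume "i < dim_row (E * U)" "j < dim_col (E * U)"
    then have ij: "i < n" "j < n" using E U by auto
    have "(X * U) $$ (i,j) = (X *\<^sub>v col U j) $ i" if "X \<in> carrier_mat n n" for X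
      using that ij U by simp
    then show "(D * U) $$ (i,j) = (E * U) $$ (i,j)" using DE[OF ij(2)] D E by (simp del: index_mult_mat_vec index_mult_mat(1))
  qed (use D E U in auto)
  have detU: "det U \<noteq> 0"
  proof -
    have "det (transpose_mat U * U) = det (transpose_mat V * V)" unfolding gram ..
    then have "det U * det U = det V * det V"
      unfolding det_mult[OF UT U] det_mult[OF VT V] det_transpose[OF U] det_transpose[OF V] .
    then show ?thesis using detV by auto
  qed
  have DE': "D = E"
  proof -
    let ?P = "Determinant.adj_mat U"
    have P: "?P \<in> carrier_mat n n" by (rule adj_mat(1)[OF U])
    have r: "(Y * U) * ?P = det U \<cdot>\<^sub>m Y" if Y: "Y \<in> carrier_mat n n" for Y
      unfolding assoc_mult_mat[OF Y U P] adj_mat(2)[OF U] mult_smult_distrib[OF Y one_carrier_mat] using Y by simp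
    have "det U \<cdot>\<^sub>m D = det U \<cdot>\<^sub>m E" using r[OF D] r[OF E] DUEU by simp
    have "D $$ (i,j) = E $$ (i,j)" if "i < n" "j < n" for i j
    proof -
      have "(det U \<cdot>\<^sub>m D) $$ (i,j) = (det U \<cdot>\<^sub>m E) $$ (i,j)" unfolding \<open>det U \<cdot>\<^sub>m D = det U \<cdot>\<^sub>m E\<close> ..
      then show ?thesis using detU that carrier_matD[OF D] carrier_matD[OF E] by simp
    qed
    then show ?thesis using D E by (intro eq_matI) auto
  qed
  \<comment> \<open>Both adjacency matrices have zero diagonal and conjugation preserves the trace;
    this forces the two eigenvalues to agree.\<close>
  have "(\<Sum>i<n. D $$ (i,i)) = 0"
  proof -
    have "(\<Sum>i<n. (transpose_mat Q * adj_mat n G * Q) $$ (i,i)) = (\<Sum>i<n. (Q * (transpose_mat Q * adj_mat n G)) $$ (i,i))"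
      by (rule trace_comm[OF QA Q])
    also have "Q * (transpose_mat Q * adj_mat n G) = adj_mat n G"
      unfolding assoc_mult_mat[OF Q QTc AG, symmetric] QQT by (rule left_mult_one_mat[OF AG])
    finally have "(\<Sum>i<n. (transpose_mat Q * adj_mat n G * Q) $$ (i,i)) = 0"
      using loop_free[OF G] by (simp add: adjacency_index)
    moreover have "D $$ (i,i) = (transpose_mat Q * adj_mat n G * Q) $$ (i,i) - adj_mat n H $$ (i,i)" if "i < n" for i
      unfolding D_def using that carrier_matD[OF AH] by (intro index_minus_mat(1)) simp_all
    ultimately show ?thesis using loop_free[OF H] by (simp add: adjacency_index del: index_mult_mat(1))
  qed
  moreover have "(\<Sum>i<n. D $$ (i,i)) = d / N * N"
    unfolding DE' E_def N_def scalar_prod_def using yH by (simp add: sum_distrib_left atLeast0LessThan)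
  ultimately have "d = 0" using N by simp
  then have D0: "D = 0\<^sub>m n n" unfolding DE' E_def by (intro eq_matI) auto
  have "transpose_mat Q * adj_mat n G * Q = adj_mat n H"
  proof (rule eq_matI)
    fix i j assume "i < dim_row (adj_mat n H :: rat mat)" "j < dim_col (adj_mat n H :: rat mat)"
    then have ij: "i < n" "j < n" by (simp_all add: adj_mat_def)
    have "D $$ (i,j) = (transpose_mat Q * adj_mat n G * Q) $$ (i,j) - adj_mat n H $$ (i,j)"
      unfolding D_def using ij carrier_matD[OF AH] by (intro index_minus_mat(1)) simp_all
    then show "(transpose_mat Q * adj_mat n G * Q) $$ (i,j) = adj_mat n H $$ (i,j)" unfolding D0 using ij by simp
  qed (use carrier_matD[OF QAQ] carrier_matD[OF AH] in auto)
  moreover have "transpose_mat Q *\<^sub>v ones_vec n = ones_vec n" using QTw[of 0] n2 unfolding walk_vec_0 by simp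
  ultimately have "regular_similarity n G H Q" unfolding regular_similarity_def using Q QTQ by blast
  then show ?thesis using QTx unfolding yH_def by blast
qed

subsection \<open>The level of a regular similarity\<close>

lemma walk_mats_nonsingular:
  assumes G: "simple_graph n G" and co: "corank_one n G"
  shows "det (W0_mat n G) \<noteq> 0" "prime p \<Longrightarrow> det (W0p_mat n G p) \<noteq> 0"
proof -
  show "det (W0_mat n G) \<noteq> 0"
    by (rule scaled_walk_mat_det[OF G co W0_scaled[OF G co]]) (simp_all add: degree_monom_eq)
  assume p: "prime p"
  then have p0: "p \<noteq> 0" by auto
  then have "lcm (2 ^ (n div 2 - 1)) (p ^ (n - 1 - s_deg n G p)) \<noteq> 0" by (simp add: lcm_eq_0_iff)
  then show "det (W0p_mat n G p) \<noteq> 0"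
    by (intro scaled_walk_mat_det[OF G co W0p_scaled[OF G co p] M_poly_annihilates(1,2)[OF G co p] p0])
qed

lemma walk_mats_carrier:
  assumes G: "simple_graph n G" and co: "corank_one n G"
  shows "W0_mat n G \<in> carrier_mat n n" "prime p \<Longrightarrow> W0p_mat n G p \<in> carrier_mat n n"
  using W0_scaled[OF G co] W0p_scaled[OF G co, of p] unfolding scaled_walk_mat_def by blast+

lemma candidate_primes_prime: "p \<in> candidate_primes n G \<Longrightarrow> prime p"
  unfolding candidate_primes_def Let_def by auto

lemma potential_primes_prime: "p \<in> potential_primes n G \<Longrightarrow> prime p"
  unfolding potential_primes_def using candidate_primes_prime by blast

lemma finite_potential_primes:
  assumes G: "simple_graph n G" and co: "corank_one n G"
  shows "finite (potential_primes n G)"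
proof (rule finite_subset)
  let ?d = "last_invariant_factor (W0_mat n G)"
  have d: "?d > 0"
    by (rule last_invariant_factor_pos[OF walk_mats_carrier(1)[OF G co] n_pos[OF G co] walk_mats_nonsingular(1)[OF G co]])
  show "finite ({2} \<union> {0..?d})" by simp
  show "potential_primes n G \<subseteq> {2} \<union> {0..?d}"
  proof
    fix p assume p: "p \<in> potential_primes n G"
    then have "p = 2 \<or> p dvd ?d" unfolding potential_primes_def candidate_primes_def Let_def by auto
    moreover have "p \<ge> 0" using potential_primes_prime[OF p] by (rule prime_ge_0_int)
    ultimately show "p \<in> {2} \<union> {0..?d}" using zdvd_imp_le[OF _ d, of p] by auto
  qed
qed

lemma L_num_pos: "L_num n G > 0"
  unfolding L_num_def using potential_primes_prime prime_gt_0_int by (intro prod_pos) auto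

text \<open>Let d be the last invariant factor and W X = d times the identity. If the columns of
  \<open>W\<close> were independent modulo \<open>p\<close>, then \<open>p\<close> would divide
  \<open>X\<close>, and d / p would already clear the denominators of W^-1, against the minimality
  of d.\<close>

lemma rank_mod_lt:
  assumes W: "W \<in> carrier_mat n n" and n: "n > 0" and det: "det W \<noteq> 0" and p: "prime p"
    and d: "p dvd last_invariant_factor W"
  shows "rank_mod p W \<le> n - 1"
proof -
  let ?d = "last_invariant_factor W"
  let ?S = "{card J | J. J \<subseteq> {0..<dim_col W} \<and> cols_independent_mod p W J}"
  have dims: "dim_row W = n" "dim_col W = n" using W by auto
  have dep: "\<not> cols_independent_mod p W {0..<n}"
  proof
    assume ind: "cols_independent_mod p W {0..<n}"
    obtain X where X: "X \<in> carrier_mat n n" "W * X = ?d \<cdot>\<^sub>m 1\<^sub>m n"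
      using last_invariant_factor_inverse[OF W n det] by blast
    have WX: "(\<Sum>j<n. W $$ (r,j) * X $$ (j,i)) = (if r = i then ?d else 0)" if "r < n" "i < n" for r i
      using index_mult_mat_sum[OF W X(1) that, symmetric] that unfolding X(2) by (simp split: if_splits)
    have "p dvd X $$ (j,i)" if "j < n" "i < n" for j i
    proof -
      have "\<forall>r<dim_row W. p dvd (\<Sum>j\<in>{0..<n}. X $$ (j,i) * W $$ (r,j))"
      proof (intro allI impI)
        fix r assume "r < dim_row W"
        then have "(\<Sum>j\<in>{0..<n}. X $$ (j,i) * W $$ (r,j)) = (if r = i then ?d else 0)"
          using WX[of r i] that dims by (simp add: atLeast0LessThan mult.commute)
        then show "p dvd (\<Sum>j\<in>{0..<n}. X $$ (j,i) * W $$ (r,j))" using d by simp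
      qed
      then show ?thesis using ind that(1) unfolding cols_independent_mod_def by auto
    qed
    then have X': "p * (X $$ (j,i) div p) = X $$ (j,i)" if "j < n" "i < n" for j i using that by simp
    let ?Y = "mat n n (\<lambda>(j,i). X $$ (j,i) div p)"
    have p0: "p > 0" using p by (rule prime_gt_0_int)
    have Y: "?Y \<in> carrier_mat n n" by simp
    have "W * ?Y = (?d div p) \<cdot>\<^sub>m 1\<^sub>m n"
    proof (rule eq_matI)
      fix r i assume "r < dim_row ((?d div p) \<cdot>\<^sub>m 1\<^sub>m n)" "i < dim_col ((?d div p) \<cdot>\<^sub>m 1\<^sub>m n)"
      then have ri: "r < n" "i < n" by simp_all
      have "p * (W * ?Y) $$ (r,i) = (\<Sum>j<n. W $$ (r,j) * (p * (X $$ (j,i) div p)))"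
        unfolding index_mult_mat_sum[OF W Y ri] sum_distrib_left
        by (rule sum.cong) (use ri in \<open>simp_all add: mult.left_commute\<close>)
      also have "\<dots> = (if r = i then ?d else 0)" using WX[OF ri] X' ri by simp
      also have "\<dots> = p * ((?d div p) \<cdot>\<^sub>m 1\<^sub>m n) $$ (r,i)" using ri d by simp
      finally show "(W * ?Y) $$ (r,i) = ((?d div p) \<cdot>\<^sub>m 1\<^sub>m n) $$ (r,i)"
        using p0 by (metis mult_left_cancel less_irrefl)
    qed (use W in auto)
    then have "?d dvd ?d div p" by (rule last_invariant_factor_least[OF W n det Y])
    moreover have "?d > 0" by (rule last_invariant_factor_pos[OF W n det])
    moreover have "?d div p < ?d" using \<open>?d > 0\<close> prime_gt_1_int[OF p] by (simp add: int_div_less_self)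
    moreover have "?d div p > 0" using \<open>?d > 0\<close> p0 d by (metis dvd_div_eq_0_iff order_less_le pos_imp_zdiv_nonneg_iff less_imp_le)
    ultimately show False using zdvd_not_zless by blast
  qed
  have "finite ?S" by (rule finite_subset[of _ "card ` Pow {0..<dim_col W}"]) auto
  moreover have "0 \<in> ?S" by (auto simp: cols_independent_mod_def intro!: exI[of _ "{}"])
  moreover have "k \<le> n - 1" if k: "k \<in> ?S" for k
  proof -
    obtain J where J: "J \<subseteq> {0..<n}" "cols_independent_mod p W J" "k = card J" using k dims by auto
    then have "J \<noteq> {0..<n}" using dep by blast
    then have "card J < card {0..<n}" using J(1) by (intro psubset_card_mono) auto
    then show ?thesis using J(3) by simp
  qed
  ultimately show ?thesis unfolding rank_mod_def by (subst Max_le_iff) auto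
qed

section \<open>Denominators of a regular similarity\<close>

definition clears_denominators :: "nat \<Rightarrow> rat mat \<Rightarrow> int \<Rightarrow> bool" where
  "clears_denominators n Q c \<longleftrightarrow> (\<forall>i<n. \<forall>j<n. of_int c * Q $$ (i,j) \<in> \<int>)"

text \<open>The floor makes this an integer vector for every \<open>c\<close>; it is exact as soon
  as \<open>c\<close> clears denominators.\<close>

definition integer_col :: "nat \<Rightarrow> rat mat \<Rightarrow> int \<Rightarrow> nat \<Rightarrow> int vec" where
  "integer_col n Q c j = vec n (\<lambda>i. \<lfloor>of_int c * Q $$ (i,j)\<rfloor>)"

lemma integer_col_carrier [simp]: "integer_col n Q c j \<in> carrier_vec n"
  by (simp add: integer_col_def)

lemma integer_col_index:
  "clears_denominators n Q c \<Longrightarrow> i < n \<Longrightarrow> j < n \<Longrightarrow> rat_of_int (integer_col n Q c j $ i) = of_int c * Q $$ (i,j)"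
  unfolding clears_denominators_def integer_col_def by (simp add: of_int_floor)

lemma scalar_prod_of_int:
  "y \<in> carrier_vec n \<Longrightarrow> x \<in> carrier_vec n \<Longrightarrow> rat_of_int (x \<bullet> y) = map_vec of_int x \<bullet> map_vec of_int y"
  by (simp add: scalar_prod_def)

text \<open>The clearing integers are closed under remainders, so the least positive one, the level
  of \<open>Q\<close>, divides all of them.\<close>

lemma clears_denominators_least:
  assumes c: "clears_denominators n Q c" "c > 0"
  obtains l where "l > 0" "clears_denominators n Q l" "\<And>b. clears_denominators n Q b \<Longrightarrow> l dvd b"
proof -
  let ?P = "\<lambda>k. k > 0 \<and> clears_denominators n Q (int k)"
  have "?P (nat c)" using c by simp
  then have P: "?P (LEAST k. ?P k)" by (rule LeastI)
  define l where "l = int (LEAST k. ?P k)"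
  have l: "l > 0" "clears_denominators n Q l" using P unfolding l_def by auto
  have "l dvd b" if b: "clears_denominators n Q b" for b
  proof (rule ccontr)
    assume "\<not> l dvd b"
    then have pos: "b mod l > 0" using l(1) by (metis dvd_eq_mod_eq_0 order_le_less pos_mod_sign)
    have "clears_denominators n Q (b mod l)" unfolding clears_denominators_def
    proof (intro allI impI)
      fix i j assume ij: "i < n" "j < n"
      have "of_int (b mod l) * Q $$ (i,j) = of_int b * Q $$ (i,j) - of_int (b div l) * (of_int l * Q $$ (i,j))"
        by (simp add: minus_div_mult_eq_mod[symmetric] algebra_simps)
      moreover have "of_int b * Q $$ (i,j) \<in> \<int>" "of_int l * Q $$ (i,j) \<in> \<int>"
        using b l(2) ij unfolding clears_denominators_def by blast+
      ultimately show "of_int (b mod l) * Q $$ (i,j) \<in> \<int>" by (simp only: Ints_diff Ints_mult Ints_of_int)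
    qed
    then have "?P (nat (b mod l))" using pos by simp
    then have "(LEAST k. ?P k) \<le> nat (b mod l)" by (rule Least_le)
    then have "l \<le> int (nat (b mod l))" unfolding l_def of_nat_le_iff .
    then have "l \<le> b mod l" using pos by simp
    then show False using pos_mod_bound[OF l(1), of b] by linarith
  qed
  then show ?thesis using l that by blast
qed

context
  fixes n :: nat and G H :: "nat set set" and Q :: "rat mat"
  assumes G: "simple_graph n G" and co: "corank_one n G" and H: "simple_graph n H"
    and Q: "regular_similarity n G H Q"
begin

text \<open>If W X is d times the identity and Q^T W is integral, then so is d Q^T = (Q^T W)
  X.\<close>

lemma last_invariant_factor_clears:
  assumes WG: "scaled_walk_mat n G M p c W" and WH: "scaled_walk_mat n H M p c W'" and det: "det W \<noteq> 0"
  shows "clears_denominators n Q (last_invariant_factor W)"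
  unfolding clears_denominators_def
proof (intro allI impI)
  fix i j assume i: "i < n" and j: "j < n"
  let ?d = "last_invariant_factor W"
  have W: "W \<in> carrier_mat n n" using WG unfolding scaled_walk_mat_def by blast
  obtain X where X: "X \<in> carrier_mat n n" "W * X = ?d \<cdot>\<^sub>m 1\<^sub>m n"
    using last_invariant_factor_inverse[OF W n_pos[OF G co] det] by blast
  have WX: "(\<Sum>s<n. rat_of_int (W $$ (r,s)) * of_int (X $$ (s,i))) = (if r = i then of_int ?d else 0)" if "r < n" for r
  proof -
    have "(\<Sum>s<n. W $$ (r,s) * X $$ (s,i)) = (if r = i then ?d else 0)"
      using index_mult_mat_sum[OF W X(1) that i, symmetric] that i unfolding X(2) by (simp split: if_splits)
    then have "rat_of_int (\<Sum>s<n. W $$ (r,s) * X $$ (s,i)) = of_int (if r = i then ?d else 0)" by (rule arg_cong)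
    then show ?thesis by (simp split: if_splits)
  qed
  have "(\<Sum>s<n. (\<Sum>r<n. Q $$ (r,j) * rat_of_int (W $$ (r,s))) * of_int (X $$ (s,i)))
      = (\<Sum>s<n. \<Sum>r<n. Q $$ (r,j) * (rat_of_int (W $$ (r,s)) * of_int (X $$ (s,i))))"
    by (simp only: sum_distrib_right mult.assoc)
  also have "\<dots> = (\<Sum>r<n. Q $$ (r,j) * (\<Sum>s<n. rat_of_int (W $$ (r,s)) * of_int (X $$ (s,i))))"
    by (subst sum.swap) (simp only: sum_distrib_left)
  also have "\<dots> = (\<Sum>r<n. if r = i then of_int ?d * Q $$ (i,j) else 0)"
    by (rule sum.cong) (simp_all add: WX mult.commute)
  also have "\<dots> = of_int ?d * Q $$ (i,j)" using i by simp
  finally have e: "of_int ?d * Q $$ (i,j) = (\<Sum>s<n. (\<Sum>r<n. Q $$ (r,j) * rat_of_int (W $$ (r,s))) * of_int (X $$ (s,i)))" by simp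
  show "of_int ?d * Q $$ (i,j) \<in> \<int>" unfolding e
    by (intro Ints_sum Ints_mult Ints_of_int similarity_scaled_walk_mat[OF G co H Q WG WH j]) simp
qed

text \<open>Conjugation by Q moves the form from A(G)^k to A(H)^k, and each column contributes one
  factor \<open>c\<close>. Exponent 0 gives the orthogonality of the vertices, exponent 1 their
  adjacency, and all exponents together the divisibility by p^2 behind the discriminant
  argument.\<close>

lemma integer_col_forms:
  assumes c: "clears_denominators n Q c" and i: "i < n" and j: "j < n"
  shows "integer_col n Q c i \<bullet> ((adj_mat n G ^\<^sub>m k) *\<^sub>v integer_col n Q c j) = c\<^sup>2 * (adj_mat n H ^\<^sub>m k) $$ (i,j)"
proof -
  let ?x = "integer_col n Q c" and ?A = "adj_mat n G :: int mat" and ?B = "adj_mat n G :: rat mat"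
  note Qc = similarity_carrier[OF G co H Q]
  let ?e = "unit_vec n :: nat \<Rightarrow> rat vec"
  have xr: "map_vec of_int (?x j) = of_int c \<cdot>\<^sub>v (Q *\<^sub>v ?e j)" if "j < n" for j
    by (intro eq_vecI) (use that Qc integer_col_index[OF c _ that] in \<open>auto simp: integer_col_def\<close>)
  have Qe: "Q *\<^sub>v ?e j \<in> carrier_vec n" for j by (rule mult_mat_vec_carrier[OF Qc(1)]) simp
  have QTx: "transpose_mat Q *\<^sub>v map_vec of_int (?x j) = of_int c \<cdot>\<^sub>v ?e j" if "j < n" for j
    unfolding xr[OF that] mult_mat_vec[OF Qc(2) Qe]
    using assoc_mult_mat_vec[OF Qc(2,1), of "?e j"] unfolding similarity_orthogonal(1)[OF G co H Q] by simp
  have xc: "map_vec rat_of_int (?x j) \<in> carrier_vec n" for j by simp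
  have Bk: "(adj_mat n X ^\<^sub>m k :: rat mat) = map_mat of_int (adj_mat n X ^\<^sub>m k)" for X
    using of_int_hom.mat_hom_pow[OF adjacency_carrier[of n X], of k, where 'a = rat] by (simp add: adjacency_hom)
  have Akx: "(?A ^\<^sub>m k) *\<^sub>v ?x j \<in> carrier_vec n"
    by (rule mult_mat_vec_carrier[OF pow_carrier_mat[OF adjacency_carrier]]) simp
  have BkH: "(adj_mat n H ^\<^sub>m k :: rat mat) \<in> carrier_mat n n" by (rule pow_carrier_mat[OF adjacency_carrier])
  have "rat_of_int (?x i \<bullet> ((?A ^\<^sub>m k) *\<^sub>v ?x j)) = map_vec of_int (?x i) \<bullet> map_vec of_int ((?A ^\<^sub>m k) *\<^sub>v ?x j)"
    by (rule scalar_prod_of_int[OF Akx]) simp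
  also have "map_vec of_int ((?A ^\<^sub>m k) *\<^sub>v ?x j) = (?B ^\<^sub>m k) *\<^sub>v map_vec of_int (?x j)"
    unfolding Bk by (rule of_int_hom.mult_mat_vec_hom[OF pow_carrier_mat[OF adjacency_carrier]]) simp
  also have "map_vec of_int (?x i) \<bullet> ((?B ^\<^sub>m k) *\<^sub>v map_vec of_int (?x j)) =
      (transpose_mat Q *\<^sub>v map_vec of_int (?x i)) \<bullet> (transpose_mat Q *\<^sub>v ((?B ^\<^sub>m k) *\<^sub>v map_vec of_int (?x j)))"
    by (rule similarity_inner[symmetric, OF G co H Q xc mult_mat_vec_carrier[OF pow_carrier_mat[OF adjacency_carrier] xc]])
  also have "\<dots> = (of_int c \<cdot>\<^sub>v ?e i) \<bullet> ((adj_mat n H ^\<^sub>m k) *\<^sub>v (of_int c \<cdot>\<^sub>v ?e j))"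
    unfolding similarity_power[OF G co H Q xc] QTx[OF i] QTx[OF j] ..
  also have "(adj_mat n H ^\<^sub>m k) *\<^sub>v (of_int c \<cdot>\<^sub>v ?e j) = of_int c \<cdot>\<^sub>v col (adj_mat n H ^\<^sub>m k) j"
  proof -
    have "(adj_mat n H ^\<^sub>m k) *\<^sub>v ?e j = col (adj_mat n H ^\<^sub>m k) j"
      using carrier_matD[OF BkH] j by (intro eq_vecI) auto
    then show ?thesis using mult_mat_vec[OF BkH, of "?e j" "of_int c"] by simp
  qed
  also have "(of_int c \<cdot>\<^sub>v ?e i) \<bullet> (of_int c \<cdot>\<^sub>v col (adj_mat n H ^\<^sub>m k) j) = of_int c * (of_int c * (adj_mat n H ^\<^sub>m k) $$ (i,j))"
    using carrier_matD[OF BkH] i j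
    by (subst smult_scalar_prod_distrib[of _ n], (simp_all)[2], subst scalar_prod_smult_distrib[of _ n]) (auto intro: carrier_vecI)
  also have "\<dots> = of_int (c\<^sup>2 * (adj_mat n H ^\<^sub>m k) $$ (i,j))"
    unfolding Bk using i j carrier_matD[OF pow_carrier_mat[OF adjacency_carrier[of n H, where 'a = int], of k]] by (simp add: power2_eq_square)
  finally show ?thesis unfolding of_int_eq_iff .
qed

lemma integer_col_ones:
  assumes c: "clears_denominators n Q c" and j: "j < n"
  shows "ones_vec n \<bullet> integer_col n Q c j = c"
proof -
  note Qc = similarity_carrier[OF G co H Q]
  have "(transpose_mat Q *\<^sub>v ones_vec n) $ j = 1" using Q j unfolding regular_similarity_def by simp
  then have s: "(\<Sum>i<n. Q $$ (i,j)) = 1"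
    using index_mult_mat_vec_sum[OF Qc(2) ones_vec_carrier j] j Qc(1) by simp
  have "rat_of_int (ones_vec n \<bullet> integer_col n Q c j) = (\<Sum>i<n. of_int c * Q $$ (i,j))"
    unfolding ones_scalar_prod[OF integer_col_carrier] of_int_sum
    by (rule sum.cong) (simp_all add: integer_col_index[OF c _ j])
  also have "\<dots> = of_int c" unfolding sum_distrib_left[symmetric] s by simp
  finally show ?thesis unfolding of_int_eq_iff .
qed

lemma prime_dividing_level_square_dvd_discriminant:
  assumes l: "clears_denominators n Q l" "\<And>b. clears_denominators n Q b \<Longrightarrow> l dvd b" "l > 0"
    and p: "prime p" "p dvd l"
  shows "p\<^sup>2 dvd discriminant (char_poly (adj_mat n G))"
proof -
  let ?x = "integer_col n Q l" and ?A = "adj_mat n G :: int mat"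
  \<comment> \<open>Otherwise l / p would clear denominators as well, although \<open>l\<close>
    divides every such number.\<close>
  have "\<exists>i<n. \<exists>j<n. \<not> p dvd ?x j $ i"
  proof (rule ccontr)
    assume "\<not> ?thesis"
    then have all: "p dvd ?x j $ i" if "i < n" "j < n" for i j using that by blast
    have p0: "p \<noteq> 0" using p(1) by auto
    have "clears_denominators n Q (l div p)" unfolding clears_denominators_def
    proof (intro allI impI)
      fix i j assume ij: "i < n" "j < n"
      have "of_int (l div p) * Q $$ (i,j) = rat_of_int (?x j $ i) / of_int p"
        using integer_col_index[OF l(1) ij] of_int_div[OF p(2)] by simp
      also have "\<dots> = of_int (?x j $ i div p)" using of_int_div[OF all[OF ij]] by simp
      finally show "of_int (l div p) * Q $$ (i,j) \<in> \<int>" by simp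
    qed
    then have "l dvd l div p" by (rule l(2))
    moreover have "l div p < l" using l(3) prime_gt_1_int[OF p(1)] by (simp add: int_div_less_self)
    moreover have "l div p > 0" using p(2) l(3) prime_gt_0_int[OF p(1)] by (auto elim!: dvdE simp: zero_less_mult_iff)
    ultimately show False using zdvd_not_zless by blast
  qed
  then obtain i j where ij: "i < n" "j < n" "\<not> p dvd ?x j $ i" by blast
  have form: "p\<^sup>2 dvd ?x j \<bullet> ((?A ^\<^sub>m k) *\<^sub>v ?x j)" for k
    unfolding integer_col_forms[OF l(1) ij(2) ij(2)] using p(2) by simp
  have x: "?x j \<in> carrier_vec n" by simp
  have iso: "pcong p (resolvent_form ?A (?x j)) 0"
  proof (rule resolvent_form_pcong_0[OF adjacency_carrier adjacency_symmetric x])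
    fix k
    show "p dvd ?x j \<bullet> ((?A ^\<^sub>m k) *\<^sub>v ?x j)"
      by (rule dvd_trans[OF _ form]) (simp add: power2_eq_square)
  qed
  let ?f = "pderiv (char_poly ?A)"
  have P: "poly_mat ?f ?A *\<^sub>v ?x j \<in> carrier_vec n"
    by (rule mult_mat_vec_carrier[OF poly_mat_carrier[OF adjacency_carrier] x])
  \<comment> \<open>The value of the form \<chi>'(A) at the column is an integer combination of the
    values of the powers A^k, so it inherits the factor p^2 that the determinant criterion asks
    for.\<close>
  have "?x j \<bullet> (poly_mat ?f ?A *\<^sub>v ?x j) = (\<Sum>r<n. ?x j $ r * umbral (\<lambda>k. ((?A ^\<^sub>m k) *\<^sub>v ?x j) $ r) ?f)"
    unfolding scalar_prod_def carrier_vecD[OF P] atLeast0LessThan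
    by (rule sum.cong) (simp_all only: index_poly_mat_mult_vec_umbral[OF adjacency_carrier x] lessThan_iff)
  also have "\<dots> = umbral (\<lambda>k. \<Sum>r<n. ?x j $ r * ((?A ^\<^sub>m k) *\<^sub>v ?x j) $ r) ?f" by (rule umbral_sum_left[symmetric])
  also have "(\<lambda>k. \<Sum>r<n. ?x j $ r * ((?A ^\<^sub>m k) *\<^sub>v ?x j) $ r) = (\<lambda>k. ?x j \<bullet> ((?A ^\<^sub>m k) *\<^sub>v ?x j))"
  proof
    fix k
    have "(?A ^\<^sub>m k) *\<^sub>v ?x j \<in> carrier_vec n"
      by (rule mult_mat_vec_carrier[OF pow_carrier_mat[OF adjacency_carrier] x])
    then show "(\<Sum>r<n. ?x j $ r * ((?A ^\<^sub>m k) *\<^sub>v ?x j) $ r) = ?x j \<bullet> ((?A ^\<^sub>m k) *\<^sub>v ?x j)"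
      unfolding scalar_prod_def by (simp only: carrier_vecD atLeast0LessThan)
  qed
  finally have "?x j \<bullet> (poly_mat ?f ?A *\<^sub>v ?x j) = umbral (\<lambda>k. ?x j \<bullet> ((?A ^\<^sub>m k) *\<^sub>v ?x j)) ?f" .
  moreover have "p\<^sup>2 dvd umbral (\<lambda>k. ?x j \<bullet> ((?A ^\<^sub>m k) *\<^sub>v ?x j)) ?f"
    unfolding umbral_def by (intro dvd_sum dvd_mult form)
  ultimately have q: "p\<^sup>2 dvd ?x j \<bullet> (poly_mat ?f ?A *\<^sub>v ?x j)" by (simp only:)
  show ?thesis
    by (rule prime_square_dvd_discriminant[OF adjacency_carrier adjacency_symmetric x p(1) iso ij(1) ij(3) q])
qed

text \<open>M_p is computed from \<chi> and the walk form alone, so \<open>H\<close> has the same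
  polynomial and the same divisor; this makes Q^T \<open>W0p_mat n G p\<close> comparable with
  \<open>W0p_mat n H p\<close>.\<close>

lemma W0p_scaled_cospectral:
  assumes p: "prime p"
  shows "scaled_walk_mat n H (M_poly n G p) p (lcm (2 ^ (n div 2 - 1)) (p ^ (n - 1 - s_deg n G p))) (W0p_mat n H p)"
proof -
  have "M_poly n H p = M_poly n G p"
    unfolding M_poly_eq similarity_char_poly_eq[OF G co H Q] ..
  then show ?thesis using W0p_scaled[OF H similarity_corank_one[OF G co H Q] p] unfolding s_deg_def by simp
qed

text \<open>The level \<open>l\<close> is compared with L prime by prime. It divides the last
  invariant factor of every \<open>W0p_mat\<close>, which bounds its exponent at \<open>p\<close> by
  \<open>t_exp n G p\<close>. It also divides that of \<open>W0_mat\<close>, so its primes pass the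
  rank test, and the discriminant test holds by the isotropic column.\<close>

lemma L_num_clears: "clears_denominators n Q (L_num n G)"
proof -
  have n: "n > 0" by (rule n_pos[OF G co])
  have coH: "corank_one n H" by (rule similarity_corank_one[OF G co H Q])
  let ?d = "last_invariant_factor (W0_mat n G)"
  have W0c: "W0_mat n G \<in> carrier_mat n n" by (rule walk_mats_carrier(1)[OF G co])
  have W0d: "det (W0_mat n G) \<noteq> 0" by (rule walk_mats_nonsingular(1)[OF G co])
  have d: "clears_denominators n Q ?d" "?d > 0"
    by (rule last_invariant_factor_clears[OF W0_scaled[OF G co] W0_scaled[OF H coH] W0d])
      (rule last_invariant_factor_pos[OF W0c n W0d])
  obtain l where l: "l > 0" "clears_denominators n Q l" "\<And>b. clears_denominators n Q b \<Longrightarrow> l dvd b"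
    using clears_denominators_least[OF d] by blast
  have pot: "p \<in> potential_primes n G \<and> multiplicity p l \<le> t_exp n G p" if p: "prime p" "p dvd l" for p
  proof -
    have Wp: "W0p_mat n G p \<in> carrier_mat n n" and Wpd: "det (W0p_mat n G p) \<noteq> 0"
      using walk_mats_carrier(2)[OF G co p(1)] walk_mats_nonsingular(2)[OF G co p(1)] by auto
    have "l dvd last_invariant_factor (W0p_mat n G p)"
      by (rule l(3)[OF last_invariant_factor_clears[OF W0p_scaled[OF G co p(1)] W0p_scaled_cospectral[OF p(1)] Wpd]])
    moreover have "last_invariant_factor (W0p_mat n G p) \<noteq> 0" using last_invariant_factor_pos[OF Wp n Wpd] by simp
    ultimately have t: "multiplicity p l \<le> t_exp n G p" unfolding t_exp_def by (intro dvd_imp_multiplicity_le) auto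
    have "multiplicity p l \<ge> 1" using p l(1) prime_multiplicity_gt_zero_iff[OF prime_imp_prime_elem[OF p(1)], of l] by simp
    then have t1: "t_exp n G p \<ge> 1" using t by simp
    have pd: "p dvd ?d" using p(2) l(3)[OF d(1)] by (rule dvd_trans)
    have rk: "rank_mod p (W0_mat n G) \<le> n - 1" by (rule rank_mod_lt[OF W0c n W0d p(1) pd])
    have sq: "p\<^sup>2 dvd discriminant (char_poly (adj_mat n G))"
      by (rule prime_dividing_level_square_dvd_discriminant[OF l(2,3,1) p])
    then have p1: "p dvd discriminant (char_poly (adj_mat n G))" by (rule dvd_trans[rotated]) (simp add: power2_eq_square)
    have "p = 2 \<or> odd p" using p(1) prime_odd_int[OF p(1)] prime_ge_2_int[OF p(1)] by linarith
    then have "p \<in> candidate_primes n G"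
      unfolding candidate_primes_def Let_def using p(1) pd p1 sq by auto
    then show ?thesis unfolding potential_primes_def using rk t1 t by simp
  qed
  have "l = (\<Prod>p\<in>prime_factors l. p ^ multiplicity p l)" using prod_prime_factors[of l] l(1) by simp
  also have "\<dots> dvd L_num n G" unfolding L_num_def
  proof (rule prod_dvd_prod_subset2[OF finite_potential_primes[OF G co]])
    show "prime_factors l \<subseteq> potential_primes n G" using pot by (auto simp: in_prime_factors_iff)
    show "p ^ multiplicity p l dvd p ^ t_exp n G p" if "p \<in> prime_factors l" for p
      using pot[of p] that by (intro le_imp_power_dvd) (auto simp: in_prime_factors_iff)
  qed
  finally obtain m where m: "L_num n G = l * m" by (rule dvdE)
  show ?thesis unfolding clears_denominators_def
  proof (intro allI impI)
    fix i j assume "i < n" "j < n"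
    then have "of_int l * Q $$ (i,j) \<in> \<int>" using l(2) unfolding clears_denominators_def by blast
    then have "of_int m * (of_int l * Q $$ (i,j)) \<in> \<int>" by (rule Ints_mult[OF Ints_of_int])
    then show "of_int (L_num n G) * Q $$ (i,j) \<in> \<int>" unfolding m of_int_mult by (simp only: mult_ac)
  qed
qed

text \<open>Since Q^T \<open>W0p_mat n G p\<close> is integral, each entry in the congruences is L
  times an integer, and L contains the required power of \<open>p\<close>.\<close>

lemma integer_col_vertex:
  assumes j: "j < n"
  shows "integer_col n Q (L_num n G) j \<in> Omega_vertices n G"
proof -
  let ?L = "L_num n G" and ?x = "integer_col n Q (L_num n G) j"
  note L = L_num_clears
  have x: "?x \<in> carrier_vec n" by simp
  have "p ^ t_exp n G p dvd (transpose_mat (W0p_mat n G p) *\<^sub>v ?x) $ i" if p: "p \<in> potential_primes n G" and i: "i < n" for p i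
  proof -
    have pp: "prime p" by (rule potential_primes_prime[OF p])
    let ?W = "W0p_mat n G p"
    have W: "?W \<in> carrier_mat n n" by (rule walk_mats_carrier(2)[OF G co pp])
    have WT: "transpose_mat ?W \<in> carrier_mat n n" using W by simp
    have "(\<Sum>r<n. Q $$ (r,j) * rat_of_int (?W $$ (r,i))) \<in> \<int>"
      by (rule similarity_scaled_walk_mat[OF G co H Q W0p_scaled[OF G co pp] W0p_scaled_cospectral[OF pp] j i])
    then obtain z where z: "(\<Sum>r<n. Q $$ (r,j) * rat_of_int (?W $$ (r,i))) = of_int z" by (auto elim: Ints_cases)
    have "(transpose_mat ?W *\<^sub>v ?x) $ i = (\<Sum>r<n. ?W $$ (r,i) * ?x $ r)"
      unfolding index_mult_mat_vec_sum[OF WT x i] by (rule sum.cong) (use W i in auto)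
    then have "rat_of_int ((transpose_mat ?W *\<^sub>v ?x) $ i) = (\<Sum>r<n. of_int ?L * (Q $$ (r,j) * rat_of_int (?W $$ (r,i))))"
      using integer_col_index[OF L _ j] by (simp add: mult_ac)
    also have "\<dots> = of_int (?L * z)" unfolding sum_distrib_left[symmetric] z by simp
    finally have "(transpose_mat ?W *\<^sub>v ?x) $ i = ?L * z" unfolding of_int_eq_iff .
    moreover have "p ^ t_exp n G p dvd ?L" unfolding L_num_def
      using p by (intro dvd_prodI[OF finite_potential_primes[OF G co]])
    ultimately show ?thesis by simp
  qed
  moreover have "?x \<bullet> ?x = ?L\<^sup>2"
    using integer_col_forms[OF L j j, of 0] j carrier_vecD[OF x] by (simp add: adj_mat_def)
  moreover have "?x \<bullet> (adj_mat n G *\<^sub>v ?x) = 0"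
    using integer_col_forms[OF L j j, of 1] j loop_free[OF H, of j] by (simp add: adjacency_index)
  ultimately show ?thesis unfolding Omega_vertices_def using integer_col_ones[OF L j] x by simp
qed

lemma integer_cols_clique:
  defines "xs \<equiv> map (integer_col n Q (L_num n G)) [0..<n]"
  shows "distinct xs" "Omega_clique n G (set xs)" "length xs = n" "Q_mat n G xs = Q"
proof -
  let ?L = "L_num n G"
  let ?x = "integer_col n Q ?L"
  have L0: "?L \<noteq> 0" using L_num_pos[of n G] by simp
  note L = L_num_clears
  have orth: "?x i \<bullet> ?x j = (if i = j then ?L\<^sup>2 else 0)" if "i < n" "j < n" for i j
    using integer_col_forms[OF L that, of 0] that by (simp add: adj_mat_def integer_col_def)
  have adj: "?x i \<bullet> (adj_mat n G *\<^sub>v ?x j) \<in> {0, ?L\<^sup>2}" if "i < n" "j < n" for i j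
    using integer_col_forms[OF L that, of 1] that by (simp add: adjacency_index)
  have inj: "i = j" if "i < n" "j < n" "?x i = ?x j" for i j
    using orth[OF that(1,2)] orth[OF that(1,1)] that(3) L0 by (auto split: if_splits)
  show "distinct xs" unfolding xs_def using inj by (auto simp: distinct_map inj_on_def)
  show "length xs = n" unfolding xs_def by simp
  show "Omega_clique n G (set xs)" unfolding Omega_clique_def
  proof (intro conjI ballI impI)
    show "set xs \<subseteq> Omega_vertices n G" unfolding xs_def using integer_col_vertex by auto
    fix u v assume "u \<in> set xs" "v \<in> set xs" "u \<noteq> v"
    then obtain i j where ij: "i < n" "j < n" "u = ?x i" "v = ?x j" unfolding xs_def by auto
    with \<open>u \<noteq> v\<close> have "i \<noteq> j" by auto
    with ij show "Omega_adjacent n G u v" unfolding Omega_adjacent_def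
      using integer_col_vertex orth[of i j] adj[of i j] by simp
  qed simp
  show "Q_mat n G xs = Q"
  proof (rule eq_matI)
    note Qc = similarity_carrier[OF G co H Q]
    fix i j assume "i < dim_row Q" "j < dim_col Q"
    then have ij: "i < n" "j < n" using Qc by auto
    then have "Q_mat n G xs $$ (i,j) = 1 / of_int ?L * rat_of_int (?x j $ i)"
      unfolding Q_mat_def xs_def by (simp add: mat_of_cols_index integer_col_def)
    then show "Q_mat n G xs $$ (i,j) = Q $$ (i,j)" unfolding integer_col_index[OF L ij] using L0 by simp
  qed (use similarity_carrier[OF G co H Q] in \<open>auto simp: Q_mat_def xs_def\<close>)
qed

end

subsection \<open>Isomorphic graphs\<close>

lemma edge_of_simple_graph:
  "simple_graph n G \<Longrightarrow> e \<in> G \<Longrightarrow> \<exists>i j. e = {i,j} \<and> i < n \<and> j < n"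
  unfolding simple_graph_def complete_edges_def by blast

lemma edge_image_iff:
  assumes G: "simple_graph n G" and H: "simple_graph n H" and \<pi>: "bij_betw \<pi> {0..<n} {0..<n}"
  shows "(\<lambda>e. \<pi> ` e) ` G = H \<longleftrightarrow> (\<forall>i<n. \<forall>j<n. {i,j} \<in> G \<longleftrightarrow> {\<pi> i, \<pi> j} \<in> H)"
proof
  have inj: "inj_on \<pi> {0..<n}" and im: "\<pi> ` {0..<n} = {0..<n}" using \<pi> unfolding bij_betw_def by auto
  show "\<forall>i<n. \<forall>j<n. {i,j} \<in> G \<longleftrightarrow> {\<pi> i, \<pi> j} \<in> H" if e: "(\<lambda>e. \<pi> ` e) ` G = H"
  proof (intro allI impI)
    fix i j assume ij: "i < n" "j < n"
    show "{i,j} \<in> G \<longleftrightarrow> {\<pi> i, \<pi> j} \<in> H"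
    proof
      assume "{i,j} \<in> G"
      then have "\<pi> ` {i,j} \<in> (\<lambda>e. \<pi> ` e) ` G" by (rule imageI)
      then show "{\<pi> i, \<pi> j} \<in> H" unfolding e by simp
    next
      assume "{\<pi> i, \<pi> j} \<in> H"
      then obtain f where f: "f \<in> G" "\<pi> ` {i,j} = \<pi> ` f" unfolding e[symmetric] by auto
      have "f \<subseteq> {0..<n}" using edge_of_simple_graph[OF G f(1)] by auto
      then have "{i,j} = f" using inj_on_image_eq_iff[OF inj, of "{i,j}" f] ij f(2) by simp
      then show "{i,j} \<in> G" using f(1) by simp
    qed
  qed
  show "(\<lambda>e. \<pi> ` e) ` G = H" if e: "\<forall>i<n. \<forall>j<n. {i,j} \<in> G \<longleftrightarrow> {\<pi> i, \<pi> j} \<in> H"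
  proof (intro equalityI subsetI)
    fix f assume "f \<in> (\<lambda>e. \<pi> ` e) ` G"
    then obtain g where g: "g \<in> G" "f = \<pi> ` g" by auto
    then obtain i j where "g = {i,j}" "i < n" "j < n" using edge_of_simple_graph[OF G] by blast
    then show "f \<in> H" using e g by simp
  next
    fix f assume f: "f \<in> H"
    then obtain k l where kl: "f = {k,l}" "k < n" "l < n" using edge_of_simple_graph[OF H] by blast
    then have "k \<in> \<pi> ` {0..<n}" "l \<in> \<pi> ` {0..<n}" unfolding im by auto
    then obtain i j where ij: "i < n" "j < n" "k = \<pi> i" "l = \<pi> j" by auto
    then have "{i,j} \<in> G" using e f kl by simp
    then have "\<pi> ` {i,j} \<in> (\<lambda>e. \<pi> ` e) ` G" by (rule imageI)
    then show "f \<in> (\<lambda>e. \<pi> ` e) ` G" unfolding kl ij by simp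
  qed
qed

lemma isomorphic_iff:
  assumes G: "simple_graph n G" and H: "simple_graph n H"
  shows "isomorphic n G H \<longleftrightarrow> (\<exists>\<pi>. bij_betw \<pi> {0..<n} {0..<n} \<and> (\<forall>i<n. \<forall>j<n. {i,j} \<in> G \<longleftrightarrow> {\<pi> i, \<pi> j} \<in> H))"
  unfolding isomorphic_def by (rule iff_exI, rule conj_cong[OF HOL.refl]) (rule edge_image_iff[OF G H])

lemma isomorphic_refl: "isomorphic n G G"
  unfolding isomorphic_def by (intro exI[of _ id]) (simp add: bij_betw_id)

lemma isomorphic_sym:
  assumes G: "simple_graph n G" and H: "simple_graph n H" and i: "isomorphic n G H"
  shows "isomorphic n H G"
proof -
  obtain \<pi> where \<pi>: "bij_betw \<pi> {0..<n} {0..<n}" "\<forall>i<n. \<forall>j<n. {i,j} \<in> G \<longleftrightarrow> {\<pi> i, \<pi> j} \<in> H"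
    using i unfolding isomorphic_iff[OF G H] by blast
  let ?\<rho> = "inv_into {0..<n} \<pi>"
  have \<rho>: "bij_betw ?\<rho> {0..<n} {0..<n}" by (rule bij_betw_inv_into[OF \<pi>(1)])
  have "?\<rho> k < n" "\<pi> (?\<rho> k) = k" if "k < n" for k
    using bij_betwE[OF \<rho>] bij_betw_inv_into_right[OF \<pi>(1), of k] that by auto
  then have "\<forall>i<n. \<forall>j<n. {i,j} \<in> H \<longleftrightarrow> {?\<rho> i, ?\<rho> j} \<in> G" using \<pi>(2) by simp
  then show ?thesis unfolding isomorphic_iff[OF H G] using \<rho> by blast
qed

lemma isomorphic_trans:
  assumes "isomorphic n G H" "isomorphic n H K"
  shows "isomorphic n G K"
proof -
  obtain \<pi> \<rho> where \<pi>: "bij_betw \<pi> {0..<n} {0..<n}" "(\<lambda>e. \<pi> ` e) ` G = H"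
    and \<rho>: "bij_betw \<rho> {0..<n} {0..<n}" "(\<lambda>e. \<rho> ` e) ` H = K"
    using assms unfolding isomorphic_def by blast
  have "(\<lambda>e. (\<rho> \<circ> \<pi>) ` e) ` G = K" unfolding \<rho>(2)[symmetric] \<pi>(2)[symmetric] by (simp add: image_image image_comp)
  then show ?thesis unfolding isomorphic_def using bij_betw_trans[OF \<pi>(1) \<rho>(1)] by blast
qed

lemma iso_class_eq_iff:
  assumes G: "simple_graph n G" and H: "simple_graph n H"
  shows "iso_class n G = iso_class n H \<longleftrightarrow> isomorphic n G H"
proof
  have "H \<in> iso_class n H" unfolding iso_class_def using H isomorphic_refl by blast
  moreover assume "iso_class n G = iso_class n H"
  ultimately have "H \<in> iso_class n G" by simp
  then show "isomorphic n G H" unfolding iso_class_def by simp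
next
  assume i: "isomorphic n G H"
  have "isomorphic n G K \<longleftrightarrow> isomorphic n H K" for K
    using isomorphic_trans[OF i, of K] isomorphic_trans[OF isomorphic_sym[OF G H i], of K] by (rule iffI[rotated])
  then show "iso_class n G = iso_class n H" unfolding iso_class_def by simp
qed

subsection \<open>Cliques as rational similarities\<close>

text \<open>More than \<open>n\<close> pairwise orthogonal vectors of squared length L^2, padded by
  zero rows to a square matrix, would have a Gram matrix whose determinant is a power of L^2,
  although the padded matrix is singular.\<close>

lemma Omega_clique_card_le:
  assumes K: "Omega_clique n G K"
  shows "card K \<le> n"
proof (rule ccontr)
  assume c: "\<not> card K \<le> n"
  have "finite K" using K unfolding Omega_clique_def by (elim conjE)
  from finite_distinct_list[OF this] obtain ys where ys: "set ys = K" "distinct ys" by blast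
  define N where "N = length ys"
  have N: "n < N" using c distinct_card[OF ys(2)] unfolding ys(1) N_def by simp
  let ?L = "L_num n G"
  let ?M = "mat N N (\<lambda>(r,c). if r < n then ys ! c $ r else 0)"
  have V: "ys ! i \<in> Omega_vertices n G" if "i < N" for i
    using K that nth_mem[of i ys] unfolding Omega_clique_def N_def ys(1) by blast
  have ip: "ys ! i \<bullet> ys ! j = (if i = j then ?L\<^sup>2 else 0)" if ij: "i < N" "j < N" for i j
  proof (cases "i = j")
    case True then show ?thesis using V[OF ij(1)] unfolding Omega_vertices_def by simp
  next
    case False
    then have "ys ! i \<noteq> ys ! j" using ys(2) ij unfolding N_def by (simp add: nth_eq_iff_index_eq)
    then have "Omega_adjacent n G (ys ! i) (ys ! j)"
      using K nth_mem[of i ys] nth_mem[of j ys] ij unfolding Omega_clique_def N_def ys(1) by blast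
    then show ?thesis using False unfolding Omega_adjacent_def by simp
  qed
  have M: "?M \<in> carrier_mat N N" by simp
  have MT: "transpose_mat ?M \<in> carrier_mat N N" by simp
  have "transpose_mat ?M * ?M = ?L\<^sup>2 \<cdot>\<^sub>m 1\<^sub>m N"
  proof (rule eq_matI)
    fix i j assume "i < dim_row (?L\<^sup>2 \<cdot>\<^sub>m 1\<^sub>m N)" "j < dim_col (?L\<^sup>2 \<cdot>\<^sub>m 1\<^sub>m N)"
    then have ij: "i < N" "j < N" by simp_all
    have yj: "dim_vec (ys ! j) = n" using V[OF ij(2)] unfolding Omega_vertices_def by auto
    have "(transpose_mat ?M * ?M) $$ (i,j) = (\<Sum>r<N. if r < n then ys ! i $ r * ys ! j $ r else 0)"
      unfolding index_mult_mat_sum[OF MT M ij] by (rule sum.cong) (use ij in auto)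
    also have "\<dots> = (\<Sum>r<n. ys ! i $ r * ys ! j $ r)"
      by (rule sum.mono_neutral_cong_right) (use N in auto)
    also have "\<dots> = ys ! i \<bullet> ys ! j" unfolding scalar_prod_def yj atLeast0LessThan ..
    finally show "(transpose_mat ?M * ?M) $$ (i,j) = (?L\<^sup>2 \<cdot>\<^sub>m 1\<^sub>m N) $$ (i,j)" using ip[OF ij] ij by simp
  qed simp_all
  then have "det (transpose_mat ?M) * det ?M = (?L\<^sup>2) ^ N" using det_mult[OF MT M] by simp
  moreover have "det ?M = 0"
    using laplace_expansion_row[OF M N] N by simp
  moreover have "?L \<noteq> 0" using L_num_pos[of n G] by simp
  ultimately show False by simp
qed

text \<open>An enumerated maximum clique. Counting is done on enumerations, where
  \<open>Q_mat\<close> is injective, and only then passes to sets.\<close>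

definition clique_list :: "nat \<Rightarrow> nat set set \<Rightarrow> int vec list \<Rightarrow> bool" where
  "clique_list n G xs \<longleftrightarrow> distinct xs \<and> length xs = n \<and> Omega_clique n G (set xs)"

lemma regular_similarity_clique_list:
  assumes G: "simple_graph n G" and co: "corank_one n G" and H: "simple_graph n H"
    and Q: "regular_similarity n G H Q"
  shows "\<exists>xs. clique_list n G xs \<and> Q_mat n G xs = Q"
  unfolding clique_list_def using integer_cols_clique[OF G co H Q] by blast

text \<open>The identity, as a similarity of \<open>G\<close> with itself, provides a clique of
  \<open>n\<close> vertices, so the upper bound on clique sizes is attained.\<close>

lemma Omega_max_cliques_iff:
  assumes G: "simple_graph n G" and co: "corank_one n G"
  shows "K \<in> Omega_max_cliques n G \<longleftrightarrow> Omega_clique n G K \<and> card K = n"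
proof -
  have "regular_similarity n G G (1\<^sub>m n)"
    unfolding regular_similarity_def by (simp add: left_mult_one_mat[OF adjacency_carrier] right_mult_one_mat[OF adjacency_carrier])
  then obtain xs where xs: "clique_list n G xs"
    using regular_similarity_clique_list[OF G co G] by blast
  then have "Omega_clique n G (set xs)" "card (set xs) = n"
    unfolding clique_list_def using distinct_card by auto
  then show ?thesis unfolding Omega_max_cliques_def using Omega_clique_card_le[of n G] le_antisym by blast
qed

lemma clique_list_max:
  assumes G: "simple_graph n G" and co: "corank_one n G"
  shows "clique_list n G xs \<longleftrightarrow> distinct xs \<and> set xs \<in> Omega_max_cliques n G"
  unfolding clique_list_def Omega_max_cliques_iff[OF G co] using distinct_card[of xs] by auto

lemma clique_list_nth:
  assumes xs: "clique_list n G xs" and i: "i < n" and j: "j < n"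
  shows "xs ! i \<in> carrier_vec n"
    "xs ! i \<bullet> xs ! j = (if i = j then (L_num n G)\<^sup>2 else 0)"
    "ones_vec n \<bullet> xs ! i = L_num n G"
    "xs ! i \<bullet> (adj_mat n G *\<^sub>v xs ! i) = 0"
    "xs ! i \<bullet> (adj_mat n G *\<^sub>v xs ! j) \<in> {0, (L_num n G)\<^sup>2}"
proof -
  have len: "length xs = n" and d: "distinct xs" and c: "Omega_clique n G (set xs)"
    using xs unfolding clique_list_def by auto
  have m: "xs ! i \<in> set xs" "xs ! j \<in> set xs" using i j len by auto
  then have V: "xs ! i \<in> Omega_vertices n G" using c unfolding Omega_clique_def by blast
  then show "xs ! i \<in> carrier_vec n" "ones_vec n \<bullet> xs ! i = L_num n G"
    and loop: "xs ! i \<bullet> (adj_mat n G *\<^sub>v xs ! i) = 0"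
    unfolding Omega_vertices_def by auto
  have adj: "Omega_adjacent n G (xs ! i) (xs ! j)" if "i \<noteq> j"
  proof -
    have "xs ! i \<noteq> xs ! j" using that d i j len by (simp add: nth_eq_iff_index_eq)
    then show ?thesis using c m unfolding Omega_clique_def by blast
  qed
  show "xs ! i \<bullet> xs ! j = (if i = j then (L_num n G)\<^sup>2 else 0)"
  proof (cases "i = j")
    case True then show ?thesis using V unfolding Omega_vertices_def by simp
  next
    case False then show ?thesis using adj unfolding Omega_adjacent_def by simp
  qed
  show "xs ! i \<bullet> (adj_mat n G *\<^sub>v xs ! j) \<in> {0, (L_num n G)\<^sup>2}"
  proof (cases "i = j")
    case True then show ?thesis using loop by simp
  next
    case False then show ?thesis using adj unfolding Omega_adjacent_def by blast
  qed
qed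

lemma Q_mat_carrier: "length xs = n \<Longrightarrow> Q_mat n G xs \<in> carrier_mat n n"
  unfolding Q_mat_def by (intro carrier_matI) simp_all

lemma Q_mat_index:
  assumes xs: "clique_list n G xs" and i: "i < n" and j: "j < n"
  shows "Q_mat n G xs $$ (i,j) = rat_of_int (xs ! j $ i) / of_int (L_num n G)"
proof -
  have "length xs = n" using xs unfolding clique_list_def by blast
  then show ?thesis using clique_list_nth(1)[OF xs j j] i j
    unfolding Q_mat_def by (simp add: mat_of_cols_index)
qed

lemma Q_mat_inject:
  assumes xs: "clique_list n G xs" and ys: "clique_list n G ys" and e: "Q_mat n G xs = Q_mat n G ys"
  shows "xs = ys"
proof (rule nth_equalityI)
  have len: "length xs = n" "length ys = n" using xs ys unfolding clique_list_def by auto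
  then show "length xs = length ys" by simp
  fix j assume "j < length xs"
  then have j: "j < n" using len by simp
  show "xs ! j = ys ! j"
  proof (rule eq_vecI)
    show "dim_vec (xs ! j) = dim_vec (ys ! j)"
      using clique_list_nth(1)[OF xs j j] clique_list_nth(1)[OF ys j j] by simp
    fix i assume "i < dim_vec (ys ! j)"
    then have i: "i < n" using clique_list_nth(1)[OF ys j j] by simp
    have "rat_of_int (xs ! j $ i) / of_int (L_num n G) = rat_of_int (ys ! j $ i) / of_int (L_num n G)"
      unfolding Q_mat_index[OF xs i j, symmetric] Q_mat_index[OF ys i j, symmetric] e ..
    then show "xs ! j $ i = ys ! j $ i" using L_num_pos[of n G] by auto
  qed
qed

lemma Q_mat_form:
  assumes xs: "clique_list n G xs" and i: "i < n" and j: "j < n" and M: "M \<in> carrier_mat n n"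
  shows "(transpose_mat (Q_mat n G xs) * map_mat of_int M * Q_mat n G xs) $$ (i,j)
    = rat_of_int (xs ! i \<bullet> (M *\<^sub>v xs ! j)) / (of_int (L_num n G))\<^sup>2"
proof -
  let ?Q = "Q_mat n G xs" and ?a = "1 / rat_of_int (L_num n G)" and ?B = "map_mat rat_of_int M"
  have len: "length xs = n" using xs unfolding clique_list_def by blast
  have Q: "?Q \<in> carrier_mat n n" by (rule Q_mat_carrier[OF len])
  have QT: "transpose_mat ?Q \<in> carrier_mat n n" using Q by simp
  have B: "?B \<in> carrier_mat n n" using M by simp
  have x: "xs ! k \<in> carrier_vec n" if "k < n" for k by (rule clique_list_nth(1)[OF xs that that])
  have xr: "map_vec rat_of_int (xs ! k) \<in> carrier_vec n" if "k < n" for k using x[OF that] by simp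
  have col: "col ?Q k = ?a \<cdot>\<^sub>v map_vec of_int (xs ! k)" if k: "k < n" for k
  proof (rule eq_vecI)
    fix r assume "r < dim_vec (?a \<cdot>\<^sub>v map_vec rat_of_int (xs ! k))"
    then have r: "r < n" using xr[OF k] by simp
    show "col ?Q k $ r = (?a \<cdot>\<^sub>v map_vec of_int (xs ! k)) $ r"
      using Q_mat_index[OF xs r k] r k Q carrier_vecD[OF x[OF k]] by simp
  qed (use Q carrier_vecD[OF x[OF k]] in simp)
  have Bx: "?B *\<^sub>v map_vec of_int (xs ! j) = map_vec of_int (M *\<^sub>v xs ! j)"
    by (rule of_int_hom.mult_mat_vec_hom[OF M x[OF j], symmetric])
  have Mx: "M *\<^sub>v xs ! j \<in> carrier_vec n" by (rule mult_mat_vec_carrier[OF M x[OF j]])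
  have "(transpose_mat ?Q * ?B * ?Q) $$ (i,j) = (transpose_mat ?Q * (?B * ?Q)) $$ (i,j)"
    unfolding assoc_mult_mat[OF QT B Q] ..
  also have "\<dots> = row (transpose_mat ?Q) i \<bullet> col (?B * ?Q) j"
    by (rule index_mult_mat(1)) (use i j Q in simp_all)
  also have "row (transpose_mat ?Q) i = col ?Q i" using i Q by simp
  also have "col (?B * ?Q) j = ?B *\<^sub>v col ?Q j" by (rule col_mult2[OF B Q j])
  also have "\<dots> = ?a \<cdot>\<^sub>v map_vec of_int (M *\<^sub>v xs ! j)"
    unfolding col[OF j] mult_mat_vec[OF B xr[OF j]] Bx ..
  also have "col ?Q i \<bullet> (?a \<cdot>\<^sub>v map_vec of_int (M *\<^sub>v xs ! j)) = ?a * (?a * (map_vec of_int (xs ! i) \<bullet> map_vec of_int (M *\<^sub>v xs ! j)))"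
  proof -
    have z: "map_vec rat_of_int (M *\<^sub>v xs ! j) \<in> carrier_vec n" using Mx by simp
    show ?thesis unfolding col[OF i] smult_scalar_prod_distrib[OF xr[OF i] smult_carrier_vec[THEN iffD2, OF z]]
      scalar_prod_smult_distrib[OF xr[OF i] z] ..
  qed
  also have "\<dots> = rat_of_int (xs ! i \<bullet> (M *\<^sub>v xs ! j)) / (of_int (L_num n G))\<^sup>2"
    unfolding scalar_prod_of_int[OF Mx x[OF i], symmetric] by (simp add: power2_eq_square)
  finally show ?thesis .
qed

lemma Q_mat_adjacency:
  assumes xs: "clique_list n G xs" and i: "i < n" and j: "j < n"
  shows "(transpose_mat (Q_mat n G xs) * adj_mat n G * Q_mat n G xs) $$ (i,j)
    = (if xs ! i \<bullet> (adj_mat n G *\<^sub>v xs ! j) = (L_num n G)\<^sup>2 then 1 else 0)"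
proof -
  have "L_num n G \<noteq> 0" using L_num_pos[of n G] by simp
  then show ?thesis
    using Q_mat_form[OF xs i j adjacency_carrier, of G] clique_list_nth(5)[OF xs i j]
    unfolding adjacency_hom by auto
qed

lemma clique_graph_iff:
  assumes xs: "clique_list n G xs"
  shows "clique_graph n G xs H \<longleftrightarrow> simple_graph n H \<and>
    (\<forall>i<n. \<forall>j<n. {i,j} \<in> H \<longleftrightarrow> xs ! i \<bullet> (adj_mat n G *\<^sub>v xs ! j) = (L_num n G)\<^sup>2)"
proof -
  let ?Q = "Q_mat n G xs"
  let ?P = "transpose_mat ?Q * adj_mat n G * ?Q"
  have "length xs = n" using xs unfolding clique_list_def by blast
  then have Q: "?Q \<in> carrier_mat n n" by (rule Q_mat_carrier)
  have P: "dim_row ?P = n" "dim_col ?P = n" using Q by simp_all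
  have AH: "dim_row (adj_mat n H :: rat mat) = n" "dim_col (adj_mat n H :: rat mat) = n"
    by (simp_all add: adj_mat_def)
  have "adj_mat n H = ?P \<longleftrightarrow> (\<forall>i<n. \<forall>j<n. adj_mat n H $$ (i,j) = ?P $$ (i,j))"
    unfolding mat_eq_iff P AH by blast
  also have "\<dots> \<longleftrightarrow> (\<forall>i<n. \<forall>j<n. {i,j} \<in> H \<longleftrightarrow> xs ! i \<bullet> (adj_mat n G *\<^sub>v xs ! j) = (L_num n G)\<^sup>2)"
  proof -
    have "adj_mat n H $$ (i,j) = ?P $$ (i,j) \<longleftrightarrow> ({i,j} \<in> H \<longleftrightarrow> xs ! i \<bullet> (adj_mat n G *\<^sub>v xs ! j) = (L_num n G)\<^sup>2)"
      if "i < n" "j < n" for i j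
      unfolding Q_mat_adjacency[OF xs that] adjacency_index[OF that] by simp
    then show ?thesis by blast
  qed
  finally show ?thesis unfolding clique_graph_def by blast
qed

text \<open>Symmetry of the form makes the edge set independent of the order of the endpoints, and
  isotropy of the vertices excludes loops.\<close>

lemma clique_graph_exists:
  assumes xs: "clique_list n G xs"
  shows "\<exists>H. clique_graph n G xs H"
proof -
  let ?L = "L_num n G"
  let ?f = "\<lambda>i j. xs ! i \<bullet> (adj_mat n G *\<^sub>v xs ! j)"
  let ?H = "{{i,j} | i j. i < n \<and> j < n \<and> ?f i j = ?L\<^sup>2}"
  have L0: "?L\<^sup>2 \<noteq> 0" using L_num_pos[of n G] by simp
  have comm: "?f i j = ?f j i" if ij: "i < n" "j < n" for i j
  proof -
    have x: "xs ! i \<in> carrier_vec n" "xs ! j \<in> carrier_vec n"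
      using clique_list_nth(1)[OF xs ij(1) ij(1)] clique_list_nth(1)[OF xs ij(2) ij(2)] by auto
    have "?f i j = (adj_mat n G *\<^sub>v xs ! i) \<bullet> xs ! j"
      by (rule scalar_prod_mult_symmetric[OF adjacency_carrier adjacency_symmetric x])
    also have "\<dots> = ?f j i" by (rule comm_scalar_prod[OF mult_mat_vec_carrier[OF adjacency_carrier x(1)] x(2)])
    finally show ?thesis .
  qed
  have "{i,j} \<in> ?H \<longleftrightarrow> ?f i j = ?L\<^sup>2" if ij: "i < n" "j < n" for i j
    using comm[OF ij] ij by (auto simp: doubleton_eq_iff)
  moreover have "simple_graph n ?H" unfolding simple_graph_def complete_edges_def
  proof
    fix e assume "e \<in> ?H"
    then obtain i j where ij: "e = {i,j}" "i < n" "j < n" "?f i j = ?L\<^sup>2" by blast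
    moreover have "i \<noteq> j" using ij(4) clique_list_nth(4)[OF xs ij(2,2)] L0 by auto
    ultimately show "e \<in> {{u,v} | u v. u < n \<and> v < n \<and> u \<noteq> v}" by blast
  qed
  ultimately have "clique_graph n G xs ?H" unfolding clique_graph_iff[OF xs] by blast
  then show ?thesis by blast
qed

lemma clique_graph_regular_similarity:
  assumes xs: "clique_list n G xs" and H: "clique_graph n G xs H"
  shows "regular_similarity n G H (Q_mat n G xs)"
proof -
  let ?Q = "Q_mat n G xs" and ?L = "L_num n G"
  have L0: "?L \<noteq> 0" using L_num_pos[of n G] by simp
  have "length xs = n" using xs unfolding clique_list_def by blast
  then have Q: "?Q \<in> carrier_mat n n" by (rule Q_mat_carrier)
  have QT: "transpose_mat ?Q \<in> carrier_mat n n" using Q by simp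
  have "transpose_mat ?Q * ?Q = 1\<^sub>m n"
  proof (rule eq_matI)
    fix i j assume "i < dim_row (1\<^sub>m n :: rat mat)" "j < dim_col (1\<^sub>m n :: rat mat)"
    then have ij: "i < n" "j < n" by simp_all
    have x: "xs ! j \<in> carrier_vec n" by (rule clique_list_nth(1)[OF xs ij(2,2)])
    have "(transpose_mat ?Q * 1\<^sub>m n * ?Q) $$ (i,j) = rat_of_int (xs ! i \<bullet> (1\<^sub>m n *\<^sub>v xs ! j)) / (of_int ?L)\<^sup>2"
      using Q_mat_form[OF xs ij one_carrier_mat] by (simp only: of_int_hom.mat_hom_one)
    then show "(transpose_mat ?Q * ?Q) $$ (i,j) = 1\<^sub>m n $$ (i,j)"
      unfolding right_mult_one_mat[OF QT] one_mult_mat_vec[OF x] clique_list_nth(2)[OF xs ij] using ij L0 by simp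
  qed (use Q in simp_all)
  moreover have "transpose_mat ?Q *\<^sub>v ones_vec n = ones_vec n"
  proof (rule eq_vecI)
    fix j assume "j < dim_vec (ones_vec n :: rat vec)"
    then have j: "j < n" by (simp add: ones_vec_def)
    have x: "xs ! j \<in> carrier_vec n" by (rule clique_list_nth(1)[OF xs j j])
    have "(transpose_mat ?Q *\<^sub>v ones_vec n) $ j = (\<Sum>i<n. rat_of_int (xs ! j $ i) / of_int ?L)"
      unfolding index_mult_mat_vec_sum[OF QT ones_vec_carrier j]
      by (rule sum.cong) (use j Q Q_mat_index[OF xs _ j] in auto)
    also have "\<dots> = rat_of_int (ones_vec n \<bullet> xs ! j) / of_int ?L"
      unfolding ones_scalar_prod[OF x] by (simp add: sum_divide_distrib)
    also have "\<dots> = 1" unfolding clique_list_nth(3)[OF xs j j] using L0 by simp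
    finally show "(transpose_mat ?Q *\<^sub>v ones_vec n) $ j = ones_vec n $ j" using j by simp
  qed (use Q in \<open>simp add: ones_vec_def\<close>)
  ultimately show ?thesis using H Q unfolding regular_similarity_def clique_graph_def by simp
qed

text \<open>Permuting the columns of Q conjugates Q^T A Q by a permutation matrix. So an isomorphism
  from \<open>K\<close> to \<open>H\<close> turns an enumeration with graph \<open>H\<close> into
  one of the same clique with graph \<open>K\<close>.\<close>

lemma clique_list_reorder:
  assumes xs: "clique_list n G xs" and \<pi>: "bij_betw \<pi> {0..<n} {0..<n}"
    and H: "clique_graph n G xs H" and K: "simple_graph n K"
    and e: "\<And>i j. i < n \<Longrightarrow> j < n \<Longrightarrow> {i,j} \<in> K \<longleftrightarrow> {\<pi> i, \<pi> j} \<in> H"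
  defines "ys \<equiv> map (\<lambda>j. xs ! \<pi> j) [0..<n]"
  shows "clique_list n G ys" "set ys = set xs" "clique_graph n G ys K"
proof -
  have len: "length xs = n" and d: "distinct xs" and c: "Omega_clique n G (set xs)"
    using xs unfolding clique_list_def by auto
  have im: "\<pi> ` {0..<n} = {0..<n}" and inj: "inj_on \<pi> {0..<n}" using \<pi> unfolding bij_betw_def by auto
  have \<pi>n: "\<pi> j < n" if "j < n" for j using bij_betwE[OF \<pi>] that by auto
  have "set ys = (!) xs ` \<pi> ` {0..<n}" unfolding ys_def by auto
  also have "\<dots> = set xs" unfolding im using len by (metis atLeast_upt list.set_map map_nth set_upt)
  finally show s: "set ys = set xs" .
  have "distinct ys" using d len unfolding ys_def
    by (auto simp: distinct_map inj_on_def nth_eq_iff_index_eq \<pi>n dest: inj_onD[OF inj])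
  then show ys: "clique_list n G ys" unfolding clique_list_def s using c by (simp add: ys_def)
  show "clique_graph n G ys K" unfolding clique_graph_iff[OF ys]
    using H K e \<pi>n unfolding clique_graph_iff[OF xs] by (simp add: ys_def)
qed

text \<open>Two enumerations of one clique differ by a permutation, which is then an isomorphism of
  their graphs. For different enumerations with equal graphs it is a nontrivial
  automorphism.\<close>

lemma clique_list_same_set:
  assumes xs: "clique_list n G xs" and ys: "clique_list n G ys" and s: "set xs = set ys"
    and H: "clique_graph n G xs H" and K: "clique_graph n G ys K"
  shows "\<exists>\<pi>. bij_betw \<pi> {0..<n} {0..<n} \<and> (\<forall>j<n. ys ! j = xs ! \<pi> j) \<and>
    (\<forall>i<n. \<forall>j<n. {i,j} \<in> K \<longleftrightarrow> {\<pi> i, \<pi> j} \<in> H)"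
proof -
  have bx: "bij_betw ((!) xs) {0..<n} (set xs)" and by': "bij_betw ((!) ys) {0..<n} (set xs)"
    using xs ys s unfolding clique_list_def by (auto intro!: bij_betw_nth)
  let ?\<pi> = "inv_into {0..<n} ((!) xs) \<circ> (!) ys"
  have \<pi>: "bij_betw ?\<pi> {0..<n} {0..<n}" by (rule bij_betw_trans[OF by' bij_betw_inv_into[OF bx]])
  have \<pi>n: "?\<pi> j < n" if "j < n" for j using bij_betwE[OF \<pi>] that by auto
  have e: "ys ! j = xs ! ?\<pi> j" if "j < n" for j
    using bij_betw_inv_into_right[OF bx] bij_betwE[OF by'] that by auto
  have "\<forall>i<n. \<forall>j<n. {i,j} \<in> K \<longleftrightarrow> {?\<pi> i, ?\<pi> j} \<in> H"
    using H K \<pi>n e unfolding clique_graph_iff[OF xs] clique_graph_iff[OF ys] by (simp del: comp_apply)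
  then show ?thesis using \<pi> e by blast
qed

text \<open>Every other enumeration of the clique gives an isomorphic graph, so the definite
  description denotes one class.\<close>

lemma phi_eq:
  assumes xs: "clique_list n G xs" and H: "clique_graph n G xs H"
  shows "phi n G (set xs) = iso_class n H"
  unfolding phi_def
proof (rule the_equality)
  show "\<exists>ys K. distinct ys \<and> set ys = set xs \<and> clique_graph n G ys K \<and> iso_class n H = iso_class n K"
    using xs H unfolding clique_list_def by blast
  fix C assume "\<exists>ys K. distinct ys \<and> set ys = set xs \<and> clique_graph n G ys K \<and> C = iso_class n K"
  then obtain ys K where ys: "distinct ys" "set ys = set xs" "clique_graph n G ys K" "C = iso_class n K" by blast
  have yl: "clique_list n G ys"
    using xs ys(1,2) distinct_card[of xs] distinct_card[of ys] unfolding clique_list_def by auto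
  have sH: "simple_graph n H" and sK: "simple_graph n K" using H ys(3) unfolding clique_graph_def by auto
  have "isomorphic n K H" unfolding isomorphic_iff[OF sK sH]
    using clique_list_same_set[OF xs yl ys(2)[symmetric] H ys(3)] by blast
  then show "C = iso_class n H" unfolding ys(4) iso_class_eq_iff[OF sK sH] .
qed

subsection \<open>Counting preimages\<close>

text \<open>One enumeration for each sign in Q^T \<xi>(G) = \<plusminus> \<xi>(H). The two differ
  because \<xi>(H) is nonzero, and there is no third one because the sign determines Q and Q
  determines the enumeration.\<close>

lemma clique_lists_of_graph:
  assumes G: "simple_graph n G" and co: "corank_one n G" and H: "simple_graph n H"
    and gc: "generalized_cospectral n G H"
  shows "\<exists>xs ys. clique_list n G xs \<and> clique_list n G ys \<and> xs \<noteq> ys \<and>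
    (\<forall>zs. clique_list n G zs \<longrightarrow> (clique_graph n G zs H \<longleftrightarrow> zs = xs \<or> zs = ys))"
proof -
  have \<chi>: "char_poly (adj_mat n G :: int mat) = char_poly (adj_mat n H)" and f: "walk_form n G = walk_form n H"
    using gc unfolding generalized_cospectral_iff[OF G H] by auto
  obtain Q where Q: "regular_similarity n G H Q" "transpose_mat Q *\<^sub>v xi_rat n G = 1 \<cdot>\<^sub>v xi_rat n H"
    using similarity_exists[OF G co H \<chi> f mult_1_left[of 1]] by blast
  obtain R where R: "regular_similarity n G H R" "transpose_mat R *\<^sub>v xi_rat n G = (-1) \<cdot>\<^sub>v xi_rat n H"
    using similarity_exists[OF G co H \<chi> f, of "-1"] by (simp only: mult_minus1 minus_minus) blast
  obtain xs where xs: "clique_list n G xs" "Q_mat n G xs = Q"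
    using regular_similarity_clique_list[OF G co H Q(1)] by blast
  obtain ys where ys: "clique_list n G ys" "Q_mat n G ys = R"
    using regular_similarity_clique_list[OF G co H R(1)] by blast
  have "xs \<noteq> ys"
  proof
    assume "xs = ys"
    then have e: "1 \<cdot>\<^sub>v xi_rat n H = (-1) \<cdot>\<^sub>v xi_rat n H" using xs(2) ys(2) Q(2) R(2) by simp
    have "xi_rat n H $ i = 0" if "i < n" for i
      using arg_cong[OF e, of "\<lambda>v. v $ i"] that by simp
    then have "xi_vec n H = 0\<^sub>v n" by (intro eq_vecI) (auto simp: xi_vec_def)
    then show False using similarity_corank_one[OF G co H Q(1)] unfolding corank_one_def by blast
  qed
  moreover have "clique_graph n G zs H \<longleftrightarrow> zs = xs \<or> zs = ys" if zs: "clique_list n G zs" for zs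
  proof
    assume "clique_graph n G zs H"
    then have Z: "regular_similarity n G H (Q_mat n G zs)" by (rule clique_graph_regular_similarity[OF zs])
    from similarity_xi[OF G co H Z] show "zs = xs \<or> zs = ys"
    proof
      assume "transpose_mat (Q_mat n G zs) *\<^sub>v xi_rat n G = xi_rat n H"
      then have "transpose_mat (Q_mat n G zs) *\<^sub>v xi_rat n G = transpose_mat Q *\<^sub>v xi_rat n G" unfolding Q(2) by simp
      then have "Q_mat n G zs = Q_mat n G xs" unfolding xs(2) by (rule similarity_determined[OF G co H Z Q(1)])
      then show ?thesis using Q_mat_inject[OF zs xs(1)] by blast
    next
      assume "transpose_mat (Q_mat n G zs) *\<^sub>v xi_rat n G = (-1) \<cdot>\<^sub>v xi_rat n H"
      then have "transpose_mat (Q_mat n G zs) *\<^sub>v xi_rat n G = transpose_mat R *\<^sub>v xi_rat n G" unfolding R(2) .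
      then have "Q_mat n G zs = Q_mat n G ys" unfolding ys(2) by (rule similarity_determined[OF G co H Z R(1)])
      then show ?thesis using Q_mat_inject[OF zs ys(1)] by blast
    qed
  next
    have "clique_graph n G xs H" "clique_graph n G ys H"
      using Q(1) R(1) xs(2) ys(2) H unfolding clique_graph_def regular_similarity_def by auto
    then show "clique_graph n G zs H" if "zs = xs \<or> zs = ys" using that by blast
  qed
  ultimately show ?thesis using xs(1) ys(1) by blast
qed

text \<open>Reordering gives every preimage an enumeration whose graph is \<open>H\<close> itself,
  so it is the set of \<open>xs\<close> or of \<open>ys\<close>. These sets coincide exactly if a
  permutation, necessarily nontrivial, turns \<open>xs\<close> into \<open>ys\<close>; as both lists
  yield \<open>H\<close>, it is an automorphism.\<close>

lemma clique_fibre: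
  assumes G: "simple_graph n G" and co: "corank_one n G" and H: "simple_graph n H"
    and gc: "generalized_cospectral n G H"
  shows "\<exists>K1 K2. {K \<in> Omega_max_cliques n G. phi n G K = iso_class n H} = {K1, K2} \<and>
    (K1 = K2 \<longleftrightarrow> symmetric_graph n H)"
proof -
  obtain xs ys where xs: "clique_list n G xs" and ys: "clique_list n G ys" and ne: "xs \<noteq> ys"
    and all: "\<And>zs. clique_list n G zs \<Longrightarrow> clique_graph n G zs H \<longleftrightarrow> zs = xs \<or> zs = ys"
    using clique_lists_of_graph[OF G co H gc] by blast
  have xH: "clique_graph n G xs H" and yH: "clique_graph n G ys H" using all xs ys by auto
  have len: "length xs = n" "distinct xs" "length ys = n" using xs ys unfolding clique_list_def by auto
  have "{K \<in> Omega_max_cliques n G. phi n G K = iso_class n H} = {set xs, set ys}"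
  proof (intro equalityI subsetI)
    fix K assume "K \<in> {K \<in> Omega_max_cliques n G. phi n G K = iso_class n H}"
    then have K: "K \<in> Omega_max_cliques n G" "phi n G K = iso_class n H" by auto
    then have "finite K" unfolding Omega_max_cliques_def Omega_clique_def by blast
    then obtain zs where zs: "set zs = K" "distinct zs" using finite_distinct_list by blast
    then have zl: "clique_list n G zs" using K(1) unfolding clique_list_max[OF G co] by simp
    obtain H' where H': "clique_graph n G zs H'" using clique_graph_exists[OF zl] by blast
    then have sH': "simple_graph n H'" unfolding clique_graph_def by blast
    have "iso_class n H = iso_class n H'" using phi_eq[OF zl H'] K(2) zs(1) by simp
    then obtain \<pi> where \<pi>: "bij_betw \<pi> {0..<n} {0..<n}" "\<forall>i<n. \<forall>j<n. {i,j} \<in> H \<longleftrightarrow> {\<pi> i, \<pi> j} \<in> H'"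
      unfolding iso_class_eq_iff[OF H sH'] isomorphic_iff[OF H sH'] by blast
    let ?us = "map (\<lambda>j. zs ! \<pi> j) [0..<n]"
    have us: "clique_list n G ?us" "set ?us = set zs" "clique_graph n G ?us H"
      using clique_list_reorder[OF zl \<pi>(1) H' H] \<pi>(2) by blast+
    then have "?us = xs \<or> ?us = ys" using all by blast
    then show "K \<in> {set xs, set ys}" using us(2) zs(1) by auto
  next
    fix K assume "K \<in> {set xs, set ys}"
    then show "K \<in> {K \<in> Omega_max_cliques n G. phi n G K = iso_class n H}"
      using xs ys phi_eq[OF xs xH] phi_eq[OF ys yH] unfolding clique_list_max[OF G co] by blast
  qed
  moreover have "set xs = set ys \<longleftrightarrow> symmetric_graph n H"
  proof
    assume s: "set xs = set ys"
    obtain \<pi> where \<pi>: "bij_betw \<pi> {0..<n} {0..<n}" "\<forall>j<n. ys ! j = xs ! \<pi> j"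
      "\<forall>i<n. \<forall>j<n. {i,j} \<in> H \<longleftrightarrow> {\<pi> i, \<pi> j} \<in> H"
      using clique_list_same_set[OF xs ys s xH yH] by blast
    \<comment> \<open>\<open>permutes\<close> asks for the identity outside \<open>{0..<n}\<close>,
      where nothing is known about \<open>\<pi>\<close>.\<close>
    define \<rho> where "\<rho> j = (if j \<in> {0..<n} then \<pi> j else j)" for j
    have \<rho>: "bij_betw \<rho> {0..<n} {0..<n}" using \<pi>(1) by (rule bij_betw_cong[THEN iffD1, rotated]) (simp add: \<rho>_def)
    have "\<rho> permutes {0..<n}" by (rule bij_imp_permutes[OF \<rho>]) (simp add: \<rho>_def)
    moreover have "(\<lambda>e. \<rho> ` e) ` H = H" unfolding edge_image_iff[OF H H \<rho>] using \<pi>(3) by (simp add: \<rho>_def)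
    moreover have "\<rho> \<noteq> id"
    proof
      assume "\<rho> = id"
      then have "\<pi> j = j" if j: "j < n" for j using fun_cong[OF \<open>\<rho> = id\<close>, of j] j unfolding \<rho>_def by simp
      then have "xs = ys" using \<pi>(2) len by (intro nth_equalityI) auto
      then show False using ne by simp
    qed
    ultimately show "symmetric_graph n H" unfolding symmetric_graph_def automorphisms_def by blast
  next
    assume "symmetric_graph n H"
    moreover have "id \<in> automorphisms n H" unfolding automorphisms_def by (simp add: permutes_id)
    ultimately obtain \<pi> where p: "\<pi> permutes {0..<n}" and im: "(\<lambda>e. \<pi> ` e) ` H = H" and nid: "\<pi> \<noteq> id"
      unfolding symmetric_graph_def automorphisms_def by blast
    have \<pi>: "bij_betw \<pi> {0..<n} {0..<n}" by (rule permutes_imp_bij[OF p])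
    let ?us = "map (\<lambda>j. xs ! \<pi> j) [0..<n]"
    have us: "clique_list n G ?us" "set ?us = set xs" "clique_graph n G ?us H"
      using clique_list_reorder[OF xs \<pi> xH H] im unfolding edge_image_iff[OF H H \<pi>] by blast+
    have "?us \<noteq> xs"
    proof
      assume e: "?us = xs"
      have "\<pi> j = j" for j
      proof (cases "j < n")
        case True
        then have "xs ! \<pi> j = xs ! j" using arg_cong[OF e, of "\<lambda>u. u ! j"] by simp
        moreover have "\<pi> j < n" using bij_betwE[OF \<pi>] True by auto
        ultimately show ?thesis using True len by (simp add: nth_eq_iff_index_eq)
      next
        case False then show ?thesis using permutes_not_in[OF p, of j] by simp
      qed
      then show False using nid by auto
    qed
    \<comment> \<open>The automorphism produces a second enumeration of the same clique with graph
      \<open>H\<close>, and only \<open>ys\<close> is left for it.\<close>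
    then have "?us = ys" using all us by blast
    then show "set xs = set ys" using us(2) by simp
  qed
  ultimately show ?thesis by blast
qed

theorem theorem4:
  fixes n :: nat and G :: "nat set set"
  assumes "simple_graph n G"
    and "almost_controllable n G"
  shows "(\<forall>xs. distinct xs \<and> set xs \<in> Omega_max_cliques n G \<longrightarrow>
            (\<exists>H. clique_graph n G xs H \<and> phi n G (set xs) = iso_class n H)) \<and>
         phi n G ` Omega_max_cliques n G = cospectral_classes n G \<and>
         (\<forall>H. simple_graph n H \<and> generalized_cospectral n G H \<longrightarrow>
            (symmetric_graph n H \<longrightarrow>
               card {K \<in> Omega_max_cliques n G. phi n G K = iso_class n H} = 1) \<and>
            (asymmetric_graph n H \<longrightarrow>
               card {K \<in> Omega_max_cliques n G. phi n G K = iso_class n H} = 2))"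
proof -
  note G = assms(1)
  have co: "corank_one n G" by (rule almost_controllable_corank_one[OF assms(2)])
  have graph: "\<exists>H. clique_graph n G xs H \<and> phi n G (set xs) = iso_class n H"
    if "distinct xs" "set xs \<in> Omega_max_cliques n G" for xs
  proof -
    have xs: "clique_list n G xs" unfolding clique_list_max[OF G co] using that by blast
    show ?thesis using clique_graph_exists[OF xs] phi_eq[OF xs] by blast
  qed
  have "phi n G K \<in> cospectral_classes n G" if K: "K \<in> Omega_max_cliques n G" for K
  proof -
    have "finite K" using K unfolding Omega_max_cliques_def Omega_clique_def by blast
    then obtain xs where xs: "set xs = K" "distinct xs" using finite_distinct_list by blast
    then have xl: "clique_list n G xs" unfolding clique_list_max[OF G co] using K by blast
    obtain H where H: "clique_graph n G xs H" "phi n G K = iso_class n H" using graph xs K by blast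
    have sH: "simple_graph n H" using H(1) unfolding clique_graph_def by blast
    \<comment> \<open>Here the correspondence is read from cliques to graphs: a maximum clique gives
      a regular similarity, which preserves \<chi> and the walk form.\<close>
    have "generalized_cospectral n G H" unfolding generalized_cospectral_iff[OF G sH]
      using similarity_char_poly_eq[OF G co sH clique_graph_regular_similarity[OF xl H(1)]] by blast
    then show ?thesis unfolding cospectral_classes_def H(2) using sH by blast
  qed
  moreover have "C \<in> phi n G ` Omega_max_cliques n G" if C: "C \<in> cospectral_classes n G" for C
  proof -
    obtain H where H: "simple_graph n H" "generalized_cospectral n G H" "C = iso_class n H"
      using C unfolding cospectral_classes_def by blast
    obtain K1 K2 where "{K \<in> Omega_max_cliques n G. phi n G K = iso_class n H} = {K1, K2}"
      using clique_fibre[OF G co H(1,2)] by blast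
    then have "K1 \<in> {K \<in> Omega_max_cliques n G. phi n G K = iso_class n H}" by simp
    then show ?thesis unfolding H(3) by (auto intro: rev_image_eqI)
  qed
  ultimately have image: "phi n G ` Omega_max_cliques n G = cospectral_classes n G" by blast
  have count: "(symmetric_graph n H \<longrightarrow> card {K \<in> Omega_max_cliques n G. phi n G K = iso_class n H} = 1) \<and>
      (asymmetric_graph n H \<longrightarrow> card {K \<in> Omega_max_cliques n G. phi n G K = iso_class n H} = 2)"
    if H: "simple_graph n H" "generalized_cospectral n G H" for H
  proof -
    obtain K1 K2 where K: "{K \<in> Omega_max_cliques n G. phi n G K = iso_class n H} = {K1, K2}"
      "K1 = K2 \<longleftrightarrow> symmetric_graph n H"
      using clique_fibre[OF G co H] by blast
    show ?thesis unfolding asymmetric_graph_def K(1) using K(2) by auto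
  qed
  show ?thesis using graph image count by blast
qed

end
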